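(* Let $Q$ be a quiver, $\kappa$ an infinite cardinal, $\mathcal{C}$ an abelian category and $(\mathcal{A},\mathcal{B})$ a complete hereditary cotorsion pair in $\mathcal{C}$. Then: (a) Let $Q(x,-)$ be finite for all $x\in Q_0$, $\kappa\geq\mathrm{ltccn}(Q)$, $Q$ be left-rooted and $\mathcal{C}$ be $AB4(\kappa)$. Then ${}^{\perp}s_*(\mathcal{B})={}^{\perp}f_*(\mathcal{B})=\Phi(\mathcal{A})$. (b) Let $Q(-,x)$ be finite for all $x\in Q_0$, $\kappa\geq\mathrm{rtccn}(Q)$, $Q$ be right-rooted and $\mathcal{C}$ be $AB4^{*}(\kappa)$. Then $s_*(\mathcal{A})^{\perp}=g_*(\mathcal{A})^{\perp}=\Psi(\mathcal{B})$.
   Context: A quiver $Q$ consists of (possibly infinite) sets $Q_0$ of vertices and $Q_1$ of arrows with source and target maps $s,t$. $Q(i,j)$ is the set of paths from $i$ to $j$ (including the trivial path if $i=j$), $Q(-,j)=\bigcup_iQ(i,j)$, $Q(i,-)=\bigcup_jQ(i,j)$. $Q_1^{*\to i}=\{\alpha\in Q_1:t(\alpha)=i\}$, $Q_1^{i\to*}=\{\alpha\in Q_1:s(\alpha)=i\}$. $Q$ is right-rooted (left-rooted) if there is no infinite sequence $\bullet\to\bullet\to\cdots$ (resp. $\cdots\to\bullet\to\bullet$) of not necessarily different composable arrows. $\mathrm{Rep}(Q,\mathcal{C})$ is the abelian category of $\mathcal{C}$-valued representations of $Q$. For a set $X$ of cardinals, $\mathrm{size}(X):=\sup X$ if $x<\sup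 X$ for all $x\in X$, and $\mathrm{size}(X):=(\sup X)^+$ otherwise. $\mathrm{ltccn}(Q):=\mathrm{size}(\{|Q(-,i)|\}_{i\in Q_0})$, $\mathrm{rtccn}(Q):=\mathrm{size}(\{|Q(i,-)|\}_{i\in Q_0})$. $AB4(\kappa)$: coproducts of families indexed by sets of cardinality $<\kappa$ exist and are exact; $AB4^*(\kappa)$ is the dual. Functors $\mathcal{C}\to\mathrm{Rep}(Q,\mathcal{C})$: $(f_i(C))_j:=C^{(Q(i,j))}$ with inclusions $\mu_\rho^C$ and $(f_i(C))_\alpha\circ\mu^C_\rho=\mu^C_{\alpha\rho}$; $(g_i(C))_j:=C^{Q(j,i)}$ with projections $\pi_\rho^C$ and $\pi^C_\rho\circ(g_i(C))_\alpha=\pi^C_{\rho\alpha}$; $s_i$ is the stalk functor, $(s_i(C))_i=C$, $(s_i(C))_j=0$ for $j\ne i$, arrows acting by $0$. For $\mathcal{S}\subseteq\mathcal{C}$, $f_*(\mathcal{S})=\{f_i(S):i\in Q_0,S\in\mathcal{S}\}$, similarly $g_*(\mathcal{S})$, $s_*(\mathcal{S})$. $\varphi_i^F:\coprod_{\alpha\in Q_1^{*\to i}}F_{s(\alpha)}\to F_i$ and $\psi_i^F:F_i\to\prod_{\alpha\in Q_1^{i\to*}}F_{t(\alpha)}$ are induced by the $F_\alpha$. $\Phi(\mathcal{X})$ is the class of representations $F$ with all $\varphi_i^F$ monomorphisms with $\mathrm{Coker}(\varphi_i^F)\in\mathcal{X}$; $\Psi(\mathcal{X})$ the class of $F$ with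 all $\psi_i^F$ epimorphisms with $\mathrm{Ker}(\psi_i^F)\in\mathcal{X}$. With Yoneda Ext, $\mathcal{X}^{\perp}=\{Y:\mathrm{Ext}^n(X,Y)=0\ \forall n\geq1,X\in\mathcal{X}\}$, ${}^{\perp}\mathcal{X}=\{Y:\mathrm{Ext}^n(Y,X)=0\ \forall n\geq1,X\in\mathcal{X}\}$. $(\mathcal{A},\mathcal{B})$ is a cotorsion pair if each class is the $\mathrm{Ext}^1$-orthogonal of the other ($\mathcal{A}=\{A:\mathrm{Ext}^1(A,B)=0\ \forall B\in\mathcal{B}\}$ and $\mathcal{B}=\{B:\mathrm{Ext}^1(A,B)=0\ \forall A\in\mathcal{A}\}$); complete if every object $X$ admits exact sequences $0\to B\to A\to X\to0$ and $0\to X\to B'\to A'\to0$ with $A,A'\in\mathcal{A}$, $B,B'\in\mathcal{B}$; hereditary if $\mathrm{Ext}^i(A,B)=0$ for all $i\geq1$, $A\in\mathcal{A}$, $B\in\mathcal{B}$. *)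

theory Defs
  imports "HOL-Algebra.Group" "HOL-Library.FuncSet" "Graph_Theory.Arc_Walk"
begin

unbundle cardinal_syntax

subsection \<open>Categories with an additive structure on the morphisms\<close>

text \<open>
  \<open>Comp C g f\<close> is the composite "g after f"; \<open>Add\<close> and \<open>Zr\<close> are the addition and the zero
  morphisms of a preadditive category. The axioms are in the locales below.
\<close>

record ('o, 'm) cat =
  Obj :: "'o set"
  Arr :: "'m set"
  Dom :: "'m \<Rightarrow> 'o"
  Cod :: "'m \<Rightarrow> 'o"
  Idn :: "'o \<Rightarrow> 'm"
  Comp :: "'m \<Rightarrow> 'm \<Rightarrow> 'm"
  Add :: "'m \<Rightarrow> 'm \<Rightarrow> 'm"
  Zr :: "'o \<Rightarrow> 'o \<Rightarrow> 'm"

definition Hom :: "('o, 'm) cat \<Rightarrow> 'o \<Rightarrow> 'o \<Rightarrow> 'm set" where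
  "Hom C X Y = {f \<in> Arr C. Dom C f = X \<and> Cod C f = Y}"

definition dual :: "('o, 'm) cat \<Rightarrow> ('o, 'm) cat" where
  "dual C = \<lparr>Obj = Obj C, Arr = Arr C, Dom = Cod C, Cod = Dom C, Idn = Idn C,
     Comp = (\<lambda>g f. Comp C f g), Add = Add C, Zr = (\<lambda>X Y. Zr C Y X)\<rparr>"

locale category =
  fixes C :: "('o, 'm) cat"
  assumes Dom_Obj: "f \<in> Arr C \<Longrightarrow> Dom C f \<in> Obj C"
    and Cod_Obj: "f \<in> Arr C \<Longrightarrow> Cod C f \<in> Obj C"
    and Idn_Hom: "X \<in> Obj C \<Longrightarrow> Idn C X \<in> Hom C X X"
    and Comp_Hom: "f \<in> Hom C X Y \<Longrightarrow> g \<in> Hom C Y Z \<Longrightarrow> Comp C g f \<in> Hom C X Z"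
    and Comp_assoc: "f \<in> Hom C X Y \<Longrightarrow> g \<in> Hom C Y Z \<Longrightarrow> h \<in> Hom C Z W
      \<Longrightarrow> Comp C h (Comp C g f) = Comp C (Comp C h g) f"
    and Comp_Idn: "f \<in> Hom C X Y \<Longrightarrow> Comp C f (Idn C X) = f"
    and Idn_Comp: "f \<in> Hom C X Y \<Longrightarrow> Comp C (Idn C Y) f = f"

definition hom_group :: "('o, 'm) cat \<Rightarrow> 'o \<Rightarrow> 'o \<Rightarrow> 'm monoid" where
  "hom_group C X Y = \<lparr>carrier = Hom C X Y, mult = Add C, one = Zr C X Y\<rparr>"

locale preadditive_category = category +
  assumes hom_comm_group: "X \<in> Obj C \<Longrightarrow> Y \<in> Obj C \<Longrightarrow> comm_group (hom_group C X Y)"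
    and Comp_Add: "f \<in> Hom C X Y \<Longrightarrow> f' \<in> Hom C X Y \<Longrightarrow> g \<in> Hom C Y Z
      \<Longrightarrow> Comp C g (Add C f f') = Add C (Comp C g f) (Comp C g f')"
    and Add_Comp: "f \<in> Hom C X Y \<Longrightarrow> g \<in> Hom C Y Z \<Longrightarrow> g' \<in> Hom C Y Z
      \<Longrightarrow> Comp C (Add C g g') f = Add C (Comp C g f) (Comp C g' f)"

definition is_mono :: "('o, 'm) cat \<Rightarrow> 'm \<Rightarrow> bool" where
  "is_mono C f \<longleftrightarrow> f \<in> Arr C \<and>
     (\<forall>W \<in> Obj C. \<forall>u \<in> Hom C W (Dom C f). \<forall>v \<in> Hom C W (Dom C f).
        Comp C f u = Comp C f v \<longrightarrow> u = v)"

definition is_epi :: "('o, 'm) cat \<Rightarrow> 'm \<Rightarrow> bool" where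
  "is_epi C f \<longleftrightarrow> f \<in> Arr C \<and>
     (\<forall>W \<in> Obj C. \<forall>u \<in> Hom C (Cod C f) W. \<forall>v \<in> Hom C (Cod C f) W.
        Comp C u f = Comp C v f \<longrightarrow> u = v)"

definition is_zero_obj :: "('o, 'm) cat \<Rightarrow> 'o \<Rightarrow> bool" where
  "is_zero_obj C Z \<longleftrightarrow> Z \<in> Obj C \<and>
     (\<forall>X \<in> Obj C. (\<exists>!f. f \<in> Hom C X Z) \<and> (\<exists>!f. f \<in> Hom C Z X))"

definition is_kernel :: "('o, 'm) cat \<Rightarrow> 'm \<Rightarrow> 'm \<Rightarrow> bool" where
  "is_kernel C f k \<longleftrightarrow> f \<in> Arr C \<and> k \<in> Arr C \<and> Cod C k = Dom C f \<and>
     Comp C f k = Zr C (Dom C k) (Cod C f) \<and>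
     (\<forall>W \<in> Obj C. \<forall>u \<in> Hom C W (Dom C f). Comp C f u = Zr C W (Cod C f) \<longrightarrow>
        (\<exists>!h. h \<in> Hom C W (Dom C k) \<and> Comp C k h = u))"

definition is_cokernel :: "('o, 'm) cat \<Rightarrow> 'm \<Rightarrow> 'm \<Rightarrow> bool" where
  "is_cokernel C f c \<longleftrightarrow> f \<in> Arr C \<and> c \<in> Arr C \<and> Dom C c = Cod C f \<and>
     Comp C c f = Zr C (Dom C f) (Cod C c) \<and>
     (\<forall>W \<in> Obj C. \<forall>u \<in> Hom C (Cod C f) W. Comp C u f = Zr C (Dom C f) W \<longrightarrow>
        (\<exists>!h. h \<in> Hom C (Cod C c) W \<and> Comp C h c = u))"

definition is_biproduct ::
  "('o, 'm) cat \<Rightarrow> 'o \<Rightarrow> 'o \<Rightarrow> 'o \<Rightarrow> 'm \<Rightarrow> 'm \<Rightarrow> 'm \<Rightarrow> 'm \<Rightarrow> bool" where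
  "is_biproduct C X Y P i1 i2 p1 p2 \<longleftrightarrow> P \<in> Obj C \<and>
     i1 \<in> Hom C X P \<and> i2 \<in> Hom C Y P \<and> p1 \<in> Hom C P X \<and> p2 \<in> Hom C P Y \<and>
     Comp C p1 i1 = Idn C X \<and> Comp C p2 i2 = Idn C Y \<and>
     Add C (Comp C i1 p1) (Comp C i2 p2) = Idn C P"

locale abelian_category = preadditive_category +
  assumes ex_zero_obj: "\<exists>Z. is_zero_obj C Z"
    and ex_biproduct: "X \<in> Obj C \<Longrightarrow> Y \<in> Obj C
      \<Longrightarrow> \<exists>P i1 i2 p1 p2. is_biproduct C X Y P i1 i2 p1 p2"
    and ex_kernel: "f \<in> Arr C \<Longrightarrow> \<exists>k. is_kernel C f k"
    and ex_cokernel: "f \<in> Arr C \<Longrightarrow> \<exists>c. is_cokernel C f c"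
    and mono_normal: "is_mono C f \<Longrightarrow> \<exists>g. is_kernel C g f"
    and epi_normal: "is_epi C f \<Longrightarrow> \<exists>g. is_cokernel C g f"

text \<open>
  Limits and colimits used as objects are chosen by Hilbert choice; the choices are meaningful
  exactly when the (co)limit in question exists.
\<close>

definition zero_obj :: "('o, 'm) cat \<Rightarrow> 'o" where
  "zero_obj C = (SOME Z. is_zero_obj C Z)"

definition Ker :: "('o, 'm) cat \<Rightarrow> 'm \<Rightarrow> 'o" where
  "Ker C f = Dom C (SOME k. is_kernel C f k)"

definition Coker :: "('o, 'm) cat \<Rightarrow> 'm \<Rightarrow> 'o" where
  "Coker C f = Cod C (SOME c. is_cokernel C f c)"

subsection \<open>Coproducts and products\<close>

definition is_coproduct ::
  "('o, 'm) cat \<Rightarrow> 'i set \<Rightarrow> ('i \<Rightarrow> 'o) \<Rightarrow> 'o \<Rightarrow> ('i \<Rightarrow> 'm) \<Rightarrow> bool" where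
  "is_coproduct C I X P inc \<longleftrightarrow> P \<in> Obj C \<and> (\<forall>i \<in> I. inc i \<in> Hom C (X i) P) \<and>
     (\<forall>Z \<in> Obj C. \<forall>f. (\<forall>i \<in> I. f i \<in> Hom C (X i) Z) \<longrightarrow>
        (\<exists>!h. h \<in> Hom C P Z \<and> (\<forall>i \<in> I. Comp C h (inc i) = f i)))"

definition is_product ::
  "('o, 'm) cat \<Rightarrow> 'i set \<Rightarrow> ('i \<Rightarrow> 'o) \<Rightarrow> 'o \<Rightarrow> ('i \<Rightarrow> 'm) \<Rightarrow> bool" where
  "is_product C I X P pr \<longleftrightarrow> P \<in> Obj C \<and> (\<forall>i \<in> I. pr i \<in> Hom C P (X i)) \<and>
     (\<forall>Z \<in> Obj C. \<forall>f. (\<forall>i \<in> I. f i \<in> Hom C Z (X i)) \<longrightarrow>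
        (\<exists>!h. h \<in> Hom C Z P \<and> (\<forall>i \<in> I. Comp C (pr i) h = f i)))"

definition coprod :: "('o, 'm) cat \<Rightarrow> 'i set \<Rightarrow> ('i \<Rightarrow> 'o) \<Rightarrow> 'o \<times> ('i \<Rightarrow> 'm)" where
  "coprod C I X = (SOME (P, inc). is_coproduct C I X P inc)"

abbreviation "coprod_obj C I X \<equiv> fst (coprod C I X)"
abbreviation "coprod_inj C I X \<equiv> snd (coprod C I X)"

definition prodt :: "('o, 'm) cat \<Rightarrow> 'i set \<Rightarrow> ('i \<Rightarrow> 'o) \<Rightarrow> 'o \<times> ('i \<Rightarrow> 'm)" where
  "prodt C I X = (SOME (P, pr). is_product C I X P pr)"

abbreviation "prodt_obj C I X \<equiv> fst (prodt C I X)"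
abbreviation "prodt_pr C I X \<equiv> snd (prodt C I X)"

definition coprod_map ::
  "('o, 'm) cat \<Rightarrow> 'i set \<Rightarrow> ('i \<Rightarrow> 'o) \<Rightarrow> ('i \<Rightarrow> 'o) \<Rightarrow> ('i \<Rightarrow> 'm) \<Rightarrow> 'm" where
  "coprod_map C I X Y f = (THE h. h \<in> Hom C (coprod_obj C I X) (coprod_obj C I Y) \<and>
     (\<forall>i \<in> I. Comp C h (coprod_inj C I X i) = Comp C (coprod_inj C I Y i) (f i)))"

subsection \<open>Exactness and Yoneda Ext\<close>

text \<open>
  Exactness of two consecutive morphisms: one and the same subobject \<open>k\<close> is both the image of
  \<open>f\<close> (the kernel of its cokernel) and the kernel of \<open>g\<close>.
\<close>

definition exact :: "('o, 'm) cat \<Rightarrow> 'm \<Rightarrow> 'm \<Rightarrow> bool" where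
  "exact C f g \<longleftrightarrow> (\<exists>c k. is_cokernel C f c \<and> is_kernel C c k \<and> is_kernel C g k)"

definition short_exact :: "('o, 'm) cat \<Rightarrow> 'm \<Rightarrow> 'm \<Rightarrow> bool" where
  "short_exact C f g \<longleftrightarrow> is_mono C f \<and> exact C f g \<and> is_epi C g"

text \<open>
  An exact sequence \<open>0 \<rightarrow> Y \<rightarrow> E\<^sub>n \<rightarrow> \<dots> \<rightarrow> E\<^sub>1 \<rightarrow> X \<rightarrow> 0\<close> is encoded as the list of its
  \<open>n + 1\<close> inner morphisms.
\<close>

definition extensions :: "('o, 'm) cat \<Rightarrow> nat \<Rightarrow> 'o \<Rightarrow> 'o \<Rightarrow> 'm list set" where
  "extensions C n X Y = {fs. length fs = Suc n \<and> set fs \<subseteq> Arr C \<and>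
     Dom C (fs ! 0) = Y \<and> Cod C (fs ! n) = X \<and>
     is_mono C (fs ! 0) \<and> (\<forall>k < n. exact C (fs ! k) (fs ! Suc k)) \<and> is_epi C (fs ! n)}"

text \<open>A morphism of extensions is the identity on both end terms.\<close>

definition ext_morphism :: "('o, 'm) cat \<Rightarrow> nat \<Rightarrow> 'o \<Rightarrow> 'o \<Rightarrow> 'm list \<Rightarrow> 'm list \<Rightarrow> bool" where
  "ext_morphism C n X Y fs gs \<longleftrightarrow>
     fs \<in> extensions C n X Y \<and> gs \<in> extensions C n X Y \<and>
     (\<exists>h :: nat \<Rightarrow> 'm. h 0 = Idn C Y \<and> h (Suc n) = Idn C X \<and>
        (\<forall>k \<le> n. h k \<in> Hom C (Dom C (fs ! k)) (Dom C (gs ! k)) \<and>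
           Comp C (gs ! k) (h k) = Comp C (h (Suc k)) (fs ! k)))"

definition yoneda_rel :: "('o, 'm) cat \<Rightarrow> nat \<Rightarrow> 'o \<Rightarrow> 'o \<Rightarrow> 'm list rel" where
  "yoneda_rel C n X Y = {(fs, gs). fs \<in> extensions C n X Y \<and> gs \<in> extensions C n X Y \<and>
     equivclp (ext_morphism C n X Y) fs gs}"

definition yoneda_Ext :: "('o, 'm) cat \<Rightarrow> nat \<Rightarrow> 'o \<Rightarrow> 'o \<Rightarrow> 'm list set set" where
  "yoneda_Ext C n X Y = extensions C n X Y // yoneda_rel C n X Y"

text \<open>
  The Baer sum makes \<open>yoneda_Ext C n X Y\<close> an abelian group; a group is zero iff its underlying
  set has exactly one element.
\<close>

definition Ext_zero :: "('o, 'm) cat \<Rightarrow> nat \<Rightarrow> 'o \<Rightarrow> 'o \<Rightarrow> bool" where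
  "Ext_zero C n X Y \<longleftrightarrow> is_singleton (yoneda_Ext C n X Y)"

definition right_perp :: "('o, 'm) cat \<Rightarrow> 'o set \<Rightarrow> 'o set" where
  "right_perp C \<X> = {Y \<in> Obj C. \<forall>n \<ge> 1. \<forall>X \<in> \<X>. Ext_zero C n X Y}"

definition left_perp :: "('o, 'm) cat \<Rightarrow> 'o set \<Rightarrow> 'o set" where
  "left_perp C \<X> = {Y \<in> Obj C. \<forall>n \<ge> 1. \<forall>X \<in> \<X>. Ext_zero C n Y X}"

definition cotorsion_pair :: "('o, 'm) cat \<Rightarrow> 'o set \<Rightarrow> 'o set \<Rightarrow> bool" where
  "cotorsion_pair C \<A> \<B> \<longleftrightarrow>
     \<A> = {A \<in> Obj C. \<forall>B \<in> \<B>. Ext_zero C 1 A B} \<and>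
     \<B> = {B \<in> Obj C. \<forall>A \<in> \<A>. Ext_zero C 1 A B}"

definition complete_pair :: "('o, 'm) cat \<Rightarrow> 'o set \<Rightarrow> 'o set \<Rightarrow> bool" where
  "complete_pair C \<A> \<B> \<longleftrightarrow> (\<forall>X \<in> Obj C.
     (\<exists>B \<in> \<B>. \<exists>A \<in> \<A>. \<exists>f \<in> Hom C B A. \<exists>g \<in> Hom C A X. short_exact C f g) \<and>
     (\<exists>B \<in> \<B>. \<exists>A \<in> \<A>. \<exists>f \<in> Hom C X B. \<exists>g \<in> Hom C B A. short_exact C f g))"

definition hereditary_pair :: "('o, 'm) cat \<Rightarrow> 'o set \<Rightarrow> 'o set \<Rightarrow> bool" where
  "hereditary_pair C \<A> \<B> \<longleftrightarrow> (\<forall>n \<ge> 1. \<forall>A \<in> \<A>. \<forall>B \<in> \<B>. Ext_zero C n A B)"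

subsection \<open>Cardinal conditions\<close>

text \<open>
  HOL cannot quantify over index types inside a definition; sets of cardinality below \<open>\<kappa>\<close> are,
  up to bijection, exactly the subsets of cardinality below \<open>\<kappa>\<close> of the type underlying \<open>\<kappa>\<close>.
\<close>

definition AB4 :: "'k rel \<Rightarrow> ('o, 'm) cat \<Rightarrow> bool" where
  "AB4 \<kappa> C \<longleftrightarrow> (\<forall>I :: 'k set. |I| <o \<kappa> \<longrightarrow>
     (\<forall>X. (\<forall>i \<in> I. X i \<in> Obj C) \<longrightarrow> (\<exists>P inc. is_coproduct C I X P inc)) \<and>
     (\<forall>X Y Z f g.
        (\<forall>i \<in> I. f i \<in> Hom C (X i) (Y i) \<and> g i \<in> Hom C (Y i) (Z i) \<and>
           short_exact C (f i) (g i)) \<longrightarrow>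
        short_exact C (coprod_map C I X Y f) (coprod_map C I Y Z g)))"

definition AB4_star :: "'k rel \<Rightarrow> ('o, 'm) cat \<Rightarrow> bool" where
  "AB4_star \<kappa> C \<longleftrightarrow> AB4 \<kappa> (dual C)"

text \<open>
  Cardinals are \<open>Card_order\<close> relations, compared by \<open>\<le>o\<close> and \<open><o\<close>. The supremum of a set of
  cardinals on a type \<open>'a\<close> is at most the cardinality of \<open>'a\<close>, hence is attained on \<open>'a\<close>.
  Its successor lives on \<open>'a set\<close>, so in the other case of \<open>card_size\<close> the supremum is copied to
  \<open>'a set\<close> amor the singleton map.
\<close>

definition is_card_sup :: "'a rel set \<Rightarrow> 'a rel \<Rightarrow> bool" where
  "is_card_sup R s \<longleftrightarrow> Card_order s \<and> (\<forall>r \<in> R. r \<le>o s) \<and>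
     (\<forall>t :: 'a rel. Card_order t \<and> (\<forall>r \<in> R. r \<le>o t) \<longrightarrow> s \<le>o t)"

definition card_sup :: "'a rel set \<Rightarrow> 'a rel" where
  "card_sup R = (SOME s. is_card_sup R s)"

definition card_size :: "'a rel set \<Rightarrow> 'a set rel" where
  "card_size R = (if \<forall>r \<in> R. r <o card_sup R
     then |(\<lambda>x. {x}) ` Field (card_sup R)| else cardSuc (card_sup R))"

subsection \<open>Quivers and their representations\<close>

text \<open>
  A quiver is a \<open>wf_digraph\<close>: vertices \<open>verts\<close>, arrows \<open>arcs\<close>, source \<open>tail\<close>, target \<open>head\<close>,
  with no finiteness assumption. A path is a pair of its starting vertex and the list of its arrows
  in the order in which they are traversed; the starting vertex separates the trivial paths. The
  path written \<open>\<alpha>\<rho>\<close> (first \<open>\<rho>\<close>, then \<open>\<alpha>\<close>) appends \<open>\<alpha>\<close> to the list, and \<open>\<rho>\<alpha>\<close> prepends it.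
\<close>

type_synonym ('v, 'e) path = "'v \<times> 'e list"

definition paths :: "('v, 'e) pre_digraph \<Rightarrow> 'v \<Rightarrow> 'v \<Rightarrow> ('v, 'e) path set" where
  "paths Q i j = {(i, p) | p. pre_digraph.awalk Q i p j}"

definition paths_to :: "('v, 'e) pre_digraph \<Rightarrow> 'v \<Rightarrow> ('v, 'e) path set" where
  "paths_to Q j = (\<Union>i \<in> verts Q. paths Q i j)"

definition paths_from :: "('v, 'e) pre_digraph \<Rightarrow> 'v \<Rightarrow> ('v, 'e) path set" where
  "paths_from Q i = (\<Union>j \<in> verts Q. paths Q i j)"

definition ltccn :: "('v, 'e) pre_digraph \<Rightarrow> ('v, 'e) path set rel" where
  "ltccn Q = card_size ((\<lambda>i. |paths_to Q i| ) ` verts Q)"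

definition rtccn :: "('v, 'e) pre_digraph \<Rightarrow> ('v, 'e) path set rel" where
  "rtccn Q = card_size ((\<lambda>i. |paths_from Q i| ) ` verts Q)"

definition arrows_into :: "('v, 'e) pre_digraph \<Rightarrow> 'v \<Rightarrow> 'e set" where
  "arrows_into Q i = {\<alpha> \<in> arcs Q. head Q \<alpha> = i}"

definition arrows_out :: "('v, 'e) pre_digraph \<Rightarrow> 'v \<Rightarrow> 'e set" where
  "arrows_out Q i = {\<alpha> \<in> arcs Q. tail Q \<alpha> = i}"

definition right_rooted :: "('v, 'e) pre_digraph \<Rightarrow> bool" where
  "right_rooted Q \<longleftrightarrow>
     \<not> (\<exists>\<alpha> :: nat \<Rightarrow> 'e. \<forall>n. \<alpha> n \<in> arcs Q \<and> head Q (\<alpha> n) = tail Q (\<alpha> (Suc n)))"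

definition left_rooted :: "('v, 'e) pre_digraph \<Rightarrow> bool" where
  "left_rooted Q \<longleftrightarrow>
     \<not> (\<exists>\<alpha> :: nat \<Rightarrow> 'e. \<forall>n. \<alpha> n \<in> arcs Q \<and> head Q (\<alpha> (Suc n)) = tail Q (\<alpha> n))"

record ('v, 'e, 'o, 'm) qrep =
  vob :: "'v \<Rightarrow> 'o"
  amor :: "'e \<Rightarrow> 'm"

text \<open>
  Representations and their morphisms are extensional (\<open>undefined\<close> off the quiver), so that HOL
  equality is equality of representations; a morphism carries its domain and codomain.
\<close>

definition reps ::
  "('v, 'e) pre_digraph \<Rightarrow> ('o, 'm) cat \<Rightarrow> ('v, 'e, 'o, 'm) qrep set" where
  "reps Q C = {F. vob F \<in> verts Q \<rightarrow>\<^sub>E Obj C \<and>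
     amor F \<in> (\<Pi>\<^sub>E \<alpha> \<in> arcs Q. Hom C (vob F (tail Q \<alpha>)) (vob F (head Q \<alpha>)))}"

type_synonym ('v, 'e, 'o, 'm) qmor =
  "('v, 'e, 'o, 'm) qrep \<times> ('v, 'e, 'o, 'm) qrep \<times> ('v \<Rightarrow> 'm)"

definition rep_mors ::
  "('v, 'e) pre_digraph \<Rightarrow> ('o, 'm) cat \<Rightarrow> ('v, 'e, 'o, 'm) qmor set" where
  "rep_mors Q C = {(F, G, \<eta>). F \<in> reps Q C \<and> G \<in> reps Q C \<and>
     \<eta> \<in> (\<Pi>\<^sub>E i \<in> verts Q. Hom C (vob F i) (vob G i)) \<and>
     (\<forall>\<alpha> \<in> arcs Q. Comp C (\<eta> (head Q \<alpha>)) (amor F \<alpha>) = Comp C (amor G \<alpha>) (\<eta> (tail Q \<alpha>)))}"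

definition Rep :: "('v, 'e) pre_digraph \<Rightarrow> ('o, 'm) cat
    \<Rightarrow> (('v, 'e, 'o, 'm) qrep, ('v, 'e, 'o, 'm) qmor) cat" where
  "Rep Q C = \<lparr>Obj = reps Q C, Arr = rep_mors Q C,
     Dom = (\<lambda>(F, G, \<eta>). F), Cod = (\<lambda>(F, G, \<eta>). G),
     Idn = (\<lambda>F. (F, F, \<lambda>i \<in> verts Q. Idn C (vob F i))),
     Comp = (\<lambda>(G', H, \<theta>) (F, G, \<eta>). (F, H, \<lambda>i \<in> verts Q. Comp C (\<theta> i) (\<eta> i))),
     Add = (\<lambda>(F, G, \<eta>) (F', G', \<theta>). (F, G, \<lambda>i \<in> verts Q. Add C (\<eta> i) (\<theta> i))),
     Zr = (\<lambda>F G. (F, G, \<lambda>i \<in> verts Q. Zr C (vob F i) (vob G i)))\<rparr>"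

definition f_rep ::
  "('v, 'e) pre_digraph \<Rightarrow> ('o, 'm) cat \<Rightarrow> 'v \<Rightarrow> 'o \<Rightarrow> ('v, 'e, 'o, 'm) qrep" where
  "f_rep Q C i X = \<lparr>vob = (\<lambda>j \<in> verts Q. coprod_obj C (paths Q i j) (\<lambda>_. X)),
     amor = (\<lambda>\<alpha> \<in> arcs Q. THE h.
       h \<in> Hom C (coprod_obj C (paths Q i (tail Q \<alpha>)) (\<lambda>_. X))
                 (coprod_obj C (paths Q i (head Q \<alpha>)) (\<lambda>_. X)) \<and>
       (\<forall>(k, p) \<in> paths Q i (tail Q \<alpha>).
          Comp C h (coprod_inj C (paths Q i (tail Q \<alpha>)) (\<lambda>_. X) (k, p)) =
          coprod_inj C (paths Q i (head Q \<alpha>)) (\<lambda>_. X) (k, p @ [\<alpha>])))\<rparr>"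

definition g_rep ::
  "('v, 'e) pre_digraph \<Rightarrow> ('o, 'm) cat \<Rightarrow> 'v \<Rightarrow> 'o \<Rightarrow> ('v, 'e, 'o, 'm) qrep" where
  "g_rep Q C i X = \<lparr>vob = (\<lambda>j \<in> verts Q. prodt_obj C (paths Q j i) (\<lambda>_. X)),
     amor = (\<lambda>\<alpha> \<in> arcs Q. THE h.
       h \<in> Hom C (prodt_obj C (paths Q (tail Q \<alpha>) i) (\<lambda>_. X))
                 (prodt_obj C (paths Q (head Q \<alpha>) i) (\<lambda>_. X)) \<and>
       (\<forall>(k, p) \<in> paths Q (head Q \<alpha>) i.
          Comp C (prodt_pr C (paths Q (head Q \<alpha>) i) (\<lambda>_. X) (k, p)) h =
          prodt_pr C (paths Q (tail Q \<alpha>) i) (\<lambda>_. X) (tail Q \<alpha>, \<alpha> # p)))\<rparr>"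

definition s_rep ::
  "('v, 'e) pre_digraph \<Rightarrow> ('o, 'm) cat \<Rightarrow> 'v \<Rightarrow> 'o \<Rightarrow> ('v, 'e, 'o, 'm) qrep" where
  "s_rep Q C i X = (let S = (\<lambda>j \<in> verts Q. if j = i then X else zero_obj C) in
     \<lparr>vob = S, amor = (\<lambda>\<alpha> \<in> arcs Q. Zr C (S (tail Q \<alpha>)) (S (head Q \<alpha>)))\<rparr>)"

definition f_star :: "('v, 'e) pre_digraph \<Rightarrow> ('o, 'm) cat \<Rightarrow> 'o set
    \<Rightarrow> ('v, 'e, 'o, 'm) qrep set" where
  "f_star Q C \<S> = {f_rep Q C i X | i X. i \<in> verts Q \<and> X \<in> \<S>}"

definition g_star :: "('v, 'e) pre_digraph \<Rightarrow> ('o, 'm) cat \<Rightarrow> 'o set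
    \<Rightarrow> ('v, 'e, 'o, 'm) qrep set" where
  "g_star Q C \<S> = {g_rep Q C i X | i X. i \<in> verts Q \<and> X \<in> \<S>}"

definition s_star :: "('v, 'e) pre_digraph \<Rightarrow> ('o, 'm) cat \<Rightarrow> 'o set
    \<Rightarrow> ('v, 'e, 'o, 'm) qrep set" where
  "s_star Q C \<S> = {s_rep Q C i X | i X. i \<in> verts Q \<and> X \<in> \<S>}"

definition phi :: "('v, 'e) pre_digraph \<Rightarrow> ('o, 'm) cat \<Rightarrow> ('v, 'e, 'o, 'm) qrep \<Rightarrow> 'v \<Rightarrow> 'm" where
  "phi Q C F i = (let X = (\<lambda>\<alpha>. vob F (tail Q \<alpha>)) in THE h.
     h \<in> Hom C (coprod_obj C (arrows_into Q i) X) (vob F i) \<and>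
     (\<forall>\<alpha> \<in> arrows_into Q i. Comp C h (coprod_inj C (arrows_into Q i) X \<alpha>) = amor F \<alpha>))"

definition psi :: "('v, 'e) pre_digraph \<Rightarrow> ('o, 'm) cat \<Rightarrow> ('v, 'e, 'o, 'm) qrep \<Rightarrow> 'v \<Rightarrow> 'm" where
  "psi Q C F i = (let X = (\<lambda>\<alpha>. vob F (head Q \<alpha>)) in THE h.
     h \<in> Hom C (vob F i) (prodt_obj C (arrows_out Q i) X) \<and>
     (\<forall>\<alpha> \<in> arrows_out Q i. Comp C (prodt_pr C (arrows_out Q i) X \<alpha>) h = amor F \<alpha>))"

definition Phi :: "('v, 'e) pre_digraph \<Rightarrow> ('o, 'm) cat \<Rightarrow> 'o set
    \<Rightarrow> ('v, 'e, 'o, 'm) qrep set" where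
  "Phi Q C \<X> = {F \<in> reps Q C. \<forall>i \<in> verts Q.
     is_mono C (phi Q C F i) \<and> Coker C (phi Q C F i) \<in> \<X>}"

definition Psi :: "('v, 'e) pre_digraph \<Rightarrow> ('o, 'm) cat \<Rightarrow> 'o set
    \<Rightarrow> ('v, 'e, 'o, 'm) qrep set" where
  "Psi Q C \<X> = {F \<in> reps Q C. \<forall>i \<in> verts Q.
     is_epi C (psi Q C F i) \<and> Ker C (psi Q C F i) \<in> \<X>}"

end

theory Submission
  imports Defs
begin

text \<open>
  Only \<open>Ext\<^sup>1\<close> is computed: it vanishes on \<open>(X, Y)\<close> iff every extension of \<open>X\<close> by \<open>Y\<close> splits, and the
  higher groups follow by dimension shifting, since every representation is a quotient of one in
  \<open>\<Phi>(\<A>)\<close> and \<open>\<Phi>(\<A>)\<close> is closed under kernels of epimorphisms.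

  If \<open>\<phi>\<^sub>i\<close> of \<open>F\<close> is a monomorphism with cokernel in \<open>\<A>\<close>, an extension of \<open>F\<close> by the stalk of
  \<open>B \<in> \<B>\<close> at \<open>i\<close> splits, because by the exactness of coproducts it induces an extension of that cokernel
  by \<open>B\<close>. Conversely, the splitting of all such extensions forces \<open>\<phi>\<^sub>i\<close> to be such a monomorphism.
  The representation \<open>f\<^sub>i(B)\<close> has finite support and is filtered by stalks of objects in \<open>\<B>\<close>, with the
  stalk at \<open>i\<close> on top; arrows strictly decrease the number of paths starting at a vertex, so
  orthogonality to \<open>f\<^sub>*(\<B>)\<close> yields orthogonality to \<open>s\<^sub>*(\<B>)\<close> by induction on that number. Part (b) is
  part (a) for the opposite quiver and the dual category.
\<close>

subsection \<open>Preadditive categories\<close>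

text \<open>The abelian category has no elements and need not have enough projectives or injectives.
  Chases are therefore run on morphisms into the object in question, which lift after refining their
  domain along an epimorphism, and the long exact sequences are replaced by the few pieces that
  matter, each proved on extensions themselves. Two of these pieces shape the proof. Closure of \<A>
  under kernels of epimorphisms has to be extracted from Ext^2, a set of zigzag classes; this takes
  a property of 2-extensions that survives every step of a zigzag. And going from Ext^1(F, G) = 0 to
  the vanishing on a stalk quotient of G would require Ext^2(F, T) = 0, where T is the kernel of
  that quotient. Instead Ext^1(K, T) = 0 is used, where K is the kernel of a cover of F in
  \<Phi>(\<A>): T is supported on vertices of smaller rank, where F already satisfies the condition
  of \<Phi>(\<A>), so K satisfies it there too. Finiteness of Q(x,-) makes T an iterated extension
  of finitely many stalks.\<close>

lemma in_Hom_iff [simp]: "f \<in> Hom C X Y \<longleftrightarrow> f \<in> Arr C \<and> Dom C f = X \<and> Cod C f = Y"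
  by (auto simp: Hom_def)

context category
begin

abbreviation comp (infixr "\<cdot>" 70) where "g \<cdot> f \<equiv> Comp C g f"

lemma Dom_in_Obj [simp]: "f \<in> Arr C \<Longrightarrow> Dom C f \<in> Obj C"
  and Cod_in_Obj [simp]: "f \<in> Arr C \<Longrightarrow> Cod C f \<in> Obj C"
  by (auto intro: Dom_Obj Cod_Obj)

lemma Idn_simps [simp]:
  assumes "X \<in> Obj C"
  shows "Idn C X \<in> Arr C" "Dom C (Idn C X) = X" "Cod C (Idn C X) = X"
  using Idn_Hom[OF assms] by auto

lemma comp_simps [simp]:
  assumes "f \<in> Arr C" "g \<in> Arr C" "Dom C g = Cod C f"
  shows "g \<cdot> f \<in> Arr C" "Dom C (g \<cdot> f) = Dom C f" "Cod C (g \<cdot> f) = Cod C g"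
  using Comp_Hom[of f "Dom C f" "Cod C f" g "Cod C g"] assms by auto

lemma comp_assoc [simp]:
  assumes "f \<in> Arr C" "g \<in> Arr C" "h \<in> Arr C" "Dom C g = Cod C f" "Dom C h = Cod C g"
  shows "(h \<cdot> g) \<cdot> f = h \<cdot> g \<cdot> f"
  using Comp_assoc[of f "Dom C f" "Cod C f" g "Cod C g" h "Cod C h"] assms by auto

lemma comp_Idn [simp]: "f \<in> Arr C \<Longrightarrow> Dom C f = X \<Longrightarrow> f \<cdot> Idn C X = f"
  using Comp_Idn[of f "Dom C f" "Cod C f"] by auto

lemma Idn_comp [simp]: "f \<in> Arr C \<Longrightarrow> Cod C f = X \<Longrightarrow> Idn C X \<cdot> f = f"
  using Idn_Comp[of f "Dom C f" "Cod C f"] by auto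

text \<open>Composites are kept nested to the right, so the left side of an equation
  \<open>g \<cdot> f = k \<cdot> h\<close> is no longer a subterm once a further factor stands on
  its right. This form and \<open>comp_cong_left1\<close> replace such a prefix.\<close>

lemma comp_cong_left:
  assumes "g \<cdot> f = k \<cdot> h" "x \<in> Arr C" "f \<in> Arr C" "g \<in> Arr C" "h \<in> Arr C" "k \<in> Arr C"
    "Dom C g = Cod C f" "Dom C k = Cod C h" "Dom C f = Cod C x" "Dom C h = Cod C x"
  shows "g \<cdot> f \<cdot> x = k \<cdot> h \<cdot> x"
proof -
  have "g \<cdot> f \<cdot> x = (g \<cdot> f) \<cdot> x" "(k \<cdot> h) \<cdot> x = k \<cdot> h \<cdot> x" using assms(2-) by simp_all
  then show ?thesis using assms(1) by metis
qed

lemma comp_cong_left1: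
  assumes "g \<cdot> f = h" "x \<in> Arr C" "f \<in> Arr C" "g \<in> Arr C"
    "Dom C g = Cod C f" "Dom C f = Cod C x"
  shows "g \<cdot> f \<cdot> x = h \<cdot> x"
proof -
  have "g \<cdot> f \<cdot> x = (g \<cdot> f) \<cdot> x" using assms(2-) by simp
  then show ?thesis using assms(1) by metis
qed

section \<open>Cancellation and composition of monomorphisms and epimorphisms\<close>

lemma is_monoD:
  assumes "is_mono C f" "f \<cdot> u = f \<cdot> v" "u \<in> Arr C" "v \<in> Arr C"
    "Cod C u = Dom C f" "Cod C v = Dom C f" "Dom C u = Dom C v"
  shows "u = v"
proof -
  have "f \<cdot> u = f \<cdot> v \<longrightarrow> u = v"
    using assms(1,3-) unfolding is_mono_def by (elim conjE, elim ballE[where x = "Dom C u"]) auto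
  then show ?thesis using assms(2) by blast
qed

lemma is_epiD:
  assumes "is_epi C f" "u \<cdot> f = v \<cdot> f" "u \<in> Arr C" "v \<in> Arr C"
    "Dom C u = Cod C f" "Dom C v = Cod C f" "Cod C u = Cod C v"
  shows "u = v"
proof -
  have "u \<cdot> f = v \<cdot> f \<longrightarrow> u = v"
    using assms(1,3-) unfolding is_epi_def by (elim conjE, elim ballE[where x = "Cod C u"]) auto
  then show ?thesis using assms(2) by blast
qed

lemma is_epi_comp:
  assumes "is_epi C f" "is_epi C g" "Dom C g = Cod C f"
  shows "is_epi C (g \<cdot> f)"
proof -
  have [simp]: "f \<in> Arr C" "g \<in> Arr C" using assms by (auto simp: is_epi_def)
  show ?thesis unfolding is_epi_def
  proof (intro conjI ballI impI)
    fix W u v assume *: "u \<in> Hom C (Cod C (g \<cdot> f)) W" "v \<in> Hom C (Cod C (g \<cdot> f)) W"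
      and eq: "u \<cdot> g \<cdot> f = v \<cdot> g \<cdot> f"
    have "(u \<cdot> g) \<cdot> f = (v \<cdot> g) \<cdot> f" using * eq assms(3) by auto
    then have "u \<cdot> g = v \<cdot> g"
      by (rule is_epiD[OF assms(1)]) (use * assms(3) in auto)
    then show "u = v" by (rule is_epiD[OF assms(2)]) (use * assms(3) in auto)
  qed (use assms(3) in auto)
qed

lemma is_mono_comp:
  assumes "is_mono C f" "is_mono C g" "Dom C g = Cod C f"
  shows "is_mono C (g \<cdot> f)"
proof -
  have [simp]: "f \<in> Arr C" "g \<in> Arr C" using assms by (auto simp: is_mono_def)
  show ?thesis unfolding is_mono_def
  proof (intro conjI ballI impI)
    fix W u v assume *: "u \<in> Hom C W (Dom C (g \<cdot> f))" "v \<in> Hom C W (Dom C (g \<cdot> f))"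
      and eq: "(g \<cdot> f) \<cdot> u = (g \<cdot> f) \<cdot> v"
    have "g \<cdot> f \<cdot> u = g \<cdot> f \<cdot> v" using * eq assms(3) by auto
    then have "f \<cdot> u = f \<cdot> v"
      by (rule is_monoD[OF assms(2)]) (use * assms(3) in auto)
    then show "u = v" by (rule is_monoD[OF assms(1)]) (use * assms(3) in auto)
  qed (use assms(3) in auto)
qed

lemma is_mono_left_inverse:
  assumes "f \<in> Arr C" "r \<in> Arr C" "Dom C r = Cod C f" "r \<cdot> f = Idn C (Dom C f)"
  shows "is_mono C f"
  unfolding is_mono_def
proof (intro conjI ballI impI)
  fix W u v assume *: "u \<in> Hom C W (Dom C f)" "v \<in> Hom C W (Dom C f)" "f \<cdot> u = f \<cdot> v"
  then have "r \<cdot> f \<cdot> u = r \<cdot> f \<cdot> v" by simp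
  moreover have "r \<cdot> f \<cdot> w = w" if "w \<in> Hom C W (Dom C f)" for w
    using comp_cong_left1[OF assms(4), of w] that assms by auto
  ultimately show "u = v" using * by metis
qed fact

lemma is_epi_right_inverse:
  assumes "f \<in> Arr C" "s \<in> Arr C" "Cod C s = Dom C f" "f \<cdot> s = Idn C (Cod C f)"
  shows "is_epi C f"
  unfolding is_epi_def
proof (intro conjI ballI impI)
  fix W u v assume *: "u \<in> Hom C (Cod C f) W" "v \<in> Hom C (Cod C f) W" "u \<cdot> f = v \<cdot> f"
  then have "(u \<cdot> f) \<cdot> s = (v \<cdot> f) \<cdot> s" by simp
  moreover have "(w \<cdot> f) \<cdot> s = w" if "w \<in> Hom C (Cod C f) W" for w
    using that assms by auto
  ultimately show "u = v" using * by metis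
qed fact

lemma is_epi_cancel_right:
  assumes "is_epi C (g \<cdot> f)" "f \<in> Arr C" "g \<in> Arr C" "Dom C g = Cod C f"
  shows "is_epi C g"
  unfolding is_epi_def
proof (intro conjI ballI impI)
  fix W u v assume *: "u \<in> Hom C (Cod C g) W" "v \<in> Hom C (Cod C g) W" "u \<cdot> g = v \<cdot> g"
  have "u \<cdot> g \<cdot> f = v \<cdot> g \<cdot> f" by (rule comp_cong_left) (use * assms(2-4) in auto)
  then show "u = v" by (rule is_epiD[OF assms(1)]) (use * assms in auto)
qed fact

lemma is_mono_cancel_left:
  assumes "is_mono C (g \<cdot> f)" "f \<in> Arr C" "g \<in> Arr C" "Dom C g = Cod C f"
  shows "is_mono C f"
  unfolding is_mono_def
proof (intro conjI ballI impI)
  fix W u v assume *: "u \<in> Hom C W (Dom C f)" "v \<in> Hom C W (Dom C f)" "f \<cdot> u = f \<cdot> v"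
  then have "(g \<cdot> f) \<cdot> u = (g \<cdot> f) \<cdot> v" using assms(2-) by auto
  then show "u = v" by (rule is_monoD[OF assms(1)]) (use * assms in auto)
qed fact

lemma is_mono_Idn [simp]: "X \<in> Obj C \<Longrightarrow> is_mono C (Idn C X)"
  by (rule is_mono_left_inverse[where r = "Idn C X"]) auto

lemma is_epi_Idn [simp]: "X \<in> Obj C \<Longrightarrow> is_epi C (Idn C X)"
  by (rule is_epi_right_inverse[where s = "Idn C X"]) auto

end

lemma is_mono_Arr [simp]: "is_mono C f \<Longrightarrow> f \<in> Arr C"
  and is_epi_Arr [simp]: "is_epi C f \<Longrightarrow> f \<in> Arr C"
  by (auto simp: is_mono_def is_epi_def)

context preadditive_category
begin

section \<open>Arithmetic in the groups of morphisms\<close>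

definition neg :: "'b \<Rightarrow> 'b" where
  "neg f = m_inv (hom_group C (Dom C f) (Cod C f)) f"

abbreviation minus where "minus f g \<equiv> Add C f (neg g)"

lemma hom_group: "X \<in> Obj C \<Longrightarrow> Y \<in> Obj C \<Longrightarrow> group (hom_group C X Y)"
  using hom_comm_group comm_group.axioms by blast

lemma Zr_simps [simp]:
  assumes "X \<in> Obj C" "Y \<in> Obj C"
  shows "Zr C X Y \<in> Arr C" "Dom C (Zr C X Y) = X" "Cod C (Zr C X Y) = Y"
  using group.is_monoid[OF hom_group[OF assms]] monoid.one_closed
  by (fastforce simp: hom_group_def)+

lemma Add_simps [simp]:
  assumes "f \<in> Arr C" "g \<in> Arr C" "Dom C f = Dom C g" "Cod C f = Cod C g"
  shows "Add C f g \<in> Arr C" "Dom C (Add C f g) = Dom C g" "Cod C (Add C f g) = Cod C g"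
proof -
  have "group (hom_group C (Dom C g) (Cod C g))" using assms by (intro hom_group) auto
  from group.is_monoid[OF this] monoid.m_closed[of "hom_group C (Dom C g) (Cod C g)" f g] assms
  have "Add C f g \<in> Hom C (Dom C g) (Cod C g)" by (auto simp: hom_group_def)
  then show "Add C f g \<in> Arr C" "Dom C (Add C f g) = Dom C g" "Cod C (Add C f g) = Cod C g"
    by auto
qed

lemma neg_simps [simp]:
  assumes "f \<in> Arr C"
  shows "neg f \<in> Arr C" "Dom C (neg f) = Dom C f" "Cod C (neg f) = Cod C f"
    "Add C f (neg f) = Zr C (Dom C f) (Cod C f)"
    "Add C (neg f) f = Zr C (Dom C f) (Cod C f)"
proof -
  interpret group "hom_group C (Dom C f) (Cod C f)" using assms by (intro hom_group) auto
  have f: "f \<in> carrier (hom_group C (Dom C f) (Cod C f))" using assms by (simp add: hom_group_def)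
  from inv_closed[OF f] show "neg f \<in> Arr C" "Dom C (neg f) = Dom C f" "Cod C (neg f) = Cod C f"
    by (auto simp: neg_def hom_group_def)
  from r_inv[OF f] l_inv[OF f]
  show "Add C f (neg f) = Zr C (Dom C f) (Cod C f)"
    "Add C (neg f) f = Zr C (Dom C f) (Cod C f)"
    by (auto simp: neg_def hom_group_def)
qed

lemma Add_Zr [simp]:
  assumes "f \<in> Arr C" "Dom C f = X" "Cod C f = Y"
  shows "Add C f (Zr C X Y) = f" "Add C (Zr C X Y) f = f"
proof -
  interpret group "hom_group C X Y" using assms by (intro hom_group) auto
  have "f \<in> carrier (hom_group C X Y)" using assms by (simp add: hom_group_def)
  from r_one[OF this] l_one[OF this]
  show "Add C f (Zr C X Y) = f" "Add C (Zr C X Y) f = f" by (auto simp: hom_group_def)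
qed

lemma Add_assoc [simp]:
  assumes "f \<in> Arr C" "g \<in> Arr C" "h \<in> Arr C" "Dom C f = Dom C g" "Cod C f = Cod C g"
    "Dom C g = Dom C h" "Cod C g = Cod C h"
  shows "Add C (Add C f g) h = Add C f (Add C g h)"
proof -
  interpret group "hom_group C (Dom C h) (Cod C h)" using assms by (intro hom_group) auto
  show ?thesis using m_assoc[of f g h] assms by (auto simp: hom_group_def)
qed

lemma Add_commute:
  assumes "f \<in> Arr C" "g \<in> Arr C" "Dom C f = Dom C g" "Cod C f = Cod C g"
  shows "Add C f g = Add C g f"
proof -
  interpret comm_group "hom_group C (Dom C g) (Cod C g)"
    using assms by (intro hom_comm_group) auto
  show ?thesis using m_comm[of f g] assms by (auto simp: hom_group_def)
qed

lemma comp_Add [simp]: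
  assumes "f \<in> Arr C" "f' \<in> Arr C" "g \<in> Arr C" "Dom C f = Dom C f'" "Cod C f = Cod C f'"
    "Dom C g = Cod C f'"
  shows "g \<cdot> Add C f f' = Add C (g \<cdot> f) (g \<cdot> f')"
  by (rule Comp_Add) (use assms in auto)

lemma Add_comp [simp]:
  assumes "f \<in> Arr C" "g' \<in> Arr C" "g \<in> Arr C" "Dom C g = Dom C g'" "Cod C g = Cod C g'"
    "Dom C g' = Cod C f"
  shows "Add C g g' \<cdot> f = Add C (g \<cdot> f) (g' \<cdot> f)"
  by (rule Add_Comp) (use assms in auto)

lemma Add_neg_cancel [simp]:
  assumes "f \<in> Arr C" "g \<in> Arr C" "Dom C g = Dom C f" "Cod C g = Cod C f"
  shows "Add C g (Add C (neg g) f) = f" "Add C (neg g) (Add C g f) = f"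
proof -
  have "Add C g (Add C (neg g) f) = Add C (Add C g (neg g)) f"
    by (rule Add_assoc[symmetric]) (use assms in auto)
  also have "\<dots> = f" using assms by simp
  finally show "Add C g (Add C (neg g) f) = f" .
  have "Add C (neg g) (Add C g f) = Add C (Add C (neg g) g) f"
    by (rule Add_assoc[symmetric]) (use assms in auto)
  also have "\<dots> = f" using assms by simp
  finally show "Add C (neg g) (Add C g f) = f" .
qed

lemma Add_left_cancel:
  assumes "Add C f g = Add C f h" "f \<in> Arr C" "g \<in> Arr C" "h \<in> Arr C" 
    "Dom C f = Dom C g" "Cod C f = Cod C g" "Dom C g = Dom C h" "Cod C g = Cod C h"
  shows "g = h"
proof -
  have "Add C (neg f) (Add C f g) = g" "Add C (neg f) (Add C f h) = h"
    by (rule Add_neg_cancel; use assms(2-) in auto)+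
  then show ?thesis using assms(1) by metis
qed

text \<open>Composition with \<open>f\<close> is additive, so \<open>f \<cdot> 0\<close> equals its
  own double and one copy cancels.\<close>

lemma comp_Zr [simp]:
  assumes "f \<in> Arr C" "Dom C f = Y" "X \<in> Obj C"
  shows "f \<cdot> Zr C X Y = Zr C X (Cod C f)"
proof (rule Add_left_cancel)
  have "Add C (f \<cdot> Zr C X Y) (f \<cdot> Zr C X Y) = f \<cdot> Add C (Zr C X Y) (Zr C X Y)"
    by (rule comp_Add[symmetric]) (use assms in auto)
  also have "Add C (Zr C X Y) (Zr C X Y) = Zr C X Y" using assms by auto
  finally show "Add C (f \<cdot> Zr C X Y) (f \<cdot> Zr C X Y) = Add C (f \<cdot> Zr C X Y) (Zr C X (Cod C f))"
    using assms by auto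
qed (use assms in auto)

lemma Zr_comp [simp]:
  assumes "f \<in> Arr C" "Cod C f = X" "Y \<in> Obj C"
  shows "Zr C X Y \<cdot> f = Zr C (Dom C f) Y"
proof (rule Add_left_cancel)
  have "Add C (Zr C X Y \<cdot> f) (Zr C X Y \<cdot> f) = Add C (Zr C X Y) (Zr C X Y) \<cdot> f"
    by (rule Add_comp[symmetric]) (use assms in auto)
  also have "Add C (Zr C X Y) (Zr C X Y) = Zr C X Y" using assms by auto
  finally show "Add C (Zr C X Y \<cdot> f) (Zr C X Y \<cdot> f) = Add C (Zr C X Y \<cdot> f) (Zr C (Dom C f) Y)"
    using assms by auto
qed (use assms in auto)

lemma eq_neg_iff:
  assumes "Add C f g = Zr C (Dom C f) (Cod C f)" "f \<in> Arr C" "g \<in> Arr C"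
    "Dom C g = Dom C f" "Cod C g = Cod C f"
  shows "g = neg f"
  by (rule Add_left_cancel[of f]) (use assms in auto)

lemma comp_neg [simp]:
  assumes "f \<in> Arr C" "g \<in> Arr C" "Dom C g = Cod C f"
  shows "g \<cdot> neg f = neg (g \<cdot> f)"
proof (rule eq_neg_iff)
  have "Add C (g \<cdot> f) (g \<cdot> neg f) = g \<cdot> Add C f (neg f)"
    by (rule comp_Add[symmetric]) (use assms in auto)
  then show "Add C (g \<cdot> f) (g \<cdot> neg f) = Zr C (Dom C (g \<cdot> f)) (Cod C (g \<cdot> f))"
    using assms by simp
qed (use assms in auto)

lemma neg_comp [simp]:
  assumes "f \<in> Arr C" "g \<in> Arr C" "Dom C g = Cod C f"
  shows "neg g \<cdot> f = neg (g \<cdot> f)"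
proof (rule eq_neg_iff)
  have "Add C (g \<cdot> f) (neg g \<cdot> f) = Add C g (neg g) \<cdot> f"
    by (rule Add_comp[symmetric]) (use assms in auto)
  then show "Add C (g \<cdot> f) (neg g \<cdot> f) = Zr C (Dom C (g \<cdot> f)) (Cod C (g \<cdot> f))"
    using assms by simp
qed (use assms in auto)

lemma neg_Zr [simp]: "X \<in> Obj C \<Longrightarrow> Y \<in> Obj C \<Longrightarrow> neg (Zr C X Y) = Zr C X Y"
  by (rule eq_neg_iff[symmetric]) auto

lemma neg_neg [simp]: "f \<in> Arr C \<Longrightarrow> neg (neg f) = f"
  by (rule eq_neg_iff[symmetric]) auto

lemma minus_eq_Zr:
  assumes "Add C f (neg g) = Zr C X Y" "f \<in> Arr C" "g \<in> Arr C"
    "Dom C g = Dom C f" "Cod C g = Cod C f" "X = Dom C f" "Y = Cod C f"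
  shows "f = g"
proof -
  have "Add C (neg g) f = Add C f (neg g)" by (rule Add_commute) (use assms(2-5) in auto)
  also have "\<dots> = Zr C (Dom C (neg g)) (Cod C (neg g))" using assms by simp
  finally have "f = neg (neg g)" by (rule eq_neg_iff) (use assms(2-5) in auto)
  then show ?thesis using neg_neg[OF assms(3)] by metis
qed

lemma is_monoI:
  assumes "f \<in> Arr C"
    "\<And>X u. u \<in> Hom C X (Dom C f) \<Longrightarrow> f \<cdot> u = Zr C X (Cod C f) \<Longrightarrow> u = Zr C X (Dom C f)"
  shows "is_mono C f"
  unfolding is_mono_def
proof (intro conjI ballI impI)
  fix W u v assume *: "u \<in> Hom C W (Dom C f)" "v \<in> Hom C W (Dom C f)" "f \<cdot> u = f \<cdot> v"
  have "minus u v = Zr C W (Dom C f)"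
    by (rule assms(2)) (use * assms(1) in auto)
  then show "u = v" by (rule minus_eq_Zr) (use * in auto)
qed fact

lemma is_epiI:
  assumes "f \<in> Arr C"
    "\<And>X u. u \<in> Hom C (Cod C f) X \<Longrightarrow> u \<cdot> f = Zr C (Dom C f) X \<Longrightarrow> u = Zr C (Cod C f) X"
  shows "is_epi C f"
  unfolding is_epi_def
proof (intro conjI ballI impI)
  fix W u v assume *: "u \<in> Hom C (Cod C f) W" "v \<in> Hom C (Cod C f) W" "u \<cdot> f = v \<cdot> f"
  have "minus u v = Zr C (Cod C f) W"
    by (rule assms(2)) (use * assms(1) in auto)
  then show "u = v" by (rule minus_eq_Zr) (use * in auto)
qed fact

lemma mono_zero:
  assumes "is_mono C f" "f \<cdot> u = Zr C X Z" "u \<in> Hom C X Y" "f \<in> Hom C Y Z"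
  shows "u = Zr C X Y"
  by (rule is_monoD[OF assms(1)]) (use assms in auto)

lemma epi_zero:
  assumes "is_epi C f" "u \<cdot> f = Zr C X Z" "f \<in> Hom C X Y" "u \<in> Hom C Y Z"
  shows "u = Zr C Y Z"
  by (rule is_epiD[OF assms(1)]) (use assms in auto)

end

subsection \<open>Duality and kernels\<close>

lemma dual_simps [simp]:
  "Obj (dual C) = Obj C" "Arr (dual C) = Arr C" "Dom (dual C) = Cod C" "Cod (dual C) = Dom C"
  "Idn (dual C) = Idn C" "Comp (dual C) g f = Comp C f g" "Add (dual C) = Add C"
  "Zr (dual C) X Y = Zr C Y X" "dual (dual C) = C"
  by (simp_all add: dual_def)

lemma Hom_dual: "Hom (dual C) X Y = Hom C Y X"
  by (auto simp: Hom_def)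

text \<open>The definitions come in mirrored pairs, so passing to \<open>dual C\<close> exchanges
  them literally and reflexivity suffices. A dual statement then costs only an interpretation in
  \<open>dual C\<close>.\<close>

lemma dual_predicates [simp]:
  "is_mono (dual C) = is_epi C" "is_epi (dual C) = is_mono C"
  "is_kernel (dual C) = is_cokernel C" "is_cokernel (dual C) = is_kernel C"
  "is_coproduct (dual C) = is_product C" "is_product (dual C) = is_coproduct C"
  "hom_group (dual C) X Y = hom_group C Y X"
  unfolding fun_eq_iff is_mono_def is_epi_def is_kernel_def is_cokernel_def
    is_coproduct_def is_product_def hom_group_def Hom_dual dual_simps
  by (rule refl TrueI allI)+

lemma is_zero_obj_dual [simp]: "is_zero_obj (dual C) = is_zero_obj C"
  unfolding fun_eq_iff is_zero_obj_def Hom_dual dual_simps by blast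

lemma is_biproduct_dual [simp]:
  "is_biproduct (dual C) X Y P i1 i2 p1 p2 = is_biproduct C X Y P p1 p2 i1 i2"
  unfolding is_biproduct_def Hom_dual dual_simps by blast

lemma (in category) category_dual: "category (dual C)"
  by unfold_locales auto

lemma (in preadditive_category) preadditive_dual: "preadditive_category (dual C)"
proof -
  interpret d: category "dual C" by (rule category_dual)
  have "preadditive_category_axioms (dual C)"
    by (rule preadditive_category_axioms.intro) (auto intro: hom_comm_group)
  then show ?thesis by (intro preadditive_category.intro d.category_axioms)
qed

lemma (in abelian_category) abelian_dual: "abelian_category (dual C)"
proof -
  interpret d: preadditive_category "dual C" by (rule preadditive_dual)
  show ?thesis
  proof
    fix X Y assume "X \<in> Obj (dual C)" "Y \<in> Obj (dual C)"
    then show "\<exists>P i1 i2 p1 p2. is_biproduct (dual C) X Y P i1 i2 p1 p2"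
      using ex_biproduct[of X Y] unfolding is_biproduct_dual dual_simps by blast
  qed (use ex_zero_obj ex_kernel ex_cokernel mono_normal epi_normal in auto)
qed

context category
begin

lemma kernel_Arr:
  assumes "is_kernel C f k"
  shows "f \<in> Arr C" "k \<in> Arr C" "Cod C k = Dom C f" "f \<cdot> k = Zr C (Dom C k) (Cod C f)"
  using assms by (auto simp: is_kernel_def)

lemma cokernel_Arr:
  assumes "is_cokernel C f c"
  shows "f \<in> Arr C" "c \<in> Arr C" "Dom C c = Cod C f" "c \<cdot> f = Zr C (Dom C f) (Cod C c)"
  using assms by (auto simp: is_cokernel_def)

lemma kernel_factor:
  assumes "is_kernel C f k" "u \<in> Arr C" "Cod C u = Dom C f" "f \<cdot> u = Zr C (Dom C u) (Cod C f)"
  obtains h where "h \<in> Arr C" "Dom C h = Dom C u" "Cod C h = Dom C k" "k \<cdot> h = u"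
proof -
  have "Dom C u \<in> Obj C" "u \<in> Hom C (Dom C u) (Dom C f)" using assms(2,3) by auto
  then have "\<exists>!h. h \<in> Hom C (Dom C u) (Dom C k) \<and> k \<cdot> h = u"
    using assms(1,4) unfolding is_kernel_def by blast
  then show thesis using that by auto
qed

lemma cokernel_factor:
  assumes "is_cokernel C f c" "u \<in> Arr C" "Dom C u = Cod C f" "u \<cdot> f = Zr C (Dom C f) (Cod C u)"
  obtains h where "h \<in> Arr C" "Cod C h = Cod C u" "Dom C h = Cod C c" "h \<cdot> c = u"
proof -
  have "Cod C u \<in> Obj C" "u \<in> Hom C (Cod C f) (Cod C u)" using assms(2,3) by auto
  then have "\<exists>!h. h \<in> Hom C (Cod C c) (Cod C u) \<and> h \<cdot> c = u"
    using assms(1,4) unfolding is_cokernel_def by blast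
  then show thesis using that by auto
qed

end

context preadditive_category
begin

lemma kernel_is_mono:
  assumes "is_kernel C f k"
  shows "is_mono C k"
proof (rule is_monoI)
  fix X u assume u: "u \<in> Hom C X (Dom C k)" "k \<cdot> u = Zr C X (Cod C k)"
  note k = kernel_Arr[OF assms]
  have un: "\<exists>!h. h \<in> Hom C W (Dom C k) \<and> k \<cdot> h = v"
    if "W \<in> Obj C" "v \<in> Hom C W (Dom C f)" "f \<cdot> v = Zr C W (Cod C f)" for W v
    using assms that unfolding is_kernel_def by blast
  have X: "X \<in> Obj C" using u by auto
  have "\<exists>!h. h \<in> Hom C X (Dom C k) \<and> k \<cdot> h = Zr C X (Dom C f)"
    by (rule un) (use X k in auto)
  moreover have "u \<in> Hom C X (Dom C k) \<and> k \<cdot> u = Zr C X (Dom C f)"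
    using u k by auto
  moreover have "Zr C X (Dom C k) \<in> Hom C X (Dom C k) \<and> k \<cdot> Zr C X (Dom C k) = Zr C X (Dom C f)"
    using X k by auto
  ultimately show "u = Zr C X (Dom C k)" by blast
qed (use kernel_Arr[OF assms] in auto)

lemma is_kernelI:
  assumes "is_mono C k" "f \<in> Arr C" "Cod C k = Dom C f" "f \<cdot> k = Zr C (Dom C k) (Cod C f)"
    "\<And>u. u \<in> Arr C \<Longrightarrow> Cod C u = Dom C f \<Longrightarrow> f \<cdot> u = Zr C (Dom C u) (Cod C f) \<Longrightarrow>
      \<exists>h \<in> Arr C. Dom C h = Dom C u \<and> Cod C h = Dom C k \<and> k \<cdot> h = u"
  shows "is_kernel C f k"
  unfolding is_kernel_def
proof (intro conjI ballI impI)
  fix W u assume u: "u \<in> Hom C W (Dom C f)" "f \<cdot> u = Zr C W (Cod C f)"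
  then obtain h where h: "h \<in> Arr C" "Dom C h = W" "Cod C h = Dom C k" "k \<cdot> h = u"
    using assms(5)[of u] by auto
  show "\<exists>!h. h \<in> Hom C W (Dom C k) \<and> k \<cdot> h = u"
  proof (rule ex1I[of _ h])
    fix h' assume h': "h' \<in> Hom C W (Dom C k) \<and> k \<cdot> h' = u"
    show "h' = h" by (rule is_monoD[OF assms(1)]) (use h h' in auto)
  qed (use h in auto)
qed (use assms in auto)

end

context preadditive_category
begin

interpretation d: preadditive_category "dual C" by (rule preadditive_dual)

lemma cokernel_is_epi: "is_cokernel C f c \<Longrightarrow> is_epi C c"
  using d.kernel_is_mono[of f c] by simp

lemma is_cokernelI:
  assumes "is_epi C k" "f \<in> Arr C" "Dom C k = Cod C f" "k \<cdot> f = Zr C (Dom C f) (Cod C k)"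
    "\<And>u. u \<in> Arr C \<Longrightarrow> Dom C u = Cod C f \<Longrightarrow> u \<cdot> f = Zr C (Dom C f) (Cod C u) \<Longrightarrow>
      \<exists>h \<in> Arr C. Cod C h = Cod C u \<and> Dom C h = Cod C k \<and> h \<cdot> k = u"
  shows "is_cokernel C f k"
  using d.is_kernelI[of k f] assms by simp

lemma is_cokernel_Zr_Idn: "X \<in> Obj C \<Longrightarrow> Y \<in> Obj C \<Longrightarrow> is_cokernel C (Zr C X Y) (Idn C Y)"
  by (rule is_cokernelI) auto

lemma mono_kernel_zero:
  assumes "is_mono C f" "is_kernel C f k"
  shows "k = Zr C (Dom C k) (Dom C f)"
  by (rule mono_zero[OF assms(1)]) (use kernel_Arr[OF assms(2)] in auto)

lemma mono_if_kernel_zero: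
  assumes "is_kernel C f k" "k = Zr C (Dom C k) (Dom C f)"
  shows "is_mono C f"
proof (rule is_monoI)
  fix X u assume u: "u \<in> Hom C X (Dom C f)" "f \<cdot> u = Zr C X (Cod C f)"
  obtain h where h: "h \<in> Arr C" "Dom C h = X" "Cod C h = Dom C k" "k \<cdot> h = u"
    by (rule kernel_factor[OF assms(1), of u]) (use u in auto)
  have "u = Zr C (Dom C k) (Dom C f) \<cdot> h" using h(4) assms(2) by metis
  also have "\<dots> = Zr C X (Dom C f)" using h kernel_Arr[OF assms(1)] by simp
  finally show "u = Zr C X (Dom C f)" .
qed (use kernel_Arr[OF assms(1)] in auto)

end

section \<open>Image factorization and pullbacks\<close>

context abelian_category
begin

text \<open>The image is the kernel \<open>m\<close> of a cokernel \<open>c\<close> of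
  \<open>f\<close>. Suppose the induced \<open>e\<close> lands in a subobject \<open>k\<close> of
  it. Normality makes \<open>m \<cdot> k\<close> a kernel of some \<open>g\<close>; but whatever
  kills \<open>f\<close> factors through \<open>c\<close> and so kills \<open>m\<close>, which
  forces \<open>k\<close> to be everything.\<close>

lemma image_factorization:
  assumes f: "f \<in> Arr C" and c: "is_cokernel C f c"
  obtains e m where "is_epi C e" "is_kernel C c m" "f = m \<cdot> e" "Dom C e = Dom C f" "Cod C e = Dom C m"
proof -
  obtain m where m: "is_kernel C c m" using ex_kernel cokernel_Arr(2)[OF c] by blast
  obtain e where e: "e \<in> Arr C" "Dom C e = Dom C f" "Cod C e = Dom C m" "m \<cdot> e = f"
    by (rule kernel_factor[OF m, of f]) (use cokernel_Arr[OF c] in auto)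
  have "is_epi C e"
  proof (rule is_epiI)
    fix X t assume "t \<in> Hom C (Cod C e) X" "t \<cdot> e = Zr C (Dom C e) X"
    then have t: "t \<in> Arr C" "Dom C t = Cod C e" "Cod C t = X" "t \<cdot> e = Zr C (Dom C e) X"
      and X: "X \<in> Obj C" by auto
    obtain k where k: "is_kernel C t k" using ex_kernel t by blast
    obtain e' where e': "e' \<in> Arr C" "Dom C e' = Dom C e" "Cod C e' = Dom C k" "k \<cdot> e' = e"
      by (rule kernel_factor[OF k, of e]) (use e t in auto)
    have "is_mono C (m \<cdot> k)"
      by (rule is_mono_comp) (use kernel_is_mono m k kernel_Arr[OF k] t e in auto)
    then obtain g where g: "is_kernel C g (m \<cdot> k)" using mono_normal by blast
    have ty [simp]: "m \<in> Arr C" "k \<in> Arr C" "Cod C k = Dom C m" "c \<in> Arr C" "g \<in> Arr C"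
      "Cod C m = Cod C f" "Dom C c = Cod C f" "Dom C g = Cod C f"
      using kernel_Arr[OF m] kernel_Arr[OF k] kernel_Arr[OF g] t e cokernel_Arr[OF c] by auto
    have gmk: "g \<cdot> m \<cdot> k = Zr C (Dom C k) (Cod C g)"
      using kernel_Arr(4)[OF g] by simp
    have "g \<cdot> f = (g \<cdot> m \<cdot> k) \<cdot> e'" using e e' by simp
    then have gf: "g \<cdot> f = Zr C (Dom C f) (Cod C g)" using e e' gmk by simp
    obtain g' where g': "g' \<in> Arr C" "Cod C g' = Cod C g" "Dom C g' = Cod C c" "g' \<cdot> c = g"
      by (rule cokernel_factor[OF c, of g]) (use gf in auto)
    have "g \<cdot> m = (g' \<cdot> c) \<cdot> m" unfolding g'(4) ..
    also have "\<dots> = Zr C (Dom C m) (Cod C g)" using g'(1-3) kernel_Arr(4)[OF m] by simp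
    finally have gm: "g \<cdot> m = Zr C (Dom C m) (Cod C g)" .
    obtain s where s: "s \<in> Arr C" "Dom C s = Dom C m" "Cod C s = Dom C (m \<cdot> k)" "(m \<cdot> k) \<cdot> s = m"
      by (rule kernel_factor[OF g, of m]) (use gm in auto)
    \<comment> \<open>\<open>m\<close> factors through \<open>m \<cdot> k\<close>, so
      \<open>k\<close> has a right inverse and \<open>t\<close>, which kills \<open>k\<close>, is
      zero.\<close>
    have "k \<cdot> s = Idn C (Dom C m)"
      by (rule is_monoD[OF kernel_is_mono[OF m]]) (use s in auto)
    then have "t = t \<cdot> k \<cdot> s" using t e by simp
    also have "\<dots> = Zr C (Dom C k) (Cod C t) \<cdot> s"
      by (rule comp_cong_left1) (use kernel_Arr[OF k] s t e in auto)
    also have "\<dots> = Zr C (Cod C e) (Cod C t)" using s(1-3) t e X kernel_Arr(2)[OF k] by simp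
    finally show "t = Zr C (Cod C e) X" unfolding t(3) .
  qed (use e in auto)
  then show thesis using that m e by metis
qed

text \<open>By normality \<open>f\<close> is a cokernel of some \<open>g\<close>, and
  \<open>g\<close> factors through the kernel \<open>k\<close>; so whatever kills \<open>k\<close>
  also kills \<open>g\<close> and factors through \<open>f\<close>.\<close>

lemma epi_is_cokernel_of_kernel:
  assumes "is_epi C f" "is_kernel C f k"
  shows "is_cokernel C k f"
proof (rule is_cokernelI)
  obtain g where g: "is_cokernel C g f" using epi_normal assms by blast
  fix u assume u: "u \<in> Arr C" "Dom C u = Cod C k" "u \<cdot> k = Zr C (Dom C k) (Cod C u)"
  have gt: "g \<in> Arr C" "Cod C g = Dom C f" "f \<cdot> g = Zr C (Dom C g) (Cod C f)"
    using cokernel_Arr[OF g] by auto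
  obtain g' where g': "g' \<in> Arr C" "Dom C g' = Dom C g" "Cod C g' = Dom C k" "k \<cdot> g' = g"
    by (rule kernel_factor[OF assms(2), of g]) (use gt in auto)
  have "u \<cdot> k \<cdot> g' = Zr C (Dom C k) (Cod C u) \<cdot> g'"
    by (rule comp_cong_left1) (use g'(1-3) u kernel_Arr[OF assms(2)] in auto)
  then have ug: "u \<cdot> g = Zr C (Dom C g) (Cod C u)" using g' u(1) by simp
  obtain h where "h \<in> Arr C" "Cod C h = Cod C u" "Dom C h = Cod C f" "h \<cdot> f = u"
    by (rule cokernel_factor[OF g, of u]) (use u gt kernel_Arr[OF assms(2)] ug in auto)
  then show "\<exists>h\<in>Arr C. Cod C h = Cod C u \<and> Dom C h = Cod C f \<and> h \<cdot> f = u" by blast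
qed (use assms(1) kernel_Arr[OF assms(2)] in auto)

text \<open>The pullback is the kernel of the difference of \<open>f \<cdot> p1\<close> and
  \<open>g \<cdot> p2\<close> on the biproduct. The last clause, stability of epimorphisms, is what
  makes chases by refinement possible. There \<open>?d\<close> is an epimorphism, as
  \<open>f\<close> factors through it, hence a cokernel of \<open>k\<close>; a \<open>u\<close> that
  kills \<open>p2 \<cdot> k\<close> gives \<open>u \<cdot> p2 = t \<cdot> ?d\<close>, and
  restriction to the first summand gives \<open>t \<cdot> f = 0\<close>, so
  \<open>t = 0\<close>.\<close>

lemma pullback:
  assumes "f \<in> Arr C" "g \<in> Arr C" "Cod C f = Cod C g"
  obtains P p q where "p \<in> Hom C P (Dom C f)" "q \<in> Hom C P (Dom C g)" "f \<cdot> p = g \<cdot> q"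
    "\<And>T a b. a \<in> Hom C T (Dom C f) \<Longrightarrow> b \<in> Hom C T (Dom C g) \<Longrightarrow> f \<cdot> a = g \<cdot> b \<Longrightarrow>
       \<exists>h \<in> Hom C T P. p \<cdot> h = a \<and> q \<cdot> h = b"
    "\<And>T h h'. h \<in> Hom C T P \<Longrightarrow> h' \<in> Hom C T P \<Longrightarrow> p \<cdot> h = p \<cdot> h' \<Longrightarrow> q \<cdot> h = q \<cdot> h' \<Longrightarrow> h = h'"
    "is_epi C f \<Longrightarrow> is_epi C q"
proof -
  let ?X = "Dom C f" and ?Y = "Dom C g" and ?Z = "Cod C g"
  obtain S i1 i2 p1 p2 where b: "is_biproduct C ?X ?Y S i1 i2 p1 p2"
    using ex_biproduct[of ?X ?Y] assms by auto
  have [simp]: "i1 \<in> Arr C" "Dom C i1 = ?X" "Cod C i1 = S" "i2 \<in> Arr C" "Dom C i2 = ?Y" "Cod C i2 = S"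
    "p1 \<in> Arr C" "Dom C p1 = S" "Cod C p1 = ?X" "p2 \<in> Arr C" "Dom C p2 = S" "Cod C p2 = ?Y"
    "S \<in> Obj C"
    "p1 \<cdot> i1 = Idn C ?X" "p2 \<cdot> i2 = Idn C ?Y"
    and sum: "Add C (i1 \<cdot> p1) (i2 \<cdot> p2) = Idn C S"
    using b by (auto simp: is_biproduct_def)
  \<comment> \<open>Vanishing of the mixed composites is not part of \<open>is_biproduct\<close>.
    Inserting the decomposition of the identity into \<open>p1 \<cdot> i2\<close> produces that
    morphism twice, and one copy cancels.\<close>
  have p1i2: "p1 \<cdot> i2 = Zr C ?Y ?X"
  proof -
    have "p1 \<cdot> Add C (i1 \<cdot> p1) (i2 \<cdot> p2) \<cdot> i2 = p1 \<cdot> i2" unfolding sum using assms by simp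
    then have "Add C (p1 \<cdot> i1 \<cdot> p1 \<cdot> i2) (p1 \<cdot> i2) = p1 \<cdot> i2" using assms by simp
    moreover have "p1 \<cdot> i1 \<cdot> p1 \<cdot> i2 = Idn C ?X \<cdot> p1 \<cdot> i2" by (rule comp_cong_left1) auto
    ultimately have "Add C (p1 \<cdot> i2) (p1 \<cdot> i2) = Add C (p1 \<cdot> i2) (Zr C ?Y ?X)"
      using assms by simp
    then show ?thesis by (rule Add_left_cancel) (use assms in auto)
  qed
  have p2i1: "p2 \<cdot> i1 = Zr C ?X ?Y"
  proof -
    have "p2 \<cdot> Add C (i1 \<cdot> p1) (i2 \<cdot> p2) \<cdot> i1 = p2 \<cdot> i1" unfolding sum using assms by simp
    then have "Add C (p2 \<cdot> i1) (p2 \<cdot> i2 \<cdot> p2 \<cdot> i1) = p2 \<cdot> i1" using assms by simp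
    moreover have "p2 \<cdot> i2 \<cdot> p2 \<cdot> i1 = Idn C ?Y \<cdot> p2 \<cdot> i1" by (rule comp_cong_left1) auto
    ultimately have "Add C (p2 \<cdot> i1) (p2 \<cdot> i1) = Add C (p2 \<cdot> i1) (Zr C ?X ?Y)"
      using assms by simp
    then show ?thesis by (rule Add_left_cancel) (use assms in auto)
  qed
  let ?d = "minus (f \<cdot> p1) (g \<cdot> p2)"
  have d: "?d \<in> Arr C" "Dom C ?d = S" "Cod C ?d = ?Z" using assms by auto
  have di1: "?d \<cdot> i1 = f" and di2: "?d \<cdot> i2 = neg g"
    using assms p1i2 p2i1 by simp_all
  obtain k where k: "is_kernel C ?d k" using ex_kernel d by blast
  have k_typ: "k \<in> Arr C" "Cod C k = S" using kernel_Arr[OF k] d by auto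
  note kt = k_typ d assms
  have dk: "minus (f \<cdot> p1 \<cdot> k) (g \<cdot> p2 \<cdot> k) = Zr C (Dom C k) ?Z"
    using kernel_Arr(4)[OF k] kt by simp
  have epi: "is_epi C (p2 \<cdot> k)" if "is_epi C f"
  proof (rule is_epiI)
    fix X u assume "u \<in> Hom C (Cod C (p2 \<cdot> k)) X" "u \<cdot> p2 \<cdot> k = Zr C (Dom C (p2 \<cdot> k)) X"
    then have u: "u \<in> Arr C" "Dom C u = ?Y" "Cod C u = X" "u \<cdot> p2 \<cdot> k = Zr C (Dom C k) X"
      and X: "X \<in> Obj C" using k_typ by auto
    have ed: "is_epi C ?d" by (rule is_epi_cancel_right[of _ i1]) (use that di1 d in auto)
    obtain t where t: "t \<in> Arr C" "Cod C t = Cod C (u \<cdot> p2)" "Dom C t = Cod C ?d" "t \<cdot> ?d = u \<cdot> p2"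
      by (rule cokernel_factor[OF epi_is_cokernel_of_kernel[OF ed k], of "u \<cdot> p2"]) (use u kt in auto)
    have "t \<cdot> f = t \<cdot> ?d \<cdot> i1" unfolding di1 ..
    also have "\<dots> = (t \<cdot> ?d) \<cdot> i1" by (rule comp_assoc[symmetric]) (use t d in simp_all)
    also have "\<dots> = Zr C ?X X" unfolding t(4) using u kt X p2i1 by simp
    finally have tf: "t \<cdot> f = Zr C ?X X" .
    have "t = Zr C ?Z X" by (rule epi_zero[OF that tf]) (use t u d assms in auto)
    then have "t \<cdot> ?d = Zr C ?Z X \<cdot> ?d" by simp
    also have "\<dots> = Zr C S X" by (rule Zr_comp[THEN trans]) (use d t u X assms in auto)
    finally have "(u \<cdot> p2) \<cdot> i2 = Zr C S X \<cdot> i2" unfolding t(4) by simp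
    then show "u = Zr C (Cod C (p2 \<cdot> k)) X" using u kt X by simp
  qed (use kt in auto)
  have *: "w = Add C (i1 \<cdot> p1 \<cdot> w) (i2 \<cdot> p2 \<cdot> w)" if w: "w \<in> Arr C" "Cod C w = S" for w
  proof -
    have "Add C (i1 \<cdot> p1 \<cdot> w) (i2 \<cdot> p2 \<cdot> w) = Add C (i1 \<cdot> p1) (i2 \<cdot> p2) \<cdot> w" using w by simp
    then show ?thesis unfolding sum using w by simp
  qed
  show thesis
  proof (rule that[of "p1 \<cdot> k" "Dom C k" "p2 \<cdot> k"])
    show "f \<cdot> p1 \<cdot> k = g \<cdot> p2 \<cdot> k" by (rule minus_eq_Zr[OF dk]) (use kt in auto)
    fix T a b assume ab: "a \<in> Hom C T ?X" "b \<in> Hom C T ?Y" "f \<cdot> a = g \<cdot> b"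
    let ?u = "Add C (i1 \<cdot> a) (i2 \<cdot> b)"
    have "p1 \<cdot> i1 \<cdot> a = Idn C ?X \<cdot> a" "p1 \<cdot> i2 \<cdot> b = Zr C ?Y ?X \<cdot> b"
      "p2 \<cdot> i1 \<cdot> a = Zr C ?X ?Y \<cdot> a" "p2 \<cdot> i2 \<cdot> b = Idn C ?Y \<cdot> b"
      by (rule comp_cong_left1; use ab p1i2 p2i1 in simp)+
    then obtain u where u: "u \<in> Arr C" "Dom C u = T" "Cod C u = S" "p1 \<cdot> u = a" "p2 \<cdot> u = b"
      using ab kt by (intro that[of ?u]) simp_all
    have "?d \<cdot> u = minus (f \<cdot> a) (g \<cdot> b)" using u kt by simp
    then have du: "?d \<cdot> u = Zr C T ?Z" using ab kt by simp
    obtain h where h: "h \<in> Arr C" "Dom C h = T" "Cod C h = Dom C k" "k \<cdot> h = u"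
      by (rule kernel_factor[OF k, of u]) (use u(1-3) d du in \<open>simp_all del: Add_comp\<close>)
    show "\<exists>h \<in> Hom C T (Dom C k). (p1 \<cdot> k) \<cdot> h = a \<and> (p2 \<cdot> k) \<cdot> h = b"
      by (rule bexI[of _ h]) (use h u kt ab in auto)
  next
    fix T h h' assume h: "h \<in> Hom C T (Dom C k)" "h' \<in> Hom C T (Dom C k)"
      "(p1 \<cdot> k) \<cdot> h = (p1 \<cdot> k) \<cdot> h'" "(p2 \<cdot> k) \<cdot> h = (p2 \<cdot> k) \<cdot> h'"
    have "p1 \<cdot> k \<cdot> h = p1 \<cdot> k \<cdot> h'" "p2 \<cdot> k \<cdot> h = p2 \<cdot> k \<cdot> h'" using h kt by simp_all
    note eqs = this
    have "k \<cdot> h = Add C (i1 \<cdot> p1 \<cdot> k \<cdot> h) (i2 \<cdot> p2 \<cdot> k \<cdot> h)" by (rule *) (use h kt in simp_all)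
    also have "\<dots> = Add C (i1 \<cdot> p1 \<cdot> k \<cdot> h') (i2 \<cdot> p2 \<cdot> k \<cdot> h')" unfolding eqs ..
    also have "\<dots> = k \<cdot> h'" by (rule *[symmetric]) (use h kt in simp_all)
    finally have "k \<cdot> h = k \<cdot> h'" .
    then show "h = h'" by (rule is_monoD[OF kernel_is_mono[OF k]]) (use h kt in auto)
  qed (use kt epi in auto)
qed

end

subsection \<open>Exact sequences in abelian categories\<close>

context abelian_category
begin

lemma biproduct:
  assumes "X \<in> Obj C" "Y \<in> Obj C"
  obtains S i1 i2 p1 p2 where "S \<in> Obj C" "i1 \<in> Hom C X S" "i2 \<in> Hom C Y S"
    "p1 \<in> Hom C S X" "p2 \<in> Hom C S Y" "p1 \<cdot> i1 = Idn C X" "p2 \<cdot> i2 = Idn C Y"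
    "p1 \<cdot> i2 = Zr C Y X" "p2 \<cdot> i1 = Zr C X Y" "Add C (i1 \<cdot> p1) (i2 \<cdot> p2) = Idn C S"
proof -
  obtain S i1 i2 p1 p2 where b: "is_biproduct C X Y S i1 i2 p1 p2"
    using ex_biproduct[OF assms] by blast
  have b: "S \<in> Obj C" "i1 \<in> Hom C X S" "i2 \<in> Hom C Y S"
    "p1 \<in> Hom C S X" "p2 \<in> Hom C S Y" "p1 \<cdot> i1 = Idn C X" "p2 \<cdot> i2 = Idn C Y"
    and sum: "Add C (i1 \<cdot> p1) (i2 \<cdot> p2) = Idn C S"
    using b unfolding is_biproduct_def by blast+
  have "p1 \<cdot> i2 = Zr C Y X"
  proof -
    have "p1 \<cdot> Add C (i1 \<cdot> p1) (i2 \<cdot> p2) \<cdot> i2 = p1 \<cdot> i2" unfolding sum using assms b by simp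
    then have "Add C (p1 \<cdot> i1 \<cdot> p1 \<cdot> i2) (p1 \<cdot> i2) = p1 \<cdot> i2" using assms b by simp
    moreover have "p1 \<cdot> i1 \<cdot> p1 \<cdot> i2 = Idn C X \<cdot> p1 \<cdot> i2"
      by (rule comp_cong_left1) (use b in auto)
    ultimately have "Add C (p1 \<cdot> i2) (p1 \<cdot> i2) = Add C (p1 \<cdot> i2) (Zr C Y X)"
      using assms b by simp
    then show ?thesis by (rule Add_left_cancel) (use assms b in auto)
  qed
  moreover have "p2 \<cdot> i1 = Zr C X Y"
  proof -
    have "p2 \<cdot> Add C (i1 \<cdot> p1) (i2 \<cdot> p2) \<cdot> i1 = p2 \<cdot> i1" unfolding sum using assms b by simp
    then have "Add C (p2 \<cdot> i1) (p2 \<cdot> i2 \<cdot> p2 \<cdot> i1) = p2 \<cdot> i1" using assms b by simp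
    moreover have "p2 \<cdot> i2 \<cdot> p2 \<cdot> i1 = Idn C Y \<cdot> p2 \<cdot> i1"
      by (rule comp_cong_left1) (use b in auto)
    ultimately have "Add C (p2 \<cdot> i1) (p2 \<cdot> i1) = Add C (p2 \<cdot> i1) (Zr C X Y)"
      using assms b by simp
    then show ?thesis by (rule Add_left_cancel) (use assms b in auto)
  qed
  ultimately show thesis using that b sum by blast
qed

text \<open>A morphism \<open>y\<close> out of \<open>T\<close> plays the part of an element of
  \<open>Y\<close>: it lifts along \<open>f\<close> once \<open>T\<close> is refined by an
  epimorphism, namely the projection of the pullback. The later diagram chases rest on this.\<close>

lemma epi_lift:
  assumes "is_epi C f" "f \<in> Hom C X Y" "y \<in> Hom C T Y"
  obtains T' e x where "is_epi C e" "e \<in> Hom C T' T" "x \<in> Hom C T' X" "f \<cdot> x = y \<cdot> e"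
proof -
  have 1: "f \<in> Arr C" "y \<in> Arr C" "Cod C f = Cod C y" using assms by auto
  show thesis by (rule pullback[OF 1]) (use that assms in auto)
qed

text \<open>Symmetric form of exactness: \<open>g \<cdot> f = 0\<close> puts the image into the
  kernel, \<open>c \<cdot> k = 0\<close> puts the kernel into the image. Cokernel and kernel enter
  on an equal footing, so passing to \<open>dual C\<close> becomes immediate.\<close>

lemma exact_iff:
  "exact C f g \<longleftrightarrow> f \<in> Arr C \<and> g \<in> Arr C \<and> Dom C g = Cod C f \<and>
    g \<cdot> f = Zr C (Dom C f) (Cod C g) \<and>
    (\<exists>c k. is_cokernel C f c \<and> is_kernel C g k \<and> c \<cdot> k = Zr C (Dom C k) (Cod C c))"
    (is "_ \<longleftrightarrow> ?rhs")
proof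
  assume "exact C f g"
  then obtain c k where c: "is_cokernel C f c" and ck: "is_kernel C c k" and k: "is_kernel C g k"
    by (auto simp: exact_def)
  note ca = cokernel_Arr[OF c] and ka = kernel_Arr[OF ck] and ga = kernel_Arr[OF k]
  obtain h where h: "h \<in> Arr C" "Dom C h = Dom C f" "Cod C h = Dom C k" "k \<cdot> h = f"
    by (rule kernel_factor[OF ck, of f]) (use ca in auto)
  have "g \<cdot> f = (g \<cdot> k) \<cdot> h" unfolding h(4)[symmetric]
    by (rule comp_assoc[symmetric]) (use h(1-3) ga ca in auto)
  also have "\<dots> = Zr C (Dom C f) (Cod C g)" unfolding ga(4) using h(1-3) ga(1,2) by auto
  finally show ?rhs using c k ca ka ga by metis
next
  assume r: ?rhs
  then obtain c k where c: "is_cokernel C f c" and k: "is_kernel C g k"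
    and z: "c \<cdot> k = Zr C (Dom C k) (Cod C c)" by blast
  note ca = cokernel_Arr[OF c] and ga = kernel_Arr[OF k]
  have "is_kernel C c k"
  proof (rule is_kernelI[OF kernel_is_mono[OF k]])
    fix u assume u: "u \<in> Arr C" "Cod C u = Dom C c" "c \<cdot> u = Zr C (Dom C u) (Cod C c)"
    obtain g' where g': "g' \<in> Arr C" "Cod C g' = Cod C g" "Dom C g' = Cod C c" "g' \<cdot> c = g"
      by (rule cokernel_factor[OF c, of g]) (use r in auto)
    have "g \<cdot> u = g' \<cdot> c \<cdot> u" unfolding g'(4)[symmetric]
      by (rule comp_assoc) (use g'(1-3) ca u in auto)
    also have "\<dots> = Zr C (Dom C u) (Cod C g)" unfolding u(3) using g'(1-3) u(1) by auto
    finally have gu: "g \<cdot> u = Zr C (Dom C u) (Cod C g)" .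
    obtain h where "h \<in> Arr C" "Dom C h = Dom C u" "Cod C h = Dom C k" "k \<cdot> h = u"
      by (rule kernel_factor[OF k, of u]) (use u ca r gu in auto)
    then show "\<exists>h\<in>Arr C. Dom C h = Dom C u \<and> Cod C h = Dom C k \<and> k \<cdot> h = u" by blast
  qed (use ca ga z r in auto)
  then show "exact C f g" unfolding exact_def using c k by blast
qed

lemma exactD:
  assumes "exact C f g"
  shows "f \<in> Arr C" "g \<in> Arr C" "Dom C g = Cod C f" "g \<cdot> f = Zr C (Dom C f) (Cod C g)"
  using assms unfolding exact_iff by blast+

text \<open>What \<open>g\<close> kills factors through the kernel \<open>k\<close>, so it is killed
  by the cokernel \<open>c\<close> of \<open>f\<close> and factors through the image
  \<open>m\<close>. It is then lifted through the epimorphism \<open>e'\<close> onto the image after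
  a refinement.\<close>

lemma exact_lift:
  assumes "exact C f g" "f \<in> Hom C X Y" "g \<in> Hom C Y Z" "y \<in> Hom C T Y" "g \<cdot> y = Zr C T Z"
  obtains T' e x where "is_epi C e" "e \<in> Hom C T' T" "x \<in> Hom C T' X" "f \<cdot> x = y \<cdot> e"
proof -
  obtain c k where c: "is_cokernel C f c" and k: "is_kernel C g k"
    and z: "c \<cdot> k = Zr C (Dom C k) (Cod C c)" using assms(1) unfolding exact_iff by blast
  note ca = cokernel_Arr[OF c] and ga = kernel_Arr[OF k]
  obtain w where w: "w \<in> Arr C" "Dom C w = T" "Cod C w = Dom C k" "k \<cdot> w = y"
    by (rule kernel_factor[OF k, of y]) (use assms in auto)
  have "c \<cdot> y = (c \<cdot> k) \<cdot> w" unfolding w(4)[symmetric]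
    by (rule comp_assoc[symmetric]) (use w(1-3) ca ga assms in auto)
  also have "\<dots> = Zr C T (Cod C c)" unfolding z using w(1-3) ca by auto
  finally have cy: "c \<cdot> y = Zr C T (Cod C c)" .
  obtain e' m where em: "is_epi C e'" "is_kernel C c m" "f = m \<cdot> e'" "Dom C e' = Dom C f"
    "Cod C e' = Dom C m"
    by (rule image_factorization[OF ca(1) c])
  note ma = kernel_Arr[OF em(2)]
  obtain v where v: "v \<in> Arr C" "Dom C v = T" "Cod C v = Dom C m" "m \<cdot> v = y"
    by (rule kernel_factor[OF em(2), of y]) (use assms ca cy in auto)
  obtain T' e x where ex: "is_epi C e" "e \<in> Hom C T' T" "x \<in> Hom C T' X" "e' \<cdot> x = v \<cdot> e"
    by (rule epi_lift[OF em(1), of X "Dom C m" v T]) (use v em assms in auto)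
  have "f \<cdot> x = m \<cdot> e' \<cdot> x" unfolding em(3)
    by (rule comp_assoc) (use ex em ma assms in auto)
  also have "\<dots> = (m \<cdot> v) \<cdot> e" unfolding ex(4)
    by (rule comp_assoc[symmetric]) (use ex v ma in auto)
  finally show thesis using that ex v by metis
qed

lemma epi_if_lifts:
  assumes "f \<in> Hom C X Y" "is_epi C e" "e \<in> Hom C T Y" "x \<in> Hom C T X" "f \<cdot> x = e"
  shows "is_epi C f"
  by (rule is_epi_cancel_right[of f x]) (use assms in auto)

text \<open>The converse of \<open>exact_lift\<close>. Testing on the kernel \<open>k\<close> of
  \<open>g\<close> itself is enough: a lift of \<open>k \<cdot> e\<close> along \<open>f\<close>
  gives \<open>c \<cdot> k \<cdot> e = 0\<close>, and the epimorphism \<open>e\<close>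
  cancels.\<close>

lemma exactI:
  assumes "f \<in> Hom C X Y" "g \<in> Hom C Y Z" "g \<cdot> f = Zr C X Z"
    "\<And>T y. T \<in> Obj C \<Longrightarrow> y \<in> Hom C T Y \<Longrightarrow> g \<cdot> y = Zr C T Z \<Longrightarrow>
      \<exists>T' e. \<exists>x \<in> Hom C T' X. is_epi C e \<and> e \<in> Hom C T' T \<and> f \<cdot> x = y \<cdot> e"
  shows "exact C f g"
proof -
  obtain c where c: "is_cokernel C f c" using ex_cokernel assms by auto
  obtain k where k: "is_kernel C g k" using ex_kernel assms by auto
  note ca = cokernel_Arr[OF c] and ga = kernel_Arr[OF k]
  obtain T' e x where x: "x \<in> Hom C T' X" "is_epi C e" "e \<in> Hom C T' (Dom C k)" "f \<cdot> x = k \<cdot> e"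
    using assms(4)[of "Dom C k" k] ga assms(2) by auto
  have "(c \<cdot> k) \<cdot> e = c \<cdot> f \<cdot> x" unfolding x(4)
    by (rule comp_assoc) (use x ca ga assms in auto)
  also have "\<dots> = Zr C (Dom C f) (Cod C c) \<cdot> x"
    by (rule comp_cong_left1) (use x ca assms in auto)
  finally have "(c \<cdot> k) \<cdot> e = Zr C T' (Cod C c)" using x assms(1) ca by simp
  then have "c \<cdot> k = Zr C (Dom C k) (Cod C c)"
    by (rule epi_zero[OF x(2)]) (use x ca ga assms in auto)
  then show ?thesis unfolding exact_iff using assms c k by auto
qed

text \<open>In the forward direction a lift \<open>x\<close> exists only after refinement by
  \<open>e\<close>. It descends along \<open>e\<close> because it kills the kernel \<open>d\<close>
  of \<open>e\<close>: there \<open>f \<cdot> x \<cdot> d = u \<cdot> e \<cdot> d = 0\<close>, and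
  \<open>f\<close> is a monomorphism.\<close>

lemma short_exact_iff: "short_exact C f g \<longleftrightarrow> is_kernel C g f \<and> is_epi C g"
proof
  assume s: "short_exact C f g"
  then have e: "exact C f g" and m: "is_mono C f" by (auto simp: short_exact_def)
  note ea = exactD[OF e]
  have "is_kernel C g f"
  proof (rule is_kernelI[OF m])
    fix u assume u: "u \<in> Arr C" "Cod C u = Dom C g" "g \<cdot> u = Zr C (Dom C u) (Cod C g)"
    obtain T' e x where ex: "is_epi C e" "e \<in> Hom C T' (Dom C u)" "x \<in> Hom C T' (Dom C f)"
      "f \<cdot> x = u \<cdot> e"
      by (rule exact_lift[OF e, of "Dom C f" "Cod C f" "Cod C g" u "Dom C u"]) (use ea u in auto)
    obtain d where d: "is_kernel C e d" using ex_kernel[OF is_epi_Arr[OF ex(1)]] by blast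
    note da = kernel_Arr[OF d]
    have "f \<cdot> x \<cdot> d = u \<cdot> e \<cdot> d" by (rule comp_cong_left) (use ex da ea u in auto)
    also have "\<dots> = Zr C (Dom C d) (Cod C f)" unfolding da(4) using da ex(2) u ea by simp
    finally have xd: "x \<cdot> d = Zr C (Dom C d) (Dom C f)"
      by (rule mono_zero[OF m]) (use da ex ea in auto)
    obtain h where h: "h \<in> Arr C" "Cod C h = Cod C x" "Dom C h = Cod C e" "h \<cdot> e = x"
      by (rule cokernel_factor[OF epi_is_cokernel_of_kernel[OF ex(1) d], of x])
        (use ex(1-3) da xd in auto)
    have "f \<cdot> h = u"
    proof (rule is_epiD[OF ex(1)])
      have "(f \<cdot> h) \<cdot> e = f \<cdot> h \<cdot> e" by (rule comp_assoc) (use h ex ea in auto)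
      then show "(f \<cdot> h) \<cdot> e = u \<cdot> e" unfolding h(4) ex(4) .
    qed (use h ex ea u in auto)
    then show "\<exists>h\<in>Arr C. Dom C h = Dom C u \<and> Cod C h = Dom C f \<and> f \<cdot> h = u"
      using h ex by auto
  qed (use ea in auto)
  then show "is_kernel C g f \<and> is_epi C g" using s by (simp add: short_exact_def)
next
  assume k: "is_kernel C g f \<and> is_epi C g"
  then have fg: "is_kernel C g f" by simp
  note fa = kernel_Arr[OF fg]
  have "exact C f g"
  proof (rule exactI)
    fix T y assume y: "T \<in> Obj C" "y \<in> Hom C T (Cod C f)" "g \<cdot> y = Zr C T (Cod C g)"
    obtain h where h: "h \<in> Arr C" "Dom C h = T" "Cod C h = Dom C f" "f \<cdot> h = y"
      by (rule kernel_factor[OF fg, of y]) (use y fa in auto)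
    show "\<exists>T' e. \<exists>x \<in> Hom C T' (Dom C f). is_epi C e \<and> e \<in> Hom C T' T \<and> f \<cdot> x = y \<cdot> e"
      by (rule exI[of _ T], rule exI[of _ "Idn C T"], rule bexI[of _ h]) (use y h in auto)
  qed (use fa in auto)
  then show "short_exact C f g" using k kernel_is_mono[OF fg] by (simp add: short_exact_def)
qed

lemma exact_dual: "exact (dual C) g f \<longleftrightarrow> exact C f g"
proof -
  interpret d: abelian_category "dual C" by (rule abelian_dual)
  show ?thesis unfolding d.exact_iff exact_iff dual_simps dual_predicates by metis
qed

lemma short_exact_dual: "short_exact (dual C) g f \<longleftrightarrow> short_exact C f g"
  by (auto simp: short_exact_def exact_dual)

lemma short_exactI:
  assumes "f \<in> Hom C X Y" "g \<in> Hom C Y Z" "g \<cdot> f = Zr C X Z"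
    "\<And>T x. T \<in> Obj C \<Longrightarrow> x \<in> Hom C T X \<Longrightarrow> f \<cdot> x = Zr C T Y \<Longrightarrow> x = Zr C T X"
    "\<And>T y. T \<in> Obj C \<Longrightarrow> y \<in> Hom C T Y \<Longrightarrow> g \<cdot> y = Zr C T Z \<Longrightarrow>
      \<exists>T' e. \<exists>x \<in> Hom C T' X. is_epi C e \<and> e \<in> Hom C T' T \<and> f \<cdot> x = y \<cdot> e"
    "is_epi C g"
  shows "short_exact C f g"
  unfolding short_exact_def
proof (intro conjI)
  show "is_mono C f" by (rule is_monoI) (use assms(1,4) in auto)
  show "exact C f g" by (rule exactI[OF assms(1-3,5)])
qed fact

lemma short_exactD:
  assumes "short_exact C f g" "f \<in> Hom C X Y" "g \<in> Hom C Y Z"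
  shows "is_mono C f" "is_epi C g" "is_kernel C g f" "is_cokernel C f g" "exact C f g"
    "g \<cdot> f = Zr C X Z"
proof -
  show "is_mono C f" "is_epi C g" "exact C f g" "is_kernel C g f"
    using assms(1) short_exact_iff by (auto simp: short_exact_def)
  then show "is_cokernel C f g" "g \<cdot> f = Zr C X Z"
    using epi_is_cokernel_of_kernel exactD assms(2,3) by auto
qed

lemma short_exact_if_kernel: "is_kernel C g f \<Longrightarrow> is_epi C g \<Longrightarrow> short_exact C f g"
  by (simp add: short_exact_iff)

lemma short_exact_if_cokernel:
  assumes "is_cokernel C f g" "is_mono C f"
  shows "short_exact C f g"
proof -
  interpret d: abelian_category "dual C" by (rule abelian_dual)
  show ?thesis using d.short_exact_if_kernel[of f g] assms by (simp add: short_exact_dual)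
qed

text \<open>The kernel of \<open>f\<close> is a zero morphism, so the identity of \<open>X\<close>
  annihilates it and factors through \<open>f\<close>, which is a cokernel of that kernel.\<close>

lemma iso_if_mono_epi:
  assumes "is_mono C f" "is_epi C f" "f \<in> Hom C X Y"
  obtains g where "g \<in> Hom C Y X" "f \<cdot> g = Idn C Y" "g \<cdot> f = Idn C X"
proof -
  obtain k where k: "is_kernel C f k" using ex_kernel[OF is_mono_Arr[OF assms(1)]] by blast
  note ka = kernel_Arr[OF k]
  have kz: "k = Zr C (Dom C k) X" using mono_kernel_zero[OF assms(1) k] assms by simp
  have "X \<in> Obj C" using assms by auto
  then have "Idn C X \<cdot> k = k" using ka assms by auto
  then have "Idn C X \<cdot> k = Zr C (Dom C k) X" using kz by metis
  note ik = this
  obtain g where g: "g \<in> Arr C" "Cod C g = X" "Dom C g = Cod C f" "g \<cdot> f = Idn C X"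
    by (rule cokernel_factor[OF epi_is_cokernel_of_kernel[OF assms(2) k], of "Idn C X"])
      (use assms ka(1-3) ik in auto)
  have "f \<cdot> g = Idn C Y"
  proof (rule is_epiD[OF assms(2)])
    have "(f \<cdot> g) \<cdot> f = f \<cdot> g \<cdot> f" by (rule comp_assoc) (use g assms in auto)
    then show "(f \<cdot> g) \<cdot> f = Idn C Y \<cdot> f" unfolding g(4) using assms by simp
  qed (use g assms in auto)
  then show thesis using that g assms by auto
qed

end

subsection \<open>Splitting of extensions\<close>

text \<open>Vanishing of Ext^1 without equivalence classes; \<open>Ext_zero_one_iff\<close>
  identifies it with \<open>Ext_zero C 1 X Y\<close> for objects \<open>X\<close> and
  \<open>Y\<close>. Asking for a section rather than a retraction is a choice, the two being
  equivalent on a short exact sequence.\<close>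

definition ext1_zero :: "('o, 'm) cat \<Rightarrow> 'o \<Rightarrow> 'o \<Rightarrow> bool" where
  "ext1_zero C X Y \<longleftrightarrow> (\<forall>E. \<forall>f \<in> Hom C Y E. \<forall>g \<in> Hom C E X. short_exact C f g \<longrightarrow>
     (\<exists>s \<in> Hom C X E. Comp C g s = Idn C X))"

context abelian_category
begin

text \<open>The difference of the identity and \<open>s \<cdot> g\<close> is killed by
  \<open>g\<close>, so it factors as \<open>f \<cdot> r\<close>; composing with \<open>f\<close> and
  cancelling the monomorphism gives the retraction.\<close>

lemma section_imp_retraction:
  assumes "short_exact C f g" "f \<in> Hom C Y E" "g \<in> Hom C E X" "s \<in> Hom C X E" "g \<cdot> s = Idn C X"
  obtains r where "r \<in> Hom C E Y" "r \<cdot> f = Idn C Y"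
proof -
  note se = short_exactD[OF assms(1-3)]
  have obj: "E \<in> Obj C" "X \<in> Obj C" "Y \<in> Obj C" using assms by auto
  let ?u = "minus (Idn C E) (s \<cdot> g)"
  have "g \<cdot> s \<cdot> g = Idn C X \<cdot> g" by (rule comp_cong_left1) (use assms in auto)
  then have gu: "g \<cdot> ?u = Zr C E X" using assms obj by simp
  obtain r where r: "r \<in> Arr C" "Dom C r = E" "Cod C r = Y" "f \<cdot> r = ?u"
    by (rule kernel_factor[OF se(3), of ?u]) (use assms obj gu in \<open>simp_all del: comp_Add\<close>)
  have "r \<cdot> f = Idn C Y"
  proof (rule is_monoD[OF se(1)])
    have "f \<cdot> r \<cdot> f = ?u \<cdot> f" by (rule comp_cong_left1) (use r assms in auto)
    also have "\<dots> = f" using se(6) assms obj by simp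
    finally show "f \<cdot> r \<cdot> f = f \<cdot> Idn C Y" using assms by simp
  qed (use r assms obj in auto)
  then show thesis using that r by simp
qed

lemma retraction_imp_section:
  assumes "short_exact C f g" "f \<in> Hom C Y E" "g \<in> Hom C E X" "r \<in> Hom C E Y" "r \<cdot> f = Idn C Y"
  obtains s where "s \<in> Hom C X E" "g \<cdot> s = Idn C X"
proof -
  interpret d: abelian_category "dual C" by (rule abelian_dual)
  show thesis
    by (rule d.section_imp_retraction[of g f X E Y r])
      (use assms that in \<open>auto simp: short_exact_dual\<close>)
qed

text \<open>Duality turns sections into retractions, hence the detour through their
  equivalence.\<close>

lemma ext1_zero_dual: "ext1_zero (dual C) Y X \<longleftrightarrow> ext1_zero C X Y"
proof -
  have "(\<exists>s \<in> Hom C X E. g \<cdot> s = Idn C X) \<longleftrightarrow> (\<exists>r \<in> Hom C E Y. r \<cdot> f = Idn C Y)"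
    if se: "f \<in> Hom C Y E" "g \<in> Hom C E X" "short_exact C f g" for f g E
  proof
    assume "\<exists>s \<in> Hom C X E. g \<cdot> s = Idn C X"
    then obtain s where s: "s \<in> Hom C X E" "g \<cdot> s = Idn C X" by blast
    show "\<exists>r \<in> Hom C E Y. r \<cdot> f = Idn C Y"
      by (rule section_imp_retraction[OF se(3,1,2) s]) blast
  next
    assume "\<exists>r \<in> Hom C E Y. r \<cdot> f = Idn C Y"
    then obtain r where r: "r \<in> Hom C E Y" "r \<cdot> f = Idn C Y" by blast
    show "\<exists>s \<in> Hom C X E. g \<cdot> s = Idn C X"
      by (rule retraction_imp_section[OF se(3,1,2) r]) blast
  qed
  note eq = this
  show ?thesis
    unfolding ext1_zero_def short_exact_dual Hom_dual dual_simps
  proof (intro iffI allI ballI impI)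
    fix E f g
    assume a: "\<forall>E. \<forall>f\<in>Hom C E X. \<forall>g\<in>Hom C Y E. short_exact C g f \<longrightarrow> (\<exists>s\<in>Hom C E Y. s \<cdot> g = Idn C Y)"
      and "f \<in> Hom C Y E" "g \<in> Hom C E X" "short_exact C f g"
    then show "\<exists>s\<in>Hom C X E. g \<cdot> s = Idn C X" using eq by blast
  next
    fix E f g
    assume a: "\<forall>E. \<forall>f\<in>Hom C Y E. \<forall>g\<in>Hom C E X. short_exact C f g \<longrightarrow> (\<exists>s\<in>Hom C X E. g \<cdot> s = Idn C X)"
      and "f \<in> Hom C E X" "g \<in> Hom C Y E" "short_exact C g f"
    then show "\<exists>s\<in>Hom C E Y. s \<cdot> g = Idn C Y" using eq by blast
  qed
qed

lemma ext1_zeroD_section: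
  assumes "ext1_zero C X Y" "short_exact C f g" "f \<in> Hom C Y E" "g \<in> Hom C E X"
  obtains s where "s \<in> Hom C X E" "g \<cdot> s = Idn C X"
  using assms unfolding ext1_zero_def by blast

lemma ext1_zeroD_retraction:
  assumes "ext1_zero C X Y" "short_exact C f g" "f \<in> Hom C Y E" "g \<in> Hom C E X"
  obtains r where "r \<in> Hom C E Y" "r \<cdot> f = Idn C Y"
proof -
  obtain s where s: "s \<in> Hom C X E" "g \<cdot> s = Idn C X"
    using assms unfolding ext1_zero_def by blast
  show thesis by (rule section_imp_retraction[OF assms(2-4) s that])
qed

text \<open>The kernel of \<open>q\<close> is embedded by the morphism \<open>j\<close> with
  components \<open>k\<close> and \<open>0\<close>. The two universal clauses are handed on because
  later constructions define further morphisms into \<open>E\<close> and compare them.\<close>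

lemma pullback_short_exact:
  assumes "short_exact C k p" "k \<in> Hom C K G" "p \<in> Hom C G S" "u \<in> Hom C X S"
  obtains E j q v where "short_exact C j q" "j \<in> Hom C K E" "q \<in> Hom C E X" "v \<in> Hom C E G"
    "p \<cdot> v = u \<cdot> q" "v \<cdot> j = k"
    "\<And>T a b. a \<in> Hom C T G \<Longrightarrow> b \<in> Hom C T X \<Longrightarrow> p \<cdot> a = u \<cdot> b \<Longrightarrow>
       \<exists>h \<in> Hom C T E. v \<cdot> h = a \<and> q \<cdot> h = b"
    "\<And>T h h'. h \<in> Hom C T E \<Longrightarrow> h' \<in> Hom C T E \<Longrightarrow> v \<cdot> h = v \<cdot> h' \<Longrightarrow> q \<cdot> h = q \<cdot> h' \<Longrightarrow> h = h'"
proof -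
  note se = short_exactD[OF assms(1-3)]
  have 1: "p \<in> Arr C" "u \<in> Arr C" "Cod C p = Cod C u" using assms by auto
  have obj: "K \<in> Obj C" "X \<in> Obj C" "S \<in> Obj C" using assms by auto
  obtain E v q where E: "v \<in> Hom C E G" "q \<in> Hom C E X" "p \<cdot> v = u \<cdot> q"
    and univ: "\<And>T a b. a \<in> Hom C T G \<Longrightarrow> b \<in> Hom C T X \<Longrightarrow> p \<cdot> a = u \<cdot> b \<Longrightarrow>
       \<exists>h \<in> Hom C T E. v \<cdot> h = a \<and> q \<cdot> h = b"
    and uniq: "\<And>T h h'. h \<in> Hom C T E \<Longrightarrow> h' \<in> Hom C T E \<Longrightarrow> v \<cdot> h = v \<cdot> h' \<Longrightarrow>
      q \<cdot> h = q \<cdot> h' \<Longrightarrow> h = h'"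
    and epi: "is_epi C q"
    by (rule pullback[OF 1]) (use that assms se in auto)
  obtain j where j: "j \<in> Hom C K E" "v \<cdot> j = k" "q \<cdot> j = Zr C K X"
    using univ[of k K "Zr C K X"] assms obj se(6) by auto
  have "is_kernel C q j"
  proof (rule is_kernelI)
    have "is_mono C (v \<cdot> j)" unfolding j(2) by (rule se)
    then show "is_mono C j" by (rule is_mono_cancel_left) (use j E in auto)
    fix y assume y: "y \<in> Arr C" "Cod C y = Dom C q" "q \<cdot> y = Zr C (Dom C y) (Cod C q)"
    have "p \<cdot> v \<cdot> y = u \<cdot> q \<cdot> y" by (rule comp_cong_left) (use E y assms in auto)
    also have "\<dots> = Zr C (Dom C y) S" unfolding y(3) using E y(1) assms by simp
    finally have pvy: "p \<cdot> v \<cdot> y = Zr C (Dom C y) S" .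
    obtain h where h: "h \<in> Arr C" "Dom C h = Dom C y" "Cod C h = K" "k \<cdot> h = v \<cdot> y"
      by (rule kernel_factor[OF se(3), of "v \<cdot> y"]) (use E(1,2) y(1,2) pvy assms in auto)
    have "v \<cdot> j \<cdot> h = k \<cdot> h" by (rule comp_cong_left1) (use j h E in auto)
    moreover have "q \<cdot> j \<cdot> h = Zr C K X \<cdot> h" by (rule comp_cong_left1) (use j h E in auto)
    ultimately have vq: "v \<cdot> j \<cdot> h = v \<cdot> y" "q \<cdot> j \<cdot> h = q \<cdot> y"
      using h y(3) E obj by simp_all
    have "j \<cdot> h = y" by (rule uniq[OF _ _ vq, of "Dom C y"]) (use j(1) h(1-3) E(2) y in auto)
    then show "\<exists>h\<in>Arr C. Dom C h = Dom C y \<and> Cod C h = Dom C j \<and> j \<cdot> h = y"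
      using h j by auto
  qed (use j E in auto)
  then have "short_exact C j q" using epi by (rule short_exact_if_kernel)
  then show thesis by (rule that[OF _ j(1) E(2,1,3) j(2) univ uniq])
qed

text \<open>The pullback of the extension along \<open>u\<close> splits, and its section followed by
  the projection \<open>v\<close> is the lift. This is the piece Hom(X, G) \<rightarrow> Hom(X, S)
  \<rightarrow> Ext^1(X, K) of the long exact sequence.\<close>

lemma ext1_zero_lift:
  assumes "ext1_zero C X K" "short_exact C k p" "k \<in> Hom C K G" "p \<in> Hom C G S" "u \<in> Hom C X S"
  obtains v where "v \<in> Hom C X G" "p \<cdot> v = u"
proof -
  obtain E j q v where E: "short_exact C j q" "j \<in> Hom C K E" "q \<in> Hom C E X" "v \<in> Hom C E G"
    "p \<cdot> v = u \<cdot> q"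
    by (rule pullback_short_exact[OF assms(2-5)])
  obtain s where s: "s \<in> Hom C X E" "q \<cdot> s = Idn C X"
    by (rule ext1_zeroD_section[OF assms(1) E(1-3)])
  have "p \<cdot> v \<cdot> s = u \<cdot> q \<cdot> s" by (rule comp_cong_left) (use E s assms in auto)
  then show thesis using that[of "v \<cdot> s"] s E assms by auto
qed

lemma ext1_zero_extend:
  assumes "ext1_zero C F G" "short_exact C k p" "k \<in> Hom C K P" "p \<in> Hom C P F" "u \<in> Hom C K G"
  obtains v where "v \<in> Hom C P G" "v \<cdot> k = u"
proof -
  interpret d: abelian_category "dual C" by (rule abelian_dual)
  show thesis
    by (rule d.ext1_zero_lift[of G F p k P K u])
      (use assms that in \<open>auto simp: short_exact_dual ext1_zero_dual\<close>)
qed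

text \<open>\<open>E'\<close> is the quotient of \<open>E\<close> by \<open>G1\<close>. Factoring
  \<open>G1\<close> out of both \<open>G\<close> and \<open>E\<close> turns an extension of
  \<open>F\<close> by \<open>G\<close> into one of \<open>F\<close> by \<open>G2\<close>.\<close>

lemma short_exact_quotient:
  assumes "short_exact C a b" "a \<in> Hom C G E" "b \<in> Hom C E F"
    "short_exact C i p" "i \<in> Hom C G1 G" "p \<in> Hom C G G2"
  obtains E' c a' b' where "short_exact C (a \<cdot> i) c" "c \<in> Hom C E E'"
    "short_exact C a' b'" "a' \<in> Hom C G2 E'" "b' \<in> Hom C E' F" "a' \<cdot> p = c \<cdot> a" "b' \<cdot> c = b"
proof -
  note ab = short_exactD[OF assms(1-3)] and ip = short_exactD[OF assms(4-6)]
  have ai: "a \<cdot> i \<in> Hom C G1 E" using assms by auto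
  obtain c where c: "is_cokernel C (a \<cdot> i) c" using ex_cokernel[of "a \<cdot> i"] ai by auto
  note ca = cokernel_Arr[OF c]
  define E' where "E' = Cod C c"
  have cE: "c \<in> Hom C E E'" using ca ai by (auto simp: E'_def)
  have obj: "E' \<in> Obj C" "G1 \<in> Obj C" "F \<in> Obj C" "G2 \<in> Obj C" using cE assms by auto
  have "is_mono C (a \<cdot> i)" by (rule is_mono_comp) (use assms ab ip in auto)
  then have se: "short_exact C (a \<cdot> i) c" by (rule short_exact_if_cokernel[OF c])
  note cs = short_exactD[OF se ai cE]
  have cai: "c \<cdot> a \<cdot> i = Zr C G1 E'" using cs(6) .
  obtain a' where a': "a' \<in> Arr C" "Cod C a' = E'" "Dom C a' = G2" "a' \<cdot> p = c \<cdot> a"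
    by (rule cokernel_factor[OF ip(4), of "c \<cdot> a"]) (use cE cai assms in auto)
  have "b \<cdot> a \<cdot> i = Zr C G F \<cdot> i" by (rule comp_cong_left1) (use ab assms in auto)
  then have bai: "b \<cdot> a \<cdot> i = Zr C G1 F" using assms obj by simp
  obtain b' where b': "b' \<in> Arr C" "Cod C b' = F" "Dom C b' = E'" "b' \<cdot> c = b"
    by (rule cokernel_factor[OF cs(4), of b]) (use bai assms ai cE in auto)
  have "short_exact C a' b'"
  proof (rule short_exactI)
    show "a' \<in> Hom C G2 E'" "b' \<in> Hom C E' F" using a' b' by auto
    have "(b' \<cdot> a') \<cdot> p = b' \<cdot> c \<cdot> a"
      unfolding a'(4)[symmetric] by (rule comp_assoc) (use a' b' assms in auto)
    also have "\<dots> = b \<cdot> a" by (rule comp_cong_left1) (use b' cE assms in auto)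
    finally have "(b' \<cdot> a') \<cdot> p = Zr C G F" using ab by simp
    then show "b' \<cdot> a' = Zr C G2 F" by (rule epi_zero[OF ip(2)]) (use a' b' assms in auto)
    have "is_epi C (b' \<cdot> c)" unfolding b'(4) by (rule ab)
    then show "is_epi C b'" by (rule is_epi_cancel_right) (use b' cE in auto)
  next
    fix T x assume x: "T \<in> Obj C" "x \<in> Hom C T G2" "a' \<cdot> x = Zr C T E'"
    obtain T' e y where y: "is_epi C e" "e \<in> Hom C T' T" "y \<in> Hom C T' G" "p \<cdot> y = x \<cdot> e"
      by (rule epi_lift[OF ip(2) assms(6) x(2)])
    have "c \<cdot> a \<cdot> y = a' \<cdot> p \<cdot> y" by (rule comp_cong_left) (use a' cE y assms in auto)
    also have "\<dots> = (a' \<cdot> x) \<cdot> e" unfolding y(4) by (rule comp_assoc[symmetric]) (use a' x y in auto)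
    also have "\<dots> = Zr C T' E'" unfolding x(3) using y obj by auto
    finally have cay: "c \<cdot> a \<cdot> y = Zr C T' E'" .
    obtain z where z: "z \<in> Arr C" "Dom C z = T'" "Cod C z = G1" "(a \<cdot> i) \<cdot> z = a \<cdot> y"
      by (rule kernel_factor[OF cs(3), of "a \<cdot> y"]) (use cay y assms cE in auto)
    have "i \<cdot> z = y" by (rule is_monoD[OF ab(1)]) (use z y assms in auto)
    then have "p \<cdot> y = p \<cdot> i \<cdot> z" by simp
    also have "\<dots> = Zr C G1 G2 \<cdot> z" by (rule comp_cong_left1) (use ip z assms in auto)
    finally have "x \<cdot> e = Zr C T' G2" unfolding y(4) using z(1-3) obj by simp
    then show "x = Zr C T G2" by (rule epi_zero[OF y(1)]) (use y x in auto)
  next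
    fix T y assume y: "T \<in> Obj C" "y \<in> Hom C T E'" "b' \<cdot> y = Zr C T F"
    obtain T' e z where z: "is_epi C e" "e \<in> Hom C T' T" "z \<in> Hom C T' E" "c \<cdot> z = y \<cdot> e"
      by (rule epi_lift[OF cs(2) cE y(2)])
    have "b \<cdot> z = b' \<cdot> c \<cdot> z" by (rule comp_cong_left1[symmetric]) (use b' cE z in auto)
    also have "\<dots> = (b' \<cdot> y) \<cdot> e" unfolding z(4) by (rule comp_assoc[symmetric]) (use b' y z in auto)
    also have "\<dots> = Zr C T' F" unfolding y(3) using z obj by auto
    finally have bz: "b \<cdot> z = Zr C T' F" .
    obtain w where w: "w \<in> Arr C" "Dom C w = T'" "Cod C w = G" "a \<cdot> w = z"
      by (rule kernel_factor[OF ab(3), of z]) (use bz z assms in auto)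
    have "a' \<cdot> p \<cdot> w = c \<cdot> a \<cdot> w" by (rule comp_cong_left) (use a' cE w assms in auto)
    then have "a' \<cdot> p \<cdot> w = y \<cdot> e" using w z by simp
    then show "\<exists>T' e. \<exists>x \<in> Hom C T' G2. is_epi C e \<and> e \<in> Hom C T' T \<and> a' \<cdot> x = y \<cdot> e"
      using z w assms by (intro exI[of _ T'] exI[of _ e] bexI[of _ "p \<cdot> w"]) auto
  qed
  then show thesis using that se cE a' b' by auto
qed

text \<open>Exactness of Ext^1(F, -) in the middle. The quotient of \<open>E\<close> by
  \<open>G1\<close> is an extension of \<open>F\<close> by \<open>G2\<close> and splits; its section
  then lifts along the projection \<open>c\<close>, whose kernel is \<open>G1\<close>.\<close>

lemma ext1_zero_middle:
  assumes "ext1_zero C F G1" "ext1_zero C F G2"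
    "short_exact C i p" "i \<in> Hom C G1 G" "p \<in> Hom C G G2"
  shows "ext1_zero C F G"
  unfolding ext1_zero_def
proof (intro allI ballI impI)
  fix E a b assume ab: "a \<in> Hom C G E" "b \<in> Hom C E F" "short_exact C a b"
  obtain E' c a' b' where E: "short_exact C (a \<cdot> i) c" "c \<in> Hom C E E'"
    "short_exact C a' b'" "a' \<in> Hom C G2 E'" "b' \<in> Hom C E' F" "b' \<cdot> c = b"
    by (rule short_exact_quotient[OF ab(3,1,2) assms(3-5)])
  obtain s where s: "s \<in> Hom C F E'" "b' \<cdot> s = Idn C F"
    by (rule ext1_zeroD_section[OF assms(2) E(3-5)])
  have ai: "a \<cdot> i \<in> Hom C G1 E" using ab assms by auto
  obtain t where t: "t \<in> Hom C F E" "c \<cdot> t = s"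
    by (rule ext1_zero_lift[OF assms(1) E(1) ai E(2) s(1)])
  have "b \<cdot> t = b' \<cdot> c \<cdot> t" by (rule comp_cong_left1[symmetric]) (use E t in auto)
  then show "\<exists>s\<in>Hom C F E. b \<cdot> s = Idn C F" using t s by auto
qed

text \<open>Composing the monomorphism with \<open>i\<close> turns an extension by \<open>Y'\<close>
  into one by \<open>Y\<close> with the same epimorphism, so a section of the latter serves for the
  former.\<close>

lemma ext1_zero_iso_right:
  assumes "ext1_zero C X Y" "i \<in> Hom C Y Y'" "is_mono C i" "is_epi C i"
  shows "ext1_zero C X Y'"
  unfolding ext1_zero_def
proof (intro allI ballI impI)
  fix E f g assume fg: "f \<in> Hom C Y' E" "g \<in> Hom C E X" "short_exact C f g"
  note se = short_exactD[OF fg(3,1,2)]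
  obtain j where j: "j \<in> Hom C Y' Y" "i \<cdot> j = Idn C Y'"
    by (rule iso_if_mono_epi[OF assms(3,4,2)])
  have "is_kernel C g (f \<cdot> i)"
  proof (rule is_kernelI)
    show "is_mono C (f \<cdot> i)" by (rule is_mono_comp) (use se fg assms in auto)
    have "g \<cdot> f \<cdot> i = Zr C Y' X \<cdot> i" by (rule comp_cong_left1) (use fg se assms in auto)
    moreover have "X \<in> Obj C" using fg by auto
    ultimately show "g \<cdot> f \<cdot> i = Zr C (Dom C (f \<cdot> i)) (Cod C g)" using fg assms by simp
    fix u assume u: "u \<in> Arr C" "Cod C u = Dom C g" "g \<cdot> u = Zr C (Dom C u) (Cod C g)"
    obtain h where h: "h \<in> Arr C" "Dom C h = Dom C u" "Cod C h = Y'" "f \<cdot> h = u"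
      by (rule kernel_factor[OF se(3) u]) (use fg in auto)
    have "i \<cdot> j \<cdot> h = Idn C Y' \<cdot> h" by (rule comp_cong_left1) (use j h assms in auto)
    then have "(f \<cdot> i) \<cdot> j \<cdot> h = u" using fg h j(1) assms(2) by auto
    then show "\<exists>h\<in>Arr C. Dom C h = Dom C u \<and> Cod C h = Dom C (f \<cdot> i) \<and> (f \<cdot> i) \<cdot> h = u"
      by (intro bexI[of _ "j \<cdot> h"]) (use fg h j(1) assms(2) in auto)
  qed (use fg assms in auto)
  then have "short_exact C (f \<cdot> i) g" using se by (intro short_exact_if_kernel)
  moreover have "f \<cdot> i \<in> Hom C Y E" using fg assms by auto
  ultimately show "\<exists>s\<in>Hom C X E. g \<cdot> s = Idn C X"
    using assms(1) fg(2) unfolding ext1_zero_def by blast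
qed

lemma ext1_zero_iso_left:
  assumes "ext1_zero C X Y" "i \<in> Hom C X' X" "is_mono C i" "is_epi C i"
  shows "ext1_zero C X' Y"
proof -
  interpret d: abelian_category "dual C" by (rule abelian_dual)
  show ?thesis using d.ext1_zero_iso_right[of Y X i X'] assms by (auto simp: ext1_zero_dual)
qed

end

subsection \<open>Yoneda Ext and dimension shifting\<close>

lemma equiv_yoneda_rel: "equiv (extensions C n X Y) (yoneda_rel C n X Y)"
proof (rule equivI)
  show "yoneda_rel C n X Y \<subseteq> extensions C n X Y \<times> extensions C n X Y"
    unfolding yoneda_rel_def by blast
  show "refl_on (extensions C n X Y) (yoneda_rel C n X Y)"
    unfolding yoneda_rel_def refl_on_def using equivclp_refl by fast
  show "sym (yoneda_rel C n X Y)"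
    unfolding yoneda_rel_def sym_def using equivclp_sym by fast
  show "trans (yoneda_rel C n X Y)"
  proof (rule transI)
    fix x y z assume "(x, y) \<in> yoneda_rel C n X Y" "(y, z) \<in> yoneda_rel C n X Y"
    then show "(x, z) \<in> yoneda_rel C n X Y"
      unfolding yoneda_rel_def using equivclp_trans[of _ x y z] by blast
  qed
qed

text \<open>\<open>Ext_zero\<close> asks for exactly one class, so besides the equivalence of all
  extensions at least one extension must be exhibited.\<close>

lemma Ext_zero_iff:
  "Ext_zero C n X Y \<longleftrightarrow> extensions C n X Y \<noteq> {} \<and>
    (\<forall>fs \<in> extensions C n X Y. \<forall>gs \<in> extensions C n X Y. equivclp (ext_morphism C n X Y) fs gs)"
    (is "?l \<longleftrightarrow> ?r")
proof
  assume ?l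
  then obtain q where q: "extensions C n X Y // yoneda_rel C n X Y = {q}"
    unfolding Ext_zero_def yoneda_Ext_def is_singleton_def by blast
  have "equivclp (ext_morphism C n X Y) fs gs"
    if fg: "fs \<in> extensions C n X Y" "gs \<in> extensions C n X Y" for fs gs
  proof -
    have "yoneda_rel C n X Y `` {fs} = q" "yoneda_rel C n X Y `` {gs} = q"
      using fg[THEN quotientI, of "yoneda_rel C n X Y"] unfolding q by blast+
    then have "yoneda_rel C n X Y `` {fs} = yoneda_rel C n X Y `` {gs}" by (rule trans[OF _ sym])
    then have "(fs, gs) \<in> yoneda_rel C n X Y"
      by (rule eq_equiv_class[OF _ equiv_yoneda_rel fg(2)])
    then show ?thesis unfolding yoneda_rel_def by blast
  qed
  moreover have "extensions C n X Y \<noteq> {}"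
  proof
    assume "extensions C n X Y = {}"
    with q show False by (simp add: quotient_def)
  qed
  ultimately show ?r by blast
next
  assume r: ?r
  have "yoneda_rel C n X Y `` {gs} = extensions C n X Y" if "gs \<in> extensions C n X Y" for gs
    using r that unfolding yoneda_rel_def by blast
  then have "extensions C n X Y // yoneda_rel C n X Y = {extensions C n X Y}"
    using r unfolding quotient_def by blast
  then show ?l by (simp add: Ext_zero_def yoneda_Ext_def)
qed

text \<open>Only an equivalence is demanded in the target, so a map that reverses the direction of
  morphisms is covered as well; this is what duality needs.\<close>

lemma equivclp_map:
  assumes "equivclp r x y" "\<And>a b. r a b \<Longrightarrow> equivclp s (f a) (f b)"
  shows "equivclp s (f x) (f y)"
  using assms(1)
proof (induction rule: equivclp_induct)
  case (step y z)
  from step(2) have "equivclp s (f y) (f z)" using assms(2)[of y z] equivclp_sym[OF assms(2)[of z y]] by blast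
  with step(3) show ?case by (rule equivclp_trans)
qed simp

text \<open>A property respected by single morphisms is constant along zigzags. It is the means of
  drawing conclusions from the vanishing of a Yoneda class.\<close>

lemma equivclp_invariant:
  assumes "equivclp r x y" "\<And>a b. r a b \<Longrightarrow> P a \<longleftrightarrow> P b"
  shows "P x \<longleftrightarrow> P y"
  using assms(1) by (induction rule: equivclp_induct) (use assms(2) in auto)

lemma extensionsI:
  assumes "length fs = Suc n" "\<And>k. k \<le> n \<Longrightarrow> fs ! k \<in> Arr C" "Dom C (fs ! 0) = Y"
    "Cod C (fs ! n) = X" "is_mono C (fs ! 0)" "\<And>k. k < n \<Longrightarrow> exact C (fs ! k) (fs ! Suc k)"
    "is_epi C (fs ! n)"
  shows "fs \<in> extensions C n X Y"
proof -
  have "set fs \<subseteq> Arr C" using assms(1,2) by (auto simp: in_set_conv_nth)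
  then show ?thesis using assms by (simp add: extensions_def)
qed

lemma extensionsD:
  assumes "fs \<in> extensions C n X Y"
  shows "length fs = Suc n" "k \<le> n \<Longrightarrow> fs ! k \<in> Arr C" "Dom C (fs ! 0) = Y"
    "Cod C (fs ! n) = X" "is_mono C (fs ! 0)" "k < n \<Longrightarrow> exact C (fs ! k) (fs ! Suc k)"
    "is_epi C (fs ! n)"
  using assms nth_mem[of k fs] unfolding extensions_def by auto

section \<open>Extensions of length one, splicing, and dimension shifting\<close>

context abelian_category
begin

lemma extension_Dom_Suc:
  assumes "fs \<in> extensions C n X Y" "k < n"
  shows "Dom C (fs ! Suc k) = Cod C (fs ! k)"
  using exactD(3)[OF extensionsD(6)[OF assms]] .

lemma extension_one_iff:
  "fs \<in> extensions C 1 X Y \<longleftrightarrow> (\<exists>E. \<exists>f \<in> Hom C Y E. \<exists>g \<in> Hom C E X. short_exact C f g \<and> fs = [f, g])"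
    (is "?l \<longleftrightarrow> ?r")
proof
  assume fs: ?l
  note e = extensionsD[OF fs]
  have "fs = [fs ! 0, fs ! 1]" using e(1) by (intro nth_equalityI) (auto simp: nth_Cons less_Suc_eq split: nat.split)
  moreover have "short_exact C (fs ! 0) (fs ! 1)" using e(5,7) e(6)[of 0] by (simp add: short_exact_def)
  moreover have "fs ! 0 \<in> Hom C Y (Cod C (fs ! 0))" using e(3) e(2)[of 0] by simp
  moreover have "fs ! 1 \<in> Hom C (Cod C (fs ! 0)) X" using e(4) e(2)[of 1] extension_Dom_Suc[OF fs, of 0] by simp
  ultimately show ?r by blast
next
  assume ?r
  then obtain E f g where fg: "f \<in> Hom C Y E" "g \<in> Hom C E X" "short_exact C f g" "fs = [f, g]" by blast
  note se = short_exactD[OF fg(3,1,2)]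
  show ?l unfolding fg(4)
    by (rule extensionsI) (use fg(1,2) se in \<open>auto simp: nth_Cons split: nat.split\<close>)
qed

lemma biproduct_short_exact:
  assumes "X \<in> Obj C" "Y \<in> Obj C"
  obtains S i1 i2 p1 p2 where "S \<in> Obj C" "i1 \<in> Hom C X S" "i2 \<in> Hom C Y S"
    "p1 \<in> Hom C S X" "p2 \<in> Hom C S Y" "p1 \<cdot> i1 = Idn C X" "p2 \<cdot> i2 = Idn C Y"
    "p1 \<cdot> i2 = Zr C Y X" "p2 \<cdot> i1 = Zr C X Y" "Add C (i1 \<cdot> p1) (i2 \<cdot> p2) = Idn C S"
    "short_exact C i1 p2"
proof -
  obtain S i1 i2 p1 p2 where S: "S \<in> Obj C" "i1 \<in> Hom C X S" "i2 \<in> Hom C Y S"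
    "p1 \<in> Hom C S X" "p2 \<in> Hom C S Y" "p1 \<cdot> i1 = Idn C X" "p2 \<cdot> i2 = Idn C Y"
    "p1 \<cdot> i2 = Zr C Y X" "p2 \<cdot> i1 = Zr C X Y" "Add C (i1 \<cdot> p1) (i2 \<cdot> p2) = Idn C S"
    by (rule biproduct[OF assms])
  have "is_kernel C p2 i1"
  proof (rule is_kernelI)
    show "is_mono C i1" by (rule is_mono_left_inverse[of _ p1]) (use S in auto)
    fix u assume u: "u \<in> Arr C" "Cod C u = Dom C p2" "p2 \<cdot> u = Zr C (Dom C u) (Cod C p2)"
    have "u = Add C (i1 \<cdot> p1) (i2 \<cdot> p2) \<cdot> u" unfolding S(10) using u S by simp
    also have "\<dots> = Add C (i1 \<cdot> p1 \<cdot> u) (i2 \<cdot> p2 \<cdot> u)" using S(2-5) u(1,2) by simp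
    also have "\<dots> = i1 \<cdot> p1 \<cdot> u" unfolding u(3) using S(2-5) u(1,2) assms by simp
    finally show "\<exists>h\<in>Arr C. Dom C h = Dom C u \<and> Cod C h = Dom C i1 \<and> i1 \<cdot> h = u"
      using S u by (intro bexI[of _ "p1 \<cdot> u"]) auto
  qed (use S in auto)
  moreover have "is_epi C p2" by (rule is_epi_right_inverse[of _ i2]) (use S in auto)
  ultimately have "short_exact C i1 p2" by (rule short_exact_if_kernel)
  then show thesis by (rule that[OF S])
qed

text \<open>A section of the first extension is pushed forward along the middle component
  \<open>h 1\<close>. In the other direction a section is first traded for a retraction, which can
  be composed with \<open>h 1\<close>, and then traded back.\<close>

lemma ext_morphism_one_splits:
  assumes "ext_morphism C 1 X Y fs gs"
  shows "(\<exists>s \<in> Hom C X (Cod C (fs ! 0)). fs ! 1 \<cdot> s = Idn C X) \<longleftrightarrow>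
    (\<exists>s \<in> Hom C X (Cod C (gs ! 0)). gs ! 1 \<cdot> s = Idn C X)" (is "?l \<longleftrightarrow> ?r")
proof -
  obtain h where fs: "fs \<in> extensions C 1 X Y" and gs: "gs \<in> extensions C 1 X Y"
    and h0: "h 0 = Idn C Y" and h2: "h 2 = Idn C X"
    and h: "\<And>k. k \<le> 1 \<Longrightarrow> h k \<in> Hom C (Dom C (fs ! k)) (Dom C (gs ! k)) \<and>
           gs ! k \<cdot> h k = h (Suc k) \<cdot> fs ! k"
    using assms by (auto simp: ext_morphism_def numeral_2_eq_2)
  obtain E f g where f: "f \<in> Hom C Y E" "g \<in> Hom C E X" "short_exact C f g" "fs = [f, g]"
    using fs unfolding extension_one_iff by blast
  obtain E' f' g' where f': "f' \<in> Hom C Y E'" "g' \<in> Hom C E' X" "short_exact C f' g'" "gs = [f', g']"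
    using gs unfolding extension_one_iff by blast
  have h1: "h 1 \<in> Hom C E E'" using h[of 1] f f' by auto
  have hf: "f' = h 1 \<cdot> f" using h[of 0] h0 f f' by auto
  have hg: "g' \<cdot> h 1 = g" using h[of 1] h2 f f' by (auto simp: numeral_2_eq_2)
  have "?l" if r: ?r
  proof -
    obtain s where s: "s \<in> Hom C X E'" "g' \<cdot> s = Idn C X" using r f' by auto
    obtain r where r: "r \<in> Hom C E' Y" "r \<cdot> f' = Idn C Y"
      by (rule section_imp_retraction[OF f'(3,1,2) s])
    have "(r \<cdot> h 1) \<cdot> f = r \<cdot> f'" unfolding hf by (rule comp_assoc) (use r h1 f in auto)
    then obtain t where "t \<in> Hom C X E" "g \<cdot> t = Idn C X"
      by (elim retraction_imp_section[OF f(3,1,2), of "r \<cdot> h 1", rotated -1]) (use r h1 f' in auto)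
    then show ?l using f by auto
  qed
  moreover have "?r" if l: ?l
  proof -
    obtain s where s: "s \<in> Hom C X E" "g \<cdot> s = Idn C X" using l f by auto
    have "g' \<cdot> h 1 \<cdot> s = g \<cdot> s" by (rule comp_cong_left1[OF hg]) (use s f' h1 in auto)
    then show ?r using s h1 f f' by (intro bexI[of _ "h 1 \<cdot> s"]) auto
  qed
  ultimately show ?thesis by blast
qed

text \<open>The biproduct extension is the base point. Splitting is constant along zigzags and holds
  there, which gives one direction; conversely a split extension maps to the biproduct
  extension.\<close>

lemma Ext_zero_one_iff:
  assumes "X \<in> Obj C" "Y \<in> Obj C"
  shows "Ext_zero C 1 X Y \<longleftrightarrow> ext1_zero C X Y"
proof -
  obtain S i1 i2 p1 p2 where S: "S \<in> Obj C" "i1 \<in> Hom C Y S" "i2 \<in> Hom C X S"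
    "p1 \<in> Hom C S Y" "p2 \<in> Hom C S X" "p1 \<cdot> i1 = Idn C Y" "p2 \<cdot> i2 = Idn C X"
    "p1 \<cdot> i2 = Zr C X Y" "p2 \<cdot> i1 = Zr C Y X" "Add C (i1 \<cdot> p1) (i2 \<cdot> p2) = Idn C S"
    "short_exact C i1 p2"
    by (rule biproduct_short_exact[OF assms(2,1)])
  have triv: "[i1, p2] \<in> extensions C 1 X Y" unfolding extension_one_iff using S by blast
  show ?thesis
  proof
    assume z: "Ext_zero C 1 X Y"
    show "ext1_zero C X Y" unfolding ext1_zero_def
    proof (intro allI ballI impI)
      fix E f g assume fg: "f \<in> Hom C Y E" "g \<in> Hom C E X" "short_exact C f g"
      then have "[f, g] \<in> extensions C 1 X Y" unfolding extension_one_iff by blast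
      then have "equivclp (ext_morphism C 1 X Y) [f, g] [i1, p2]"
        using z triv unfolding Ext_zero_iff by blast
      then have "(\<exists>s \<in> Hom C X (Cod C ([f, g] ! 0)). [f, g] ! 1 \<cdot> s = Idn C X) \<longleftrightarrow>
          (\<exists>s \<in> Hom C X (Cod C ([i1, p2] ! 0)). [i1, p2] ! 1 \<cdot> s = Idn C X)"
        by (rule equivclp_invariant) (rule ext_morphism_one_splits)
      then show "\<exists>s\<in>Hom C X E. g \<cdot> s = Idn C X" using S fg by auto
    qed
  next
    assume z: "ext1_zero C X Y"
    have "ext_morphism C 1 X Y fs [i1, p2]" if fs: "fs \<in> extensions C 1 X Y" for fs
    proof -
      obtain E f g where f: "f \<in> Hom C Y E" "g \<in> Hom C E X" "short_exact C f g" "fs = [f, g]"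
        using fs unfolding extension_one_iff by blast
      obtain r where r: "r \<in> Hom C E Y" "r \<cdot> f = Idn C Y"
        by (rule ext1_zeroD_retraction[OF z f(3,1,2)])
      have gf: "g \<cdot> f = Zr C Y X" using short_exactD(6)[OF f(3,1,2)] .
      \<comment> \<open>The retraction and the projection are the two coordinates of a morphism to
        the biproduct.\<close>
      let ?m = "Add C (i1 \<cdot> r) (i2 \<cdot> g)"
      have m: "?m \<in> Hom C E S" using r S f by auto
      have mf: "?m \<cdot> f = i1" using r gf S f assms by simp
      have "p2 \<cdot> i1 \<cdot> r = Zr C Y X \<cdot> r" "p2 \<cdot> i2 \<cdot> g = Idn C X \<cdot> g"
        by (rule comp_cong_left1; use S f r in auto)+
      then have pm: "p2 \<cdot> ?m = g" using r S f assms by simp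
      let ?h = "\<lambda>k::nat. if k = 0 then Idn C Y else if k = 1 then ?m else Idn C X"
      show ?thesis unfolding ext_morphism_def
      proof (intro conjI exI[of _ ?h] allI impI fs triv)
        fix k :: nat assume "k \<le> 1"
        then consider "k = 0" | "k = 1" by linarith
        then show "?h k \<in> Hom C (Dom C (fs ! k)) (Dom C ([i1, p2] ! k))"
          "[i1, p2] ! k \<cdot> ?h k = ?h (Suc k) \<cdot> fs ! k"
          by (cases; use m mf pm S(2,5) f(1,2,4) assms in \<open>simp del: comp_Add Add_comp\<close>)+
      qed auto
    qed
    then have "equivclp (ext_morphism C 1 X Y) fs [i1, p2]" if "fs \<in> extensions C 1 X Y" for fs
      using that r_into_equivclp[of "ext_morphism C 1 X Y"] by blast
    note to_triv = this
    show "Ext_zero C 1 X Y" unfolding Ext_zero_iff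
    proof (intro conjI ballI)
      fix fs gs assume "fs \<in> extensions C 1 X Y" "gs \<in> extensions C 1 X Y"
      then show "equivclp (ext_morphism C 1 X Y) fs gs"
        by (rule equivclp_trans[OF to_triv equivclp_sym[OF to_triv]])
    qed (use triv in blast)
  qed
qed

text \<open>The Yoneda product of an extension \<open>fs\<close> of \<open>K\<close> with \<open>0
  \<rightarrow> K \<rightarrow> P \<rightarrow> X \<rightarrow> 0\<close>: the map onto
  \<open>K\<close> and the inclusion \<open>k\<close> merge into one entry.\<close>

definition ext_splice :: "'b list \<Rightarrow> 'b \<Rightarrow> 'b \<Rightarrow> 'b list" where
  "ext_splice fs k p = butlast fs @ [k \<cdot> last fs, p]"

lemma ext_splice_nth:
  assumes "length fs = Suc n"
  shows "length (ext_splice fs k p) = Suc (Suc n)" "j < n \<Longrightarrow> ext_splice fs k p ! j = fs ! j"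
    "ext_splice fs k p ! n = k \<cdot> fs ! n" "ext_splice fs k p ! Suc n = p"
proof -
  have "fs \<noteq> []" using assms by auto
  then have "last fs = fs ! n" using assms by (simp add: last_conv_nth)
  then show "length (ext_splice fs k p) = Suc (Suc n)" "j < n \<Longrightarrow> ext_splice fs k p ! j = fs ! j"
    "ext_splice fs k p ! n = k \<cdot> fs ! n" "ext_splice fs k p ! Suc n = p"
    using assms by (auto simp: ext_splice_def nth_append nth_butlast)
qed

text \<open>Composition with the monomorphism \<open>k\<close> keeps the kernel of the last map
  \<open>l\<close>, and precomposition with the epimorphism \<open>l\<close> keeps the image of
  \<open>k\<close>; so both new joints are exact.\<close>

lemma ext_splice_extension:
  assumes fs: "fs \<in> extensions C n K Y" and n: "n \<ge> 1"
    and se: "short_exact C k p" "k \<in> Hom C K P" "p \<in> Hom C P X"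
  shows "ext_splice fs k p \<in> extensions C (Suc n) X Y"
proof -
  note e = extensionsD[OF fs] and s = ext_splice_nth[OF extensionsD(1)[OF fs], where k = k and p = p]
    and kp = short_exactD[OF se]
  define l where "l = fs ! n"
  have l: "l \<in> Arr C" "Cod C l = K" "is_epi C l" using e(2,4,7) by (auto simp: l_def)
  have lD: "Dom C l = Cod C (fs ! (n - 1))" and ex: "exact C (fs ! (n - 1)) l"
    using extension_Dom_Suc[OF fs, of "n - 1"] e(6)[of "n - 1"] n by (auto simp: l_def)
  have kl: "k \<cdot> l \<in> Hom C (Dom C l) P" using se l by auto
  have ex1: "exact C (fs ! (n - 1)) (k \<cdot> l)"
  proof (rule exactI)
    show "fs ! (n - 1) \<in> Hom C (Dom C (fs ! (n - 1))) (Dom C l)" using exactD[OF ex] by auto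
    show "k \<cdot> l \<in> Hom C (Dom C l) P" by fact
    have P: "P \<in> Obj C" using se by auto
    have "(k \<cdot> l) \<cdot> fs ! (n - 1) = k \<cdot> l \<cdot> fs ! (n - 1)"
      by (rule comp_assoc) (use exactD[OF ex] se l in auto)
    also have "\<dots> = Zr C (Dom C (fs ! (n - 1))) P" unfolding exactD(4)[OF ex]
      using exactD(1)[OF ex] se l by simp
    finally show "(k \<cdot> l) \<cdot> fs ! (n - 1) = Zr C (Dom C (fs ! (n - 1))) P" .
    fix T y assume y: "T \<in> Obj C" "y \<in> Hom C T (Dom C l)" "(k \<cdot> l) \<cdot> y = Zr C T P"
    then have "k \<cdot> l \<cdot> y = Zr C T P" using se l by simp
    then have ly: "l \<cdot> y = Zr C T K" by (rule mono_zero[OF kp(1)]) (use y se l in auto)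
    obtain T' e x where "is_epi C e" "e \<in> Hom C T' T" "x \<in> Hom C T' (Dom C (fs ! (n - 1)))"
      "fs ! (n - 1) \<cdot> x = y \<cdot> e"
      by (rule exact_lift[OF ex, of _ "Dom C l" K y T]) (use exactD[OF ex] l ly y in auto)
    then show "\<exists>T' e. \<exists>x\<in>Hom C T' (Dom C (fs ! (n - 1))).
        is_epi C e \<and> e \<in> Hom C T' T \<and> fs ! (n - 1) \<cdot> x = y \<cdot> e" by blast
  qed
  have ex2: "exact C (k \<cdot> l) p"
  proof (rule exactI)
    have X: "X \<in> Obj C" using se by auto
    have "p \<cdot> k \<cdot> l = Zr C K X \<cdot> l" by (rule comp_cong_left1) (use kp se l in auto)
    then show "p \<cdot> k \<cdot> l = Zr C (Dom C l) X" using l X by simp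
    fix T y assume y: "T \<in> Obj C" "y \<in> Hom C T P" "p \<cdot> y = Zr C T X"
    obtain t where t: "t \<in> Arr C" "Dom C t = T" "Cod C t = K" "k \<cdot> t = y"
      by (rule kernel_factor[OF kp(3), of y]) (use y se in auto)
    obtain T' e x where x: "is_epi C e" "e \<in> Hom C T' T" "x \<in> Hom C T' (Dom C l)" "l \<cdot> x = t \<cdot> e"
      by (rule epi_lift[OF l(3), of "Dom C l" K t T]) (use l t in auto)
    have "(k \<cdot> l) \<cdot> x = k \<cdot> l \<cdot> x" by (rule comp_assoc) (use x l se in auto)
    also have "\<dots> = y \<cdot> e" unfolding x(4) by (rule comp_cong_left1) (use t x se in auto)
    finally show "\<exists>T' e. \<exists>x\<in>Hom C T' (Dom C l). is_epi C e \<and> e \<in> Hom C T' T \<and> (k \<cdot> l) \<cdot> x = y \<cdot> e"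
      using x by blast
  qed (use kl se in auto)
  show ?thesis
  proof (rule extensionsI)
    fix j assume "j \<le> Suc n"
    then consider "j < n" | "j = n" | "j = Suc n" by linarith
    then show "ext_splice fs k p ! j \<in> Arr C"
      by cases (use s e(2)[of j] kl se in \<open>auto simp flip: l_def\<close>)
  next
    fix j assume "j < Suc n"
    then consider "Suc j < n" | "Suc j = n" | "j = n" by linarith
    then show "exact C (ext_splice fs k p ! j) (ext_splice fs k p ! Suc j)"
    proof cases
      case 1 then show ?thesis using s e(6)[of j] by auto
    next
      case 2
      then have "j = n - 1" "j < n" using n by auto
      then show ?thesis using ex1 s 2 by (metis l_def)
    next
      case 3 then show ?thesis using ex2 s by (simp add: l_def)
    qed
  qed (use s e n kp se in \<open>auto simp: Suc_le_eq\<close>)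
qed

lemma ext_splice_morphism:
  assumes m: "ext_morphism C n K Y fs gs" and n: "n \<ge> 1"
    and se: "short_exact C k p" "k \<in> Hom C K P" "p \<in> Hom C P X"
  shows "ext_morphism C (Suc n) X Y (ext_splice fs k p) (ext_splice gs k p)"
proof -
  obtain h where fs: "fs \<in> extensions C n K Y" and gs: "gs \<in> extensions C n K Y"
    and h0: "h 0 = Idn C Y" and hn: "h (Suc n) = Idn C K"
    and h: "\<And>j. j \<le> n \<Longrightarrow> h j \<in> Hom C (Dom C (fs ! j)) (Dom C (gs ! j))"
      "\<And>j. j \<le> n \<Longrightarrow> gs ! j \<cdot> h j = h (Suc j) \<cdot> fs ! j"
    using m unfolding ext_morphism_def by blast
  note s = ext_splice_nth[OF extensionsD(1)[OF fs], where k = k and p = p] and t = ext_splice_nth[OF extensionsD(1)[OF gs], where k = k and p = p]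
  have l: "fs ! n \<in> Arr C" "Cod C (fs ! n) = K" "gs ! n \<in> Arr C" "Cod C (gs ! n) = K"
    using extensionsD[OF fs] extensionsD[OF gs] by auto
  have P: "P \<in> Obj C" "X \<in> Obj C" "K \<in> Obj C" using se by auto
  let ?h = "\<lambda>j. if j \<le> n then h j else if j = Suc n then Idn C P else Idn C X"
  show ?thesis unfolding ext_morphism_def
  proof (intro conjI exI[of _ ?h] allI impI)
    show "ext_splice fs k p \<in> extensions C (Suc n) X Y" "ext_splice gs k p \<in> extensions C (Suc n) X Y"
      using ext_splice_extension[OF _ n se] fs gs by auto
    fix j assume "j \<le> Suc n"
    then consider "j < n" | "j = n" | "j = Suc n" by linarith
    then show "?h j \<in> Hom C (Dom C (ext_splice fs k p ! j)) (Dom C (ext_splice gs k p ! j)) "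
      by cases (use s t h(1)[of j] l se P in auto)
    have "(k \<cdot> gs ! n) \<cdot> h n = k \<cdot> gs ! n \<cdot> h n"
      by (rule comp_assoc) (use h(1)[of n] l se in auto)
    then have *: "(k \<cdot> gs ! n) \<cdot> h n = k \<cdot> fs ! n" using h(2)[of n] hn l by simp
    show "ext_splice gs k p ! j \<cdot> ?h j = ?h (Suc j) \<cdot> ext_splice fs k p ! j"
      using \<open>j \<le> Suc n\<close>
    proof -
      consider "j < n" | "j = n" | "j = Suc n" using \<open>j \<le> Suc n\<close> by linarith
      then show ?thesis
      proof cases
        case 1 then show ?thesis using s(2)[of j] t(2)[of j] h(2)[of j] by auto
      next
        case 2 then show ?thesis using s(3) t(3) * l se by simp
      next
        case 3 then show ?thesis using s(4) t(4) se by simp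
      qed
    qed
  qed (use h0 in auto)
qed

text \<open>When \<open>p\<close> factors through the last map \<open>c\<close> by \<open>u\<close>,
  some splice along \<open>p\<close> maps to \<open>gs\<close>. Its new term is the pullback of
  \<open>b\<close> along \<open>u \<cdot> k\<close>; the projection \<open>q\<close> to
  \<open>K\<close> is an epimorphism because \<open>u \<cdot> k\<close> lands in the kernel of
  \<open>c\<close>, which is the image of \<open>b\<close>.\<close>

lemma extension_pullback:
  assumes gs: "gs \<in> extensions C (Suc (Suc m)) X Y"
    and u: "u \<in> Hom C P (Dom C (gs ! Suc (Suc m)))" "gs ! Suc (Suc m) \<cdot> u = p"
    and se: "short_exact C k p" "k \<in> Hom C K P" "p \<in> Hom C P X"
  obtains fs where "fs \<in> extensions C (Suc m) K Y"
    "ext_morphism C (Suc (Suc m)) X Y (ext_splice fs k p) gs"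
proof -
  note e = extensionsD[OF gs] and kp = short_exactD[OF se]
  define a b c where abc: "a = gs ! m" "b = gs ! Suc m" "c = gs ! Suc (Suc m)"
  have exab: "exact C a b" and exbc: "exact C b c" using e(6)[of m] e(6)[of "Suc m"] by (auto simp: abc)
  define E1 E2 E3 where E: "E1 = Dom C c" "E2 = Dom C b" "E3 = Dom C a"
  have a: "a \<in> Hom C E3 E2" and b: "b \<in> Hom C E2 E1" and c: "c \<in> Hom C E1 X"
    using exactD[OF exab] exactD[OF exbc] e(4) by (auto simp: E abc)
  have u: "u \<in> Hom C P E1" "c \<cdot> u = p" using u by (auto simp: abc E)
  have obj: "E1 \<in> Obj C" "E2 \<in> Obj C" "E3 \<in> Obj C" "K \<in> Obj C" "X \<in> Obj C" using a b c se by auto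
  have ba: "b \<cdot> a = Zr C E3 E1" using exactD(4)[OF exab] a b by auto
  have cb: "c \<cdot> b = Zr C E2 X" using exactD(4)[OF exbc] c b by auto
  have 1: "b \<in> Arr C" "u \<cdot> k \<in> Arr C" "Cod C b = Cod C (u \<cdot> k)" using b u se by auto
  obtain E2' v q where v: "v \<in> Hom C E2' E2" and q: "q \<in> Hom C E2' K" and vq: "b \<cdot> v = (u \<cdot> k) \<cdot> q"
    and univ: "\<And>T x y. x \<in> Hom C T E2 \<Longrightarrow> y \<in> Hom C T K \<Longrightarrow> b \<cdot> x = (u \<cdot> k) \<cdot> y \<Longrightarrow>
       \<exists>h \<in> Hom C T E2'. v \<cdot> h = x \<and> q \<cdot> h = y"
    and uniq: "\<And>T h h'. h \<in> Hom C T E2' \<Longrightarrow> h' \<in> Hom C T E2' \<Longrightarrow> v \<cdot> h = v \<cdot> h' \<Longrightarrow>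
       q \<cdot> h = q \<cdot> h' \<Longrightarrow> h = h'"
    by (rule pullback[OF 1]) (use that b u se in auto)
  have obj': "E2' \<in> Obj C" using v by auto
  have epi_q: "is_epi C q"
  proof -
    have "c \<cdot> u \<cdot> k = p \<cdot> k" by (rule comp_cong_left1[OF u(2)]) (use u c se in auto)
    then have cuk: "c \<cdot> u \<cdot> k = Zr C K X" using kp(6) by simp
    have uk: "u \<cdot> k \<in> Hom C K E1" using u se by auto
    obtain T e x where x: "is_epi C e" "e \<in> Hom C T K" "x \<in> Hom C T E2" "b \<cdot> x = (u \<cdot> k) \<cdot> e"
      by (rule exact_lift[OF exbc b c uk cuk])
    obtain h where "h \<in> Hom C T E2'" "q \<cdot> h = e" using univ[OF x(3,2,4)] by blast
    then show ?thesis using epi_if_lifts[OF q x(1,2)] by blast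
  qed
  have "b \<cdot> a = (u \<cdot> k) \<cdot> Zr C E3 K" using ba u se obj by simp
  \<comment> \<open>The lift of \<open>a\<close> with zero component in \<open>K\<close>; it has the
    same kernel as \<open>a\<close>, and its image is the kernel of \<open>q\<close>.\<close>
  then obtain a' where a': "a' \<in> Hom C E3 E2'" "v \<cdot> a' = a" "q \<cdot> a' = Zr C E3 K"
    using univ[of a E3 "Zr C E3 K"] a obj by auto
  define fs where "fs = take m gs @ [a', q]"
  have len: "length fs = Suc (Suc m)" using e(1) by (simp add: fs_def)
  have nth: "\<And>j. j < m \<Longrightarrow> fs ! j = gs ! j" "fs ! m = a'" "fs ! Suc m = q"
    using e(1) by (auto simp: fs_def nth_append)
  have ex_aq: "exact C a' q"
  proof (rule exactI[OF a'(1) q a'(3)])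
    fix T y assume y: "T \<in> Obj C" "y \<in> Hom C T E2'" "q \<cdot> y = Zr C T K"
    have "b \<cdot> v \<cdot> y = (u \<cdot> k) \<cdot> q \<cdot> y" by (rule comp_cong_left) (use vq v q b u se y in auto)
    also have "\<dots> = Zr C T E1" unfolding y(3) using u se y(1) obj by simp
    finally have bvy: "b \<cdot> v \<cdot> y = Zr C T E1" .
    have vy: "v \<cdot> y \<in> Hom C T E2" using v y by auto
    obtain T' e x where x: "is_epi C e" "e \<in> Hom C T' T" "x \<in> Hom C T' E3" "a \<cdot> x = (v \<cdot> y) \<cdot> e"
      by (rule exact_lift[OF exab a b vy bvy])
    have "a' \<cdot> x = y \<cdot> e"
    proof (rule uniq[of _ T'])
      have "v \<cdot> a' \<cdot> x = a \<cdot> x" by (rule comp_cong_left1) (use a' v x in auto)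
      then show "v \<cdot> a' \<cdot> x = v \<cdot> y \<cdot> e" unfolding x(4) using v x y by simp
      have "q \<cdot> a' \<cdot> x = Zr C E3 K \<cdot> x" by (rule comp_cong_left1) (use a' q x in auto)
      moreover have "q \<cdot> y \<cdot> e = Zr C T K \<cdot> e" by (rule comp_cong_left1) (use y q x in auto)
      ultimately show "q \<cdot> a' \<cdot> x = q \<cdot> y \<cdot> e" using x(2,3) obj by simp
    qed (use a' x y in auto)
    then show "\<exists>T' e. \<exists>x\<in>Hom C T' E3. is_epi C e \<and> e \<in> Hom C T' T \<and> a' \<cdot> x = y \<cdot> e"
      using x by blast
  qed
  have ex_a: "exact C l a'" if l: "exact C l a" for l
  proof (rule exactI)
    have lh: "l \<in> Hom C (Dom C l) E3" using exactD[OF l] a by auto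
    then show "l \<in> Hom C (Dom C l) E3" .
    have al: "a \<cdot> l = Zr C (Dom C l) E2" using exactD(4)[OF l] a by auto
    show "a' \<cdot> l = Zr C (Dom C l) E2'"
    proof (rule uniq[of _ "Dom C l"])
      have "v \<cdot> a' \<cdot> l = a \<cdot> l" by (rule comp_cong_left1) (use a' v lh in auto)
      then show "v \<cdot> a' \<cdot> l = v \<cdot> Zr C (Dom C l) E2'" using al v lh by simp
      have "q \<cdot> a' \<cdot> l = Zr C E3 K \<cdot> l" by (rule comp_cong_left1) (use a' q lh in auto)
      then show "q \<cdot> a' \<cdot> l = q \<cdot> Zr C (Dom C l) E2'" using q lh obj by simp
    qed (use a' lh obj' in auto)
    fix T y assume y: "T \<in> Obj C" "y \<in> Hom C T E3" "a' \<cdot> y = Zr C T E2'"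
    have "a \<cdot> y = v \<cdot> a' \<cdot> y" by (rule comp_cong_left1[symmetric]) (use a' v y in auto)
    then have ay: "a \<cdot> y = Zr C T E2" unfolding y(3) using v y(1) by simp
    show "\<exists>T' e. \<exists>x\<in>Hom C T' (Dom C l). is_epi C e \<and> e \<in> Hom C T' T \<and> l \<cdot> x = y \<cdot> e"
      by (rule exact_lift[OF l lh a y(2) ay]) blast
  qed (use a' in auto)
  have fs: "fs \<in> extensions C (Suc m) K Y"
  proof (rule extensionsI[OF len])
    fix j assume "j \<le> Suc m"
    then consider "j < m" | "j = m" | "j = Suc m" by linarith
    then show "fs ! j \<in> Arr C" by cases (use nth e(2)[of j] a' q in auto)
  next
    fix j assume "j < Suc m"
    then consider "Suc j < m" | "Suc j = m" | "j = m" by linarith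
    then show "exact C (fs ! j) (fs ! Suc j)"
    proof cases
      case 1 then show ?thesis using nth(1)[of j] nth(1)[of "Suc j"] e(6)[of j] by auto
    next
      case 2 then show ?thesis using nth(1)[of j] nth(2) ex_a[of "gs ! j"] e(6)[of j] abc(1) by auto
    next
      case 3 then show ?thesis using ex_aq nth by simp
    qed
  next
    show "Dom C (fs ! 0) = Y" using nth e(3) a' E(3) abc(1) by (cases "m = 0") auto
    show "is_mono C (fs ! 0)"
    proof (cases "m = 0")
      case True
      have "is_mono C (v \<cdot> a')" using a'(2) e(5) True abc(1) by simp
      then have "is_mono C a'" by (rule is_mono_cancel_left) (use a' v in auto)
      then show ?thesis using nth True by simp
    qed (use nth e(5) in auto)
  qed (use nth q epi_q in auto)
  note s = ext_splice_nth[OF len, where k = k and p = p]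
  \<comment> \<open>Identities up to the term before the pullback, then the two comparison maps
    \<open>v\<close> and \<open>u\<close>; the last square is
    \<open>c \<cdot> u = p\<close>.\<close>
  let ?h = "\<lambda>j. if j \<le> m then Idn C (Dom C (gs ! j)) else if j = Suc m then v
    else if j = Suc (Suc m) then u else Idn C X"
  have bv: "b \<cdot> v = u \<cdot> k \<cdot> q" using vq u se q by simp
  have "ext_morphism C (Suc (Suc m)) X Y (ext_splice fs k p) gs"
    unfolding ext_morphism_def
  proof (intro conjI exI[of _ ?h] allI impI gs)
    show "ext_splice fs k p \<in> extensions C (Suc (Suc m)) X Y"
      by (rule ext_splice_extension[OF fs _ se]) simp
    fix j assume "j \<le> Suc (Suc m)"
    then consider "j < m" | "j = m" | "j = Suc m" | "j = Suc (Suc m)" by linarith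
    note cases = this
    show "?h j \<in> Hom C (Dom C (ext_splice fs k p ! j)) (Dom C (gs ! j))"
      using cases
    proof cases
      case 1 then show ?thesis using s(2)[of j] nth(1)[of j] e(2)[of j] by auto
    next
      case 2 then show ?thesis using s(2)[of j] nth(2) a a' abc(1) obj by auto
    next
      case 3 then show ?thesis using s(3) nth(3) q se v b abc(2) by auto
    next
      case 4 then show ?thesis using s(4) se u c abc(3) by auto
    qed
    show "gs ! j \<cdot> ?h j = ?h (Suc j) \<cdot> ext_splice fs k p ! j"
      using cases
    proof cases
      case 1
      then show ?thesis using s(2)[of j] nth(1)[of j] e(2)[of j] extension_Dom_Suc[OF gs, of j] by auto
    next
      case 2 then show ?thesis using s(2)[of j] nth(2) a a' abc(1) by auto
    next
      case 3 then show ?thesis using s(3) nth(3) bv abc(2) by auto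
    next
      case 4 then show ?thesis using s(4) se u abc(3) by auto
    qed
  qed (use e(2)[of 0] e(3) in auto)
  then show thesis by (rule that[OF fs])
qed

text \<open>Given two extensions of \<open>X\<close>, their last maps are pulled back against each
  other, and the pullback \<open>W\<close> is covered by some \<open>P\<close> in
  \<open>\<X>\<close>. Both extensions are then reached from splices along one and the same sequence
  from \<open>K\<close> over \<open>P\<close> to \<open>X\<close>, and the induction hypothesis for
  \<open>K\<close> connects the two splices.\<close>

theorem Ext_zero_dimension_shift:
  assumes cover: "\<And>E. E \<in> Obj C \<Longrightarrow> \<exists>P \<in> \<X>. \<exists>p \<in> Hom C P E. is_epi C p"
    and kernel: "\<And>K P X k p. short_exact C k p \<Longrightarrow> k \<in> Hom C K P \<Longrightarrow> p \<in> Hom C P X \<Longrightarrow>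
      P \<in> \<X> \<Longrightarrow> X \<in> \<X> \<Longrightarrow> K \<in> \<X>"
    and ext1: "\<And>X. X \<in> \<X> \<Longrightarrow> ext1_zero C X Y" and sub: "\<X> \<subseteq> Obj C" and Y: "Y \<in> Obj C"
    and "n \<ge> 1" "X \<in> \<X>"
  shows "Ext_zero C n X Y"
  using assms(6,7)
proof (induction n arbitrary: X rule: nat_induct_at_least)
  case base
  then show ?case using Ext_zero_one_iff ext1 sub Y by blast
next
  case (Suc n)
  then obtain m where m: "n = Suc m" by (cases n) auto
  have X: "X \<in> Obj C" using Suc sub by blast
  have ker: "\<exists>K k. K \<in> \<X> \<and> k \<in> Hom C K P \<and> short_exact C k p"
    if p: "P \<in> \<X>" "p \<in> Hom C P X" "is_epi C p" for P p
  proof -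
    obtain k where k: "is_kernel C p k" using ex_kernel[OF is_epi_Arr[OF p(3)]] by blast
    note ka = kernel_Arr[OF k]
    have se: "short_exact C k p" by (rule short_exact_if_kernel[OF k p(3)])
    have kh: "k \<in> Hom C (Dom C k) P" using ka p by auto
    then show ?thesis using kernel[OF se kh p(2,1) Suc.prems] se by blast
  qed
  show ?case unfolding Ext_zero_iff
  proof (intro conjI ballI)
    \<comment> \<open>An extension of \<open>X\<close> exists as a splice with one of
      \<open>K\<close>, which the induction hypothesis supplies.\<close>
    obtain P p where p: "P \<in> \<X>" "p \<in> Hom C P X" "is_epi C p" using cover[OF X] by blast
    obtain K k where k: "K \<in> \<X>" "k \<in> Hom C K P" "short_exact C k p" using ker[OF p] by blast
    obtain fs where "fs \<in> extensions C n K Y" using Suc.IH[OF k(1)] unfolding Ext_zero_iff by blast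
    from ext_splice_extension[OF this _ k(3,2) p(2)] Suc.hyps
    show "extensions C (Suc n) X Y \<noteq> {}" by auto
  next
    fix gs gs' assume gs: "gs \<in> extensions C (Suc n) X Y" and gs': "gs' \<in> extensions C (Suc n) X Y"
    define c c' where cc: "c = gs ! Suc n" "c' = gs' ! Suc n"
    have c: "c \<in> Arr C" "Cod C c = X" "is_epi C c"
      using extensionsD(4,7)[OF gs] extensionsD(2)[OF gs, of "Suc n"] by (auto simp: cc)
    have c': "c' \<in> Arr C" "Cod C c' = X" "is_epi C c'"
      using extensionsD(4,7)[OF gs'] extensionsD(2)[OF gs', of "Suc n"] by (auto simp: cc)
    have 1: "Cod C c = Cod C c'" using c c' by simp
    obtain W w w' where w: "w \<in> Hom C W (Dom C c)" "w' \<in> Hom C W (Dom C c')" "c \<cdot> w = c' \<cdot> w'"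
      and epi: "is_epi C c \<Longrightarrow> is_epi C w'"
      by (rule pullback[OF c(1) c'(1) 1]) blast
    obtain P p where p: "P \<in> \<X>" "p \<in> Hom C P W" "is_epi C p" using cover[of W] Dom_in_Obj[of w] w(1) by (metis in_Hom_iff)
    have epi': "is_epi C (c' \<cdot> w' \<cdot> p)"
    proof (rule is_epi_comp)
      show "is_epi C (w' \<cdot> p)" by (rule is_epi_comp) (use epi c p w in auto)
    qed (use c' w p in auto)
    have pH: "c' \<cdot> w' \<cdot> p \<in> Hom C P X" using c' w p by auto
    obtain K k where k: "K \<in> \<X>" "k \<in> Hom C K P" "short_exact C k (c' \<cdot> w' \<cdot> p)"
      using ker[OF p(1) pH epi'] by blast
    have eq: "c \<cdot> w \<cdot> p = c' \<cdot> w' \<cdot> p" by (rule comp_cong_left) (use w p c c' in auto)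
    have wp: "w \<cdot> p \<in> Hom C P (Dom C c)" "w' \<cdot> p \<in> Hom C P (Dom C c')" using w p by auto
    obtain fs where fs: "fs \<in> extensions C n K Y"
      "ext_morphism C (Suc n) X Y (ext_splice fs k (c' \<cdot> w' \<cdot> p)) gs"
      using extension_pullback[OF gs[unfolded m] _ _ k(3,2) pH, of "w \<cdot> p"] wp(1) eq unfolding cc m by blast
    obtain fs' where fs': "fs' \<in> extensions C n K Y"
      "ext_morphism C (Suc n) X Y (ext_splice fs' k (c' \<cdot> w' \<cdot> p)) gs'"
      using extension_pullback[OF gs'[unfolded m] _ _ k(3,2) pH, of "w' \<cdot> p"] wp(2) unfolding cc m by blast
    have "equivclp (ext_morphism C n K Y) fs fs'"
      using Suc.IH[OF k(1)] fs fs' unfolding Ext_zero_iff by blast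
    then have "equivclp (ext_morphism C (Suc n) X Y) (ext_splice fs k (c' \<cdot> w' \<cdot> p)) (ext_splice fs' k (c' \<cdot> w' \<cdot> p))"
      by (rule equivclp_map) (use ext_splice_morphism[OF _ Suc.hyps k(3,2) pH] in blast)
    note mid = this
    have "equivclp (ext_morphism C (Suc n) X Y) gs (ext_splice fs k (c' \<cdot> w' \<cdot> p))"
      by (rule equivclp_sym) (rule r_into_equivclp[of "ext_morphism C (Suc n) X Y", OF fs(2)])
    note front = this
    have "equivclp (ext_morphism C (Suc n) X Y) (ext_splice fs' k (c' \<cdot> w' \<cdot> p)) gs'"
      by (rule r_into_equivclp[of "ext_morphism C (Suc n) X Y", OF fs'(2)])
    then show "equivclp (ext_morphism C (Suc n) X Y) gs gs'"
      by (rule equivclp_trans[OF equivclp_trans[OF front mid]])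
  qed
qed

end

subsection \<open>Yoneda Ext and duality\<close>

text \<open>The classical criterion for a trivial 2-extension: the extension of the image of
  \<open>f1\<close> by the domain of \<open>f0\<close> is the restriction of an extension
  \<open>W\<close> of the whole codomain of \<open>f1\<close>. Unlike triviality itself it mentions
  no zigzag.\<close>

definition factors_two :: "('o, 'm) cat \<Rightarrow> 'm \<Rightarrow> 'm \<Rightarrow> 'm \<Rightarrow> bool" where
  "factors_two C f0 f1 f2 \<longleftrightarrow> (\<exists>W. \<exists>a \<in> Hom C (Dom C f1) W. \<exists>q \<in> Hom C W (Cod C f1).
     Comp C q a = f1 \<and> short_exact C (Comp C a f0) q \<and> short_exact C a (Comp C f2 q))"

context abelian_category
begin

text \<open>The criterion is self-dual: \<open>a\<close> and \<open>q\<close> change places, and so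
  do the two short exact sequences.\<close>

lemma factors_two_dualI:
  assumes "factors_two C f0 f1 f2"
  shows "factors_two (dual C) f2 f1 f0"
proof -
  obtain W a q where W: "a \<in> Hom C (Dom C f1) W" "q \<in> Hom C W (Cod C f1)"
     "q \<cdot> a = f1 \<and> short_exact C (a \<cdot> f0) q \<and> short_exact C a (f2 \<cdot> q)"
    using assms unfolding factors_two_def by blast
  then have W': "q \<cdot> a = f1 \<and> short_exact C a (f2 \<cdot> q) \<and> short_exact C (a \<cdot> f0) q" by blast
  show ?thesis
    unfolding factors_two_def dual_simps Hom_dual short_exact_dual
    by (rule exI[of _ W], rule bexI[of _ q], rule bexI[of _ a], rule W') (rule W)+
qed

lemma factors_two_dual: "factors_two (dual C) f2 f1 f0 = factors_two C f0 f1 f2"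
proof
  assume "factors_two (dual C) f2 f1 f0"
  from abelian_category.factors_two_dualI[OF abelian_dual this]
  show "factors_two C f0 f1 f2" unfolding dual_simps .
qed (rule factors_two_dualI)

text \<open>\<open>W\<close> is the pullback of \<open>W'\<close> along \<open>h2\<close>, and
  \<open>a\<close> has components \<open>a' \<cdot> h1\<close> and \<open>f1\<close>. The first
  sequence is the pulled back one; exactness of the second is a chase that uses exactness of the
  given 2-extension at both inner terms.\<close>

lemma factors_two_pullback:
  assumes f: "f0 \<in> Hom C B E2" "f1 \<in> Hom C E2 E1" "f2 \<in> Hom C E1 X"
      "is_mono C f0" "exact C f0 f1" "exact C f1 f2" "is_epi C f2"
    and g: "g0 \<in> Hom C B G2" "g1 \<in> Hom C G2 G1" "g2 \<in> Hom C G1 X"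
    and h: "h1 \<in> Hom C E2 G2" "h2 \<in> Hom C E1 G1" "h1 \<cdot> f0 = g0" "g1 \<cdot> h1 = h2 \<cdot> f1"
    and fac: "factors_two C g0 g1 g2"
  shows "factors_two C f0 f1 f2"
proof -
  obtain W' a' q' where W': "a' \<in> Hom C G2 W'" "q' \<in> Hom C W' G1" "q' \<cdot> a' = g1"
    "short_exact C (a' \<cdot> g0) q'"
  proof -
    have D: "Dom C g1 = G2" "Cod C g1 = G1" using g by auto
    show thesis using fac that unfolding factors_two_def D by blast
  qed
  have ag: "a' \<cdot> g0 \<in> Hom C B W'" using W' g by auto
  obtain W j q v where W: "short_exact C j q" "j \<in> Hom C B W" "q \<in> Hom C W E1" "v \<in> Hom C W W'"
    "q' \<cdot> v = h2 \<cdot> q" "v \<cdot> j = a' \<cdot> g0"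
    and univ: "\<And>T a b. a \<in> Hom C T W' \<Longrightarrow> b \<in> Hom C T E1 \<Longrightarrow> q' \<cdot> a = h2 \<cdot> b \<Longrightarrow>
       \<exists>h \<in> Hom C T W. v \<cdot> h = a \<and> q \<cdot> h = b"
    and uniq: "\<And>T h h'. h \<in> Hom C T W \<Longrightarrow> h' \<in> Hom C T W \<Longrightarrow> v \<cdot> h = v \<cdot> h' \<Longrightarrow> q \<cdot> h = q \<cdot> h' \<Longrightarrow> h = h'"
    by (rule pullback_short_exact[OF W'(4) ag W'(2) h(2)]) (rule that)
  note se = short_exactD[OF W(1-3)] and se' = short_exactD[OF W'(4) ag W'(2)]
  have obj: "B \<in> Obj C" "E1 \<in> Obj C" "X \<in> Obj C" "W \<in> Obj C" "E2 \<in> Obj C" using f W by auto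
  have "q' \<cdot> a' \<cdot> h1 = g1 \<cdot> h1" by (rule comp_cong_left1) (use W' h in auto)
  then have "q' \<cdot> a' \<cdot> h1 = h2 \<cdot> f1" using h(4) by simp
  then obtain a where a: "a \<in> Hom C E2 W" "v \<cdot> a = a' \<cdot> h1" "q \<cdot> a = f1"
    using univ[of "a' \<cdot> h1" E2 f1] W' h f by auto
  have mono_v: "z = Zr C T B" if "z \<in> Hom C T B" "a \<cdot> f0 \<cdot> z = Zr C T W" for z T
  proof -
    have "(v \<cdot> a) \<cdot> f0 \<cdot> z = v \<cdot> a \<cdot> f0 \<cdot> z" by (rule comp_assoc) (use W a f that in auto)
    also have "\<dots> = Zr C T W'" unfolding that(2) using W that(1) by auto
    finally have "(a' \<cdot> h1) \<cdot> f0 \<cdot> z = Zr C T W'" unfolding a(2) .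
    moreover have "(a' \<cdot> g0) \<cdot> z = (a' \<cdot> h1) \<cdot> f0 \<cdot> z"
      unfolding h(3)[symmetric] using W' h(1) f that(1) by simp
    ultimately have "(a' \<cdot> g0) \<cdot> z = Zr C T W'" by simp
    then show ?thesis by (rule mono_zero[OF se'(1)]) (use that ag in auto)
  qed
  have f10: "f1 \<cdot> f0 = Zr C B E1" and f21: "f2 \<cdot> f1 = Zr C E2 X"
    using exactD(4)[OF f(5)] exactD(4)[OF f(6)] f(1-3) by auto
  have af0: "a \<cdot> f0 \<in> Hom C B W" using a f by auto
  have qaf: "q \<cdot> a \<cdot> f0 = Zr C B E1"
    by (rule trans[OF comp_cong_left1[OF a(3)] f10]) (use W a f in auto)
  have vaf: "v \<cdot> a \<cdot> f0 = a' \<cdot> g0"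
  proof -
    have "v \<cdot> a \<cdot> f0 = a' \<cdot> h1 \<cdot> f0" by (rule comp_cong_left) (use a W W' h f in auto)
    then show ?thesis unfolding h(3) .
  qed
  \<comment> \<open>Both are the morphism into the pullback with components
    \<open>a' \<cdot> g0\<close> and \<open>0\<close>.\<close>
  have "j = a \<cdot> f0" by (rule uniq[OF W(2) af0]) (use W(6) vaf qaf se(6) in simp_all)
  then have ker: "is_kernel C q (a \<cdot> f0)" using se(3) by simp
  have ses1: "short_exact C (a \<cdot> f0) q" by (rule short_exact_if_kernel[OF ker se(2)])
  have ses2: "short_exact C a (f2 \<cdot> q)"
  proof (rule short_exactI[OF a(1), of _ X])
    show "f2 \<cdot> q \<in> Hom C W X" using W f by auto
    have "(f2 \<cdot> q) \<cdot> a = f2 \<cdot> q \<cdot> a" by (rule comp_assoc) (use a W f in auto)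
    then show "(f2 \<cdot> q) \<cdot> a = Zr C E2 X" unfolding a(3) f21 .
    show "is_epi C (f2 \<cdot> q)" by (rule is_epi_comp) (use se f W in auto)
  next
    fix T x assume x: "T \<in> Obj C" "x \<in> Hom C T E2" "a \<cdot> x = Zr C T W"
    have "f1 \<cdot> x = q \<cdot> a \<cdot> x" by (rule comp_cong_left1[symmetric]) (use a W x in auto)
    then have f1x: "f1 \<cdot> x = Zr C T E1" unfolding x(3) using W(3) x(1) by simp
    obtain T' e z where z: "is_epi C e" "e \<in> Hom C T' T" "z \<in> Hom C T' B" "f0 \<cdot> z = x \<cdot> e"
      by (rule exact_lift[OF f(5,1,2) x(2) f1x])
    have "a \<cdot> f0 \<cdot> z = Zr C T W \<cdot> e" unfolding z(4)
      by (rule comp_cong_left1[OF x(3)]) (use a x z in auto)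
    then have "z = Zr C T' B" by (intro mono_v z) (use z(2) obj in auto)
    then have "x \<cdot> e = Zr C T' E2" using z(2-4) f(1) by auto
    then show "x = Zr C T E2" by (rule epi_zero[OF z(1)]) (use z x in auto)
  next
    fix T w assume w: "T \<in> Obj C" "w \<in> Hom C T W" "(f2 \<cdot> q) \<cdot> w = Zr C T X"
    have fqw: "f2 \<cdot> q \<cdot> w = Zr C T X" using w W(3) f(3) by simp
    have qw: "q \<cdot> w \<in> Hom C T E1" using w(2) W(3) by auto
    obtain T' e z where z: "is_epi C e" "e \<in> Hom C T' T" "z \<in> Hom C T' E2" "f1 \<cdot> z = (q \<cdot> w) \<cdot> e"
      by (rule exact_lift[OF f(6,2,3) qw fqw])
    \<comment> \<open>After refinement \<open>w\<close> and \<open>a \<cdot> z\<close> agree modulo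
      the kernel of \<open>q\<close>, which is the image of \<open>a \<cdot> f0\<close>; correcting
      \<open>z\<close> by a morphism into \<open>B\<close> yields a true preimage of
      \<open>w\<close>.\<close>
    let ?d = "minus (w \<cdot> e) (a \<cdot> z)"
    have qaz: "q \<cdot> a \<cdot> z = f1 \<cdot> z" by (rule comp_cong_left1[OF a(3)]) (use a(1) W z in auto)
    have d: "?d \<in> Hom C T' W" using w z a(1) by auto
    have "q \<cdot> ?d = minus (q \<cdot> w \<cdot> e) (q \<cdot> a \<cdot> z)" using w(2) z(2,3) a(1) W(3) by simp
    also have "\<dots> = Zr C T' E1" unfolding qaz z(4) using w(2) z(2) W(3) by simp
    finally have qd: "q \<cdot> ?d = Zr C T' E1" .
    obtain y where y: "y \<in> Arr C" "Dom C y = T'" "Cod C y = B" "(a \<cdot> f0) \<cdot> y = ?d"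
      by (rule kernel_factor[OF ker, of ?d]) (use d qd af0 W(3) in \<open>auto simp del: comp_Add\<close>)
    have "a \<cdot> Add C (f0 \<cdot> y) z = Add C ((a \<cdot> f0) \<cdot> y) (a \<cdot> z)"
      using y(1-3) z(3) a(1) f(1) by simp
    also have "\<dots> = w \<cdot> e" unfolding y(4) using w(2) z(2,3) a(1) by simp
    finally show "\<exists>T' e. \<exists>x\<in>Hom C T' E2. is_epi C e \<and> e \<in> Hom C T' T \<and> a \<cdot> x = w \<cdot> e"
      using z(1,2) y(1-3) z(3) f(1)
      by (intro exI[of _ T'] exI[of _ e] bexI[of _ "Add C (f0 \<cdot> y) z"]) auto
  qed
  have D: "Dom C f1 = E2" "Cod C f1 = E1" using f by auto
  have "q \<cdot> a = f1 \<and> short_exact C (a \<cdot> f0) q \<and> short_exact C a (f2 \<cdot> q)"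
    using a(3) ses1 ses2 by blast
  note fin = this
  show ?thesis unfolding factors_two_def D
    by (rule exI[of _ W], rule bexI[of _ a], rule bexI[of _ q], rule fin) (rule W a)+
qed

text \<open>Dual to the pullback; together they let the criterion travel along a morphism of
  2-extensions in either direction.\<close>

lemma factors_two_pushout:
  assumes "f0 \<in> Hom C B E2" "f1 \<in> Hom C E2 E1" "f2 \<in> Hom C E1 X"
    "g0 \<in> Hom C B G2" "g1 \<in> Hom C G2 G1" "g2 \<in> Hom C G1 X"
    "is_mono C g0" "exact C g0 g1" "exact C g1 g2" "is_epi C g2"
    "h1 \<in> Hom C E2 G2" "h2 \<in> Hom C E1 G1" "g1 \<cdot> h1 = h2 \<cdot> f1" "g2 \<cdot> h2 = f2"
    "factors_two C f0 f1 f2"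
  shows "factors_two C g0 g1 g2"
proof -
  interpret d: abelian_category "dual C" by (rule abelian_dual)
  have "factors_two (dual C) g2 g1 g0"
    by (rule d.factors_two_pullback[of g2 X G1 g1 G2 g0 B f2 E1 f1 E2 f0 h2 h1])
      (use assms in \<open>simp_all add: factors_two_dual exact_dual\<close>)
  then show ?thesis by (simp add: factors_two_dual)
qed

lemma extension_twoD:
  assumes "fs \<in> extensions C 2 X B"
  shows "fs ! 0 \<in> Hom C B (Cod C (fs ! 0))" "fs ! 1 \<in> Hom C (Cod C (fs ! 0)) (Cod C (fs ! 1))"
    "fs ! 2 \<in> Hom C (Cod C (fs ! 1)) X" "is_mono C (fs ! 0)" "exact C (fs ! 0) (fs ! 1)"
    "exact C (fs ! 1) (fs ! 2)" "is_epi C (fs ! 2)"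
proof -
  note e = extensionsD[OF assms]
  show 1: "exact C (fs ! 0) (fs ! 1)" "exact C (fs ! 1) (fs ! 2)" "is_mono C (fs ! 0)" "is_epi C (fs ! 2)"
    using e(6)[of 0] e(6)[of 1] e(5,7) by (auto simp: numeral_2_eq_2)
  show "fs ! 0 \<in> Hom C B (Cod C (fs ! 0))" "fs ! 1 \<in> Hom C (Cod C (fs ! 0)) (Cod C (fs ! 1))"
    "fs ! 2 \<in> Hom C (Cod C (fs ! 1)) X"
    using exactD(1-3)[OF 1(1)] exactD(1-3)[OF 1(2)] e(3,4) by auto
qed

lemma ext_morphism_factors_two:
  assumes "ext_morphism C 2 X B fs gs"
  shows "factors_two C (fs ! 0) (fs ! 1) (fs ! 2) \<longleftrightarrow> factors_two C (gs ! 0) (gs ! 1) (gs ! 2)"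
proof -
  obtain h where fs: "fs \<in> extensions C 2 X B" and gs: "gs \<in> extensions C 2 X B"
    and h0: "h 0 = Idn C B" and h3: "h (Suc 2) = Idn C X"
    and h: "\<And>k. k \<le> 2 \<Longrightarrow> h k \<in> Hom C (Dom C (fs ! k)) (Dom C (gs ! k))"
           "\<And>k. k \<le> 2 \<Longrightarrow> gs ! k \<cdot> h k = h (Suc k) \<cdot> fs ! k"
    using assms unfolding ext_morphism_def by blast
  note f = extension_twoD[OF fs] and g = extension_twoD[OF gs]
  have h1: "h 1 \<in> Hom C (Cod C (fs ! 0)) (Cod C (gs ! 0))"
    and h2: "h 2 \<in> Hom C (Cod C (fs ! 1)) (Cod C (gs ! 1))" using h(1)[of 1] h(1)[of 2] f g by auto
  have s0: "h 1 \<cdot> fs ! 0 = gs ! 0" using h(2)[of 0] h0 g(1) by simp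
  have s1: "gs ! 1 \<cdot> h 1 = h 2 \<cdot> fs ! 1" using h(2)[of 1] by (simp add: numeral_2_eq_2)
  have s2: "gs ! 2 \<cdot> h 2 = fs ! 2" using h(2)[of 2] h3 f(3) by simp
  show ?thesis
    using factors_two_pullback[OF f g(1-3) h1 h2 s0 s1] factors_two_pushout[OF f(1-3) g h1 h2 s1 s2]
    by blast
qed

text \<open>The exact piece Ext^1(P, B) \<rightarrow> Ext^1(K, B) \<rightarrow> Ext^2(X, B). The
  splice of an extension \<open>E\<close> of \<open>K\<close> with the given sequence is linked to
  the trivial 2-extension, so \<open>factors_two\<close> passes to it and prolongs \<open>E\<close>
  to an extension \<open>W\<close> of \<open>P\<close>. That one splits, and its retraction
  restricts to \<open>E\<close>.\<close>

theorem ext1_zero_kernel: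
  assumes "Ext_zero C 2 X B" "ext1_zero C P B"
    and se: "short_exact C k p" "k \<in> Hom C K P" "p \<in> Hom C P X" and B: "B \<in> Obj C"
  shows "ext1_zero C K B"
  unfolding ext1_zero_def
proof (intro allI ballI impI)
  fix E f g assume fg: "f \<in> Hom C B E" "g \<in> Hom C E K" "short_exact C f g"
  have X: "X \<in> Obj C" using se by auto
  have "[f, g] \<in> extensions C 1 K B" unfolding extension_one_iff using fg by blast
  from ext_splice_extension[OF this _ se] have ext: "[f, k \<cdot> g, p] \<in> extensions C 2 X B"
    by (simp add: ext_splice_def numeral_2_eq_2)
  obtain S i1 i2 p1 p2 where S: "S \<in> Obj C" "i1 \<in> Hom C B S" "i2 \<in> Hom C X S"
    "p1 \<in> Hom C S B" "p2 \<in> Hom C S X" "p2 \<cdot> i1 = Zr C B X" "short_exact C i1 p2"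
    by (rule biproduct_short_exact[OF B X])
  \<comment> \<open>The trivial 2-extension, two identities joined by a zero morphism; the object
    \<open>W\<close> for it is the biproduct of \<open>B\<close> and \<open>X\<close>.\<close>
  let ?t = "[Idn C B, Zr C B X, Idn C X]"
  have ex: "exact C (Idn C B) (Zr C B X)" "exact C (Zr C B X) (Idn C X)"
  proof -
    show "exact C (Idn C B) (Zr C B X)"
    proof (rule exactI)
      fix T y assume "T \<in> Obj C" "y \<in> Hom C T B"
      then show "\<exists>T' e. \<exists>x\<in>Hom C T' B. is_epi C e \<and> e \<in> Hom C T' T \<and> Idn C B \<cdot> x = y \<cdot> e"
        by (intro exI[of _ T] exI[of _ "Idn C T"] bexI[of _ y]) auto
    qed (use B X in auto)
    show "exact C (Zr C B X) (Idn C X)"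
    proof (rule exactI)
      fix T y assume y: "T \<in> Obj C" "y \<in> Hom C T X" "Idn C X \<cdot> y = Zr C T X"
      have "y = Idn C X \<cdot> y" using y by simp
      then have y0: "y = Zr C T X" unfolding y(3) .
      show "\<exists>T' e. \<exists>x\<in>Hom C T' B. is_epi C e \<and> e \<in> Hom C T' T \<and> Zr C B X \<cdot> x = y \<cdot> e"
        unfolding y0 using y(1) B X
        by (intro exI[of _ T] exI[of _ "Idn C T"] bexI[of _ "Zr C T B"]) auto
    qed (use B X in auto)
  qed
  have triv: "?t \<in> extensions C 2 X B"
  proof (rule extensionsI)
    fix j :: nat assume "j \<le> 2"
    then consider "j = 0" | "j = 1" | "j = 2" by linarith
    then show "?t ! j \<in> Arr C" by cases (use B X in auto)
  next
    fix j :: nat assume "j < 2"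
    then consider "j = 0" | "j = 1" by linarith
    then show "exact C (?t ! j) (?t ! Suc j)" by cases (use ex in auto)
  qed (use B X in auto)
  have fac_triv: "factors_two C (?t ! 0) (?t ! 1) (?t ! 2)"
  proof -
    have D: "?t ! 0 = Idn C B" "?t ! 1 = Zr C B X" "?t ! 2 = Idn C X"
      "Dom C (Zr C B X) = B" "Cod C (Zr C B X) = X" using B X by auto
    have "p2 \<cdot> i1 = Zr C B X \<and> short_exact C (i1 \<cdot> Idn C B) p2 \<and> short_exact C i1 (Idn C X \<cdot> p2)"
      using S by simp
    note fin = this
    show ?thesis unfolding factors_two_def D
      by (rule exI[of _ S], rule bexI[of _ i1], rule bexI[of _ p2], rule fin) (rule S)+
  qed
  have "equivclp (ext_morphism C 2 X B) [f, k \<cdot> g, p] ?t"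
    using assms(1) ext triv unfolding Ext_zero_iff by blast
  then have "factors_two C ([f, k \<cdot> g, p] ! 0) ([f, k \<cdot> g, p] ! 1) ([f, k \<cdot> g, p] ! 2) \<longleftrightarrow>
      factors_two C (?t ! 0) (?t ! 1) (?t ! 2)"
    by (rule equivclp_invariant) (rule ext_morphism_factors_two)
  then have fac: "factors_two C f (k \<cdot> g) p" using fac_triv by simp
  have D: "Dom C (k \<cdot> g) = E" "Cod C (k \<cdot> g) = P" using fg se by auto
  obtain W a q where W: "a \<in> Hom C E W" "q \<in> Hom C W P" "short_exact C (a \<cdot> f) q"
    using fac unfolding factors_two_def D by blast
  have af: "a \<cdot> f \<in> Hom C B W" using W fg by auto
  obtain r where r: "r \<in> Hom C W B" "r \<cdot> a \<cdot> f = Idn C B"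
    by (rule ext1_zeroD_retraction[OF assms(2) W(3) af W(2)])
  have ra: "r \<cdot> a \<in> Hom C E B" "(r \<cdot> a) \<cdot> f = Idn C B" using r W fg by auto
  show "\<exists>s\<in>Hom C K E. g \<cdot> s = Idn C K"
    by (rule retraction_imp_section[OF fg(3,1,2) ra]) blast
qed

text \<open>The kernel of \<open>g\<close> is the zero morphism out of \<open>Z\<close>, so
  \<open>g\<close> is mono as well as epi and hence invertible.\<close>

lemma ext1_zero_zero_obj:
  assumes "is_zero_obj C Z" "X \<in> Obj C"
  shows "ext1_zero C X Z"
  unfolding ext1_zero_def
proof (intro allI ballI impI)
  fix E f g assume fg: "f \<in> Hom C Z E" "g \<in> Hom C E X" "short_exact C f g"
  note se = short_exactD[OF fg(3,1,2)]
  have obj: "Z \<in> Obj C" "E \<in> Obj C" using fg by auto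
  have uniq: "u = v" if "u \<in> Hom C Z T" "v \<in> Hom C Z T" for u v T
  proof -
    have "T \<in> Obj C" using that by auto
    then show ?thesis using assms(1) that unfolding is_zero_obj_def by blast
  qed
  have "f = Zr C Z E" by (rule uniq[OF fg(1)]) (use obj in auto)
  then have "is_mono C g" using mono_if_kernel_zero[OF se(3)] fg by auto
  then obtain s where "s \<in> Hom C X E" "g \<cdot> s = Idn C X"
    using iso_if_mono_epi[OF _ se(2) fg(2)] by blast
  then show "\<exists>s\<in>Hom C X E. g \<cdot> s = Idn C X" by blast
qed

end

text \<open>A contravariant isomorphism that fixes objects. \<open>Rep (op Q) (dual C)\<close> is
  not literally \<open>dual (Rep Q C)\<close>, because a morphism of representations stores its
  domain and codomain; \<open>t\<close> repairs this. Only the category axioms are assumed, so that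
  duality is available while \<open>Rep Q C\<close> is still being shown to be abelian.\<close>

locale anti_iso = D: category D + D': category D' for D :: "('o, 'm) cat" and D' :: "('o, 'm2) cat" +
  fixes t :: "'m \<Rightarrow> 'm2" and t' :: "'m2 \<Rightarrow> 'm"
  assumes Obj_eq: "Obj D' = Obj D"
    and t_Arr: "f \<in> Arr D \<Longrightarrow> t f \<in> Arr D' \<and> Dom D' (t f) = Cod D f \<and> Cod D' (t f) = Dom D f \<and> t' (t f) = f"
    and t'_Arr: "f' \<in> Arr D' \<Longrightarrow> t' f' \<in> Arr D \<and> Dom D (t' f') = Cod D' f' \<and> Cod D (t' f') = Dom D' f' \<and> t (t' f') = f'"
    and t_comp: "f \<in> Arr D \<Longrightarrow> g \<in> Arr D \<Longrightarrow> Dom D g = Cod D f \<Longrightarrow> t (Comp D g f) = Comp D' (t f) (t g)"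
    and t_Idn: "X \<in> Obj D \<Longrightarrow> t (Idn D X) = Idn D' X"
    and t_Zr: "X \<in> Obj D \<Longrightarrow> Y \<in> Obj D \<Longrightarrow> t (Zr D X Y) = Zr D' Y X"
begin

lemma t_Hom: "f \<in> Hom D X Y \<Longrightarrow> t f \<in> Hom D' Y X"
  using t_Arr by auto

lemma t_inj: "f \<in> Arr D \<Longrightarrow> g \<in> Arr D \<Longrightarrow> t f = t g \<Longrightarrow> f = g"
  using t_Arr by metis

lemma t'_comp:
  assumes "f \<in> Arr D'" "g \<in> Arr D'" "Dom D' g = Cod D' f"
  shows "t' (Comp D' g f) = Comp D (t' f) (t' g)"
proof -
  note tf = t'_Arr[OF assms(1)] and tg = t'_Arr[OF assms(2)]
  have gf: "Comp D' g f \<in> Arr D'" using assms by simp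
  have "t (Comp D (t' f) (t' g)) = Comp D' (t (t' g)) (t (t' f))"
    by (rule t_comp) (use assms tf tg in auto)
  also have "\<dots> = t (t' (Comp D' g f))" using tf tg t'_Arr[OF gf] by simp
  finally show ?thesis
    by (intro t_inj[symmetric]) (use assms tf tg t'_Arr[OF gf] in auto)
qed

lemma t'_Zr: "X \<in> Obj D \<Longrightarrow> Y \<in> Obj D \<Longrightarrow> Zr D X Y \<in> Arr D \<Longrightarrow> t' (Zr D' Y X) = Zr D X Y"
  using t_Zr[of X Y] t_Arr[of "Zr D X Y"] by simp

lemma t_mono:
  assumes "is_mono D f"
  shows "is_epi D' (t f)"
  unfolding is_epi_def
proof (intro conjI ballI impI)
  have f: "f \<in> Arr D" using assms by simp
  note tf = t_Arr[OF f]
  show "t f \<in> Arr D'" using tf by blast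
  fix W u v assume u: "u \<in> Hom D' (Cod D' (t f)) W" and v: "v \<in> Hom D' (Cod D' (t f)) W"
    and eq: "Comp D' u (t f) = Comp D' v (t f)"
  note tu = t'_Arr[of u] and tv = t'_Arr[of v]
  have "Comp D f (t' u) = t' (Comp D' u (t f))" "Comp D f (t' v) = t' (Comp D' v (t f))"
    using t'_comp[of "t f" u] t'_comp[of "t f" v] u v tf by auto
  then have eq': "Comp D f (t' u) = Comp D f (t' v)" unfolding eq by simp
  have "t' u = t' v"
    by (rule D.is_monoD[OF assms eq']) (use u v tu tv tf in auto)
  then show "u = v" using tu tv u v by (metis in_Hom_iff)
qed

text \<open>The category axioms say nothing about \<open>Zr\<close>, hence the premise that zero
  morphisms are arrows; preadditive categories discharge it.\<close>

lemma t_kernel: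
  assumes k: "is_kernel D f k" and Zr_Arr: "\<And>X Y. X \<in> Obj D \<Longrightarrow> Y \<in> Obj D \<Longrightarrow> Zr D X Y \<in> Arr D"
  shows "is_cokernel D' (t f) (t k)"
  unfolding is_cokernel_def
proof (intro conjI ballI impI)
  note ka = D.kernel_Arr[OF k]
  note tf = t_Arr[OF ka(1)] and tk = t_Arr[OF ka(2)]
  have obj: "Dom D k \<in> Obj D" "Cod D f \<in> Obj D" using ka by auto
  show "t f \<in> Arr D'" "t k \<in> Arr D'" "Dom D' (t k) = Cod D' (t f)" using tf tk ka by auto
  have "Comp D' (t k) (t f) = t (Comp D f k)" by (rule t_comp[symmetric]) (use ka in auto)
  also have "\<dots> = Zr D' (Dom D' (t f)) (Cod D' (t k))" unfolding ka(4) using t_Zr obj tf tk by simp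
  finally show "Comp D' (t k) (t f) = Zr D' (Dom D' (t f)) (Cod D' (t k))" .
  fix W u assume W: "W \<in> Obj D'" and u: "u \<in> Hom D' (Cod D' (t f)) W"
    and z: "Comp D' u (t f) = Zr D' (Dom D' (t f)) W"
  note tu = t'_Arr[of u]
  have WD: "W \<in> Obj D" using W Obj_eq by simp
  have "Comp D (t' (t f)) (t' u) = t' (Comp D' u (t f))" by (rule t'_comp[symmetric]) (use u tf in auto)
  also have "\<dots> = Zr D W (Cod D f)" unfolding z using t'_Zr[OF WD obj(2) Zr_Arr[OF WD obj(2)]] tf by simp
  finally have fu: "Comp D f (t' u) = Zr D (Dom D (t' u)) (Cod D f)" using tf tu u by simp
  obtain h where h: "h \<in> Arr D" "Dom D h = Dom D (t' u)" "Cod D h = Dom D k" "Comp D k h = t' u"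
    by (rule D.kernel_factor[OF k _ _ fu]) (use tu u tf in auto)
  note th = t_Arr[OF h(1)]
  have "Comp D' (t h) (t k) = t (Comp D k h)" by (rule t_comp[symmetric]) (use h ka in auto)
  then have hk: "Comp D' (t h) (t k) = u" unfolding h(4) using tu u by simp
  show "\<exists>!h. h \<in> Hom D' (Cod D' (t k)) W \<and> Comp D' h (t k) = u"
  proof (rule ex1I)
    show "t h \<in> Hom D' (Cod D' (t k)) W \<and> Comp D' (t h) (t k) = u"
      using th tk h(1-3) tu u hk by auto
    fix h' assume h': "h' \<in> Hom D' (Cod D' (t k)) W \<and> Comp D' h' (t k) = u"
    note th' = t'_Arr[of h']
    have "Comp D (t' (t k)) (t' h') = t' (Comp D' h' (t k))"
      by (rule t'_comp[symmetric]) (use h' tk in auto)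
    then have "Comp D k (t' h') = Comp D k h" using h' tk h(4) by simp
    then have A: "t' h' \<in> Hom D (Dom D (t' u)) (Dom D k) \<and> Comp D k (t' h') = t' u"
      using h(4) h' th' tk tu u by auto
    have B: "h \<in> Hom D (Dom D (t' u)) (Dom D k) \<and> Comp D k h = t' u" using h by auto
    have "Dom D (t' u) \<in> Obj D" "t' u \<in> Hom D (Dom D (t' u)) (Dom D f)" using tu u tf by auto
    then have "\<exists>!w. w \<in> Hom D (Dom D (t' u)) (Dom D k) \<and> Comp D k w = t' u"
      using k fu unfolding is_kernel_def by blast
    then have "t' h' = h" using A B by blast
    then show "h' = t h" using th' h' by auto
  qed
qed

end

lemma (in anti_iso) anti_iso_sym:
  assumes Zr_Arr: "\<And>X Y. X \<in> Obj D \<Longrightarrow> Y \<in> Obj D \<Longrightarrow> Zr D X Y \<in> Arr D"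
  shows "anti_iso D' D t' t"
proof (intro anti_iso.intro anti_iso_axioms.intro D.category_axioms D'.category_axioms)
  show "f \<in> Arr D' \<Longrightarrow> g \<in> Arr D' \<Longrightarrow> Dom D' g = Cod D' f \<Longrightarrow> t' (Comp D' g f) = Comp D (t' f) (t' g)"
    for f g by (rule t'_comp)
  show "t' (Idn D' X) = Idn D X" if "X \<in> Obj D'" for X
    using t_Idn[of X] t_Arr[of "Idn D X"] that Obj_eq by simp
  show "t' (Zr D' X Y) = Zr D Y X" if "X \<in> Obj D'" "Y \<in> Obj D'" for X Y
    by (rule t'_Zr) (use that Obj_eq Zr_Arr in auto)
  show "Obj D = Obj D'" using Obj_eq by simp
qed (fact t'_Arr t_Arr)+

lemma (in anti_iso) anti_iso_dual: "anti_iso (dual D) (dual D') t t'"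
proof (intro anti_iso.intro anti_iso_axioms.intro D.category_dual D'.category_dual)
  show "t (Comp (dual D) g f) = Comp (dual D') (t f) (t g)"
    if "f \<in> Arr (dual D)" "g \<in> Arr (dual D)" "Dom (dual D) g = Cod (dual D) f" for f g
    using t_comp[of g f] that by simp
qed (use Obj_eq t_Arr t'_Arr t_Idn t_Zr in auto)

locale abelian_anti_iso = anti_iso D D' t t' + D: abelian_category D + D': abelian_category D'
  for D :: "('o, 'm) cat" and D' :: "('o, 'm2) cat" and t t'
begin

text \<open>The symmetric description \<open>exact_iff\<close> is transported: \<open>t\<close>
  exchanges the cokernel of \<open>f\<close> with the kernel of \<open>g\<close>.\<close>

lemma t_exact:
  assumes "exact D f g"
  shows "exact D' (t g) (t f)"
proof -
  have f: "f \<in> Arr D" "g \<in> Arr D" "Dom D g = Cod D f" "Comp D g f = Zr D (Dom D f) (Cod D g)"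
    using D.exactD[OF assms] by auto
  obtain c k where c: "is_cokernel D f c" and k: "is_kernel D g k"
    and z: "Comp D c k = Zr D (Dom D k) (Cod D c)"
    using assms unfolding D.exact_iff by blast
  note ca = D.cokernel_Arr[OF c] and ka = D.kernel_Arr[OF k]
  have c': "is_kernel D' (t f) (t c)"
    using anti_iso.t_kernel[OF anti_iso_dual, of f c] c by simp
  have k': "is_cokernel D' (t g) (t k)" by (rule t_kernel[OF k]) simp
  note tf = t_Arr[OF f(1)] and tg = t_Arr[OF f(2)] and tc = t_Arr[OF ca(2)] and tk = t_Arr[OF ka(2)]
  have "Comp D' (t f) (t g) = t (Comp D g f)" by (rule t_comp[symmetric]) (use f in auto)
  then have 1: "Comp D' (t f) (t g) = Zr D' (Dom D' (t g)) (Cod D' (t f))"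
    unfolding f(4) using t_Zr f(1,2) tf tg by simp
  have "Comp D' (t k) (t c) = t (Comp D c k)" by (rule t_comp[symmetric]) (use ca ka f in auto)
  then have 2: "Comp D' (t k) (t c) = Zr D' (Dom D' (t c)) (Cod D' (t k))"
    unfolding z using t_Zr ca(2) ka(2) tc tk by simp
  have "t g \<in> Arr D'" "t f \<in> Arr D'" "Dom D' (t f) = Cod D' (t g)" using f tf tg by auto
  then show ?thesis unfolding D'.exact_iff using 1 2 c' k' by blast
qed

text \<open>Read contravariantly an extension runs backwards, so the list is reversed and the end
  terms change places.\<close>

lemma t_extension:
  assumes "fs \<in> extensions D n X Y"
  shows "rev (map t fs) \<in> extensions D' n Y X"
proof -
  note e = extensionsD[OF assms]
  have nth: "rev (map t fs) ! k = t (fs ! (n - k))" if "k \<le> n" for k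
    using that e(1) by (simp add: rev_nth)
  have n0: "rev (map t fs) ! 0 = t (fs ! n)" "rev (map t fs) ! n = t (fs ! 0)"
    using nth[of 0] nth[of n] by simp_all
  have tn: "Dom D' (t (fs ! n)) = X" using t_Arr[OF e(2)[of n]] e(4) by simp
  have t0: "Cod D' (t (fs ! 0)) = Y" using t_Arr[OF e(2)[of 0]] e(3) by simp
  have epi: "is_epi D' (t (fs ! 0))" by (rule t_mono[OF e(5)])
  have mono: "is_mono D' (t (fs ! n))"
    using anti_iso.t_mono[OF anti_iso_dual, of "fs ! n"] e(7) by simp
  show ?thesis
  proof (rule extensionsI)
    show "length (rev (map t fs)) = Suc n" using e(1) by simp
    show "rev (map t fs) ! k \<in> Arr D'" if "k \<le> n" for k
      using nth[OF that] t_Arr[OF e(2)[of "n - k"]] by simp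
    show "exact D' (rev (map t fs) ! k) (rev (map t fs) ! Suc k)" if "k < n" for k
    proof -
      have "exact D (fs ! (n - Suc k)) (fs ! Suc (n - Suc k))" by (rule e(6)) (use that in simp)
      moreover have "Suc (n - Suc k) = n - k" using that by simp
      ultimately show ?thesis using t_exact nth[of k] nth[of "Suc k"] that by simp
    qed
  qed (simp_all only: n0 tn t0 mono epi)
qed

lemma t_ext_morphism:
  assumes "ext_morphism D n X Y fs gs"
  shows "ext_morphism D' n Y X (rev (map t gs)) (rev (map t fs))"
proof -
  obtain h where fs: "fs \<in> extensions D n X Y" and gs: "gs \<in> extensions D n X Y"
    and h0: "h 0 = Idn D Y" and hn: "h (Suc n) = Idn D X"
    and h: "\<And>k. k \<le> n \<Longrightarrow> h k \<in> Hom D (Dom D (fs ! k)) (Dom D (gs ! k))"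
      "\<And>k. k \<le> n \<Longrightarrow> Comp D (gs ! k) (h k) = Comp D (h (Suc k)) (fs ! k)"
    using assms unfolding ext_morphism_def by blast
  note e = extensionsD[OF fs] and e' = extensionsD[OF gs]
  have XY: "X \<in> Obj D" "Y \<in> Obj D"
    using e(2)[of n] e(2)[of 0] D.Cod_Obj[of "fs ! n"] D.Dom_Obj[of "fs ! 0"] e(3,4) by auto
  have nth: "rev (map t fs) ! k = t (fs ! (n - k))" "rev (map t gs) ! k = t (gs ! (n - k))"
    if "k \<le> n" for k
    using that e(1) e'(1) by (simp_all add: rev_nth)
  have h_Suc: "h (Suc k) \<in> Hom D (Cod D (fs ! k)) (Cod D (gs ! k))" if "k \<le> n" for k
  proof (cases "k = n")
    case True
    then show ?thesis using hn e(4) e'(4) XY by simp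
  next
    case False
    then have "k < n" using that by simp
    then show ?thesis
      using h(1)[of "Suc k"] D.extension_Dom_Suc[OF fs] D.extension_Dom_Suc[OF gs] by simp
  qed
  show ?thesis unfolding ext_morphism_def
  proof (intro conjI exI[of _ "\<lambda>k. t (h (Suc n - k))"] allI impI t_extension fs gs)
    show "t (h (Suc n - 0)) = Idn D' X" using hn t_Idn XY by simp
    show "t (h (Suc n - Suc n)) = Idn D' Y" using h0 t_Idn XY by simp
    fix k assume k: "k \<le> n"
    let ?j = "n - k"
    have j: "?j \<le> n" "Suc n - k = Suc ?j" "Suc n - Suc k = ?j" using k by auto
    note hj = h_Suc[OF j(1)] and hj' = h(1)[OF j(1)]
    note f = e(2)[OF j(1)] and g = e'(2)[OF j(1)]
    show "t (h (Suc n - k)) \<in> Hom D' (Dom D' (rev (map t gs) ! k)) (Dom D' (rev (map t fs) ! k))"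
      unfolding nth[OF k] j using t_Hom[OF hj] t_Arr[OF f] t_Arr[OF g] by simp
    have "Comp D' (t (fs ! ?j)) (t (h (Suc ?j))) = t (Comp D (h (Suc ?j)) (fs ! ?j))"
      by (rule t_comp[symmetric]) (use f hj in auto)
    also have "\<dots> = t (Comp D (gs ! ?j) (h ?j))" using h(2)[OF j(1)] by simp
    also have "\<dots> = Comp D' (t (h ?j)) (t (gs ! ?j))" by (rule t_comp) (use g hj' in auto)
    finally show "Comp D' (rev (map t fs) ! k) (t (h (Suc n - k))) =
        Comp D' (t (h (Suc n - Suc k))) (rev (map t gs) ! k)"
      unfolding nth[OF k] j .
  qed
qed

lemma abelian_anti_iso_sym: "abelian_anti_iso D' D t' t"
  by (intro abelian_anti_iso.intro anti_iso_sym D.abelian_category_axioms D'.abelian_category_axioms) simp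

lemma t'_extension: "fs \<in> extensions D' n X Y \<Longrightarrow> rev (map t' fs) \<in> extensions D n Y X"
  using abelian_anti_iso.t_extension[OF abelian_anti_iso_sym] .

text \<open>A morphism of extensions is sent to one in the opposite direction, which a zigzag
  absorbs; since \<open>t'\<close> inverts \<open>t\<close>, every extension in \<open>D'\<close>
  comes from one in \<open>D\<close>.\<close>

lemma Ext_zero_t:
  assumes "Ext_zero D n X Y"
  shows "Ext_zero D' n Y X"
  unfolding Ext_zero_iff
proof (intro conjI ballI)
  note z = assms[unfolded Ext_zero_iff]
  show "extensions D' n Y X \<noteq> {}" using z t_extension by blast
  fix fs gs assume fs: "fs \<in> extensions D' n Y X" and gs: "gs \<in> extensions D' n Y X"
  have inv: "rev (map t (rev (map t' hs))) = hs" if "hs \<in> extensions D' n Y X" for hs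
  proof -
    have "\<forall>x \<in> set hs. t (t' x) = x" using that t'_Arr unfolding extensions_def by blast
    then have "map t (map t' hs) = hs" by (simp add: map_idI)
    then show ?thesis by (simp add: rev_map)
  qed
  have "equivclp (ext_morphism D n X Y) (rev (map t' fs)) (rev (map t' gs))"
    using z t'_extension fs gs by blast
  then have "equivclp (ext_morphism D' n Y X) (rev (map t (rev (map t' fs)))) (rev (map t (rev (map t' gs))))"
    by (rule equivclp_map)
      (rule equivclp_sym, rule r_into_equivclp[of "ext_morphism D' n Y X"], rule t_ext_morphism)
  then show "equivclp (ext_morphism D' n Y X) fs gs" unfolding inv[OF fs] inv[OF gs] .
qed

lemma Ext_zero_t_iff: "Ext_zero D' n Y X \<longleftrightarrow> Ext_zero D n X Y"
  using Ext_zero_t abelian_anti_iso.Ext_zero_t[OF abelian_anti_iso_sym] by blast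

end

text \<open>\<open>dual C\<close> has the same arrows as \<open>C\<close>, so the translation of
  arrows is the identity.\<close>

lemma (in abelian_category) Ext_zero_dual: "Ext_zero (dual C) n Y X \<longleftrightarrow> Ext_zero C n X Y"
proof -
  interpret d: abelian_category "dual C" by (rule abelian_dual)
  interpret abelian_anti_iso C "dual C" "\<lambda>f. f" "\<lambda>f. f"
    by (intro abelian_anti_iso.intro anti_iso.intro anti_iso_axioms.intro category_axioms
        d.category_axioms abelian_category_axioms d.abelian_category_axioms) auto
  show ?thesis by (rule Ext_zero_t_iff)
qed

subsection \<open>Categories of representations\<close>

definition op :: "('v, 'e) pre_digraph \<Rightarrow> ('v, 'e) pre_digraph" where
  "op Q = \<lparr>verts = verts Q, arcs = arcs Q, tail = head Q, head = tail Q\<rparr>"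

lemma op_simps [simp]:
  "verts (op Q) = verts Q" "arcs (op Q) = arcs Q" "tail (op Q) = head Q" "head (op Q) = tail Q"
  "op (op Q) = Q"
  by (simp_all add: op_def)

text \<open>Cutting the data down to the quiver builds in the extensionality that
  \<open>reps\<close> demands, so it need not be argued anew for each such construction;
  \<open>mk_mor\<close> does the same for morphisms.\<close>

definition mk_rep ::
  "('v, 'e) pre_digraph \<Rightarrow> ('v \<Rightarrow> 'o) \<Rightarrow> ('e \<Rightarrow> 'm) \<Rightarrow> ('v, 'e, 'o, 'm) qrep" where
  "mk_rep Q ob ar = \<lparr>vob = restrict ob (verts Q), amor = restrict ar (arcs Q)\<rparr>"

definition mk_mor :: "('v, 'e) pre_digraph \<Rightarrow> ('v, 'e, 'o, 'm) qrep \<Rightarrow> ('v, 'e, 'o, 'm) qrep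
    \<Rightarrow> ('v \<Rightarrow> 'm) \<Rightarrow> ('v, 'e, 'o, 'm) qmor" where
  "mk_mor Q F G \<eta> = (F, G, restrict \<eta> (verts Q))"

abbreviation cmp :: "('v, 'e, 'o, 'm) qmor \<Rightarrow> 'v \<Rightarrow> 'm" where
  "cmp f \<equiv> snd (snd f)"

lemma vob_mk_rep [simp]: "i \<in> verts Q \<Longrightarrow> vob (mk_rep Q ob ar) i = ob i"
  and amor_mk_rep [simp]: "\<alpha> \<in> arcs Q \<Longrightarrow> amor (mk_rep Q ob ar) \<alpha> = ar \<alpha>"
  and cmp_mk_mor [simp]: "i \<in> verts Q \<Longrightarrow> cmp (mk_mor Q F G \<eta>) i = \<eta> i"
  by (simp_all add: mk_rep_def mk_mor_def)

lemma Rep_Obj: "Obj (Rep Q C) = reps Q C"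
  by (simp add: Rep_def)

lemma cmp_simps [simp]:
  assumes "i \<in> verts Q"
  shows "cmp (Comp (Rep Q C) g f) i = Comp C (cmp g i) (cmp f i)"
    "cmp (Idn (Rep Q C) F) i = Idn C (vob F i)"
    "cmp (Zr (Rep Q C) F G) i = Zr C (vob F i) (vob G i)"
    "cmp (Add (Rep Q C) f g) i = Add C (cmp f i) (cmp g i)"
  using assms by (simp_all add: Rep_def split_beta)

lemma Rep_Hom_iff:
  "f \<in> Hom (Rep Q C) F G \<longleftrightarrow> fst f = F \<and> fst (snd f) = G \<and> F \<in> reps Q C \<and> G \<in> reps Q C \<and>
    cmp f \<in> extensional (verts Q) \<and> (\<forall>i \<in> verts Q. cmp f i \<in> Hom C (vob F i) (vob G i)) \<and>
    (\<forall>\<alpha> \<in> arcs Q. Comp C (cmp f (head Q \<alpha>)) (amor F \<alpha>) = Comp C (amor G \<alpha>) (cmp f (tail Q \<alpha>)))"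
  by (cases f) (auto simp: Rep_def rep_mors_def PiE_def Pi_def)

lemma Rep_HomD:
  assumes "f \<in> Hom (Rep Q C) F G"
  shows "F \<in> reps Q C" "G \<in> reps Q C"
    "i \<in> verts Q \<Longrightarrow> cmp f i \<in> Hom C (vob F i) (vob G i)"
    "\<alpha> \<in> arcs Q \<Longrightarrow> Comp C (cmp f (head Q \<alpha>)) (amor F \<alpha>) = Comp C (amor G \<alpha>) (cmp f (tail Q \<alpha>))"
  using assms unfolding Rep_Hom_iff by blast+

lemma Rep_Hom_eqI:
  assumes "f \<in> Hom (Rep Q C) F G" "g \<in> Hom (Rep Q C) F G" "\<And>i. i \<in> verts Q \<Longrightarrow> cmp f i = cmp g i"
  shows "f = g"
proof -
  have "cmp f = cmp g"
    by (rule extensionalityI[of _ "verts Q"]) (use assms in \<open>auto simp: Rep_Hom_iff simp del: in_Hom_iff\<close>)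
  then show ?thesis using assms(1,2) unfolding Rep_Hom_iff by (auto simp: prod_eq_iff)
qed

lemma mk_mor_Hom:
  assumes "F \<in> reps Q C" "G \<in> reps Q C" "\<And>i. i \<in> verts Q \<Longrightarrow> \<eta> i \<in> Hom C (vob F i) (vob G i)"
    "\<And>\<alpha>. \<alpha> \<in> arcs Q \<Longrightarrow> head Q \<alpha> \<in> verts Q \<and> tail Q \<alpha> \<in> verts Q"
    "\<And>\<alpha>. \<alpha> \<in> arcs Q \<Longrightarrow> Comp C (\<eta> (head Q \<alpha>)) (amor F \<alpha>) = Comp C (amor G \<alpha>) (\<eta> (tail Q \<alpha>))"
  shows "mk_mor Q F G \<eta> \<in> Hom (Rep Q C) F G"
  unfolding Rep_Hom_iff using assms by (auto simp: mk_mor_def)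

lemma mk_rep_reps:
  assumes "\<And>i. i \<in> verts Q \<Longrightarrow> ob i \<in> Obj C"
    "\<And>\<alpha>. \<alpha> \<in> arcs Q \<Longrightarrow> head Q \<alpha> \<in> verts Q \<and> tail Q \<alpha> \<in> verts Q"
    "\<And>\<alpha>. \<alpha> \<in> arcs Q \<Longrightarrow> ar \<alpha> \<in> Hom C (ob (tail Q \<alpha>)) (ob (head Q \<alpha>))"
  shows "mk_rep Q ob ar \<in> reps Q C"
  using assms by (auto simp: reps_def mk_rep_def PiE_def Pi_def)

lemma repsD:
  assumes "F \<in> reps Q C"
  shows "i \<in> verts Q \<Longrightarrow> vob F i \<in> Obj C"
    "\<alpha> \<in> arcs Q \<Longrightarrow> amor F \<alpha> \<in> Hom C (vob F (tail Q \<alpha>)) (vob F (head Q \<alpha>))"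
  using assms by (auto simp: reps_def PiE_def Pi_def)

lemma reps_op_dual: "reps (op Q) (dual C) = reps Q C"
  by (simp add: reps_def Hom_dual del: in_Hom_iff)

section \<open>The preadditive category of representations\<close>

locale quiver_reps = wf_digraph Q + abelian_category C
  for Q :: "('v, 'e) pre_digraph" and C :: "('o, 'm) cat"
begin

lemma ends [simp]: "\<alpha> \<in> arcs Q \<Longrightarrow> head Q \<alpha> \<in> verts Q" "\<alpha> \<in> arcs Q \<Longrightarrow> tail Q \<alpha> \<in> verts Q"
  by (auto intro: head_in_verts tail_in_verts)

lemma ends' : "\<alpha> \<in> arcs Q \<Longrightarrow> head Q \<alpha> \<in> verts Q \<and> tail Q \<alpha> \<in> verts Q"
  by simp

lemma op_dual: "quiver_reps (op Q) (dual C)"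
  by (intro quiver_reps.intro wf_digraph.intro abelian_dual) auto

lemma Rep_Comp_Hom:
  assumes f: "f \<in> Hom (Rep Q C) F G" and g: "g \<in> Hom (Rep Q C) G H"
  shows "Comp (Rep Q C) g f \<in> Hom (Rep Q C) F H"
proof -
  note fD = Rep_HomD[OF f] and gD = Rep_HomD[OF g]
  have "Comp (Rep Q C) g f = mk_mor Q F H (\<lambda>i. cmp g i \<cdot> cmp f i)"
    using f g unfolding Rep_Hom_iff by (auto simp: mk_mor_def Rep_def split_beta)
  moreover have "mk_mor Q F H (\<lambda>i. cmp g i \<cdot> cmp f i) \<in> Hom (Rep Q C) F H"
  proof (rule mk_mor_Hom[OF fD(1) gD(2) _ ends'])
    show "cmp g i \<cdot> cmp f i \<in> Hom C (vob F i) (vob H i)" if "i \<in> verts Q" for i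
      using fD(3)[OF that] gD(3)[OF that] by auto
    fix \<alpha> assume \<alpha>: "\<alpha> \<in> arcs Q"
    let ?h = "head Q \<alpha>" and ?t = "tail Q \<alpha>"
    note ty = fD(3)[of ?h] fD(3)[of ?t] gD(3)[of ?h] gD(3)[of ?t] repsD(2)[OF fD(1) \<alpha>]
      repsD(2)[OF fD(2) \<alpha>] repsD(2)[OF gD(2) \<alpha>]
    have "(cmp g ?h \<cdot> cmp f ?h) \<cdot> amor F \<alpha> = cmp g ?h \<cdot> cmp f ?h \<cdot> amor F \<alpha>"
      by (rule comp_assoc) (use ty \<alpha> in auto)
    also have "\<dots> = (cmp g ?h \<cdot> amor G \<alpha>) \<cdot> cmp f ?t" unfolding fD(4)[OF \<alpha>]
      by (rule comp_assoc[symmetric]) (use ty \<alpha> in auto)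
    also have "\<dots> = amor H \<alpha> \<cdot> cmp g ?t \<cdot> cmp f ?t" unfolding gD(4)[OF \<alpha>]
      by (rule comp_assoc) (use ty \<alpha> in auto)
    finally show "(cmp g ?h \<cdot> cmp f ?h) \<cdot> amor F \<alpha> = amor H \<alpha> \<cdot> cmp g ?t \<cdot> cmp f ?t" .
  qed
  ultimately show ?thesis by metis
qed

lemma Rep_Idn_Hom:
  assumes "F \<in> reps Q C"
  shows "Idn (Rep Q C) F \<in> Hom (Rep Q C) F F"
proof -
  have "Idn (Rep Q C) F = mk_mor Q F F (\<lambda>i. Idn C (vob F i))" by (simp add: Rep_def mk_mor_def)
  moreover have "\<dots> \<in> Hom (Rep Q C) F F"
    by (rule mk_mor_Hom[OF assms assms _ ends']) (use repsD[OF assms] in auto)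
  ultimately show ?thesis by metis
qed

lemma category_Rep: "category (Rep Q C)"
proof
  fix f assume "f \<in> Arr (Rep Q C)"
  then have "f \<in> Hom (Rep Q C) (Dom (Rep Q C) f) (Cod (Rep Q C) f)" by simp
  from Rep_HomD(1,2)[OF this]
  show "Dom (Rep Q C) f \<in> Obj (Rep Q C)" "Cod (Rep Q C) f \<in> Obj (Rep Q C)" by (simp_all add: Rep_Obj)
next
  fix F assume "F \<in> Obj (Rep Q C)"
  then show "Idn (Rep Q C) F \<in> Hom (Rep Q C) F F" using Rep_Idn_Hom Rep_Obj by blast
next
  fix f g F G H assume "f \<in> Hom (Rep Q C) F G" "g \<in> Hom (Rep Q C) G H"
  then show "Comp (Rep Q C) g f \<in> Hom (Rep Q C) F H" by (rule Rep_Comp_Hom)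
next
  fix f g h F G H K
  assume f: "f \<in> Hom (Rep Q C) F G" and g: "g \<in> Hom (Rep Q C) G H" and h: "h \<in> Hom (Rep Q C) H K"
  show "Comp (Rep Q C) h (Comp (Rep Q C) g f) = Comp (Rep Q C) (Comp (Rep Q C) h g) f"
  proof (rule Rep_Hom_eqI)
    fix i assume i: "i \<in> verts Q"
    show "cmp (Comp (Rep Q C) h (Comp (Rep Q C) g f)) i = cmp (Comp (Rep Q C) (Comp (Rep Q C) h g) f) i"
      using Rep_HomD(3)[OF f i] Rep_HomD(3)[OF g i] Rep_HomD(3)[OF h i] i by simp
  qed (rule Rep_Comp_Hom f g h)+
next
  fix f F G assume f: "f \<in> Hom (Rep Q C) F G"
  show "Comp (Rep Q C) f (Idn (Rep Q C) F) = f"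
  proof (rule Rep_Hom_eqI)
    show "Comp (Rep Q C) f (Idn (Rep Q C) F) \<in> Hom (Rep Q C) F G"
      by (rule Rep_Comp_Hom[OF Rep_Idn_Hom f]) (rule Rep_HomD[OF f])
    show "cmp (Comp (Rep Q C) f (Idn (Rep Q C) F)) i = cmp f i" if "i \<in> verts Q" for i
      using Rep_HomD(3)[OF f that] that by simp
  qed (rule f)
  show "Comp (Rep Q C) (Idn (Rep Q C) G) f = f"
  proof (rule Rep_Hom_eqI)
    show "Comp (Rep Q C) (Idn (Rep Q C) G) f \<in> Hom (Rep Q C) F G"
      by (rule Rep_Comp_Hom[OF f Rep_Idn_Hom]) (rule Rep_HomD[OF f])
    show "cmp (Comp (Rep Q C) (Idn (Rep Q C) G) f) i = cmp f i" if "i \<in> verts Q" for i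
      using Rep_HomD(3)[OF f that] that by simp
  qed (rule f)
qed

lemma Rep_Add_Hom:
  assumes f: "f \<in> Hom (Rep Q C) F G" and g: "g \<in> Hom (Rep Q C) F G"
  shows "Add (Rep Q C) f g \<in> Hom (Rep Q C) F G"
proof -
  note fD = Rep_HomD[OF f] and gD = Rep_HomD[OF g]
  have "Add (Rep Q C) f g = mk_mor Q F G (\<lambda>i. Add C (cmp f i) (cmp g i))"
    using f g unfolding Rep_Hom_iff by (auto simp: mk_mor_def Rep_def split_beta)
  moreover have "mk_mor Q F G (\<lambda>i. Add C (cmp f i) (cmp g i)) \<in> Hom (Rep Q C) F G"
  proof (rule mk_mor_Hom[OF fD(1,2) _ ends'])
    show "Add C (cmp f i) (cmp g i) \<in> Hom C (vob F i) (vob G i)" if "i \<in> verts Q" for i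
      using fD(3)[OF that] gD(3)[OF that] by auto
    fix \<alpha> assume \<alpha>: "\<alpha> \<in> arcs Q"
    let ?h = "head Q \<alpha>" and ?t = "tail Q \<alpha>"
    note ty = fD(3)[of ?h] fD(3)[of ?t] gD(3)[of ?h] gD(3)[of ?t] repsD(2)[OF fD(1) \<alpha>]
      repsD(2)[OF fD(2) \<alpha>]
    show "Add C (cmp f ?h) (cmp g ?h) \<cdot> amor F \<alpha> = amor G \<alpha> \<cdot> Add C (cmp f ?t) (cmp g ?t)"
      using ty \<alpha> fD(4)[OF \<alpha>] gD(4)[OF \<alpha>] by simp
  qed
  ultimately show ?thesis by metis
qed

lemma Rep_Zr_Hom:
  assumes "F \<in> reps Q C" "G \<in> reps Q C"
  shows "Zr (Rep Q C) F G \<in> Hom (Rep Q C) F G"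
proof -
  have "Zr (Rep Q C) F G = mk_mor Q F G (\<lambda>i. Zr C (vob F i) (vob G i))" by (simp add: Rep_def mk_mor_def)
  moreover have "\<dots> \<in> Hom (Rep Q C) F G"
    by (rule mk_mor_Hom[OF assms _ ends']) (use repsD[OF assms(1)] repsD[OF assms(2)] in auto)
  ultimately show ?thesis by metis
qed

lemma preadditive_Rep: "preadditive_category (Rep Q C)"
proof (intro preadditive_category.intro preadditive_category_axioms.intro category_Rep)
  fix F G assume "F \<in> Obj (Rep Q C)" "G \<in> Obj (Rep Q C)"
  then have FG: "F \<in> reps Q C" "G \<in> reps Q C" by (simp_all add: Rep_Obj)
  have c: "carrier (hom_group (Rep Q C) F G) = Hom (Rep Q C) F G"
    "mult (hom_group (Rep Q C) F G) = Add (Rep Q C)" "one (hom_group (Rep Q C) F G) = Zr (Rep Q C) F G"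
    by (simp_all add: hom_group_def)
  note H = Rep_Add_Hom Rep_Zr_Hom[OF FG]
  show "comm_group (hom_group (Rep Q C) F G)"
  proof (rule comm_groupI, unfold c)
    fix f g assume f: "f \<in> Hom (Rep Q C) F G" and g: "g \<in> Hom (Rep Q C) F G"
    show "Add (Rep Q C) f g \<in> Hom (Rep Q C) F G" by (rule H f g)+
    show "Add (Rep Q C) f g = Add (Rep Q C) g f"
    proof (rule Rep_Hom_eqI)
      show "cmp (Add (Rep Q C) f g) i = cmp (Add (Rep Q C) g f) i" if i: "i \<in> verts Q" for i
        using Add_commute[of "cmp f i" "cmp g i"] Rep_HomD(3)[OF f i] Rep_HomD(3)[OF g i] i by simp
    qed (rule H f g)+
  next
    show "Zr (Rep Q C) F G \<in> Hom (Rep Q C) F G" by (rule H)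
  next
    fix f g h assume f: "f \<in> Hom (Rep Q C) F G" and g: "g \<in> Hom (Rep Q C) F G" and h: "h \<in> Hom (Rep Q C) F G"
    show "Add (Rep Q C) (Add (Rep Q C) f g) h = Add (Rep Q C) f (Add (Rep Q C) g h)"
    proof (rule Rep_Hom_eqI)
      show "cmp (Add (Rep Q C) (Add (Rep Q C) f g) h) i = cmp (Add (Rep Q C) f (Add (Rep Q C) g h)) i"
        if i: "i \<in> verts Q" for i
        using Rep_HomD(3)[OF f i] Rep_HomD(3)[OF g i] Rep_HomD(3)[OF h i] i by simp
    qed (rule H f g h)+
  next
    fix f assume f: "f \<in> Hom (Rep Q C) F G"
    note fD = Rep_HomD[OF f]
    show "Add (Rep Q C) (Zr (Rep Q C) F G) f = f"
    proof (rule Rep_Hom_eqI)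
      show "cmp (Add (Rep Q C) (Zr (Rep Q C) F G) f) i = cmp f i" if i: "i \<in> verts Q" for i
        using fD(3)[OF i] i by simp
    qed (rule H f)+
    have n: "mk_mor Q F G (\<lambda>i. neg (cmp f i)) \<in> Hom (Rep Q C) F G"
    proof (rule mk_mor_Hom[OF FG _ ends'])
      show "neg (cmp f i) \<in> Hom C (vob F i) (vob G i)" if "i \<in> verts Q" for i
        using fD(3)[OF that] by auto
      fix \<alpha> assume \<alpha>: "\<alpha> \<in> arcs Q"
      show "neg (cmp f (head Q \<alpha>)) \<cdot> amor F \<alpha> = amor G \<alpha> \<cdot> neg (cmp f (tail Q \<alpha>))"
        using fD(3)[of "head Q \<alpha>"] fD(3)[of "tail Q \<alpha>"] repsD(2)[OF FG(1) \<alpha>] repsD(2)[OF FG(2) \<alpha>]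
          fD(4)[OF \<alpha>] \<alpha> by simp
    qed
    show "\<exists>g \<in> Hom (Rep Q C) F G. Add (Rep Q C) g f = Zr (Rep Q C) F G"
    proof (rule bexI[OF _ n], rule Rep_Hom_eqI)
      show "cmp (Add (Rep Q C) (mk_mor Q F G (\<lambda>i. neg (cmp f i))) f) i = cmp (Zr (Rep Q C) F G) i"
        if i: "i \<in> verts Q" for i
        using fD(3)[OF i] i by simp
    qed (rule H n f)+
  qed
next
  fix f f' g F G H
  assume f: "f \<in> Hom (Rep Q C) F G" and f': "f' \<in> Hom (Rep Q C) F G" and g: "g \<in> Hom (Rep Q C) G H"
  show "Comp (Rep Q C) g (Add (Rep Q C) f f') = Add (Rep Q C) (Comp (Rep Q C) g f) (Comp (Rep Q C) g f')"
  proof (rule Rep_Hom_eqI)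
    show "cmp (Comp (Rep Q C) g (Add (Rep Q C) f f')) i = cmp (Add (Rep Q C) (Comp (Rep Q C) g f) (Comp (Rep Q C) g f')) i"
      if i: "i \<in> verts Q" for i
      using Rep_HomD(3)[OF f i] Rep_HomD(3)[OF f' i] Rep_HomD(3)[OF g i] i by simp
  qed (rule Rep_Comp_Hom Rep_Add_Hom f f' g)+
next
  fix f g g' F G H
  assume f: "f \<in> Hom (Rep Q C) F G" and g: "g \<in> Hom (Rep Q C) G H" and g': "g' \<in> Hom (Rep Q C) G H"
  show "Comp (Rep Q C) (Add (Rep Q C) g g') f = Add (Rep Q C) (Comp (Rep Q C) g f) (Comp (Rep Q C) g' f)"
  proof (rule Rep_Hom_eqI)
    show "cmp (Comp (Rep Q C) (Add (Rep Q C) g g') f) i = cmp (Add (Rep Q C) (Comp (Rep Q C) g f) (Comp (Rep Q C) g' f)) i"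
      if i: "i \<in> verts Q" for i
      using Rep_HomD(3)[OF f i] Rep_HomD(3)[OF g i] Rep_HomD(3)[OF g' i] i by simp
  qed (rule Rep_Comp_Hom Rep_Add_Hom f g g')+
qed

end

sublocale quiver_reps \<subseteq> R: preadditive_category "Rep Q C"
  by (rule preadditive_Rep)

section \<open>Pointwise kernels of representations\<close>

context quiver_reps
begin

text \<open>The pointwise factorizations \<open>h i\<close> commute with the arrows because this may
  be checked after composing with the monomorphism that \<open>k\<close> provides at the
  head.\<close>

lemma Rep_is_kernelI:
  assumes f: "f \<in> Hom (Rep Q C) F G" and k: "k \<in> Hom (Rep Q C) K F"
    and ker: "\<And>i. i \<in> verts Q \<Longrightarrow> is_kernel C (cmp f i) (cmp k i)"
  shows "is_kernel (Rep Q C) f k"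
proof (rule R.is_kernelI)
  note fD = Rep_HomD[OF f] and kD = Rep_HomD[OF k]
  show "is_mono (Rep Q C) k"
    unfolding is_mono_def
  proof (intro conjI ballI impI)
    show "k \<in> Arr (Rep Q C)" using k by auto
    fix W u v assume "u \<in> Hom (Rep Q C) W (Dom (Rep Q C) k)" "v \<in> Hom (Rep Q C) W (Dom (Rep Q C) k)"
      and eq: "Comp (Rep Q C) k u = Comp (Rep Q C) k v"
    then have u: "u \<in> Hom (Rep Q C) W K" and v: "v \<in> Hom (Rep Q C) W K" using k by auto
    show "u = v"
    proof (rule Rep_Hom_eqI[OF u v])
      fix i assume i: "i \<in> verts Q"
      have "cmp k i \<cdot> cmp u i = cmp k i \<cdot> cmp v i" using arg_cong[OF eq, of "\<lambda>x. cmp x i"] i by simp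
      then show "cmp u i = cmp v i"
        by (rule is_monoD[OF kernel_is_mono[OF ker[OF i]]])
          (use Rep_HomD(3)[OF u i] Rep_HomD(3)[OF v i] kD(3)[OF i] in auto)
    qed
  qed
  show "f \<in> Arr (Rep Q C)" "Cod (Rep Q C) k = Dom (Rep Q C) f" using f k by auto
  have "Comp (Rep Q C) f k = Zr (Rep Q C) K G"
  proof (rule Rep_Hom_eqI)
    show "cmp (Comp (Rep Q C) f k) i = cmp (Zr (Rep Q C) K G) i" if i: "i \<in> verts Q" for i
      using kernel_Arr[OF ker[OF i]] fD(3)[OF i] kD(3)[OF i] i by simp
  qed (rule Rep_Comp_Hom Rep_Zr_Hom f k fD kD)+
  then show "Comp (Rep Q C) f k = Zr (Rep Q C) (Dom (Rep Q C) k) (Cod (Rep Q C) f)" using f k by auto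
  fix u assume u0: "u \<in> Arr (Rep Q C)" "Cod (Rep Q C) u = Dom (Rep Q C) f"
    "Comp (Rep Q C) f u = Zr (Rep Q C) (Dom (Rep Q C) u) (Cod (Rep Q C) f)"
  define W where "W = Dom (Rep Q C) u"
  have u: "u \<in> Hom (Rep Q C) W F" and fu: "Comp (Rep Q C) f u = Zr (Rep Q C) W G"
    using u0 f by (auto simp: W_def)
  note uD = Rep_HomD[OF u]
  have "\<exists>h. h \<in> Hom C (vob W i) (vob K i) \<and> cmp k i \<cdot> h = cmp u i" if i: "i \<in> verts Q" for i
  proof -
    have "cmp f i \<cdot> cmp u i = Zr C (vob W i) (vob G i)" using arg_cong[OF fu, of "\<lambda>x. cmp x i"] i by simp
    then have fui: "cmp f i \<cdot> cmp u i = Zr C (Dom C (cmp u i)) (Cod C (cmp f i))"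
      using uD(3)[OF i] fD(3)[OF i] by simp
    obtain h where "h \<in> Arr C" "Dom C h = Dom C (cmp u i)" "Cod C h = Dom C (cmp k i)" "cmp k i \<cdot> h = cmp u i"
      by (rule kernel_factor[OF ker[OF i] _ _ fui]) (use uD(3)[OF i] fD(3)[OF i] in auto)
    then show ?thesis using uD(3)[OF i] kD(3)[OF i] by auto
  qed
  then obtain h where h: "\<And>i. i \<in> verts Q \<Longrightarrow> h i \<in> Hom C (vob W i) (vob K i) \<and> cmp k i \<cdot> h i = cmp u i"
    by metis
  have H: "mk_mor Q W K h \<in> Hom (Rep Q C) W K"
  proof (rule mk_mor_Hom[OF uD(1) kD(1) _ ends'])
    show "h i \<in> Hom C (vob W i) (vob K i)" if "i \<in> verts Q" for i using h that by blast
    fix \<alpha> assume \<alpha>: "\<alpha> \<in> arcs Q"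
    let ?h = "head Q \<alpha>" and ?t = "tail Q \<alpha>"
    have vt: "?h \<in> verts Q" "?t \<in> verts Q" using \<alpha> by auto
    note ty = kD(3)[OF vt(1)] kD(3)[OF vt(2)] h[OF vt(1)] h[OF vt(2)] repsD(2)[OF kD(1) \<alpha>]
      repsD(2)[OF fD(1) \<alpha>] repsD(2)[OF uD(1) \<alpha>]
    have "cmp k ?h \<cdot> h ?h \<cdot> amor W \<alpha> = cmp u ?h \<cdot> amor W \<alpha>"
      by (rule comp_cong_left1) (use ty in auto)
    also have "\<dots> = amor F \<alpha> \<cdot> cmp k ?t \<cdot> h ?t" using uD(4)[OF \<alpha>] h[OF vt(2)] by simp
    also have "\<dots> = cmp k ?h \<cdot> amor K \<alpha> \<cdot> h ?t"
      by (rule comp_cong_left[OF kD(4)[OF \<alpha>, symmetric]]) (use ty in auto)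
    finally show "h ?h \<cdot> amor W \<alpha> = amor K \<alpha> \<cdot> h ?t"
      by (rule is_monoD[OF kernel_is_mono[OF ker[OF vt(1)]]]) (use ty in auto)
  qed
  have "Comp (Rep Q C) k (mk_mor Q W K h) = u"
  proof (rule Rep_Hom_eqI)
    show "cmp (Comp (Rep Q C) k (mk_mor Q W K h)) i = cmp u i" if "i \<in> verts Q" for i
      using h[OF that] that by simp
  qed (rule Rep_Comp_Hom H k u)+
  then show "\<exists>h \<in> Arr (Rep Q C). Dom (Rep Q C) h = Dom (Rep Q C) u \<and> Cod (Rep Q C) h = Dom (Rep Q C) k \<and>
      Comp (Rep Q C) k h = u"
    using H k u by (intro bexI[of _ "mk_mor Q W K h"]) auto
qed

text \<open>The kernels chosen at the vertices are joined by the maps that the arrows of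
  \<open>F\<close> induce on them. Having a kernel that is pointwise by construction lets properties
  in \<open>Rep Q C\<close> be read off at the vertices.\<close>

lemma Rep_pointwise_kernel:
  assumes f: "f \<in> Hom (Rep Q C) F G"
  obtains K k where "k \<in> Hom (Rep Q C) K F" "\<And>i. i \<in> verts Q \<Longrightarrow> is_kernel C (cmp f i) (cmp k i)"
proof -
  note fD = Rep_HomD[OF f]
  have "\<exists>k. is_kernel C (cmp f i) k" if "i \<in> verts Q" for i using ex_kernel fD(3)[OF that] by auto
  then obtain k where k: "\<And>i. i \<in> verts Q \<Longrightarrow> is_kernel C (cmp f i) (k i)" by metis
  have kt: "k i \<in> Hom C (Dom C (k i)) (vob F i)" if "i \<in> verts Q" for i
    using kernel_Arr[OF k[OF that]] fD(3)[OF that] by auto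
  have "\<exists>c. c \<in> Hom C (Dom C (k (tail Q \<alpha>))) (Dom C (k (head Q \<alpha>))) \<and>
      k (head Q \<alpha>) \<cdot> c = amor F \<alpha> \<cdot> k (tail Q \<alpha>)" if \<alpha>: "\<alpha> \<in> arcs Q" for \<alpha>
  proof -
    let ?h = "head Q \<alpha>" and ?t = "tail Q \<alpha>"
    have vt: "?h \<in> verts Q" "?t \<in> verts Q" using \<alpha> by auto
    note ty = kt[OF vt(1)] kt[OF vt(2)] repsD(2)[OF fD(1) \<alpha>] repsD(2)[OF fD(2) \<alpha>] fD(3)[OF vt(1)] fD(3)[OF vt(2)]
    have "cmp f ?h \<cdot> amor F \<alpha> \<cdot> k ?t = amor G \<alpha> \<cdot> cmp f ?t \<cdot> k ?t"
      by (rule comp_cong_left[OF fD(4)[OF \<alpha>]]) (use ty in auto)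
    also have "\<dots> = Zr C (Dom C (k ?t)) (vob G ?h)"
      unfolding kernel_Arr(4)[OF k[OF vt(2)]] using ty by simp
    finally have z: "cmp f ?h \<cdot> amor F \<alpha> \<cdot> k ?t = Zr C (Dom C (k ?t)) (vob G ?h)" .
    obtain c where "c \<in> Arr C" "Dom C c = Dom C (amor F \<alpha> \<cdot> k ?t)" "Cod C c = Dom C (k ?h)"
      "k ?h \<cdot> c = amor F \<alpha> \<cdot> k ?t"
      by (rule kernel_factor[OF k[OF vt(1)], of "amor F \<alpha> \<cdot> k ?t"]) (use ty z in auto)
    then show ?thesis using ty by auto
  qed
  then obtain c where c: "\<And>\<alpha>. \<alpha> \<in> arcs Q \<Longrightarrow> c \<alpha> \<in> Hom C (Dom C (k (tail Q \<alpha>))) (Dom C (k (head Q \<alpha>))) \<and>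
      k (head Q \<alpha>) \<cdot> c \<alpha> = amor F \<alpha> \<cdot> k (tail Q \<alpha>)" by metis
  let ?K = "mk_rep Q (\<lambda>i. Dom C (k i)) c"
  have K: "?K \<in> reps Q C"
  proof (rule mk_rep_reps[OF _ ends'])
    show "Dom C (k i) \<in> Obj C" if "i \<in> verts Q" for i using kt[OF that] by simp
    show "c \<alpha> \<in> Hom C (Dom C (k (tail Q \<alpha>))) (Dom C (k (head Q \<alpha>)))" if "\<alpha> \<in> arcs Q" for \<alpha>
      using c[OF that] by blast
  qed
  have "mk_mor Q ?K F k \<in> Hom (Rep Q C) ?K F"
  proof (rule mk_mor_Hom[OF K fD(1) _ ends'])
    show "k i \<in> Hom C (vob ?K i) (vob F i)" if "i \<in> verts Q" for i using kt[OF that] that by simp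
    show "k (head Q \<alpha>) \<cdot> amor ?K \<alpha> = amor F \<alpha> \<cdot> k (tail Q \<alpha>)" if "\<alpha> \<in> arcs Q" for \<alpha>
      using c[OF that] that by simp
  qed
  then show thesis by (rule that) (use k in simp)
qed

end

definition swap :: "('v, 'e, 'o, 'm) qmor \<Rightarrow> ('v, 'e, 'o, 'm) qmor" where
  "swap f = (fst (snd f), fst f, cmp f)"

lemma cmp_swap [simp]: "cmp (swap f) = cmp f"
  and swap_swap [simp]: "swap (swap f) = f"
  by (simp_all add: swap_def)

lemma swap_Hom: "f \<in> Hom (Rep Q C) F G \<Longrightarrow> swap f \<in> Hom (Rep (op Q) (dual C)) G F"
  unfolding Rep_Hom_iff reps_op_dual Hom_dual by (simp add: swap_def)

context quiver_reps
begin

lemma anti_iso_swap: "anti_iso (Rep Q C) (Rep (op Q) (dual C)) swap swap"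
proof -
  interpret o: quiver_reps "op Q" "dual C" by (rule op_dual)
  show ?thesis
  proof (intro anti_iso.intro anti_iso_axioms.intro category_Rep o.category_Rep)
    show "Obj (Rep (op Q) (dual C)) = Obj (Rep Q C)" by (simp add: Rep_Obj reps_op_dual)
    show "swap f \<in> Arr (Rep (op Q) (dual C)) \<and> Dom (Rep (op Q) (dual C)) (swap f) = Cod (Rep Q C) f \<and>
      Cod (Rep (op Q) (dual C)) (swap f) = Dom (Rep Q C) f \<and> swap (swap f) = f" if "f \<in> Arr (Rep Q C)" for f
      using swap_Hom[of f Q C "Dom (Rep Q C) f" "Cod (Rep Q C) f"] that by auto
    show "swap f \<in> Arr (Rep Q C) \<and> Dom (Rep Q C) (swap f) = Cod (Rep (op Q) (dual C)) f \<and>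
      Cod (Rep Q C) (swap f) = Dom (Rep (op Q) (dual C)) f \<and> swap (swap f) = f"
      if "f \<in> Arr (Rep (op Q) (dual C))" for f
      using swap_Hom[of f "op Q" "dual C" "Dom (Rep (op Q) (dual C)) f" "Cod (Rep (op Q) (dual C)) f"] that
      by auto
  qed (simp_all add: Rep_def swap_def split_beta)
qed

text \<open>This is the kernel statement for the opposite quiver over the dual category, carried
  over by \<open>swap\<close>.\<close>

lemma Rep_is_cokernelI:
  assumes f: "f \<in> Hom (Rep Q C) F G" and c: "c \<in> Hom (Rep Q C) G H"
    and coker: "\<And>i. i \<in> verts Q \<Longrightarrow> is_cokernel C (cmp f i) (cmp c i)"
  shows "is_cokernel (Rep Q C) f c"
proof -
  interpret o: quiver_reps "op Q" "dual C" by (rule op_dual)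
  interpret a: anti_iso "Rep (op Q) (dual C)" "Rep Q C" swap swap
    by (rule anti_iso.anti_iso_sym[OF anti_iso_swap]) simp
  have "is_kernel (Rep (op Q) (dual C)) (swap f) (swap c)"
    by (rule o.Rep_is_kernelI[OF swap_Hom[OF f] swap_Hom[OF c]]) (use coker in simp)
  from a.t_kernel[OF this] show ?thesis by simp
qed

lemma Rep_pointwise_cokernel:
  assumes f: "f \<in> Hom (Rep Q C) F G"
  obtains H c where "c \<in> Hom (Rep Q C) G H" "\<And>i. i \<in> verts Q \<Longrightarrow> is_cokernel C (cmp f i) (cmp c i)"
proof -
  interpret o: quiver_reps "op Q" "dual C" by (rule op_dual)
  obtain K k where k: "k \<in> Hom (Rep (op Q) (dual C)) K G"
    "\<And>i. i \<in> verts Q \<Longrightarrow> is_cokernel C (cmp f i) (cmp k i)"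
    by (rule o.Rep_pointwise_kernel[OF swap_Hom[OF f]]) (use that in simp)
  have "swap k \<in> Hom (Rep Q C) G K" using swap_Hom[OF k(1)] by simp
  then show thesis by (rule that) (use k in simp)
qed

text \<open>The pointwise kernel of \<open>f\<close> is a kernel in \<open>Rep Q C\<close>; for a
  monomorphism it is zero there, hence zero at each vertex.\<close>

lemma Rep_mono_pointwise:
  assumes "is_mono (Rep Q C) f" "f \<in> Hom (Rep Q C) F G" "i \<in> verts Q"
  shows "is_mono C (cmp f i)"
proof -
  obtain K k where k: "k \<in> Hom (Rep Q C) K F" "\<And>i. i \<in> verts Q \<Longrightarrow> is_kernel C (cmp f i) (cmp k i)"
    by (rule Rep_pointwise_kernel[OF assms(2)]) (rule that)
  have ker: "is_kernel (Rep Q C) f k" by (rule Rep_is_kernelI[OF assms(2) k])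
  have "k = Zr (Rep Q C) K F" using R.mono_kernel_zero[OF assms(1) ker] k assms by auto
  then have "cmp k i = cmp (Zr (Rep Q C) K F) i" by simp
  then have "cmp k i = Zr C (vob K i) (vob F i)" using assms(3) by simp
  then have "cmp k i = Zr C (Dom C (cmp k i)) (Dom C (cmp f i))"
    using Rep_HomD(3)[OF k(1) assms(3)] Rep_HomD(3)[OF assms(2,3)] by simp
  then show ?thesis by (rule mono_if_kernel_zero[OF k(2)[OF assms(3)]])
qed

text \<open>At each vertex a monomorphism is a kernel of its cokernel, and pointwise kernels are
  kernels.\<close>

lemma Rep_mono_normal:
  assumes "is_mono (Rep Q C) f"
  shows "\<exists>g. is_kernel (Rep Q C) g f"
proof -
  define F G where "F = Dom (Rep Q C) f" "G = Cod (Rep Q C) f"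
  have f: "f \<in> Hom (Rep Q C) F G" using assms by (simp add: F_G_def)
  obtain H c where c: "c \<in> Hom (Rep Q C) G H" "\<And>i. i \<in> verts Q \<Longrightarrow> is_cokernel C (cmp f i) (cmp c i)"
    by (rule Rep_pointwise_cokernel[OF f]) (rule that)
  have "is_kernel C (cmp c i) (cmp f i)" if "i \<in> verts Q" for i
    using short_exact_if_cokernel[OF c(2)[OF that] Rep_mono_pointwise[OF assms f that]] short_exact_iff by blast
  then show ?thesis using Rep_is_kernelI[OF c(1) f] by blast
qed

lemma abelian_Rep: "abelian_category (Rep Q C)"
proof (intro abelian_category.intro abelian_category_axioms.intro preadditive_Rep)
  interpret o: quiver_reps "op Q" "dual C" by (rule op_dual)
  interpret a: anti_iso "Rep Q C" "Rep (op Q) (dual C)" swap swap by (rule anti_iso_swap)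
  interpret a': anti_iso "Rep (op Q) (dual C)" "Rep Q C" swap swap by (rule a.anti_iso_sym) simp
  obtain Z where Z: "is_zero_obj C Z" using ex_zero_obj by blast
  then have ZO: "Z \<in> Obj C" by (simp add: is_zero_obj_def)
  let ?Z = "mk_rep Q (\<lambda>_. Z) (\<lambda>_. Zr C Z Z)"
  have ZR: "?Z \<in> reps Q C" by (rule mk_rep_reps[OF _ ends']) (use ZO in auto)
  have "is_zero_obj (Rep Q C) ?Z" unfolding is_zero_obj_def Rep_Obj
  proof (intro conjI ballI ZR)
    fix F assume F: "F \<in> reps Q C"
    show "\<exists>!f. f \<in> Hom (Rep Q C) F ?Z"
    proof (rule ex1I[of _ "Zr (Rep Q C) F ?Z"])
      fix f assume f: "f \<in> Hom (Rep Q C) F ?Z"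
      show "f = Zr (Rep Q C) F ?Z"
      proof (rule Rep_Hom_eqI[OF f Rep_Zr_Hom[OF F ZR]])
        fix i assume i: "i \<in> verts Q"
        have "\<exists>!u. u \<in> Hom C (vob F i) Z" using Z repsD(1)[OF F i] by (simp add: is_zero_obj_def del: in_Hom_iff)
        moreover have "cmp f i \<in> Hom C (vob F i) Z" "Zr C (vob F i) Z \<in> Hom C (vob F i) Z"
          using Rep_HomD(3)[OF f i] repsD(1)[OF F i] ZO i by auto
        ultimately show "cmp f i = cmp (Zr (Rep Q C) F ?Z) i" using i by (simp del: in_Hom_iff) blast
      qed
    qed (rule Rep_Zr_Hom[OF F ZR])
    show "\<exists>!f. f \<in> Hom (Rep Q C) ?Z F"
    proof (rule ex1I[of _ "Zr (Rep Q C) ?Z F"])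
      fix f assume f: "f \<in> Hom (Rep Q C) ?Z F"
      show "f = Zr (Rep Q C) ?Z F"
      proof (rule Rep_Hom_eqI[OF f Rep_Zr_Hom[OF ZR F]])
        fix i assume i: "i \<in> verts Q"
        have "\<exists>!u. u \<in> Hom C Z (vob F i)" using Z repsD(1)[OF F i] by (simp add: is_zero_obj_def del: in_Hom_iff)
        moreover have "cmp f i \<in> Hom C Z (vob F i)" "Zr C Z (vob F i) \<in> Hom C Z (vob F i)"
          using Rep_HomD(3)[OF f i] repsD(1)[OF F i] ZO i by auto
        ultimately show "cmp f i = cmp (Zr (Rep Q C) ?Z F) i" using i by (simp del: in_Hom_iff) blast
      qed
    qed (rule Rep_Zr_Hom[OF ZR F])
  qed
  then show "\<exists>Z. is_zero_obj (Rep Q C) Z" by blast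
next
  fix F G assume "F \<in> Obj (Rep Q C)" "G \<in> Obj (Rep Q C)"
  then have F: "F \<in> reps Q C" and G: "G \<in> reps Q C" by (simp_all add: Rep_Obj)
  let ?P = "\<lambda>i S i1 i2 p1 p2. S \<in> Obj C \<and> i1 \<in> Hom C (vob F i) S \<and> i2 \<in> Hom C (vob G i) S \<and>
    p1 \<in> Hom C S (vob F i) \<and> p2 \<in> Hom C S (vob G i) \<and> p1 \<cdot> i1 = Idn C (vob F i) \<and> p2 \<cdot> i2 = Idn C (vob G i) \<and>
    p1 \<cdot> i2 = Zr C (vob G i) (vob F i) \<and> p2 \<cdot> i1 = Zr C (vob F i) (vob G i) \<and>
    Add C (i1 \<cdot> p1) (i2 \<cdot> p2) = Idn C S"
  \<comment> \<open>The five data of a biproduct are packed into one tuple, so that a single choice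
    function serves for all vertices.\<close>
  have "\<forall>i \<in> verts Q. \<exists>b. ?P i (fst b) (fst (snd b)) (fst (snd (snd b))) (fst (snd (snd (snd b)))) (snd (snd (snd (snd b))))"
  proof
    fix i assume i: "i \<in> verts Q"
    obtain S i1 i2 p1 p2 where "S \<in> Obj C" "i1 \<in> Hom C (vob F i) S" "i2 \<in> Hom C (vob G i) S"
      "p1 \<in> Hom C S (vob F i)" "p2 \<in> Hom C S (vob G i)" "p1 \<cdot> i1 = Idn C (vob F i)" "p2 \<cdot> i2 = Idn C (vob G i)"
      "p1 \<cdot> i2 = Zr C (vob G i) (vob F i)" "p2 \<cdot> i1 = Zr C (vob F i) (vob G i)"
      "Add C (i1 \<cdot> p1) (i2 \<cdot> p2) = Idn C S"
      by (rule biproduct[OF repsD(1)[OF F i] repsD(1)[OF G i]])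
    then have "?P i S i1 i2 p1 p2" by blast
    then show "\<exists>b. ?P i (fst b) (fst (snd b)) (fst (snd (snd b))) (fst (snd (snd (snd b)))) (snd (snd (snd (snd b))))"
      by (intro exI[of _ "(S, i1, i2, p1, p2)"]) (simp only: fst_conv snd_conv)
  qed
  from bchoice[OF this] obtain b where
    b: "\<forall>i \<in> verts Q. ?P i (fst (b i)) (fst (snd (b i))) (fst (snd (snd (b i)))) (fst (snd (snd (snd (b i))))) (snd (snd (snd (snd (b i)))))"
    by blast
  define S i1 i2 p1 p2 where S: "S = (\<lambda>i. fst (b i))" "i1 = (\<lambda>i. fst (snd (b i)))"
    "i2 = (\<lambda>i. fst (snd (snd (b i))))" "p1 = (\<lambda>i. fst (snd (snd (snd (b i)))))"
    "p2 = (\<lambda>i. snd (snd (snd (snd (b i)))))"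
  have "?P i (S i) (i1 i) (i2 i) (p1 i) (p2 i)" if "i \<in> verts Q" for i
    using bspec[OF b that] unfolding S .
  then have b: "S i \<in> Obj C" "i1 i \<in> Hom C (vob F i) (S i)" "i2 i \<in> Hom C (vob G i) (S i)"
    "p1 i \<in> Hom C (S i) (vob F i)" "p2 i \<in> Hom C (S i) (vob G i)" "p1 i \<cdot> i1 i = Idn C (vob F i)"
    "p2 i \<cdot> i2 i = Idn C (vob G i)" "p1 i \<cdot> i2 i = Zr C (vob G i) (vob F i)"
    "p2 i \<cdot> i1 i = Zr C (vob F i) (vob G i)" "Add C (i1 i \<cdot> p1 i) (i2 i \<cdot> p2 i) = Idn C (S i)"
    if "i \<in> verts Q" for i
    using that by blast+
  \<comment> \<open>The diagonal map. The biproducts are chosen vertex by vertex, so an arrow has to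
    be assembled from its two components.\<close>
  let ?ar = "\<lambda>\<alpha>. Add C (i1 (head Q \<alpha>) \<cdot> amor F \<alpha> \<cdot> p1 (tail Q \<alpha>)) (i2 (head Q \<alpha>) \<cdot> amor G \<alpha> \<cdot> p2 (tail Q \<alpha>))"
  let ?S = "mk_rep Q S ?ar"
  have SR: "?S \<in> reps Q C"
  proof (rule mk_rep_reps[OF b(1) ends'])
    fix \<alpha> assume \<alpha>: "\<alpha> \<in> arcs Q"
    show "?ar \<alpha> \<in> Hom C (S (tail Q \<alpha>)) (S (head Q \<alpha>))"
      using b(2-5)[of "head Q \<alpha>"] b(2-5)[of "tail Q \<alpha>"] repsD(2)[OF F \<alpha>] repsD(2)[OF G \<alpha>] \<alpha> by auto
  qed
  have nat: "i1 (head Q \<alpha>) \<cdot> amor F \<alpha> = ?ar \<alpha> \<cdot> i1 (tail Q \<alpha>)" "i2 (head Q \<alpha>) \<cdot> amor G \<alpha> = ?ar \<alpha> \<cdot> i2 (tail Q \<alpha>)"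
    "p1 (head Q \<alpha>) \<cdot> ?ar \<alpha> = amor F \<alpha> \<cdot> p1 (tail Q \<alpha>)" "p2 (head Q \<alpha>) \<cdot> ?ar \<alpha> = amor G \<alpha> \<cdot> p2 (tail Q \<alpha>)"
    if \<alpha>: "\<alpha> \<in> arcs Q" for \<alpha>
  proof -
    let ?h = "head Q \<alpha>" and ?t = "tail Q \<alpha>"
    have vt: "?h \<in> verts Q" "?t \<in> verts Q" using \<alpha> by auto
    note h = b[OF vt(1)] and t = b[OF vt(2)]
    note ty = h(1-5) t(1-5) repsD(2)[OF F \<alpha>] repsD(2)[OF G \<alpha>]
      repsD(1)[OF F vt(1)] repsD(1)[OF G vt(1)] repsD(1)[OF F vt(2)] repsD(1)[OF G vt(2)]
    show "i1 ?h \<cdot> amor F \<alpha> = ?ar \<alpha> \<cdot> i1 ?t" "i2 ?h \<cdot> amor G \<alpha> = ?ar \<alpha> \<cdot> i2 ?t"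
      using ty t(6-9) by simp_all
    have "p1 ?h \<cdot> i1 ?h \<cdot> amor F \<alpha> \<cdot> p1 ?t = Idn C (vob F ?h) \<cdot> amor F \<alpha> \<cdot> p1 ?t"
      "p1 ?h \<cdot> i2 ?h \<cdot> amor G \<alpha> \<cdot> p2 ?t = Zr C (vob G ?h) (vob F ?h) \<cdot> amor G \<alpha> \<cdot> p2 ?t"
      "p2 ?h \<cdot> i1 ?h \<cdot> amor F \<alpha> \<cdot> p1 ?t = Zr C (vob F ?h) (vob G ?h) \<cdot> amor F \<alpha> \<cdot> p1 ?t"
      "p2 ?h \<cdot> i2 ?h \<cdot> amor G \<alpha> \<cdot> p2 ?t = Idn C (vob G ?h) \<cdot> amor G \<alpha> \<cdot> p2 ?t"
      by (rule comp_cong_left1; use ty h(6-9) in simp)+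
    then show "p1 ?h \<cdot> ?ar \<alpha> = amor F \<alpha> \<cdot> p1 ?t" "p2 ?h \<cdot> ?ar \<alpha> = amor G \<alpha> \<cdot> p2 ?t"
      using ty by simp_all
  qed
  have m1: "mk_mor Q F ?S i1 \<in> Hom (Rep Q C) F ?S"
  proof (rule mk_mor_Hom[OF F SR _ ends'])
    show "i1 i \<in> Hom C (vob F i) (vob ?S i)" if "i \<in> verts Q" for i
      using b(2)[OF that] that by (simp only: vob_mk_rep)
    show "i1 (head Q \<alpha>) \<cdot> amor F \<alpha> = amor ?S \<alpha> \<cdot> i1 (tail Q \<alpha>)" if "\<alpha> \<in> arcs Q" for \<alpha>
      using nat(1)[OF that] that by (simp only: amor_mk_rep)
  qed
  have m2: "mk_mor Q G ?S i2 \<in> Hom (Rep Q C) G ?S"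
  proof (rule mk_mor_Hom[OF G SR _ ends'])
    show "i2 i \<in> Hom C (vob G i) (vob ?S i)" if "i \<in> verts Q" for i
      using b(3)[OF that] that by (simp only: vob_mk_rep)
    show "i2 (head Q \<alpha>) \<cdot> amor G \<alpha> = amor ?S \<alpha> \<cdot> i2 (tail Q \<alpha>)" if "\<alpha> \<in> arcs Q" for \<alpha>
      using nat(2)[OF that] that by (simp only: amor_mk_rep)
  qed
  have m3: "mk_mor Q ?S F p1 \<in> Hom (Rep Q C) ?S F"
  proof (rule mk_mor_Hom[OF SR F _ ends'])
    show "p1 i \<in> Hom C (vob ?S i) (vob F i)" if "i \<in> verts Q" for i
      using b(4)[OF that] that by (simp only: vob_mk_rep)
    show "p1 (head Q \<alpha>) \<cdot> amor ?S \<alpha> = amor F \<alpha> \<cdot> p1 (tail Q \<alpha>)" if "\<alpha> \<in> arcs Q" for \<alpha>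
      using nat(3)[OF that] that by (simp only: amor_mk_rep)
  qed
  have m4: "mk_mor Q ?S G p2 \<in> Hom (Rep Q C) ?S G"
  proof (rule mk_mor_Hom[OF SR G _ ends'])
    show "p2 i \<in> Hom C (vob ?S i) (vob G i)" if "i \<in> verts Q" for i
      using b(5)[OF that] that by (simp only: vob_mk_rep)
    show "p2 (head Q \<alpha>) \<cdot> amor ?S \<alpha> = amor G \<alpha> \<cdot> p2 (tail Q \<alpha>)" if "\<alpha> \<in> arcs Q" for \<alpha>
      using nat(4)[OF that] that by (simp only: amor_mk_rep)
  qed
  note mors = m1 m2 m3 m4
  have "is_biproduct (Rep Q C) F G ?S (mk_mor Q F ?S i1) (mk_mor Q G ?S i2) (mk_mor Q ?S F p1) (mk_mor Q ?S G p2)"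
    unfolding is_biproduct_def
  proof (intro conjI mors)
    show "?S \<in> Obj (Rep Q C)" using SR by (simp add: Rep_Obj)
    show "Comp (Rep Q C) (mk_mor Q ?S F p1) (mk_mor Q F ?S i1) = Idn (Rep Q C) F"
      by (rule Rep_Hom_eqI[OF Rep_Comp_Hom[OF mors(1,3)] Rep_Idn_Hom[OF F]]) (use b(6) in simp)
    show "Comp (Rep Q C) (mk_mor Q ?S G p2) (mk_mor Q G ?S i2) = Idn (Rep Q C) G"
      by (rule Rep_Hom_eqI[OF Rep_Comp_Hom[OF mors(2,4)] Rep_Idn_Hom[OF G]]) (use b(7) in simp)
    show "Add (Rep Q C) (Comp (Rep Q C) (mk_mor Q F ?S i1) (mk_mor Q ?S F p1))
        (Comp (Rep Q C) (mk_mor Q G ?S i2) (mk_mor Q ?S G p2)) = Idn (Rep Q C) ?S"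
      by (rule Rep_Hom_eqI[OF Rep_Add_Hom[OF Rep_Comp_Hom[OF mors(3,1)] Rep_Comp_Hom[OF mors(4,2)]] Rep_Idn_Hom[OF SR]])
        (use b(10) in simp)
  qed
  then show "\<exists>P i1 i2 p1 p2. is_biproduct (Rep Q C) F G P i1 i2 p1 p2" by blast
next
  fix f assume "f \<in> Arr (Rep Q C)"
  then have f: "f \<in> Hom (Rep Q C) (Dom (Rep Q C) f) (Cod (Rep Q C) f)" by simp
  show "\<exists>k. is_kernel (Rep Q C) f k"
  proof -
    obtain K k where k: "k \<in> Hom (Rep Q C) K (Dom (Rep Q C) f)"
      "\<And>i. i \<in> verts Q \<Longrightarrow> is_kernel C (cmp f i) (cmp k i)"
      by (rule Rep_pointwise_kernel[OF f]) (rule that)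
    show ?thesis by (rule exI[of _ k], rule Rep_is_kernelI[OF f k])
  qed
  show "\<exists>c. is_cokernel (Rep Q C) f c"
  proof -
    obtain H c where c: "c \<in> Hom (Rep Q C) (Cod (Rep Q C) f) H"
      "\<And>i. i \<in> verts Q \<Longrightarrow> is_cokernel C (cmp f i) (cmp c i)"
      by (rule Rep_pointwise_cokernel[OF f]) (rule that)
    show ?thesis by (rule exI[of _ c], rule Rep_is_cokernelI[OF f c])
  qed
next
  fix f assume "is_mono (Rep Q C) f"
  then show "\<exists>g. is_kernel (Rep Q C) g f" by (rule Rep_mono_normal)
next
  interpret o: quiver_reps "op Q" "dual C" by (rule op_dual)
  interpret a: anti_iso "Rep Q C" "Rep (op Q) (dual C)" swap swap by (rule anti_iso_swap)
  interpret a': anti_iso "Rep (op Q) (dual C)" "Rep Q C" swap swap by (rule a.anti_iso_sym) simp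
  \<comment> \<open>Normality of epimorphisms is normality of monomorphisms over the opposite quiver
    and the dual category.\<close>
  fix f assume "is_epi (Rep Q C) f"
  then have "is_mono (Rep (op Q) (dual C)) (swap f)"
    using anti_iso.t_mono[OF a.anti_iso_dual, of f] by simp
  then obtain g where "is_kernel (Rep (op Q) (dual C)) g (swap f)" using o.Rep_mono_normal by blast
  from a'.t_kernel[OF this] have "is_cokernel (Rep Q C) (swap g) f" by simp
  then show "\<exists>g. is_cokernel (Rep Q C) g f" by blast
qed

end

sublocale quiver_reps \<subseteq> R: abelian_category "Rep Q C"
  by (rule abelian_Rep)

section \<open>Exactness of representations is tested at the vertices\<close>

context quiver_reps
begin

lemma abelian_anti_iso_swap: "abelian_anti_iso (Rep Q C) (Rep (op Q) (dual C)) swap swap"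
  by (intro abelian_anti_iso.intro anti_iso_swap abelian_Rep quiver_reps.abelian_Rep[OF op_dual])

lemma Ext_zero_op: "Ext_zero (Rep (op Q) (dual C)) n Y X \<longleftrightarrow> Ext_zero (Rep Q C) n X Y"
  by (rule abelian_anti_iso.Ext_zero_t_iff[OF abelian_anti_iso_swap])

lemma Rep_monoI:
  assumes f: "f \<in> Hom (Rep Q C) F G" and m: "\<And>i. i \<in> verts Q \<Longrightarrow> is_mono C (cmp f i)"
  shows "is_mono (Rep Q C) f"
  unfolding is_mono_def
proof (intro conjI ballI impI)
  show "f \<in> Arr (Rep Q C)" using f by auto
  fix W u v assume "u \<in> Hom (Rep Q C) W (Dom (Rep Q C) f)" "v \<in> Hom (Rep Q C) W (Dom (Rep Q C) f)"
    and eq: "Comp (Rep Q C) f u = Comp (Rep Q C) f v"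
  then have u: "u \<in> Hom (Rep Q C) W F" and v: "v \<in> Hom (Rep Q C) W F" using f by auto
  show "u = v"
  proof (rule Rep_Hom_eqI[OF u v])
    fix i assume i: "i \<in> verts Q"
    have "cmp f i \<cdot> cmp u i = cmp f i \<cdot> cmp v i" using arg_cong[OF eq, of "\<lambda>x. cmp x i"] i by simp
    then show "cmp u i = cmp v i"
      by (rule is_monoD[OF m[OF i]])
        (use Rep_HomD(3)[OF u i] Rep_HomD(3)[OF v i] Rep_HomD(3)[OF f i] in auto)
  qed
qed

lemma Rep_epi_iff:
  assumes f: "f \<in> Hom (Rep Q C) F G"
  shows "is_epi (Rep Q C) f \<longleftrightarrow> (\<forall>i \<in> verts Q. is_epi C (cmp f i))"
proof -
  interpret o: quiver_reps "op Q" "dual C" by (rule op_dual)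
  interpret a: anti_iso "Rep Q C" "Rep (op Q) (dual C)" swap swap by (rule anti_iso_swap)
  interpret a': anti_iso "Rep (op Q) (dual C)" "Rep Q C" swap swap by (rule a.anti_iso_sym) simp
  note sf = swap_Hom[OF f]
  show ?thesis
  proof
    assume "is_epi (Rep Q C) f"
    then have "is_mono (Rep (op Q) (dual C)) (swap f)"
      using anti_iso.t_mono[OF a.anti_iso_dual, of f] by simp
    then show "\<forall>i \<in> verts Q. is_epi C (cmp f i)" using o.Rep_mono_pointwise[OF _ sf] by simp
  next
    assume "\<forall>i \<in> verts Q. is_epi C (cmp f i)"
    then have "is_mono (Rep (op Q) (dual C)) (swap f)" using o.Rep_monoI[OF sf] by simp
    from a'.t_mono[OF this] show "is_epi (Rep Q C) f" by simp
  qed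
qed

text \<open>In the forward direction the pointwise kernel \<open>k\<close> of \<open>g\<close>
  factors through \<open>f\<close>, which is a kernel in \<open>Rep Q C\<close>; this factorization
  at each vertex makes \<open>cmp f i\<close> a kernel there.\<close>

lemma Rep_short_exact_iff:
  assumes f: "f \<in> Hom (Rep Q C) F G" and g: "g \<in> Hom (Rep Q C) G H"
  shows "short_exact (Rep Q C) f g \<longleftrightarrow> (\<forall>i \<in> verts Q. short_exact C (cmp f i) (cmp g i))"
proof
  assume s: "short_exact (Rep Q C) f g"
  note se = R.short_exactD[OF s f g]
  obtain K k where k: "k \<in> Hom (Rep Q C) K G" "\<And>i. i \<in> verts Q \<Longrightarrow> is_kernel C (cmp g i) (cmp k i)"
    by (rule Rep_pointwise_kernel[OF g]) (rule that)
  have ker: "is_kernel (Rep Q C) g k" by (rule Rep_is_kernelI[OF g k])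
  have kz: "Comp (Rep Q C) g k = Zr (Rep Q C) (Dom (Rep Q C) k) (Cod (Rep Q C) g)"
    using R.kernel_Arr(4)[OF ker] .
  obtain h where h: "h \<in> Arr (Rep Q C)" "Dom (Rep Q C) h = K" "Cod (Rep Q C) h = F" "Comp (Rep Q C) f h = k"
    by (rule R.kernel_factor[OF se(3) _ _ kz]) (use k(1) f g in auto)
  show "\<forall>i \<in> verts Q. short_exact C (cmp f i) (cmp g i)"
  proof
    fix i assume i: "i \<in> verts Q"
    note ty = Rep_HomD(3)[OF f i] Rep_HomD(3)[OF g i] Rep_HomD(3)[OF k(1) i]
    have hH: "h \<in> Hom (Rep Q C) K F" using h by simp
    have hi: "cmp h i \<in> Hom C (vob K i) (vob F i)" by (rule Rep_HomD(3)[OF hH i])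
    have fh: "cmp f i \<cdot> cmp h i = cmp k i" using arg_cong[OF h(4), of "\<lambda>x. cmp x i"] i by simp
    have "is_kernel C (cmp g i) (cmp f i)"
    proof (rule is_kernelI)
      show "is_mono C (cmp f i)" by (rule Rep_mono_pointwise[OF se(1) f i])
      have "cmp g i \<cdot> cmp f i = Zr C (vob F i) (vob H i)"
        using arg_cong[OF se(6), of "\<lambda>x. cmp x i"] i by simp
      then show "cmp g i \<cdot> cmp f i = Zr C (Dom C (cmp f i)) (Cod C (cmp g i))" using ty by simp
      fix u assume u: "u \<in> Arr C" "Cod C u = Dom C (cmp g i)" "cmp g i \<cdot> u = Zr C (Dom C u) (Cod C (cmp g i))"
      obtain w where w: "w \<in> Arr C" "Dom C w = Dom C u" "Cod C w = Dom C (cmp k i)" "cmp k i \<cdot> w = u"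
        by (rule kernel_factor[OF k(2)[OF i] u])
      have "cmp f i \<cdot> cmp h i \<cdot> w = cmp k i \<cdot> w" by (rule comp_cong_left1[OF fh]) (use w ty hi in auto)
      then show "\<exists>h\<in>Arr C. Dom C h = Dom C u \<and> Cod C h = Dom C (cmp f i) \<and> cmp f i \<cdot> h = u"
        using w ty hi by (intro bexI[of _ "cmp h i \<cdot> w"]) auto
    qed (use ty in auto)
    moreover have "is_epi C (cmp g i)" using Rep_epi_iff[OF g] se(2) i by blast
    ultimately show "short_exact C (cmp f i) (cmp g i)" by (rule short_exact_if_kernel)
  qed
next
  assume s: "\<forall>i \<in> verts Q. short_exact C (cmp f i) (cmp g i)"
  have "is_kernel (Rep Q C) g f" by (rule Rep_is_kernelI[OF g f]) (use s short_exact_iff in blast)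
  moreover have "is_epi (Rep Q C) g" unfolding Rep_epi_iff[OF g] using s short_exact_iff by blast
  ultimately show "short_exact (Rep Q C) f g" by (rule R.short_exact_if_kernel)
qed

end

subsection \<open>Exact coproducts and cotorsion pairs\<close>

lemma coprod_is_coproduct:
  assumes "\<exists>P inc. is_coproduct C I X P inc"
  shows "is_coproduct C I X (coprod_obj C I X) (coprod_inj C I X)"
proof -
  have "case coprod C I X of (P, inc) \<Rightarrow> is_coproduct C I X P inc"
    unfolding coprod_def by (rule someI_ex) (use assms in auto)
  then show ?thesis by (simp only: split_beta)
qed

lemma ex1_eqD: "\<exists>!x. P x \<Longrightarrow> P a \<Longrightarrow> P b \<Longrightarrow> a = b"
  by blast

lemma is_coproductD:
  assumes "is_coproduct C I X P inc" "Z \<in> Obj C" "\<forall>i \<in> I. f i \<in> Hom C (X i) Z"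
  shows "\<exists>!h. h \<in> Hom C P Z \<and> (\<forall>i \<in> I. Comp C h (inc i) = f i)"
  by (rule assms(1)[unfolded is_coproduct_def, THEN conjunct2, THEN conjunct2, THEN bspec, OF assms(2),
        THEN spec, THEN mp, OF assms(3)])

text \<open>\<open>AB4\<close> speaks only of index sets inside the type of \<kappa>, whereas the
  coproducts needed here are indexed by arrows and paths. Transport along a bijection bridges the
  gap.\<close>

lemma is_coproduct_reindex:
  assumes h: "bij_betw h I J" and X: "\<And>i. i \<in> I \<Longrightarrow> X i = Y (h i)" "\<And>i. i \<in> I \<Longrightarrow> inc i = inc' (h i)"
    and c: "is_coproduct C J Y P inc'"
  shows "is_coproduct C I X P inc"
  unfolding is_coproduct_def
proof (intro conjI ballI allI impI)
  have hJ: "h i \<in> J" if "i \<in> I" for i using h that unfolding bij_betw_def by blast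
  have inv: "inv_into I h j \<in> I" "h (inv_into I h j) = j" if "j \<in> J" for j
    using inv_into_into[of j h I] f_inv_into_f[of j h I] h that unfolding bij_betw_def by blast+
  have inv': "inv_into I h (h i) = i" if "i \<in> I" for i
    by (rule inv_into_f_f[OF _ that]) (use h in \<open>simp add: bij_betw_def\<close>)
  show "P \<in> Obj C" using c unfolding is_coproduct_def by blast
  show "inc i \<in> Hom C (X i) P" if "i \<in> I" for i
    unfolding X(1)[OF that] X(2)[OF that]
    by (rule c[unfolded is_coproduct_def, THEN conjunct2, THEN conjunct1, THEN bspec, OF hJ[OF that]])
  fix Z f assume Z: "Z \<in> Obj C" and f: "\<forall>i\<in>I. f i \<in> Hom C (X i) Z"
  have "\<forall>j \<in> J. f (inv_into I h j) \<in> Hom C (Y j) Z"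
  proof
    fix j assume j: "j \<in> J"
    have "f (inv_into I h j) \<in> Hom C (X (inv_into I h j)) Z" using f inv(1)[OF j] by blast
    then show "f (inv_into I h j) \<in> Hom C (Y j) Z" unfolding X(1)[OF inv(1)[OF j]] inv(2)[OF j] .
  qed
  then have ex: "\<exists>!g. g \<in> Hom C P Z \<and> (\<forall>j \<in> J. Comp C g (inc' j) = f (inv_into I h j))"
    by (rule is_coproductD[OF c Z])
  have eq: "(\<forall>j \<in> J. Comp C g (inc' j) = f (inv_into I h j)) \<longleftrightarrow> (\<forall>i \<in> I. Comp C g (inc i) = f i)" for g
  proof
    assume a: "\<forall>j \<in> J. Comp C g (inc' j) = f (inv_into I h j)"
    show "\<forall>i \<in> I. Comp C g (inc i) = f i"
    proof
      fix i assume i: "i \<in> I"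
      have "Comp C g (inc' (h i)) = f (inv_into I h (h i))" using a hJ[OF i] by blast
      then show "Comp C g (inc i) = f i" unfolding X(2)[OF i] inv'[OF i] .
    qed
  next
    assume a: "\<forall>i \<in> I. Comp C g (inc i) = f i"
    show "\<forall>j \<in> J. Comp C g (inc' j) = f (inv_into I h j)"
    proof
      fix j assume j: "j \<in> J"
      have "Comp C g (inc (inv_into I h j)) = f (inv_into I h j)" using a inv(1)[OF j] by blast
      then show "Comp C g (inc' j) = f (inv_into I h j)" unfolding X(2)[OF inv(1)[OF j]] inv(2)[OF j] .
    qed
  qed
  show "\<exists>!g. g \<in> Hom C P Z \<and> (\<forall>i \<in> I. Comp C g (inc i) = f i)" using ex unfolding eq .
qed

text \<open>\<open>J\<close> is the copy of \<open>I\<close> inside the type underlying \<kappa>, to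
  which \<open>AB4\<close> can be applied.\<close>

lemma ordLess_bij_subset:
  assumes "Card_order \<kappa>" "|I| <o \<kappa>"
  obtains h and J :: "'k set" where "bij_betw h I J" "|J| <o (\<kappa> :: 'k rel)"
proof -
  have "\<exists>B \<subseteq> Field \<kappa>. |I| =o |B| \<and> |B| \<le>o \<kappa>"
    by (rule internalize_card_of_ordLeq[THEN iffD1, OF ordLess_imp_ordLeq[OF assms(2)]])
  then obtain J :: "'k set" where J: "|I| =o |J|" by (elim exE conjE) (rule that)
  have J': "|J| <o \<kappa>" by (rule ordIso_ordLess_trans[OF ordIso_symmetric[OF J] assms(2)])
  have "\<exists>h. bij_betw h I J" by (rule card_of_ordIso[THEN iffD2, OF J])
  then show thesis by (elim exE) (rule that[OF _ J'])
qed

lemma AB4D: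
  fixes \<kappa> :: "'k rel" and J :: "'k set"
  assumes "AB4 \<kappa> C" "|J| <o \<kappa>"
  shows "\<forall>j \<in> J. X j \<in> Obj C \<Longrightarrow> \<exists>P inc. is_coproduct C J X P inc"
    "\<forall>j \<in> J. f j \<in> Hom C (X j) (Y j) \<and> g j \<in> Hom C (Y j) (Z j) \<and> short_exact C (f j) (g j) \<Longrightarrow>
      short_exact C (coprod_map C J X Y f) (coprod_map C J Y Z g)"
proof -
  note a = assms(1)[unfolded AB4_def, THEN spec, THEN mp, OF assms(2)]
  show "\<forall>j \<in> J. X j \<in> Obj C \<Longrightarrow> \<exists>P inc. is_coproduct C J X P inc"
    by (rule a[THEN conjunct1, THEN spec, THEN mp])
  show "\<forall>j \<in> J. f j \<in> Hom C (X j) (Y j) \<and> g j \<in> Hom C (Y j) (Z j) \<and> short_exact C (f j) (g j) \<Longrightarrow>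
      short_exact C (coprod_map C J X Y f) (coprod_map C J Y Z g)"
    by (rule a[THEN conjunct2, THEN spec, THEN spec, THEN spec, THEN spec, THEN spec, THEN mp])
qed

section \<open>Uniqueness of coproducts and exactness of coproduct maps\<close>

context abelian_category
begin

lemma coproduct_Obj: "is_coproduct C I X P inc \<Longrightarrow> P \<in> Obj C"
  and coproduct_inc: "is_coproduct C I X P inc \<Longrightarrow> i \<in> I \<Longrightarrow> inc i \<in> Hom C (X i) P"
  unfolding is_coproduct_def by blast+

lemma coproduct_factor:
  assumes "is_coproduct C I X P inc" "Z \<in> Obj C" "\<And>i. i \<in> I \<Longrightarrow> f i \<in> Hom C (X i) Z"
  obtains h where "h \<in> Hom C P Z" "\<And>i. i \<in> I \<Longrightarrow> h \<cdot> inc i = f i"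
proof -
  have "\<forall>i\<in>I. f i \<in> Hom C (X i) Z" using assms(3) by blast
  then have "\<exists>!h. h \<in> Hom C P Z \<and> (\<forall>i\<in>I. h \<cdot> inc i = f i)"
    by (rule is_coproductD[OF assms(1,2)])
  then show thesis using that by blast
qed

lemma coproduct_eqI:
  assumes c: "is_coproduct C I X P inc" and h: "h \<in> Hom C P Z" "h' \<in> Hom C P Z"
    and eq: "\<And>i. i \<in> I \<Longrightarrow> h \<cdot> inc i = h' \<cdot> inc i"
  shows "h = h'"
proof -
  have Z: "Z \<in> Obj C" using h by auto
  have f: "\<forall>i\<in>I. h' \<cdot> inc i \<in> Hom C (X i) Z" using coproduct_inc[OF c] h by fastforce
  have "\<exists>!g. g \<in> Hom C P Z \<and> (\<forall>i\<in>I. g \<cdot> inc i = h' \<cdot> inc i)"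
    by (rule is_coproductD[OF c Z f])
  moreover have "h \<in> Hom C P Z \<and> (\<forall>i\<in>I. h \<cdot> inc i = h' \<cdot> inc i)" using h eq by blast
  moreover have "h' \<in> Hom C P Z \<and> (\<forall>i\<in>I. h' \<cdot> inc i = h' \<cdot> inc i)" using h by blast
  ultimately show ?thesis by (rule ex1_eqD)
qed

lemma coproduct_iso:
  assumes c: "is_coproduct C I X P inc" and d: "is_coproduct C I X P' inc'"
  obtains u v where "u \<in> Hom C P P'" "v \<in> Hom C P' P" "u \<cdot> v = Idn C P'" "v \<cdot> u = Idn C P"
    "is_mono C u" "is_epi C u" "\<And>i. i \<in> I \<Longrightarrow> u \<cdot> inc i = inc' i"
proof -
  note o = coproduct_Obj[OF c] coproduct_Obj[OF d]
  obtain u where u: "u \<in> Hom C P P'" "\<And>i. i \<in> I \<Longrightarrow> u \<cdot> inc i = inc' i"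
    by (rule coproduct_factor[OF c o(2) coproduct_inc[OF d]]) blast+
  obtain v where v: "v \<in> Hom C P' P" "\<And>i. i \<in> I \<Longrightarrow> v \<cdot> inc' i = inc i"
    by (rule coproduct_factor[OF d o(1) coproduct_inc[OF c]]) blast+
  have uv: "u \<cdot> v = Idn C P'"
  proof (rule coproduct_eqI[OF d])
    fix i assume i: "i \<in> I"
    have "(u \<cdot> v) \<cdot> inc' i = u \<cdot> v \<cdot> inc' i"
      by (rule comp_assoc) (use u(1) v(1) coproduct_inc[OF d i] in auto)
    then show "(u \<cdot> v) \<cdot> inc' i = Idn C P' \<cdot> inc' i" unfolding v(2)[OF i] u(2)[OF i]
      using coproduct_inc[OF d i] by simp
  qed (use u(1) v(1) o in auto)
  have vu: "v \<cdot> u = Idn C P"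
  proof (rule coproduct_eqI[OF c])
    fix i assume i: "i \<in> I"
    have "(v \<cdot> u) \<cdot> inc i = v \<cdot> u \<cdot> inc i"
      by (rule comp_assoc) (use u(1) v(1) coproduct_inc[OF c i] in auto)
    then show "(v \<cdot> u) \<cdot> inc i = Idn C P \<cdot> inc i" unfolding u(2)[OF i] v(2)[OF i]
      using coproduct_inc[OF c i] by simp
  qed (use u(1) v(1) o in auto)
  have "is_mono C u" by (rule is_mono_left_inverse[of _ v]) (use u(1) v(1) vu in auto)
  moreover have "is_epi C u" by (rule is_epi_right_inverse[of _ v]) (use u(1) v(1) uv in auto)
  ultimately show thesis by (rule that[OF u(1) v(1) uv vu]) (rule u(2))
qed

text \<open>The kernel property is tested after composing with the monomorphism \<open>b\<close>,
  and an inverse of \<open>a\<close> pulls the resulting factorization back. The isomorphisms will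
  compare given coproducts with the chosen ones.\<close>

lemma short_exact_iso:
  assumes s: "short_exact C u' v'" "u' \<in> Hom C X' Y'" "v' \<in> Hom C Y' Z'"
    and uv: "u \<in> Hom C X Y" "v \<in> Hom C Y Z"
    and abc: "a \<in> Hom C X X'" "b \<in> Hom C Y Y'" "c \<in> Hom C Z Z'"
    and a: "is_mono C a" "is_epi C a" and b: "is_mono C b" "is_epi C b" and c: "is_mono C c" "is_epi C c"
    and sq: "u' \<cdot> a = b \<cdot> u" "v' \<cdot> b = c \<cdot> v"
  shows "short_exact C u v"
proof -
  note se = short_exactD[OF s]
  obtain a' where a': "a' \<in> Hom C X' X" "a \<cdot> a' = Idn C X'" by (rule iso_if_mono_epi[OF a abc(1)])
  obtain c' where c': "c' \<in> Hom C Z' Z" "c \<cdot> c' = Idn C Z'" "c' \<cdot> c = Idn C Z"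
    by (rule iso_if_mono_epi[OF c abc(3)])
  have obj: "X \<in> Obj C" "Z \<in> Obj C" "Z' \<in> Obj C" "X' \<in> Obj C" using abc by auto
  have "is_kernel C v u"
  proof (rule is_kernelI)
    have "is_mono C (b \<cdot> u)" unfolding sq(1)[symmetric] by (rule is_mono_comp) (use se a abc s in auto)
    then show "is_mono C u" by (rule is_mono_cancel_left) (use uv abc in auto)
    have "c \<cdot> v \<cdot> u = v' \<cdot> b \<cdot> u" by (rule comp_cong_left[OF sq(2)[symmetric]]) (use uv abc s in auto)
    also have "\<dots> = (v' \<cdot> u') \<cdot> a" unfolding sq(1)[symmetric] by (rule comp_assoc[symmetric]) (use abc s in auto)
    also have "\<dots> = Zr C X Z'" unfolding se(6) using abc obj by auto
    finally have "v \<cdot> u = Zr C X Z" by (rule mono_zero[OF c(1)]) (use uv abc in auto)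
    then show "v \<cdot> u = Zr C (Dom C u) (Cod C v)" using uv by simp
    fix y assume "y \<in> Arr C" "Cod C y = Dom C v" "v \<cdot> y = Zr C (Dom C y) (Cod C v)"
    then have y: "y \<in> Hom C (Dom C y) Y" "v \<cdot> y = Zr C (Dom C y) Z" using uv by auto
    have "v' \<cdot> b \<cdot> y = c \<cdot> v \<cdot> y" by (rule comp_cong_left[OF sq(2)]) (use uv abc s y in auto)
    also have "\<dots> = Zr C (Dom C y) Z'" unfolding y(2) using abc y(1) by auto
    finally have vby: "v' \<cdot> b \<cdot> y = Zr C (Dom C y) Z'" .
    obtain w where w: "w \<in> Arr C" "Dom C w = Dom C y" "Cod C w = X'" "u' \<cdot> w = b \<cdot> y"
      by (rule kernel_factor[OF se(3), of "b \<cdot> y"]) (use vby y(1) s abc in auto)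
    have "b \<cdot> u \<cdot> a' \<cdot> w = u' \<cdot> a \<cdot> a' \<cdot> w"
      by (rule comp_cong_left[OF sq(1)[symmetric]]) (use uv abc s a' w in auto)
    also have "a \<cdot> a' \<cdot> w = Idn C X' \<cdot> w" by (rule comp_cong_left1[OF a'(2)]) (use abc a' w in auto)
    finally have eq: "b \<cdot> u \<cdot> a' \<cdot> w = b \<cdot> y" using w by simp
    have "u \<cdot> a' \<cdot> w = y" by (rule is_monoD[OF b(1) eq]) (use uv abc a' w y(1) in auto)
    then show "\<exists>h\<in>Arr C. Dom C h = Dom C y \<and> Cod C h = Dom C u \<and> u \<cdot> h = y"
      using w a' uv by (intro bexI[of _ "a' \<cdot> w"]) auto
  qed (use uv in auto)
  moreover have "is_epi C v"
  proof -
    have e: "is_epi C (c \<cdot> v)" unfolding sq(2)[symmetric] by (rule is_epi_comp) (use se b abc s in auto)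
    have "is_epi C c'" by (rule is_epi_right_inverse[of _ c]) (use c' abc in auto)
    then have "is_epi C (c' \<cdot> c \<cdot> v)" by (intro is_epi_comp e) (use c' abc uv in auto)
    moreover have "c' \<cdot> c \<cdot> v = Idn C Z \<cdot> v" by (rule comp_cong_left1[OF c'(3)]) (use c' abc uv in auto)
    ultimately show ?thesis using uv by simp
  qed
  ultimately show ?thesis by (rule short_exact_if_kernel)
qed

lemma AB4_ex_coproduct:
  fixes \<kappa> :: "'k rel"
  assumes "AB4 \<kappa> C" "Card_order \<kappa>" "|I| <o \<kappa>" "\<And>i. i \<in> I \<Longrightarrow> X i \<in> Obj C"
  shows "\<exists>P inc. is_coproduct C I X P inc"
proof -
  obtain h and J :: "'k set" where h: "bij_betw h I J" "|J| <o \<kappa>" by (rule ordLess_bij_subset[OF assms(2,3)])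
  let ?g = "inv_into I h"
  have g: "?g j \<in> I" if "j \<in> J" for j
    using inv_into_into[of j h I] h(1) that unfolding bij_betw_def by blast
  have g': "?g (h i) = i" if "i \<in> I" for i
    by (rule inv_into_f_f[OF _ that]) (use h(1) in \<open>simp add: bij_betw_def\<close>)
  have "\<forall>j \<in> J. X (?g j) \<in> Obj C" using g assms(4) by blast
  from AB4D(1)[OF assms(1) h(2) this] obtain P inc where "is_coproduct C J (\<lambda>j. X (?g j)) P inc"
    by (elim exE)
  from is_coproduct_reindex[OF h(1) _ _ this, of X "\<lambda>i. inc (h i)"] g'
  show ?thesis by auto
qed

lemma coprod_map_props:
  assumes X: "\<exists>P inc. is_coproduct C I X P inc" and Y: "\<exists>P inc. is_coproduct C I Y P inc"
    and f: "\<And>i. i \<in> I \<Longrightarrow> f i \<in> Hom C (X i) (Y i)"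
  shows "coprod_map C I X Y f \<in> Hom C (coprod_obj C I X) (coprod_obj C I Y)"
    "i \<in> I \<Longrightarrow> coprod_map C I X Y f \<cdot> coprod_inj C I X i = coprod_inj C I Y i \<cdot> f i"
proof -
  note x = coprod_is_coproduct[OF X] and y = coprod_is_coproduct[OF Y]
  have t: "coprod_inj C I Y i \<cdot> f i \<in> Hom C (X i) (coprod_obj C I Y)" if "i \<in> I" for i
    using coproduct_inc[OF y that] f[OF that] by auto
  have "\<forall>i\<in>I. coprod_inj C I Y i \<cdot> f i \<in> Hom C (X i) (coprod_obj C I Y)" using t by blast
  then have "\<exists>!h. h \<in> Hom C (coprod_obj C I X) (coprod_obj C I Y) \<and>
     (\<forall>i \<in> I. h \<cdot> coprod_inj C I X i = coprod_inj C I Y i \<cdot> f i)"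
    by (rule is_coproductD[OF x coproduct_Obj[OF y]])
  from theI'[OF this, folded coprod_map_def]
  show "coprod_map C I X Y f \<in> Hom C (coprod_obj C I X) (coprod_obj C I Y)"
    "i \<in> I \<Longrightarrow> coprod_map C I X Y f \<cdot> coprod_inj C I X i = coprod_inj C I Y i \<cdot> f i"
    by blast+
qed

text \<open>\<open>AB4\<close> concerns chosen coproducts over subsets of one type. After
  reindexing, the given coproducts are compared with the chosen ones by isomorphisms, under which
  \<open>u\<close> and \<open>v\<close> correspond to the coproduct maps because they agree on all
  inclusions.\<close>

lemma AB4_short_exact:
  fixes \<kappa> :: "'k rel"
  assumes AB: "AB4 \<kappa> C" "Card_order \<kappa>" "|I| <o \<kappa>"
    and PX: "is_coproduct C I X PX iX" and PY: "is_coproduct C I Y PY iY" and PZ: "is_coproduct C I Z PZ iZ"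
    and fg: "\<And>i. i \<in> I \<Longrightarrow> f i \<in> Hom C (X i) (Y i)" "\<And>i. i \<in> I \<Longrightarrow> g i \<in> Hom C (Y i) (Z i)"
      "\<And>i. i \<in> I \<Longrightarrow> short_exact C (f i) (g i)"
    and uv: "u \<in> Hom C PX PY" "v \<in> Hom C PY PZ"
      "\<And>i. i \<in> I \<Longrightarrow> u \<cdot> iX i = iY i \<cdot> f i" "\<And>i. i \<in> I \<Longrightarrow> v \<cdot> iY i = iZ i \<cdot> g i"
  shows "short_exact C u v"
proof -
  obtain h and J :: "'k set" where h: "bij_betw h I J" "|J| <o \<kappa>" by (rule ordLess_bij_subset[OF AB(2,3)])
  let ?k = "inv_into I h"
  have k: "?k j \<in> I" if "j \<in> J" for j
    using inv_into_into[of j h I] h(1) that unfolding bij_betw_def by blast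
  have hJ: "h i \<in> J" if "i \<in> I" for i using h(1) that unfolding bij_betw_def by blast
  have kh: "?k (h i) = i" if "i \<in> I" for i
    by (rule inv_into_f_f[OF _ that]) (use h(1) in \<open>simp add: bij_betw_def\<close>)
  have bk: "bij_betw ?k J I" by (rule bij_betw_inv_into[OF h(1)])
  let ?X = "\<lambda>j. X (?k j)" and ?Y = "\<lambda>j. Y (?k j)" and ?Z = "\<lambda>j. Z (?k j)"
    and ?f = "\<lambda>j. f (?k j)" and ?g = "\<lambda>j. g (?k j)"
  have exX: "\<exists>P inc. is_coproduct C J ?X P inc" and exY: "\<exists>P inc. is_coproduct C J ?Y P inc"
    and exZ: "\<exists>P inc. is_coproduct C J ?Z P inc"
    using is_coproduct_reindex[OF bk _ _ PX, of ?X "\<lambda>j. iX (?k j)"]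
      is_coproduct_reindex[OF bk _ _ PY, of ?Y "\<lambda>j. iY (?k j)"]
      is_coproduct_reindex[OF bk _ _ PZ, of ?Z "\<lambda>j. iZ (?k j)"] by blast+
  have f': "?f j \<in> Hom C (?X j) (?Y j)" "?g j \<in> Hom C (?Y j) (?Z j)" if "j \<in> J" for j
    using fg(1,2)[OF k[OF that]] by blast+
  have mf: "coprod_map C J ?X ?Y ?f \<in> Hom C (coprod_obj C J ?X) (coprod_obj C J ?Y)"
    "\<And>j. j \<in> J \<Longrightarrow> coprod_map C J ?X ?Y ?f \<cdot> coprod_inj C J ?X j = coprod_inj C J ?Y j \<cdot> ?f j"
    by (rule coprod_map_props[OF exX exY f'(1)]; assumption)+
  have mg: "coprod_map C J ?Y ?Z ?g \<in> Hom C (coprod_obj C J ?Y) (coprod_obj C J ?Z)"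
    "\<And>j. j \<in> J \<Longrightarrow> coprod_map C J ?Y ?Z ?g \<cdot> coprod_inj C J ?Y j = coprod_inj C J ?Z j \<cdot> ?g j"
    by (rule coprod_map_props[OF exY exZ f'(2)]; assumption)+
  have cX: "is_coproduct C I X (coprod_obj C J ?X) (\<lambda>i. coprod_inj C J ?X (h i))"
    by (rule is_coproduct_reindex[OF h(1) _ _ coprod_is_coproduct[OF exX]]) (use kh in simp_all)
  have cY: "is_coproduct C I Y (coprod_obj C J ?Y) (\<lambda>i. coprod_inj C J ?Y (h i))"
    by (rule is_coproduct_reindex[OF h(1) _ _ coprod_is_coproduct[OF exY]]) (use kh in simp_all)
  have cZ: "is_coproduct C I Z (coprod_obj C J ?Z) (\<lambda>i. coprod_inj C J ?Z (h i))"
    by (rule is_coproduct_reindex[OF h(1) _ _ coprod_is_coproduct[OF exZ]]) (use kh in simp_all)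
  have "\<forall>j \<in> J. ?f j \<in> Hom C (?X j) (?Y j) \<and> ?g j \<in> Hom C (?Y j) (?Z j) \<and> short_exact C (?f j) (?g j)"
    using f' fg(3)[OF k] by blast
  then have se: "short_exact C (coprod_map C J ?X ?Y ?f) (coprod_map C J ?Y ?Z ?g)"
    by (rule AB4D(2)[OF AB(1) h(2)])
  obtain a where a: "a \<in> Hom C PX (coprod_obj C J ?X)" "is_mono C a" "is_epi C a"
    "\<And>i. i \<in> I \<Longrightarrow> a \<cdot> iX i = coprod_inj C J ?X (h i)"
    by (rule coproduct_iso[OF PX cX]) blast
  obtain b where b: "b \<in> Hom C PY (coprod_obj C J ?Y)" "is_mono C b" "is_epi C b"
    "\<And>i. i \<in> I \<Longrightarrow> b \<cdot> iY i = coprod_inj C J ?Y (h i)"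
    by (rule coproduct_iso[OF PY cY]) blast
  obtain c where c: "c \<in> Hom C PZ (coprod_obj C J ?Z)" "is_mono C c" "is_epi C c"
    "\<And>i. i \<in> I \<Longrightarrow> c \<cdot> iZ i = coprod_inj C J ?Z (h i)"
    by (rule coproduct_iso[OF PZ cZ]) blast
  \<comment> \<open>Stated in general so that it serves for both squares: morphisms out of a
    coproduct are compared on the inclusions.\<close>
  have sq: "m \<cdot> a' = b' \<cdot> w"
    if P: "is_coproduct C I X1 P1 i1" "is_coproduct C I X2 P2 i2" "a' \<in> Hom C P1 Q1" "b' \<in> Hom C P2 Q2"
      "m \<in> Hom C Q1 Q2" "w \<in> Hom C P1 P2"
      and eq: "\<And>i. i \<in> I \<Longrightarrow> a' \<cdot> i1 i = j1 i" "\<And>i. i \<in> I \<Longrightarrow> b' \<cdot> i2 i = j2 i"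
      "\<And>i. i \<in> I \<Longrightarrow> w \<cdot> i1 i = i2 i \<cdot> ff i" "\<And>i. i \<in> I \<Longrightarrow> m \<cdot> j1 i = j2 i \<cdot> ff i"
      "\<And>i. i \<in> I \<Longrightarrow> ff i \<in> Hom C (X1 i) (X2 i)"
    for m a' b' w X1 X2 P1 P2 Q1 Q2 i1 i2 j1 j2 ff
  proof (rule coproduct_eqI[OF P(1)])
    fix i assume i: "i \<in> I"
    note t = coproduct_inc[OF P(1) i] coproduct_inc[OF P(2) i] eq(5)[OF i]
    have "(m \<cdot> a') \<cdot> i1 i = m \<cdot> a' \<cdot> i1 i" by (rule comp_assoc) (use P t in auto)
    also have "\<dots> = j2 i \<cdot> ff i" unfolding eq(1)[OF i] by (rule eq(4)[OF i])
    also have "\<dots> = (b' \<cdot> i2 i) \<cdot> ff i" unfolding eq(2)[OF i] ..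
    also have "\<dots> = b' \<cdot> i2 i \<cdot> ff i" by (rule comp_assoc) (use P t in auto)
    also have "\<dots> = b' \<cdot> w \<cdot> i1 i" unfolding eq(3)[OF i] ..
    also have "\<dots> = (b' \<cdot> w) \<cdot> i1 i" by (rule comp_assoc[symmetric]) (use P t in auto)
    finally show "(m \<cdot> a') \<cdot> i1 i = (b' \<cdot> w) \<cdot> i1 i" .
  qed (use P in auto)
  have 1: "coprod_map C J ?X ?Y ?f \<cdot> coprod_inj C J ?X (h i) = coprod_inj C J ?Y (h i) \<cdot> f i"
    "coprod_map C J ?Y ?Z ?g \<cdot> coprod_inj C J ?Y (h i) = coprod_inj C J ?Z (h i) \<cdot> g i" if "i \<in> I" for i
    using mf(2)[OF hJ[OF that]] mg(2)[OF hJ[OF that]] unfolding kh[OF that] .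
  have s1: "coprod_map C J ?X ?Y ?f \<cdot> a = b \<cdot> u"
    by (rule sq[OF PX PY a(1) b(1) mf(1) uv(1) a(4) b(4) uv(3) 1(1) fg(1)])
  have s2: "coprod_map C J ?Y ?Z ?g \<cdot> b = c \<cdot> v"
    by (rule sq[OF PY PZ b(1) c(1) mg(1) uv(2) b(4) c(4) uv(4) 1(2) fg(2)])
  show ?thesis
    by (rule short_exact_iso[OF se mf(1) mg(1) uv(1,2) a(1) b(1) c(1) a(2,3) b(2,3) c(2,3) s1 s2])
qed

lemma cokernel_exact: "is_cokernel C f c \<Longrightarrow> exact C f c"
  unfolding exact_def using ex_kernel cokernel_Arr(2) by blast

text \<open>The snake lemma in the case where the connecting morphism would start at the kernel of
  \<open>\<phi>F\<close>, which is zero; this is why \<open>k'\<close> is mono.\<close>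

lemma snake_cokernels:
  assumes U: "short_exact C uk ue" "uk \<in> Hom C UK UE" "ue \<in> Hom C UE UF"
    and V: "short_exact C k e" "k \<in> Hom C K E" "e \<in> Hom C E F"
    and ph: "\<phi>K \<in> Hom C UK K" "\<phi>E \<in> Hom C UE E" "\<phi>F \<in> Hom C UF F"
      "\<phi>E \<cdot> uk = k \<cdot> \<phi>K" "\<phi>F \<cdot> ue = e \<cdot> \<phi>E" "is_mono C \<phi>F"
    and c: "is_cokernel C \<phi>K cK" "is_cokernel C \<phi>E cE" "is_cokernel C \<phi>F cF"
    and ch: "cK \<in> Hom C K CK" "cE \<in> Hom C E CE" "cF \<in> Hom C F CF"
  obtains k' e' where "k' \<in> Hom C CK CE" "e' \<in> Hom C CE CF" "k' \<cdot> cK = cE \<cdot> k" "e' \<cdot> cE = cF \<cdot> e"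
    "short_exact C k' e'"
proof -
  note us = short_exactD[OF U] and vs = short_exactD[OF V]
  have obj: "CK \<in> Obj C" "CE \<in> Obj C" "CF \<in> Obj C" "UK \<in> Obj C" "UE \<in> Obj C" "K \<in> Obj C" "F \<in> Obj C"
    using ch U ph by auto
  have z: "cK \<cdot> \<phi>K = Zr C UK CK" "cE \<cdot> \<phi>E = Zr C UE CE" "cF \<cdot> \<phi>F = Zr C UF CF"
    using cokernel_Arr(4)[OF c(1)] cokernel_Arr(4)[OF c(2)] cokernel_Arr(4)[OF c(3)] ph ch by simp_all
  have "cE \<cdot> k \<cdot> \<phi>K = (cE \<cdot> \<phi>E) \<cdot> uk" unfolding ph(4)[symmetric]
    by (rule comp_assoc[symmetric]) (use ch ph U in auto)
  then have 1: "(cE \<cdot> k) \<cdot> \<phi>K = Zr C UK CE" unfolding z using ch ph V U obj by simp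
  obtain k' where k': "k' \<in> Arr C" "Cod C k' = CE" "Dom C k' = CK" "k' \<cdot> cK = cE \<cdot> k"
    by (rule cokernel_factor[OF c(1), of "cE \<cdot> k"]) (use 1 ch ph V in auto)
  have "cF \<cdot> e \<cdot> \<phi>E = (cF \<cdot> \<phi>F) \<cdot> ue" unfolding ph(5)[symmetric]
    by (rule comp_assoc[symmetric]) (use ch ph U in auto)
  then have 2: "(cF \<cdot> e) \<cdot> \<phi>E = Zr C UE CF" unfolding z using ch ph V U obj by simp
  obtain e' where e': "e' \<in> Arr C" "Cod C e' = CF" "Dom C e' = CE" "e' \<cdot> cE = cF \<cdot> e"
    by (rule cokernel_factor[OF c(2), of "cF \<cdot> e"]) (use 2 ch ph V in auto)
  note epi = cokernel_is_epi[OF c(1)] cokernel_is_epi[OF c(2)] cokernel_is_epi[OF c(3)]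
  note ex = cokernel_exact[OF c(2)] cokernel_exact[OF c(3)]
  have "short_exact C k' e'"
  proof (rule short_exactI)
    show "k' \<in> Hom C CK CE" "e' \<in> Hom C CE CF" using k' e' by auto
    have "(e' \<cdot> k') \<cdot> cK = e' \<cdot> cE \<cdot> k" unfolding k'(4)[symmetric]
      by (rule comp_assoc) (use k' e' ch in auto)
    also have "\<dots> = cF \<cdot> e \<cdot> k" by (rule comp_cong_left[OF e'(4)]) (use e' ch V in auto)
    also have "\<dots> = Zr C K CF" unfolding vs(6) using ch obj by simp
    finally show "e' \<cdot> k' = Zr C CK CF" by (rule epi_zero[OF epi(1)]) (use k' e' ch in auto)
    have "is_epi C (e' \<cdot> cE)" unfolding e'(4) by (rule is_epi_comp) (use vs epi ch V in auto)
    then show "is_epi C e'" by (rule is_epi_cancel_right) (use e' ch in auto)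
  next
    fix T x assume x: "T \<in> Obj C" "x \<in> Hom C T CK" "k' \<cdot> x = Zr C T CE"
    obtain T1 e1 y where y: "is_epi C e1" "e1 \<in> Hom C T1 T" "y \<in> Hom C T1 K" "cK \<cdot> y = x \<cdot> e1"
      by (rule epi_lift[OF epi(1) ch(1) x(2)])
    have "cE \<cdot> k \<cdot> y = k' \<cdot> cK \<cdot> y" by (rule comp_cong_left[OF k'(4)[symmetric]]) (use k' ch V y in auto)
    also have "\<dots> = (k' \<cdot> x) \<cdot> e1" unfolding y(4) by (rule comp_assoc[symmetric]) (use k' x y in auto)
    also have "\<dots> = Zr C T1 CE" unfolding x(3) using y(2) obj by auto
    finally have cky: "cE \<cdot> k \<cdot> y = Zr C T1 CE" .
    have kyH: "k \<cdot> y \<in> Hom C T1 E" using V y by auto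
    obtain T2 e2 u where u: "is_epi C e2" "e2 \<in> Hom C T2 T1" "u \<in> Hom C T2 UE" "\<phi>E \<cdot> u = (k \<cdot> y) \<cdot> e2"
      by (rule exact_lift[OF ex(1) ph(2) ch(2) kyH cky])
    have T2: "T2 \<in> Obj C" using u by auto
    \<comment> \<open>\<open>u\<close> becomes zero in \<open>F\<close>; as \<open>\<phi>F\<close>
      is mono it is already zero in \<open>UF\<close>, so it comes from \<open>UK\<close>.\<close>
    have "\<phi>F \<cdot> ue \<cdot> u = e \<cdot> \<phi>E \<cdot> u" by (rule comp_cong_left[OF ph(5)]) (use ph U V u in auto)
    also have "\<dots> = (e \<cdot> k) \<cdot> y \<cdot> e2" unfolding u(4) using V y u by simp
    also have "\<dots> = Zr C T2 F" unfolding vs(6) using y(2,3) u(2) obj by simp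
    finally have "ue \<cdot> u = Zr C T2 UF" by (rule mono_zero[OF ph(6)]) (use ph U u in auto)
    then have ueu: "ue \<cdot> u = Zr C (Dom C u) (Cod C ue)" using u(3) U by auto
    obtain w where w: "w \<in> Arr C" "Dom C w = T2" "Cod C w = UK" "uk \<cdot> w = u"
      by (rule kernel_factor[OF us(3) _ _ ueu]) (use u U in auto)
    have "k \<cdot> \<phi>K \<cdot> w = \<phi>E \<cdot> uk \<cdot> w" by (rule comp_cong_left[OF ph(4)[symmetric]]) (use ph U V w in auto)
    also have "\<dots> = k \<cdot> y \<cdot> e2" unfolding w(4) u(4) by (rule comp_assoc) (use V y u in auto)
    finally have "\<phi>K \<cdot> w = y \<cdot> e2" by (rule is_monoD[OF vs(1)]) (use ph V y u w in auto)
    then have "cK \<cdot> y \<cdot> e2 = cK \<cdot> \<phi>K \<cdot> w" by simp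
    also have "\<dots> = Zr C UK CK \<cdot> w" by (rule comp_cong_left1[OF z(1)]) (use ch ph w in auto)
    finally have cye: "cK \<cdot> y \<cdot> e2 = Zr C T2 CK" using w(1-3) obj by simp
    have "x \<cdot> e1 \<cdot> e2 = cK \<cdot> y \<cdot> e2" by (rule comp_cong_left[OF y(4)[symmetric]]) (use x y u ch in auto)
    then have xe: "x \<cdot> e1 \<cdot> e2 = Zr C T2 CK" using cye by simp
    have "is_epi C (e1 \<cdot> e2)" by (rule is_epi_comp[OF u(1) y(1)]) (use y u in auto)
    then show "x = Zr C T CK" by (rule epi_zero[OF _ xe]) (use x y u in auto)
  next
    fix T y assume y: "T \<in> Obj C" "y \<in> Hom C T CE" "e' \<cdot> y = Zr C T CF"
    obtain T1 e1 x where x: "is_epi C e1" "e1 \<in> Hom C T1 T" "x \<in> Hom C T1 E" "cE \<cdot> x = y \<cdot> e1"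
      by (rule epi_lift[OF epi(2) ch(2) y(2)])
    have "cF \<cdot> e \<cdot> x = e' \<cdot> cE \<cdot> x" by (rule comp_cong_left[OF e'(4)[symmetric]]) (use e' ch V x in auto)
    also have "\<dots> = (e' \<cdot> y) \<cdot> e1" unfolding x(4) by (rule comp_assoc[symmetric]) (use e' x y in auto)
    also have "\<dots> = Zr C T1 CF" unfolding y(3) using x(2) obj by auto
    finally have cex: "cF \<cdot> e \<cdot> x = Zr C T1 CF" .
    have exH: "e \<cdot> x \<in> Hom C T1 F" using V x by auto
    obtain T2 e2 u where u: "is_epi C e2" "e2 \<in> Hom C T2 T1" "u \<in> Hom C T2 UF" "\<phi>F \<cdot> u = (e \<cdot> x) \<cdot> e2"
      by (rule exact_lift[OF ex(2) ph(3) ch(3) exH cex])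
    obtain T3 e3 v where v: "is_epi C e3" "e3 \<in> Hom C T3 T2" "v \<in> Hom C T3 UE" "ue \<cdot> v = u \<cdot> e3"
      by (rule epi_lift[OF us(2) U(3) u(3)])
    define ee where "ee = e2 \<cdot> e3"
    have ee: "ee \<in> Hom C T3 T1" using u v by (auto simp: ee_def)
    \<comment> \<open>After refinement \<open>x\<close> and \<open>\<phi>E \<cdot> v\<close> have
      the same image in \<open>F\<close>, so their difference comes from \<open>K\<close>; the
      correction term vanishes in the cokernel of \<open>\<phi>E\<close>.\<close>
    let ?z = "minus (x \<cdot> ee) (\<phi>E \<cdot> v)"
    have zH: "?z \<in> Hom C T3 E" using x ee v ph by auto
    have "e \<cdot> \<phi>E \<cdot> v = \<phi>F \<cdot> ue \<cdot> v" by (rule comp_cong_left[OF ph(5)[symmetric]]) (use ph U V v in auto)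
    also have "\<dots> = (\<phi>F \<cdot> u) \<cdot> e3" unfolding v(4) by (rule comp_assoc[symmetric]) (use ph u v in auto)
    also have "\<dots> = e \<cdot> x \<cdot> ee" unfolding u(4) using V x u v by (simp add: ee_def)
    finally have ev: "e \<cdot> \<phi>E \<cdot> v = e \<cdot> x \<cdot> ee" .
    have "e \<cdot> ?z = minus (e \<cdot> x \<cdot> ee) (e \<cdot> \<phi>E \<cdot> v)" using V x ee v ph by simp
    also have "\<dots> = Zr C T3 F" unfolding ev using V x ee by simp
    finally have ez: "e \<cdot> ?z = Zr C T3 F" .
    obtain w where w: "w \<in> Arr C" "Dom C w = T3" "Cod C w = K" "k \<cdot> w = ?z"
      by (rule kernel_factor[OF vs(3), of ?z]) (use zH ez V in \<open>auto simp del: comp_Add\<close>)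
    have cEv: "cE \<cdot> \<phi>E \<cdot> v = Zr C UE CE \<cdot> v" by (rule comp_cong_left1[OF z(2)]) (use ch ph v in auto)
    have "k' \<cdot> cK \<cdot> w = cE \<cdot> k \<cdot> w" by (rule comp_cong_left[OF k'(4)]) (use k' ch V w in auto)
    also have "\<dots> = minus (cE \<cdot> x \<cdot> ee) (cE \<cdot> \<phi>E \<cdot> v)" unfolding w(4) using ch x(2,3) ee v(2,3) ph(2) by simp
    also have "\<dots> = cE \<cdot> x \<cdot> ee" unfolding cEv using ch x(2,3) ee v(3) obj Dom_in_Obj[of v] by simp
    also have "\<dots> = y \<cdot> e1 \<cdot> ee" by (rule comp_cong_left[OF x(4)]) (use ch x y ee in auto)
    finally have fin: "k' \<cdot> cK \<cdot> w = y \<cdot> e1 \<cdot> ee" .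
    have "is_epi C ee" unfolding ee_def by (rule is_epi_comp[OF v(1) u(1)]) (use u v in auto)
    then have "is_epi C (e1 \<cdot> ee)" by (rule is_epi_comp[OF _ x(1)]) (use ee x in auto)
    then show "\<exists>T' e. \<exists>x\<in>Hom C T' CK. is_epi C e \<and> e \<in> Hom C T' T \<and> k' \<cdot> x = y \<cdot> e"
      using fin w ch ee x by (intro exI[of _ T3] exI[of _ "e1 \<cdot> ee"] bexI[of _ "cK \<cdot> w"]) auto
  qed
  then show thesis using that k' e' by auto
qed

end

section \<open>Closure properties of the classes of a hereditary cotorsion pair\<close>

locale hereditary_cotorsion = abelian_category C for C :: "('o, 'm) cat" +
  fixes \<A> \<B> :: "'o set"
  assumes cotorsion: "cotorsion_pair C \<A> \<B>" and complete: "complete_pair C \<A> \<B>"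
    and hereditary: "hereditary_pair C \<A> \<B>"
begin

lemma A_Obj: "A \<in> \<A> \<Longrightarrow> A \<in> Obj C" and B_Obj: "B \<in> \<B> \<Longrightarrow> B \<in> Obj C"
  using cotorsion unfolding cotorsion_pair_def by blast+

lemma A_iff: "A \<in> \<A> \<longleftrightarrow> A \<in> Obj C \<and> (\<forall>B \<in> \<B>. ext1_zero C A B)"
proof -
  have "A \<in> \<A> \<longleftrightarrow> A \<in> Obj C \<and> (\<forall>B \<in> \<B>. Ext_zero C 1 A B)"
    using cotorsion unfolding cotorsion_pair_def by blast
  then show ?thesis using Ext_zero_one_iff B_Obj by blast
qed

lemma B_iff: "B \<in> \<B> \<longleftrightarrow> B \<in> Obj C \<and> (\<forall>A \<in> \<A>. ext1_zero C A B)"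
proof -
  have "B \<in> \<B> \<longleftrightarrow> B \<in> Obj C \<and> (\<forall>A \<in> \<A>. Ext_zero C 1 A B)"
    using cotorsion unfolding cotorsion_pair_def by blast
  then show ?thesis using Ext_zero_one_iff A_Obj by blast
qed

lemma A_cover:
  assumes "E \<in> Obj C"
  obtains A p where "A \<in> \<A>" "p \<in> Hom C A E" "is_epi C p"
  using complete assms unfolding complete_pair_def short_exact_def by blast

lemma B_embed:
  assumes "X \<in> Obj C"
  obtains B f where "B \<in> \<B>" "f \<in> Hom C X B" "is_mono C f"
  using complete assms unfolding complete_pair_def short_exact_def by blast

text \<open>Ext^1(K, B) is squeezed between Ext^1(P, B) and Ext^2(X, B), which vanish for every
  \<open>B\<close> in \<open>\<B>\<close>; the second one by heredity.\<close>

lemma A_kernel: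
  assumes "short_exact C k p" "k \<in> Hom C K P" "p \<in> Hom C P X" "P \<in> \<A>" "X \<in> \<A>"
  shows "K \<in> \<A>"
  unfolding A_iff
proof (intro conjI ballI)
  show "K \<in> Obj C" using assms by auto
  fix B assume B: "B \<in> \<B>"
  have "Ext_zero C 2 X B" using hereditary assms(5) B unfolding hereditary_pair_def by simp
  then show "ext1_zero C K B"
    by (rule ext1_zero_kernel[OF _ _ assms(1-3) B_Obj[OF B]]) (use assms(4) B A_iff in blast)
qed

lemma A_iso:
  assumes "X \<in> \<A>" "i \<in> Hom C X' X" "is_mono C i" "is_epi C i"
  shows "X' \<in> \<A>"
  unfolding A_iff
proof (intro conjI ballI)
  show "X' \<in> Obj C" using assms by auto
  fix B assume "B \<in> \<B>"
  then have "ext1_zero C X B" using assms(1) A_iff by blast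
  then show "ext1_zero C X' B" by (rule ext1_zero_iso_left[OF _ assms(2-4)])
qed

lemma B_iso:
  assumes "Y \<in> \<B>" "i \<in> Hom C Y Y'" "is_mono C i" "is_epi C i"
  shows "Y' \<in> \<B>"
  unfolding B_iff
proof (intro conjI ballI)
  show "Y' \<in> Obj C" using assms by auto
  fix A assume "A \<in> \<A>"
  then have "ext1_zero C A Y" using assms(1) B_iff by blast
  then show "ext1_zero C A Y'" by (rule ext1_zero_iso_right[OF _ assms(2-4)])
qed

lemma B_extension:
  assumes "short_exact C i p" "i \<in> Hom C G1 G" "p \<in> Hom C G G2" "G1 \<in> \<B>" "G2 \<in> \<B>"
  shows "G \<in> \<B>"
  unfolding B_iff
proof (intro conjI ballI)
  show "G \<in> Obj C" using assms by auto
  fix A assume "A \<in> \<A>"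
  then have "ext1_zero C A G1" "ext1_zero C A G2" using assms(4,5) B_iff by blast+
  then show "ext1_zero C A G" by (rule ext1_zero_middle[OF _ _ assms(1-3)])
qed

lemma B_zero: "is_zero_obj C Z \<Longrightarrow> Z \<in> \<B>"
  unfolding B_iff using ext1_zero_zero_obj A_Obj by (auto simp: is_zero_obj_def simp del: in_Hom_iff)

text \<open>Finite coproducts are built from biproducts one index at a time, so that existence and
  membership in \<open>\<B>\<close> come together, the latter from closure under extensions.\<close>

lemma finite_coproduct_B_ex:
  assumes "finite I" "\<And>i. i \<in> I \<Longrightarrow> X i \<in> \<B>"
  shows "\<exists>P inc. is_coproduct C I X P inc \<and> P \<in> \<B>"
  using assms
proof (induction I)
  case empty
  obtain Z where Z: "is_zero_obj C Z" using ex_zero_obj by blast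
  then have "is_coproduct C {} X Z undefined"
    unfolding is_coproduct_def is_zero_obj_def by blast
  then show ?case using B_zero[OF Z] by blast
next
  case (insert j I)
  then obtain P inc where P: "is_coproduct C I X P inc" "P \<in> \<B>" by blast
  have Xj: "X j \<in> \<B>" using insert by blast
  obtain S i1 i2 p1 p2 where S: "S \<in> Obj C" "i1 \<in> Hom C P S" "i2 \<in> Hom C (X j) S"
    "p1 \<in> Hom C S P" "p2 \<in> Hom C S (X j)" "p1 \<cdot> i1 = Idn C P" "p2 \<cdot> i2 = Idn C (X j)"
    "p1 \<cdot> i2 = Zr C (X j) P" "p2 \<cdot> i1 = Zr C P (X j)" "Add C (i1 \<cdot> p1) (i2 \<cdot> p2) = Idn C S"
    "short_exact C i1 p2"
    by (rule biproduct_short_exact[OF B_Obj[OF P(2)] B_Obj[OF Xj]])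
  let ?inc = "\<lambda>i. if i = j then i2 else i1 \<cdot> inc i"
  have incH: "inc i \<in> Hom C (X i) P" if "i \<in> I" for i by (rule coproduct_inc[OF P(1) that])
  have obj: "P \<in> Obj C" "X j \<in> Obj C" using P Xj B_Obj by auto
  have "is_coproduct C (insert j I) X S ?inc"
    unfolding is_coproduct_def
  proof (intro conjI ballI allI impI S(1))
    show "?inc i \<in> Hom C (X i) S" if "i \<in> insert j I" for i using that incH S by auto
    fix Z f assume Z: "Z \<in> Obj C" and f: "\<forall>i \<in> insert j I. f i \<in> Hom C (X i) Z"
    have fj: "f j \<in> Hom C (X j) Z" using f by blast
    obtain h where h: "h \<in> Hom C P Z" "\<And>i. i \<in> I \<Longrightarrow> h \<cdot> inc i = f i"
      by (rule coproduct_factor[OF P(1) Z, of f]) (use f in blast)+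
    let ?h = "Add C (h \<cdot> p1) (f j \<cdot> p2)"
    have "h \<cdot> p1 \<cdot> i1 = h" "f j \<cdot> p2 \<cdot> i2 = f j" unfolding S(6,7) using h fj by auto
    moreover have "h \<cdot> p1 \<cdot> i2 = Zr C (X j) Z" "f j \<cdot> p2 \<cdot> i1 = Zr C P Z"
      unfolding S(8,9) using h(1) fj obj by auto
    ultimately have hi: "?h \<cdot> i1 = h" "?h \<cdot> i2 = f j" using h(1) fj S(2-5) obj Z by simp_all
    show "\<exists>!g. g \<in> Hom C S Z \<and> (\<forall>i \<in> insert j I. g \<cdot> ?inc i = f i)"
    proof (rule ex1I)
      have "?h \<cdot> ?inc i = f i" if i: "i \<in> insert j I" for i
      proof (cases "i = j")
        case False
        then have iI: "i \<in> I" using i by blast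
        have "?h \<cdot> i1 \<cdot> inc i = h \<cdot> inc i"
          by (rule comp_cong_left1[OF hi(1)]) (use h(1) fj S(2-5) incH[OF iI] in auto)
        then show ?thesis using h(2)[OF iI] False by simp
      qed (use hi in simp)
      then show "?h \<in> Hom C S Z \<and> (\<forall>i \<in> insert j I. ?h \<cdot> ?inc i = f i)" using h(1) fj S(2-5) by auto
      fix g assume g: "g \<in> Hom C S Z \<and> (\<forall>i \<in> insert j I. g \<cdot> ?inc i = f i)"
      have g2: "g \<cdot> i2 = f j" using g by auto
      have g1: "g \<cdot> i1 = h"
      proof (rule coproduct_eqI[OF P(1)])
        fix i assume i: "i \<in> I"
        then have "i \<noteq> j" using insert.hyps by blast
        then have "g \<cdot> i1 \<cdot> inc i = f i" using g i by auto
        moreover have "(g \<cdot> i1) \<cdot> inc i = g \<cdot> i1 \<cdot> inc i" by (rule comp_assoc) (use g S incH[OF i] in auto)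
        ultimately show "(g \<cdot> i1) \<cdot> inc i = h \<cdot> inc i" using h(2)[OF i] by simp
      qed (use g h S in auto)
      have "g = g \<cdot> Add C (i1 \<cdot> p1) (i2 \<cdot> p2)" unfolding S(10) using g by auto
      also have "\<dots> = Add C (g \<cdot> i1 \<cdot> p1) (g \<cdot> i2 \<cdot> p2)" by (rule comp_Add) (use g S(2-5) in auto)
      also have "g \<cdot> i1 \<cdot> p1 = h \<cdot> p1" by (rule comp_cong_left1[OF g1]) (use g S(2-5) in auto)
      also have "g \<cdot> i2 \<cdot> p2 = f j \<cdot> p2" by (rule comp_cong_left1[OF g2]) (use g S(2-5) in auto)
      finally show "g = ?h" .
    qed
  qed
  moreover have "S \<in> \<B>" by (rule B_extension[OF S(11,2,5) P(2) Xj])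
  ultimately show ?case by blast
qed

lemma finite_coproduct_B:
  assumes "finite I" "\<And>i. i \<in> I \<Longrightarrow> X i \<in> \<B>" "is_coproduct C I X P inc"
  shows "P \<in> \<B>"
proof -
  have "\<exists>P inc. is_coproduct C I X P inc \<and> P \<in> \<B>"
    by (rule finite_coproduct_B_ex[OF assms(1)]) (rule assms(2))
  then obtain P' inc' where P': "is_coproduct C I X P' inc'" "P' \<in> \<B>" by blast
  obtain u where "u \<in> Hom C P' P" "is_mono C u" "is_epi C u"
    by (rule coproduct_iso[OF P'(1) assms(3)]) blast
  then show ?thesis using B_iso P'(2) by blast
qed

end

subsection \<open>Stalk representations and extensions\<close>

context abelian_category
begin

lemma zero_obj_is_zero: "is_zero_obj C (zero_obj C)"
  unfolding zero_obj_def by (rule someI_ex[OF ex_zero_obj])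

lemma zero_obj_Obj [simp]: "zero_obj C \<in> Obj C"
  using zero_obj_is_zero unfolding is_zero_obj_def by blast

lemma zero_obj_Hom_eq:
  assumes "is_zero_obj C Z"
  shows "u \<in> Hom C X Z \<Longrightarrow> v \<in> Hom C X Z \<Longrightarrow> u = v"
    "u \<in> Hom C Z X \<Longrightarrow> v \<in> Hom C Z X \<Longrightarrow> u = v"
proof -
  show "u = v" if u: "u \<in> Hom C X Z" "v \<in> Hom C X Z"
  proof -
    have "X \<in> Obj C" using u by auto
    then have "\<exists>!f. f \<in> Hom C X Z" using assms unfolding is_zero_obj_def by blast
    then show ?thesis using u by (rule ex1_eqD)
  qed
  show "u = v" if u: "u \<in> Hom C Z X" "v \<in> Hom C Z X"
  proof -
    have "X \<in> Obj C" using u by auto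
    then have "\<exists>!f. f \<in> Hom C Z X" using assms unfolding is_zero_obj_def by blast
    then show ?thesis using u by (rule ex1_eqD)
  qed
qed

text \<open>Stated for any isomorphism \<open>u\<close> rather than an identity, as the value of a
  free representation at its own vertex is only isomorphic to the given object.\<close>

lemma short_exact_zero_iso:
  assumes Z: "is_zero_obj C Z" and u: "u \<in> Hom C X Y" "is_mono C u" "is_epi C u"
  shows "short_exact C (Zr C Z X) u"
proof (rule short_exact_if_kernel[OF is_kernelI u(3)])
  have obj: "Z \<in> Obj C" "X \<in> Obj C" "Y \<in> Obj C" using Z u by (auto simp: is_zero_obj_def)
  show "is_mono C (Zr C Z X)"
  proof (rule is_monoI)
    fix W v assume v: "v \<in> Hom C W (Dom C (Zr C Z X))"
    then have "v \<in> Hom C W Z" "Zr C W Z \<in> Hom C W Z" using obj by auto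
    then have "v = Zr C W Z" by (rule zero_obj_Hom_eq(1)[OF Z])
    then show "v = Zr C W (Dom C (Zr C Z X))" using obj by simp
  qed (use obj in auto)
  show "u \<in> Arr C" "Cod C (Zr C Z X) = Dom C u" "u \<cdot> Zr C Z X = Zr C (Dom C (Zr C Z X)) (Cod C u)"
    using u obj by auto
  fix y assume y: "y \<in> Arr C" "Cod C y = Dom C u" "u \<cdot> y = Zr C (Dom C y) (Cod C u)"
  have "y = Zr C (Dom C y) X" by (rule mono_zero[OF u(2)]) (use y u in auto)
  moreover have "Zr C Z X \<cdot> Zr C (Dom C y) Z = Zr C (Dom C y) X" using obj y(1) by simp
  ultimately have "Zr C Z X \<cdot> Zr C (Dom C y) Z = y" by metis
  then show "\<exists>h\<in>Arr C. Dom C h = Dom C y \<and> Cod C h = Dom C (Zr C Z X) \<and> Zr C Z X \<cdot> h = y"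
    using obj y(1) by (intro bexI[of _ "Zr C (Dom C y) Z"]) auto
qed

lemma short_exact_zero_Idn: "is_zero_obj C Z \<Longrightarrow> X \<in> Obj C \<Longrightarrow> short_exact C (Zr C Z X) (Idn C X)"
  by (rule short_exact_zero_iso[of Z _ X X]) auto

lemma short_exact_Idn_zero:
  assumes "is_zero_obj C Z" "X \<in> Obj C"
  shows "short_exact C (Idn C X) (Zr C X Z)"
proof -
  interpret d: abelian_category "dual C" by (rule abelian_dual)
  show ?thesis using d.short_exact_zero_Idn[of Z X] assms by (simp add: short_exact_dual)
qed

lemma cokernel_iso:
  assumes c: "is_cokernel C f c" and c': "is_cokernel C f c'"
  obtains h where "h \<in> Hom C (Cod C c) (Cod C c')" "is_mono C h" "is_epi C h"
proof -
  note ca = cokernel_Arr[OF c] and ca' = cokernel_Arr[OF c']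
  obtain h where h: "h \<in> Arr C" "Cod C h = Cod C c'" "Dom C h = Cod C c" "h \<cdot> c = c'"
    by (rule cokernel_factor[OF c ca'(2,3,4)])
  obtain k where k: "k \<in> Arr C" "Cod C k = Cod C c" "Dom C k = Cod C c'" "k \<cdot> c' = c"
    by (rule cokernel_factor[OF c' ca(2,3,4)])
  have kh: "k \<cdot> h = Idn C (Cod C c)"
  proof (rule is_epiD[OF cokernel_is_epi[OF c]])
    have "(k \<cdot> h) \<cdot> c = k \<cdot> h \<cdot> c" by (rule comp_assoc) (use h k ca in auto)
    then show "(k \<cdot> h) \<cdot> c = Idn C (Cod C c) \<cdot> c" unfolding h(4) k(4) using ca by simp
  qed (use h(1-3) k(1-3) ca in auto)
  have hk: "h \<cdot> k = Idn C (Cod C c')"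
  proof (rule is_epiD[OF cokernel_is_epi[OF c']])
    have "(h \<cdot> k) \<cdot> c' = h \<cdot> k \<cdot> c'" by (rule comp_assoc) (use h(1-3) k(1-3) ca' in auto)
    then show "(h \<cdot> k) \<cdot> c' = Idn C (Cod C c') \<cdot> c'" unfolding k(4) h(4) using ca' by simp
  qed (use h(1-3) k(1-3) ca' in auto)
  have "is_mono C h" by (rule is_mono_left_inverse[of _ k]) (use h(1-3) k(1-3) kh in auto)
  moreover have "is_epi C h" by (rule is_epi_right_inverse[of _ k]) (use h(1-3) k(1-3) hk in auto)
  ultimately show thesis using that h(1-3) by auto
qed

lemma Coker_cokernel:
  assumes "f \<in> Arr C"
  obtains c where "is_cokernel C f c" "Cod C c = Coker C f" "c \<in> Hom C (Cod C f) (Coker C f)"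
proof -
  have c: "is_cokernel C f (SOME c. is_cokernel C f c)" by (rule someI_ex[OF ex_cokernel[OF assms]])
  show thesis by (rule that[OF c]) (use cokernel_Arr[OF c] in \<open>auto simp: Coker_def\<close>)
qed

end

text \<open>\<open>Coker\<close> is a Hilbert choice. Since \<open>\<A>\<close> is closed under
  isomorphism, membership may be decided on any cokernel.\<close>

lemma (in hereditary_cotorsion) Coker_A_iff:
  assumes "is_cokernel C f c"
  shows "Coker C f \<in> \<A> \<longleftrightarrow> Cod C c \<in> \<A>"
proof -
  obtain c' where c': "is_cokernel C f c'" "Cod C c' = Coker C f"
    by (rule Coker_cokernel[OF cokernel_Arr(1)[OF assms]])
  obtain h where h: "h \<in> Hom C (Cod C c) (Cod C c')" "is_mono C h" "is_epi C h"
    by (rule cokernel_iso[OF assms c'(1)])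
  obtain k where k: "k \<in> Hom C (Cod C c') (Cod C c)" "is_mono C k" "is_epi C k"
    by (rule cokernel_iso[OF c'(1) assms])
  show ?thesis using A_iso[OF _ h] A_iso[OF _ k] c'(2) by metis
qed

context quiver_reps
begin

lemma s_rep_props:
  assumes X: "X \<in> Obj C"
  shows "s_rep Q C i X \<in> reps Q C"
    "j \<in> verts Q \<Longrightarrow> vob (s_rep Q C i X) j = (if j = i then X else zero_obj C)"
    "\<alpha> \<in> arcs Q \<Longrightarrow> amor (s_rep Q C i X) \<alpha> =
      Zr C (vob (s_rep Q C i X) (tail Q \<alpha>)) (vob (s_rep Q C i X) (head Q \<alpha>))"
proof -
  show 1: "vob (s_rep Q C i X) j = (if j = i then X else zero_obj C)" if "j \<in> verts Q" for j
    using that by (simp add: s_rep_def Let_def)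
  show 2: "amor (s_rep Q C i X) \<alpha> =
      Zr C (vob (s_rep Q C i X) (tail Q \<alpha>)) (vob (s_rep Q C i X) (head Q \<alpha>))" if "\<alpha> \<in> arcs Q" for \<alpha>
    using that by (simp add: s_rep_def Let_def)
  have ob: "vob (s_rep Q C i X) j \<in> Obj C" if "j \<in> verts Q" for j using 1[OF that] X by simp
  have e: "vob (s_rep Q C i X) \<in> extensional (verts Q)" "amor (s_rep Q C i X) \<in> extensional (arcs Q)"
    by (simp_all add: s_rep_def Let_def)
  show "s_rep Q C i X \<in> reps Q C"
    unfolding reps_def PiE_def Pi_def using e ob 2 by simp
qed

text \<open>\<open>G\<close> with its value at \<open>j\<close> erased. If the arrows leaving
  \<open>j\<close> end in zero objects, it is the quotient of \<open>G\<close> by the stalk at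
  \<open>j\<close>; if the arrows entering \<open>j\<close> start in zero objects, it is the kernel
  of the projection onto that stalk.\<close>

definition trunc :: "('v, 'e, 'o, 'm) qrep \<Rightarrow> 'v \<Rightarrow> ('v, 'e, 'o, 'm) qrep" where
  "trunc G j = mk_rep Q (\<lambda>k. if k = j then zero_obj C else vob G k)
     (\<lambda>\<alpha>. if head Q \<alpha> = j \<or> tail Q \<alpha> = j
       then Zr C (if tail Q \<alpha> = j then zero_obj C else vob G (tail Q \<alpha>))
         (if head Q \<alpha> = j then zero_obj C else vob G (head Q \<alpha>))
       else amor G \<alpha>)"

lemma trunc_props:
  assumes G: "G \<in> reps Q C"
  shows "trunc G j \<in> reps Q C" "k \<in> verts Q \<Longrightarrow> vob (trunc G j) k = (if k = j then zero_obj C else vob G k)"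
    "\<alpha> \<in> arcs Q \<Longrightarrow> amor (trunc G j) \<alpha> = (if head Q \<alpha> = j \<or> tail Q \<alpha> = j
       then Zr C (vob (trunc G j) (tail Q \<alpha>)) (vob (trunc G j) (head Q \<alpha>)) else amor G \<alpha>)"
proof -
  show "trunc G j \<in> reps Q C" unfolding trunc_def
  proof (rule mk_rep_reps[OF _ ends'])
    show "(if k = j then zero_obj C else vob G k) \<in> Obj C" if "k \<in> verts Q" for k
      using repsD(1)[OF G that] by simp
    show "(if head Q \<alpha> = j \<or> tail Q \<alpha> = j
       then Zr C (if tail Q \<alpha> = j then zero_obj C else vob G (tail Q \<alpha>))
         (if head Q \<alpha> = j then zero_obj C else vob G (head Q \<alpha>))
       else amor G \<alpha>) \<in> Hom C (if tail Q \<alpha> = j then zero_obj C else vob G (tail Q \<alpha>))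
         (if head Q \<alpha> = j then zero_obj C else vob G (head Q \<alpha>))" if "\<alpha> \<in> arcs Q" for \<alpha>
      using repsD(1)[OF G] repsD(2)[OF G that] that by auto
  qed
qed (simp_all add: trunc_def)

lemma Rep_zero_objI:
  assumes G: "G \<in> reps Q C" and z: "\<And>i. i \<in> verts Q \<Longrightarrow> is_zero_obj C (vob G i)"
  shows "is_zero_obj (Rep Q C) G"
  unfolding is_zero_obj_def Rep_Obj
proof (intro conjI ballI G)
  fix F assume F: "F \<in> reps Q C"
  show "\<exists>!f. f \<in> Hom (Rep Q C) F G"
  proof (rule ex1I[of _ "Zr (Rep Q C) F G"])
    fix f assume f: "f \<in> Hom (Rep Q C) F G"
    show "f = Zr (Rep Q C) F G"
    proof (rule Rep_Hom_eqI[OF f Rep_Zr_Hom[OF F G]])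
      fix i assume i: "i \<in> verts Q"
      show "cmp f i = cmp (Zr (Rep Q C) F G) i"
        by (rule zero_obj_Hom_eq(1)[OF z[OF i] Rep_HomD(3)[OF f i] Rep_HomD(3)[OF Rep_Zr_Hom[OF F G] i]])
    qed
  qed (rule Rep_Zr_Hom[OF F G])
  show "\<exists>!f. f \<in> Hom (Rep Q C) G F"
  proof (rule ex1I[of _ "Zr (Rep Q C) G F"])
    fix f assume f: "f \<in> Hom (Rep Q C) G F"
    show "f = Zr (Rep Q C) G F"
    proof (rule Rep_Hom_eqI[OF f Rep_Zr_Hom[OF G F]])
      fix i assume i: "i \<in> verts Q"
      show "cmp f i = cmp (Zr (Rep Q C) G F) i"
        by (rule zero_obj_Hom_eq(2)[OF z[OF i] Rep_HomD(3)[OF f i] Rep_HomD(3)[OF Rep_Zr_Hom[OF G F] i]])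
    qed
  qed (rule Rep_Zr_Hom[OF G F])
qed

lemma mem_paths_to: "(k, p) \<in> paths_to Q j \<longleftrightarrow> awalk k p j"
  unfolding paths_to_def paths_def awalk_def by auto

end

text \<open>
  In the application \<open>d x\<close> is the number of paths starting at \<open>x\<close>.
\<close>

locale left_setting = quiver_reps Q C + hereditary_cotorsion C \<A> \<B>
  for Q :: "('v, 'e) pre_digraph" and C :: "('o, 'm) cat" and \<A> \<B> +
  fixes \<kappa> :: "'k rel" and d :: "'v \<Rightarrow> nat"
  assumes Card_\<kappa>: "Card_order \<kappa>" and AB4: "AB4 \<kappa> C"
    and paths_small: "i \<in> verts Q \<Longrightarrow> |paths_to Q i| <o \<kappa>"
    and d_less: "\<alpha> \<in> arcs Q \<Longrightarrow> d (head Q \<alpha>) < d (tail Q \<alpha>)"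
begin

abbreviation "Uo F i \<equiv> coprod_obj C (arrows_into Q i) (\<lambda>\<alpha>. vob F (tail Q \<alpha>))"
abbreviation "Ui F i \<equiv> coprod_inj C (arrows_into Q i) (\<lambda>\<alpha>. vob F (tail Q \<alpha>))"
abbreviation "\<phi> F i \<equiv> phi Q C F i"

lemma arrows_intoD: "\<alpha> \<in> arrows_into Q i \<Longrightarrow> \<alpha> \<in> arcs Q" "\<alpha> \<in> arrows_into Q i \<Longrightarrow> head Q \<alpha> = i"
  "\<alpha> \<in> arrows_into Q i \<Longrightarrow> tail Q \<alpha> \<in> verts Q"
  by (auto simp: arrows_into_def)

text \<open>An arrow into \<open>i\<close> is a path of length one that ends there, so the bound on
  paths also covers the coproduct in the source of \<open>\<phi>\<close>.\<close>

lemma arrows_small: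
  assumes "i \<in> verts Q"
  shows "|arrows_into Q i| <o \<kappa>"
proof -
  have "|arrows_into Q i| \<le>o |paths_to Q i|"
  proof (rule card_of_ordLeqI)
    show "inj_on (\<lambda>\<alpha>. (tail Q \<alpha>, [\<alpha>])) (arrows_into Q i)" by (rule inj_onI) simp
    show "(tail Q \<alpha>, [\<alpha>]) \<in> paths_to Q i" if "\<alpha> \<in> arrows_into Q i" for \<alpha>
      using arrows_intoD[OF that] by (auto simp: mem_paths_to awalk_def)
  qed
  then show ?thesis by (rule ordLeq_ordLess_trans[OF _ paths_small[OF assms]])
qed

lemma U_coproduct:
  assumes F: "F \<in> reps Q C" and i: "i \<in> verts Q"
  shows "is_coproduct C (arrows_into Q i) (\<lambda>\<alpha>. vob F (tail Q \<alpha>)) (Uo F i) (Ui F i)"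
  by (rule coprod_is_coproduct, rule AB4_ex_coproduct[OF AB4 Card_\<kappa> arrows_small[OF i]])
    (rule repsD(1)[OF F], rule arrows_intoD(3))

lemma phi_props:
  assumes F: "F \<in> reps Q C" and i: "i \<in> verts Q"
  shows "\<phi> F i \<in> Hom C (Uo F i) (vob F i)" "\<alpha> \<in> arrows_into Q i \<Longrightarrow> \<phi> F i \<cdot> Ui F i \<alpha> = amor F \<alpha>"
proof -
  have "\<forall>\<alpha> \<in> arrows_into Q i. amor F \<alpha> \<in> Hom C (vob F (tail Q \<alpha>)) (vob F i)"
  proof
    fix \<alpha> assume a: "\<alpha> \<in> arrows_into Q i"
    show "amor F \<alpha> \<in> Hom C (vob F (tail Q \<alpha>)) (vob F i)"
      using repsD(2)[OF F arrows_intoD(1)[OF a]] unfolding arrows_intoD(2)[OF a] .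
  qed
  from theI'[OF is_coproductD[OF U_coproduct[OF F i] repsD(1)[OF F i] this]]
  show "\<phi> F i \<in> Hom C (Uo F i) (vob F i)" "\<alpha> \<in> arrows_into Q i \<Longrightarrow> \<phi> F i \<cdot> Ui F i \<alpha> = amor F \<alpha>"
    unfolding phi_def Let_def by blast+
qed

text \<open>Naturality of \<open>\<phi>\<close>. The behaviour of \<open>u\<close> on the inclusions
  is kept in the conclusion, since \<open>U_short_exact\<close> recognizes the morphism by
  it.\<close>

lemma U_map:
  assumes f: "f \<in> Hom (Rep Q C) F G" and i: "i \<in> verts Q"
  obtains u where "u \<in> Hom C (Uo F i) (Uo G i)"
    "\<And>\<alpha>. \<alpha> \<in> arrows_into Q i \<Longrightarrow> u \<cdot> Ui F i \<alpha> = Ui G i \<alpha> \<cdot> cmp f (tail Q \<alpha>)"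
    "\<phi> G i \<cdot> u = cmp f i \<cdot> \<phi> F i"
proof -
  note fD = Rep_HomD[OF f]
  note cF = U_coproduct[OF fD(1) i] and cG = U_coproduct[OF fD(2) i]
  note pF = phi_props[OF fD(1) i] and pG = phi_props[OF fD(2) i]
  have "Ui G i \<alpha> \<cdot> cmp f (tail Q \<alpha>) \<in> Hom C (vob F (tail Q \<alpha>)) (Uo G i)" if "\<alpha> \<in> arrows_into Q i" for \<alpha>
    using coproduct_inc[OF cG that] fD(3)[OF arrows_intoD(3)[OF that]] by auto
  then obtain u where u: "u \<in> Hom C (Uo F i) (Uo G i)"
    "\<And>\<alpha>. \<alpha> \<in> arrows_into Q i \<Longrightarrow> u \<cdot> Ui F i \<alpha> = Ui G i \<alpha> \<cdot> cmp f (tail Q \<alpha>)"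
    using coproduct_factor[OF cF coproduct_Obj[OF cG], of "\<lambda>\<alpha>. Ui G i \<alpha> \<cdot> cmp f (tail Q \<alpha>)"] by blast
  have "\<phi> G i \<cdot> u = cmp f i \<cdot> \<phi> F i"
  proof (rule coproduct_eqI[OF cF])
    fix \<alpha> assume a: "\<alpha> \<in> arrows_into Q i"
    note aD = arrows_intoD[OF a]
    note ty = coproduct_inc[OF cF a] coproduct_inc[OF cG a] fD(3)[OF aD(3)] fD(3)[OF i] pF(1) pG(1) u(1)
    have "(\<phi> G i \<cdot> u) \<cdot> Ui F i \<alpha> = \<phi> G i \<cdot> u \<cdot> Ui F i \<alpha>" by (rule comp_assoc) (use ty in auto)
    also have "\<dots> = amor G \<alpha> \<cdot> cmp f (tail Q \<alpha>)" unfolding u(2)[OF a]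
      by (rule comp_cong_left1[OF pG(2)[OF a]]) (use ty in auto)
    also have "\<dots> = cmp f i \<cdot> \<phi> F i \<cdot> Ui F i \<alpha>" unfolding pF(2)[OF a] using fD(4)[OF aD(1)] aD(2) by simp
    also have "\<dots> = (cmp f i \<cdot> \<phi> F i) \<cdot> Ui F i \<alpha>" by (rule comp_assoc[symmetric]) (use ty in auto)
    finally show "(\<phi> G i \<cdot> u) \<cdot> Ui F i \<alpha> = (cmp f i \<cdot> \<phi> F i) \<cdot> Ui F i \<alpha>" .
  qed (use pF(1) pG(1) u(1) fD(3)[OF i] in auto)
  note eq = this
  show thesis by (rule that[OF u(1) _ eq]) (rule u(2))
qed

text \<open>Exactness of coproducts is applied to the short exact sequences at the tails of the
  arrows into \<open>i\<close>.\<close>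

lemma U_short_exact:
  assumes s: "short_exact (Rep Q C) f g" and f: "f \<in> Hom (Rep Q C) F G" and g: "g \<in> Hom (Rep Q C) G H"
    and i: "i \<in> verts Q"
    and u: "u \<in> Hom C (Uo F i) (Uo G i)"
    "\<And>\<alpha>. \<alpha> \<in> arrows_into Q i \<Longrightarrow> u \<cdot> Ui F i \<alpha> = Ui G i \<alpha> \<cdot> cmp f (tail Q \<alpha>)"
    and v: "v \<in> Hom C (Uo G i) (Uo H i)"
    "\<And>\<alpha>. \<alpha> \<in> arrows_into Q i \<Longrightarrow> v \<cdot> Ui G i \<alpha> = Ui H i \<alpha> \<cdot> cmp g (tail Q \<alpha>)"
  shows "short_exact C u v"
proof (rule AB4_short_exact[OF AB4 Card_\<kappa> arrows_small[OF i] U_coproduct[OF Rep_HomD(1)[OF f] i]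
      U_coproduct[OF Rep_HomD(2)[OF f] i] U_coproduct[OF Rep_HomD(2)[OF g] i]])
  fix \<alpha> assume a: "\<alpha> \<in> arrows_into Q i"
  show "cmp f (tail Q \<alpha>) \<in> Hom C (vob F (tail Q \<alpha>)) (vob G (tail Q \<alpha>))"
    "cmp g (tail Q \<alpha>) \<in> Hom C (vob G (tail Q \<alpha>)) (vob H (tail Q \<alpha>))"
    by (rule Rep_HomD(3)[OF f arrows_intoD(3)[OF a]] Rep_HomD(3)[OF g arrows_intoD(3)[OF a]])+
  show "short_exact C (cmp f (tail Q \<alpha>)) (cmp g (tail Q \<alpha>))"
    using s arrows_intoD(3)[OF a] unfolding Rep_short_exact_iff[OF f g] by blast
  show "u \<cdot> Ui F i \<alpha> = Ui G i \<alpha> \<cdot> cmp f (tail Q \<alpha>)" "v \<cdot> Ui G i \<alpha> = Ui H i \<alpha> \<cdot> cmp g (tail Q \<alpha>)"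
    by (rule u v a)+
qed (rule u v)+

text \<open>The condition of \<open>\<Phi>(\<A>)\<close> at a single vertex, isolated because the
  main induction knows it only at vertices of smaller rank than the current one.\<close>

definition good :: "'v \<Rightarrow> ('v, 'e, 'o, 'm) qrep \<Rightarrow> bool" where
  "good i F \<longleftrightarrow> F \<in> reps Q C \<and> is_mono C (\<phi> F i) \<and> Coker C (\<phi> F i) \<in> \<A>"

lemma Phi_iff: "F \<in> Phi Q C \<A> \<longleftrightarrow> F \<in> reps Q C \<and> (\<forall>i \<in> verts Q. good i F)"
  unfolding Phi_def good_def by blast

text \<open>The snake argument for the squares formed by \<open>\<phi>\<close> at \<open>i\<close>.
  The cokernel \<open>cK\<close> is left free because for a stalk it will be an identity.\<close>

lemma coker_sequence:
  assumes s: "short_exact (Rep Q C) k e" and k: "k \<in> Hom (Rep Q C) K E" and e: "e \<in> Hom (Rep Q C) E F"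
    and i: "i \<in> verts Q" and m: "is_mono C (\<phi> F i)" and cK: "is_cokernel C (\<phi> K i) cK"
    and cKH: "cK \<in> Hom C (vob K i) CK"
  obtains cE k' e' where "cE \<in> Hom C (vob E i) (Coker C (\<phi> E i))" "is_cokernel C (\<phi> E i) cE"
    "k' \<in> Hom C CK (Coker C (\<phi> E i))" "e' \<in> Hom C (Coker C (\<phi> E i)) (Coker C (\<phi> F i))"
    "k' \<cdot> cK = cE \<cdot> cmp k i" "short_exact C k' e'"
proof -
  note kD = Rep_HomD[OF k] and eD = Rep_HomD[OF e]
  obtain uk where uk: "uk \<in> Hom C (Uo K i) (Uo E i)"
    "\<And>\<alpha>. \<alpha> \<in> arrows_into Q i \<Longrightarrow> uk \<cdot> Ui K i \<alpha> = Ui E i \<alpha> \<cdot> cmp k (tail Q \<alpha>)"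
    "\<phi> E i \<cdot> uk = cmp k i \<cdot> \<phi> K i" by (rule U_map[OF k i]) (rule that)
  obtain ue where ue: "ue \<in> Hom C (Uo E i) (Uo F i)"
    "\<And>\<alpha>. \<alpha> \<in> arrows_into Q i \<Longrightarrow> ue \<cdot> Ui E i \<alpha> = Ui F i \<alpha> \<cdot> cmp e (tail Q \<alpha>)"
    "\<phi> F i \<cdot> ue = cmp e i \<cdot> \<phi> E i" by (rule U_map[OF e i]) (rule that)
  have us: "short_exact C uk ue" by (rule U_short_exact[OF s k e i uk(1,2) ue(1,2)])
  have vs: "short_exact C (cmp k i) (cmp e i)" using s i unfolding Rep_short_exact_iff[OF k e] by blast
  note pK = phi_props(1)[OF kD(1) i] and pE = phi_props(1)[OF kD(2) i] and pF = phi_props(1)[OF eD(2) i]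
  have "\<phi> E i \<in> Arr C" "\<phi> F i \<in> Arr C" using pE pF by auto
  obtain cE where cE: "is_cokernel C (\<phi> E i) cE" "cE \<in> Hom C (Cod C (\<phi> E i)) (Coker C (\<phi> E i))"
    by (rule Coker_cokernel[OF \<open>\<phi> E i \<in> Arr C\<close>])
  obtain cF where cF: "is_cokernel C (\<phi> F i) cF" "cF \<in> Hom C (Cod C (\<phi> F i)) (Coker C (\<phi> F i))"
    by (rule Coker_cokernel[OF \<open>\<phi> F i \<in> Arr C\<close>])
  have cE': "cE \<in> Hom C (vob E i) (Coker C (\<phi> E i))" and cF': "cF \<in> Hom C (vob F i) (Coker C (\<phi> F i))"
    using cE(2) cF(2) pE pF by auto
  obtain k' e' where "k' \<in> Hom C CK (Coker C (\<phi> E i))" "e' \<in> Hom C (Coker C (\<phi> E i)) (Coker C (\<phi> F i))"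
    "k' \<cdot> cK = cE \<cdot> cmp k i" "e' \<cdot> cE = cF \<cdot> cmp e i" "short_exact C k' e'"
    by (rule snake_cokernels[OF us uk(1) ue(1) vs kD(3)[OF i] eD(3)[OF i] pK pE pF uk(3) ue(3) m
          cK cE(1) cF(1) cKH cE' cF'])
  then show thesis using that[OF cE' cE(1)] by blast
qed

text \<open>\<open>\<phi> K i\<close> is mono because composing it with the inclusion at
  \<open>i\<close> gives \<open>\<phi> P i\<close> after a monomorphism. Its cokernel is then the
  kernel term of a short exact sequence whose other two terms lie in \<open>\<A>\<close>.\<close>

lemma good_kernel:
  assumes s: "short_exact (Rep Q C) k e" and k: "k \<in> Hom (Rep Q C) K P" and e: "e \<in> Hom (Rep Q C) P F"
    and i: "i \<in> verts Q" and gP: "good i P" and gF: "good i F"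
  shows "good i K"
proof -
  note kD = Rep_HomD[OF k] and eD = Rep_HomD[OF e]
  obtain uk where uk: "uk \<in> Hom C (Uo K i) (Uo P i)"
    "\<And>\<alpha>. \<alpha> \<in> arrows_into Q i \<Longrightarrow> uk \<cdot> Ui K i \<alpha> = Ui P i \<alpha> \<cdot> cmp k (tail Q \<alpha>)"
    "\<phi> P i \<cdot> uk = cmp k i \<cdot> \<phi> K i" by (rule U_map[OF k i]) (rule that)
  obtain ue where ue: "ue \<in> Hom C (Uo P i) (Uo F i)"
    "\<And>\<alpha>. \<alpha> \<in> arrows_into Q i \<Longrightarrow> ue \<cdot> Ui P i \<alpha> = Ui F i \<alpha> \<cdot> cmp e (tail Q \<alpha>)"
    "\<phi> F i \<cdot> ue = cmp e i \<cdot> \<phi> P i" by (rule U_map[OF e i]) (rule that)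
  have us: "short_exact C uk ue" by (rule U_short_exact[OF s k e i uk(1,2) ue(1,2)])
  note pK = phi_props(1)[OF kD(1) i] and pP = phi_props(1)[OF kD(2) i]
  have "is_mono C (\<phi> P i \<cdot> uk)"
    by (rule is_mono_comp) (use short_exactD(1)[OF us uk(1) ue(1)] gP pP uk(1) in \<open>auto simp: good_def\<close>)
  then have "is_mono C (cmp k i \<cdot> \<phi> K i)" unfolding uk(3) .
  then have m: "is_mono C (\<phi> K i)" by (rule is_mono_cancel_left) (use pK kD(3)[OF i] in auto)
  have "\<phi> K i \<in> Arr C" using pK by auto
  obtain cK where cK: "is_cokernel C (\<phi> K i) cK" "cK \<in> Hom C (Cod C (\<phi> K i)) (Coker C (\<phi> K i))"
    by (rule Coker_cokernel[OF \<open>\<phi> K i \<in> Arr C\<close>])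
  have cK': "cK \<in> Hom C (vob K i) (Coker C (\<phi> K i))" using cK(2) pK by auto
  have mF: "is_mono C (\<phi> F i)" using gF by (simp add: good_def)
  obtain k' e' where "k' \<in> Hom C (Coker C (\<phi> K i)) (Coker C (\<phi> P i))"
    "e' \<in> Hom C (Coker C (\<phi> P i)) (Coker C (\<phi> F i))" "short_exact C k' e'"
    by (rule coker_sequence[OF s k e i mF cK(1) cK']) (rule that)
  then have "Coker C (\<phi> K i) \<in> \<A>" using A_kernel gP gF unfolding good_def by blast
  then show ?thesis using m kD(1) by (simp add: good_def)
qed

text \<open>For the stalk \<open>\<phi>\<close> vanishes at \<open>i\<close>, so the cokernels at
  \<open>i\<close> form an extension of \<open>Coker C (\<phi> F i)\<close> by \<open>B\<close>, and
  it splits. The splitting composed with \<open>cE\<close> gives a retraction of the original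
  extension, since \<open>cE\<close> kills everything that arrives at \<open>i\<close> along an
  arrow.\<close>

lemma good_ext1_stalk:
  assumes gF: "good i F" and i: "i \<in> verts Q" and B: "B \<in> \<B>"
  shows "ext1_zero (Rep Q C) F (s_rep Q C i B)"
  unfolding ext1_zero_def
proof (intro allI ballI impI)
  let ?s = "s_rep Q C i B"
  have BO: "B \<in> Obj C" by (rule B_Obj[OF B])
  note sP = s_rep_props[OF BO, where i = i]
  fix E a b assume a: "a \<in> Hom (Rep Q C) ?s E" and b: "b \<in> Hom (Rep Q C) E F"
    and ab: "short_exact (Rep Q C) a b"
  note aD = Rep_HomD[OF a] and bD = Rep_HomD[OF b]
  have si: "vob ?s i = B" using sP(2)[OF i] by simp
  note ps = phi_props[OF sP(1) i] and cs = U_coproduct[OF sP(1) i]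
  have "\<phi> ?s i = Zr C (Uo ?s i) B"
  proof (rule coproduct_eqI[OF cs])
    fix \<alpha> assume al: "\<alpha> \<in> arrows_into Q i"
    show "\<phi> ?s i \<cdot> Ui ?s i \<alpha> = Zr C (Uo ?s i) B \<cdot> Ui ?s i \<alpha>"
      using ps(2)[OF al] sP(3)[OF arrows_intoD(1)[OF al]] arrows_intoD(2)[OF al] si
        coproduct_inc[OF cs al] BO by simp
  qed (use ps(1) si coproduct_Obj[OF cs] BO in auto)
  then have c0: "is_cokernel C (\<phi> ?s i) (Idn C B)" using is_cokernel_Zr_Idn[OF coproduct_Obj[OF cs] BO] by simp
  have c0H: "Idn C B \<in> Hom C (vob ?s i) B" using si BO by simp
  have mF: "is_mono C (\<phi> F i)" using gF by (simp add: good_def)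
  obtain cE k' e' where cE: "cE \<in> Hom C (vob E i) (Coker C (\<phi> E i))" "is_cokernel C (\<phi> E i) cE"
    and k': "k' \<in> Hom C B (Coker C (\<phi> E i))" "e' \<in> Hom C (Coker C (\<phi> E i)) (Coker C (\<phi> F i))"
    "k' \<cdot> Idn C B = cE \<cdot> cmp a i" "short_exact C k' e'"
    by (rule coker_sequence[OF ab a b i mF c0 c0H])
  have "ext1_zero C (Coker C (\<phi> F i)) B" using gF B A_iff unfolding good_def by blast
  then obtain r where r: "r \<in> Hom C (Coker C (\<phi> E i)) B" "r \<cdot> k' = Idn C B"
    by (rule ext1_zeroD_retraction[OF _ k'(4,1,2)])
  have ca: "cE \<cdot> cmp a i = k'" using k'(1,3) by simp
  \<comment> \<open>The stalk is zero away from \<open>i\<close>, so the component at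
    \<open>i\<close> alone carries the retraction.\<close>
  let ?rho = "\<lambda>j. if j = i then r \<cdot> cE else Zr C (vob E j) (zero_obj C)"
  have rho: "mk_mor Q E ?s ?rho \<in> Hom (Rep Q C) E ?s"
  proof (rule mk_mor_Hom[OF bD(1) sP(1) _ ends'])
    show "?rho j \<in> Hom C (vob E j) (vob ?s j)" if "j \<in> verts Q" for j
      using r cE repsD(1)[OF bD(1) that] sP(2)[OF that] by auto
    fix \<alpha> assume al: "\<alpha> \<in> arcs Q"
    let ?h = "head Q \<alpha>" and ?t = "tail Q \<alpha>"
    have vt: "?h \<in> verts Q" "?t \<in> verts Q" using al by auto
    have rt: "?rho ?t \<in> Hom C (vob E ?t) (vob ?s ?t)"
      using r cE repsD(1)[OF bD(1) vt(2)] sP(2)[OF vt(2)] by auto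
    note obj = repsD(1)[OF sP(1) vt(1)] repsD(1)[OF sP(1) vt(2)] repsD(1)[OF bD(1) vt(1)] repsD(1)[OF bD(1) vt(2)]
    have "amor ?s \<alpha> \<cdot> ?rho ?t = Zr C (vob E ?t) (vob ?s ?h)" unfolding sP(3)[OF al]
      using rt obj by (simp del: if_split_asm split del: if_split)
    moreover have "?rho ?h \<cdot> amor E \<alpha> = Zr C (vob E ?t) (vob ?s ?h)"
    proof (cases "?h = i")
      case True
      then have ai: "\<alpha> \<in> arrows_into Q i" using al by (simp add: arrows_into_def)
      note pE = phi_props[OF bD(1) i] and cU = coproduct_inc[OF U_coproduct[OF bD(1) i] ai]
      have zE: "cE \<cdot> \<phi> E i = Zr C (Uo E i) (Coker C (\<phi> E i))" using cokernel_Arr(4)[OF cE(2)] pE(1) cE(1) by simp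
      have "(r \<cdot> cE) \<cdot> amor E \<alpha> = r \<cdot> cE \<cdot> \<phi> E i \<cdot> Ui E i \<alpha>"
        unfolding pE(2)[OF ai] by (rule comp_assoc) (use r cE repsD(2)[OF bD(1) al] True in auto)
      also have "cE \<cdot> \<phi> E i \<cdot> Ui E i \<alpha> = Zr C (Uo E i) (Coker C (\<phi> E i)) \<cdot> Ui E i \<alpha>"
        by (rule comp_cong_left1[OF zE]) (use cE(1) pE(1) cU in auto)
      also have "r \<cdot> Zr C (Uo E i) (Coker C (\<phi> E i)) \<cdot> Ui E i \<alpha> = Zr C (vob E ?t) B"
        using cU r(1) Dom_in_Obj[of r] obj(4) by simp
      finally have eq: "(r \<cdot> cE) \<cdot> amor E \<alpha> = Zr C (vob E ?t) B" .
      have e1: "?rho ?h = r \<cdot> cE" and e2: "vob ?s ?h = B" using True si by simp_all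
      show ?thesis unfolding e1 e2 by (rule eq)
    next
      case False
      then show ?thesis using repsD(2)[OF bD(1) al] sP(2)[OF vt(1)] by simp
    qed
    ultimately show "?rho ?h \<cdot> amor E \<alpha> = amor ?s \<alpha> \<cdot> ?rho ?t" by simp
  qed
  have "Comp (Rep Q C) (mk_mor Q E ?s ?rho) a = Idn (Rep Q C) ?s"
  proof (rule Rep_Hom_eqI[OF Rep_Comp_Hom[OF a rho] Rep_Idn_Hom[OF sP(1)]])
    fix j assume j: "j \<in> verts Q"
    show "cmp (Comp (Rep Q C) (mk_mor Q E ?s ?rho) a) j = cmp (Idn (Rep Q C) ?s) j"
    proof (cases "j = i")
      case True
      have "(r \<cdot> cE) \<cdot> cmp a i = r \<cdot> cE \<cdot> cmp a i" by (rule comp_assoc) (use r cE aD(3)[OF i] in auto)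
      then show ?thesis using True i ca r(2) si by simp
    next
      case False
      then have z: "is_zero_obj C (vob ?s j)" using sP(2)[OF j] zero_obj_is_zero by simp
      show ?thesis
        by (rule zero_obj_Hom_eq(1)[OF z Rep_HomD(3)[OF Rep_Comp_Hom[OF a rho] j] Rep_HomD(3)[OF Rep_Idn_Hom[OF sP(1)] j]])
    qed
  qed
  then show "\<exists>s\<in>Hom (Rep Q C) F E. Comp (Rep Q C) b s = Idn (Rep Q C) F"
    using R.retraction_imp_section[OF ab a b rho] by blast
qed

text \<open>
  Replacing \<open>F\<^sub>i\<close> by \<open>W\<close>, with the arrows into \<open>i\<close> lifted along \<open>l\<close>, gives an extension of \<open>F\<close> by
  the stalk representation of \<open>B\<close>.
\<close>

lemma stalk_extension_splits:
  assumes F: "F \<in> reps Q C" and i: "i \<in> verts Q" and B: "B \<in> Obj C"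
    and z: "ext1_zero (Rep Q C) F (s_rep Q C i B)"
    and W: "short_exact C b w" "b \<in> Hom C B W" "w \<in> Hom C W (vob F i)"
    and l: "\<And>\<alpha>. \<alpha> \<in> arrows_into Q i \<Longrightarrow> l \<alpha> \<in> Hom C (vob F (tail Q \<alpha>)) W"
      "\<And>\<alpha>. \<alpha> \<in> arrows_into Q i \<Longrightarrow> w \<cdot> l \<alpha> = amor F \<alpha>"
  obtains r where "r \<in> Hom C W B" "r \<cdot> b = Idn C B"
    "\<And>\<alpha>. \<alpha> \<in> arrows_into Q i \<Longrightarrow> r \<cdot> l \<alpha> = Zr C (vob F (tail Q \<alpha>)) B"
proof -
  let ?s = "s_rep Q C i B"
  note sP = s_rep_props[OF B, where i = i]
  note sw = short_exactD[OF W]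
  \<comment> \<open>\<open>pr\<close> compares the modified vertices with those of \<open>F\<close>,
    and \<open>l'\<close> lifts each arrow of \<open>F\<close> to its modified target; only the
    vertex \<open>i\<close> changes.\<close>
  define ob where "ob j = (if j = i then W else vob F j)" for j
  define pr where "pr j = (if j = i then w else Idn C (vob F j))" for j
  define l' where "l' \<alpha> = (if head Q \<alpha> = i then l \<alpha> else amor F \<alpha>)" for \<alpha>
  have WO: "W \<in> Obj C" using W by auto
  have pr: "pr j \<in> Hom C (ob j) (vob F j)" "is_epi C (pr j)" if "j \<in> verts Q" for j
    using W sw(2) repsD(1)[OF F that] by (auto simp: ob_def pr_def)
  have l': "l' \<alpha> \<in> Hom C (vob F (tail Q \<alpha>)) (ob (head Q \<alpha>))" "pr (head Q \<alpha>) \<cdot> l' \<alpha> = amor F \<alpha>"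
    if al: "\<alpha> \<in> arcs Q" for \<alpha>
  proof -
    have ai: "\<alpha> \<in> arrows_into Q i" if "head Q \<alpha> = i" using al that by (simp add: arrows_into_def)
    show "l' \<alpha> \<in> Hom C (vob F (tail Q \<alpha>)) (ob (head Q \<alpha>))"
      using l(1)[OF ai] repsD(2)[OF F al] by (auto simp: l'_def ob_def)
    show "pr (head Q \<alpha>) \<cdot> l' \<alpha> = amor F \<alpha>"
      using l(2)[OF ai] repsD(2)[OF F al] by (auto simp: l'_def pr_def)
  qed
  \<comment> \<open>An arrow of \<open>E\<close> first projects its tail to \<open>F\<close> and
    then applies the lift. It therefore kills the image of \<open>B\<close>, which makes the stalk a
    subrepresentation.\<close>
  define E where "E = mk_rep Q ob (\<lambda>\<alpha>. l' \<alpha> \<cdot> pr (tail Q \<alpha>))"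
  have E: "E \<in> reps Q C" unfolding E_def
  proof (rule mk_rep_reps[OF _ ends'])
    show "ob j \<in> Obj C" if "j \<in> verts Q" for j using WO repsD(1)[OF F that] by (simp add: ob_def)
    show "l' \<alpha> \<cdot> pr (tail Q \<alpha>) \<in> Hom C (ob (tail Q \<alpha>)) (ob (head Q \<alpha>))" if "\<alpha> \<in> arcs Q" for \<alpha>
      using l'(1)[OF that] pr(1)[of "tail Q \<alpha>"] that by auto
  qed
  have vE: "vob E j = ob j" if "j \<in> verts Q" for j using that by (simp add: E_def)
  have aE: "amor E \<alpha> = l' \<alpha> \<cdot> pr (tail Q \<alpha>)" if "\<alpha> \<in> arcs Q" for \<alpha> using that by (simp add: E_def)
  have q: "mk_mor Q E F pr \<in> Hom (Rep Q C) E F"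
  proof (rule mk_mor_Hom[OF E F _ ends'])
    show "pr j \<in> Hom C (vob E j) (vob F j)" if "j \<in> verts Q" for j using pr(1)[OF that] vE[OF that] by simp
    fix \<alpha> assume al: "\<alpha> \<in> arcs Q"
    show "pr (head Q \<alpha>) \<cdot> amor E \<alpha> = amor F \<alpha> \<cdot> pr (tail Q \<alpha>)" unfolding aE[OF al]
      by (rule comp_cong_left1[OF l'(2)[OF al]])
        (use l'(1)[OF al] pr(1)[of "tail Q \<alpha>"] pr(1)[of "head Q \<alpha>"] al in auto)
  qed
  define aa where "aa j = (if j = i then b else Zr C (zero_obj C) (vob F j))" for j
  have aa: "aa j \<in> Hom C (vob ?s j) (ob j)" if "j \<in> verts Q" for j
    using W repsD(1)[OF F that] sP(2)[OF that] by (auto simp: aa_def ob_def)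
  have praa: "pr j \<cdot> aa j = Zr C (vob ?s j) (vob F j)" if "j \<in> verts Q" for j
    using sw(6) W sP(2)[OF that] repsD(1)[OF F that] by (auto simp: aa_def pr_def)
  have a: "mk_mor Q ?s E aa \<in> Hom (Rep Q C) ?s E"
  proof (rule mk_mor_Hom[OF sP(1) E _ ends'])
    show "aa j \<in> Hom C (vob ?s j) (vob E j)" if "j \<in> verts Q" for j using aa[OF that] vE[OF that] by simp
    fix \<alpha> assume al: "\<alpha> \<in> arcs Q"
    let ?h = "head Q \<alpha>" and ?t = "tail Q \<alpha>"
    have vt: "?h \<in> verts Q" "?t \<in> verts Q" using al by auto
    note ty = aa[OF vt(1)] aa[OF vt(2)] l'(1)[OF al] pr(1)[OF vt(2)] repsD(1)[OF sP(1) vt(2)] repsD(1)[OF sP(1) vt(1)] repsD(1)[OF F vt(2)]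
    have "amor E \<alpha> \<cdot> aa ?t = l' \<alpha> \<cdot> pr ?t \<cdot> aa ?t" unfolding aE[OF al] by (rule comp_assoc) (use ty in auto)
    also have "\<dots> = Zr C (vob ?s ?t) (ob ?h)" unfolding praa[OF vt(2)] using ty by simp
    finally show "aa ?h \<cdot> amor ?s \<alpha> = amor E \<alpha> \<cdot> aa ?t" unfolding sP(3)[OF al] using ty by simp
  qed
  have se: "short_exact (Rep Q C) (mk_mor Q ?s E aa) (mk_mor Q E F pr)"
    unfolding Rep_short_exact_iff[OF a q]
  proof
    fix j assume j: "j \<in> verts Q"
    have "short_exact C (aa j) (pr j)"
      using W(1) short_exact_zero_Idn[OF zero_obj_is_zero repsD(1)[OF F j]] by (simp add: aa_def pr_def)
    then show "short_exact C (cmp (mk_mor Q ?s E aa) j) (cmp (mk_mor Q E F pr) j)" using j by simp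
  qed
  obtain rho where rho: "rho \<in> Hom (Rep Q C) E ?s" "Comp (Rep Q C) rho (mk_mor Q ?s E aa) = Idn (Rep Q C) ?s"
    by (rule R.ext1_zeroD_retraction[OF z se a q])
  note rD = Rep_HomD[OF rho(1)]
  have si: "vob ?s i = B" using sP(2)[OF i] by simp
  have r: "cmp rho i \<in> Hom C W B" using rD(3)[OF i] vE[OF i] si by (simp add: ob_def)
  have rb: "cmp rho i \<cdot> b = Idn C B" using arg_cong[OF rho(2), of "\<lambda>x. cmp x i"] i si by (simp add: aa_def)
  have "cmp rho i \<cdot> l \<alpha> = Zr C (vob F (tail Q \<alpha>)) B" if al: "\<alpha> \<in> arrows_into Q i" for \<alpha>
  proof -
    note aD = arrows_intoD[OF al]
    have ll: "l' \<alpha> = l \<alpha>" using aD by (simp add: l'_def)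
    note ty = pr(1)[OF aD(3)] l(1)[OF al] r rD(3)[OF aD(3)] repsD(1)[OF sP(1) aD(3)] repsD(1)[OF F aD(3)]
    \<comment> \<open>The arrows of the stalk are zero, so naturality of \<open>rho\<close> makes
      \<open>cmp rho i \<cdot> l \<alpha>\<close> vanish after the epimorphism \<open>pr\<close> at
      the tail.\<close>
    have "(cmp rho i \<cdot> l \<alpha>) \<cdot> pr (tail Q \<alpha>) = cmp rho i \<cdot> amor E \<alpha>"
      unfolding aE[OF aD(1)] ll by (rule comp_assoc) (use ty in auto)
    also have "\<dots> = amor ?s \<alpha> \<cdot> cmp rho (tail Q \<alpha>)" using rD(4)[OF aD(1)] aD(2) by simp
    also have "\<dots> = Zr C (ob (tail Q \<alpha>)) B"
      unfolding sP(3)[OF aD(1)] aD(2) si using ty vE[OF aD(3)] B by simp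
    finally show ?thesis by (rule epi_zero[OF pr(2)[OF aD(3)]]) (use ty in auto)
  qed
  note eq = this
  show thesis by (rule that[OF r rb]) (rule eq)
qed

end

lemma (in abelian_category) coproduct_factor_ex:
  assumes "is_coproduct C I X P inc" "Z \<in> Obj C" "\<And>i. i \<in> I \<Longrightarrow> f i \<in> Hom C (X i) Z"
  shows "\<exists>h. h \<in> Hom C P Z \<and> (\<forall>i \<in> I. h \<cdot> inc i = f i)"
proof -
  have "\<forall>i\<in>I. f i \<in> Hom C (X i) Z" by (rule ballI, rule assms(3))
  from is_coproductD[OF assms(1,2) this] show ?thesis by (rule ex1_implies_ex)
qed

section \<open>From vanishing of Ext^1 on stalks to the condition at a vertex; covers\<close>

context left_setting
begin

text \<open>
  Embed the domain of \<open>\<phi>\<close> into some \<open>B \<in> \<B>\<close> by \<open>u\<close>, and twist the trivial extension of \<open>F\<close> by the stalk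
  of \<open>B\<close> with \<open>u\<close>: a splitting shows that \<open>-u\<close> factors through \<open>\<phi>\<close>.
\<close>

lemma mono_if_ext1_stalk:
  assumes F: "F \<in> reps Q C" and i: "i \<in> verts Q"
    and z: "\<And>B. B \<in> \<B> \<Longrightarrow> ext1_zero (Rep Q C) F (s_rep Q C i B)"
  shows "is_mono C (\<phi> F i)"
proof -
  note cU = U_coproduct[OF F i] and pF = phi_props[OF F i]
  note UO = coproduct_Obj[OF cU] and FO = repsD(1)[OF F i]
  obtain B u where u: "B \<in> \<B>" "u \<in> Hom C (Uo F i) B" "is_mono C u" by (rule B_embed[OF UO])
  note BO = B_Obj[OF u(1)]
  obtain S i1 i2 p1 p2 where S: "S \<in> Obj C" "i1 \<in> Hom C B S" "i2 \<in> Hom C (vob F i) S"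
    "p1 \<in> Hom C S B" "p2 \<in> Hom C S (vob F i)" "p1 \<cdot> i1 = Idn C B" "p2 \<cdot> i2 = Idn C (vob F i)"
    "p1 \<cdot> i2 = Zr C (vob F i) B" "p2 \<cdot> i1 = Zr C B (vob F i)" "short_exact C i1 p2"
    by (rule biproduct_short_exact[OF BO FO])
  \<comment> \<open>Each lift differs from the obvious one,
    \<open>i2 \<cdot> amor F \<alpha>\<close>, by a component \<open>u\<close> in \<open>B\<close>;
    a splitting has to undo this twist.\<close>
  let ?l = "\<lambda>\<alpha>. Add C (i1 \<cdot> u \<cdot> Ui F i \<alpha>) (i2 \<cdot> amor F \<alpha>)"
  have am: "amor F \<alpha> \<in> Hom C (vob F (tail Q \<alpha>)) (vob F i)" if al: "\<alpha> \<in> arrows_into Q i" for \<alpha>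
    using repsD(2)[OF F arrows_intoD(1)[OF al]] unfolding arrows_intoD(2)[OF al] .
  have l: "?l \<alpha> \<in> Hom C (vob F (tail Q \<alpha>)) S" if al: "\<alpha> \<in> arrows_into Q i" for \<alpha>
    using coproduct_inc[OF cU al] am[OF al] u(2) S(2,3) by auto
  have pl: "p2 \<cdot> ?l \<alpha> = amor F \<alpha>" if al: "\<alpha> \<in> arrows_into Q i" for \<alpha>
  proof -
    note ty = coproduct_inc[OF cU al] am[OF al] u(2) S(2,3,5) FO BO
    have "p2 \<cdot> ?l \<alpha> = Add C (p2 \<cdot> i1 \<cdot> u \<cdot> Ui F i \<alpha>) (p2 \<cdot> i2 \<cdot> amor F \<alpha>)"
      by (rule comp_Add) (use ty in auto)
    also have "p2 \<cdot> i1 \<cdot> u \<cdot> Ui F i \<alpha> = Zr C B (vob F i) \<cdot> u \<cdot> Ui F i \<alpha>"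
      by (rule comp_cong_left1[OF S(9)]) (use ty in auto)
    also have "p2 \<cdot> i2 \<cdot> amor F \<alpha> = Idn C (vob F i) \<cdot> amor F \<alpha>"
      by (rule comp_cong_left1[OF S(7)]) (use ty in auto)
    finally show ?thesis using ty by simp
  qed
  obtain r where r: "r \<in> Hom C S B" "r \<cdot> i1 = Idn C B"
    and rl: "\<And>\<alpha>. \<alpha> \<in> arrows_into Q i \<Longrightarrow> r \<cdot> ?l \<alpha> = Zr C (vob F (tail Q \<alpha>)) B"
    by (rule stalk_extension_splits[OF F i BO z[OF u(1)] S(10,2,5), of ?l]) (assumption | erule l | erule pl | rule that)+
  \<comment> \<open>On each inclusion, \<open>r \<cdot> ?l \<alpha> = 0\<close> says that
    \<open>u\<close> and \<open>r \<cdot> i2 \<cdot> \<phi> F i\<close> add up to zero. Since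
    \<open>u\<close> is mono, what \<open>\<phi> F i\<close> kills must be zero.\<close>
  have "(r \<cdot> i2) \<cdot> \<phi> F i = neg u"
  proof (rule coproduct_eqI[OF cU])
    fix \<alpha> assume al: "\<alpha> \<in> arrows_into Q i"
    note ty = coproduct_inc[OF cU al] am[OF al] u(2) S(2,3,5) r(1) pF(1) FO BO
    have "r \<cdot> ?l \<alpha> = Add C (r \<cdot> i1 \<cdot> u \<cdot> Ui F i \<alpha>) (r \<cdot> i2 \<cdot> amor F \<alpha>)"
      by (rule comp_Add) (use ty in auto)
    also have "r \<cdot> i1 \<cdot> u \<cdot> Ui F i \<alpha> = Idn C B \<cdot> u \<cdot> Ui F i \<alpha>"
      by (rule comp_cong_left1[OF r(2)]) (use ty in auto)
    also have "\<dots> = u \<cdot> Ui F i \<alpha>" using ty by simp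
    finally have sum: "Add C (u \<cdot> Ui F i \<alpha>) (r \<cdot> i2 \<cdot> amor F \<alpha>) = Zr C (vob F (tail Q \<alpha>)) B"
      unfolding rl[OF al] by simp
    have "r \<cdot> i2 \<cdot> amor F \<alpha> = neg (u \<cdot> Ui F i \<alpha>)"
      by (rule eq_neg_iff) (use sum ty in simp_all)
    then have "r \<cdot> i2 \<cdot> \<phi> F i \<cdot> Ui F i \<alpha> = neg (u \<cdot> Ui F i \<alpha>)" unfolding pF(2)[OF al] .
    then show "((r \<cdot> i2) \<cdot> \<phi> F i) \<cdot> Ui F i \<alpha> = neg u \<cdot> Ui F i \<alpha>" using ty by simp
  qed (use r S u pF in auto)
  note eq = this
  show ?thesis
  proof (rule is_monoI)
    show "\<phi> F i \<in> Arr C" using pF(1) by auto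
    fix T x assume "x \<in> Hom C T (Dom C (\<phi> F i))" "\<phi> F i \<cdot> x = Zr C T (Cod C (\<phi> F i))"
    then have x: "x \<in> Hom C T (Uo F i)" "\<phi> F i \<cdot> x = Zr C T (vob F i)" "T \<in> Obj C" using pF(1) by auto
    have "neg u \<cdot> x = (r \<cdot> i2) \<cdot> \<phi> F i \<cdot> x"
      by (rule comp_cong_left1[OF eq, symmetric]) (use r S pF x in auto)
    also have "\<dots> = Zr C T B" unfolding x(2) using r(1) S(3) x(3) by simp
    finally have "neg (u \<cdot> x) = Zr C T B" using u(2) x(1) by simp
    then have "neg (neg (u \<cdot> x)) = neg (Zr C T B)" by simp
    then have "u \<cdot> x = Zr C T B" using u(2) x(1,3) BO by simp
    then have "x = Zr C T (Uo F i)" by (rule mono_zero[OF u(3)]) (use u x in auto)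
    then show "x = Zr C T (Dom C (\<phi> F i))" using pF(1) by simp
  qed
qed

text \<open>
  An extension \<open>V\<close> of the cokernel of \<open>\<phi>\<close> by \<open>B\<close> pulls back to an extension \<open>W\<close> of \<open>F\<^sub>i\<close> through which
  \<open>\<phi>\<close> factors, so the previous construction applies.
\<close>

lemma good_if_ext1_stalk:
  assumes F: "F \<in> reps Q C" and i: "i \<in> verts Q"
    and z: "\<And>B. B \<in> \<B> \<Longrightarrow> ext1_zero (Rep Q C) F (s_rep Q C i B)"
  shows "good i F"
proof -
  note cU = U_coproduct[OF F i] and pF = phi_props[OF F i]
  note UO = coproduct_Obj[OF cU] and FO = repsD(1)[OF F i]
  have m: "is_mono C (\<phi> F i)" by (rule mono_if_ext1_stalk[OF F i]) (rule z)
  have pA: "\<phi> F i \<in> Arr C" using pF(1) by auto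
  obtain c where c: "is_cokernel C (\<phi> F i) c" "Cod C c = Coker C (\<phi> F i)" by (rule Coker_cokernel[OF pA])
  define K where "K = Coker C (\<phi> F i)"
  have cH: "c \<in> Hom C (vob F i) K" using cokernel_Arr[OF c(1)] c(2) pF(1) by (auto simp: K_def)
  have KO: "K \<in> Obj C" using cH by auto
  have cse: "short_exact C (\<phi> F i) c" by (rule short_exact_if_cokernel[OF c(1) m])
  note cs = short_exactD[OF cse pF(1) cH]
  have am: "amor F \<alpha> \<in> Hom C (vob F (tail Q \<alpha>)) (vob F i)" if al: "\<alpha> \<in> arrows_into Q i" for \<alpha>
    using repsD(2)[OF F arrows_intoD(1)[OF al]] unfolding arrows_intoD(2)[OF al] .
  have "ext1_zero C K B" if B: "B \<in> \<B>" for B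
    unfolding ext1_zero_def
  proof (intro allI ballI impI)
    fix V b v assume b: "b \<in> Hom C B V" and v: "v \<in> Hom C V K" and bv: "short_exact C b v"
    note BO = B_Obj[OF B] and bs = short_exactD[OF bv b v]
    have VO: "V \<in> Obj C" using v by auto
    obtain W j q v1 where W: "short_exact C j q" "j \<in> Hom C B W" "q \<in> Hom C W (vob F i)" "v1 \<in> Hom C W V"
      "v \<cdot> v1 = c \<cdot> q" "v1 \<cdot> j = b"
      and univ: "\<And>T a b. a \<in> Hom C T V \<Longrightarrow> b \<in> Hom C T (vob F i) \<Longrightarrow> v \<cdot> a = c \<cdot> b \<Longrightarrow>
         \<exists>h \<in> Hom C T W. v1 \<cdot> h = a \<and> q \<cdot> h = b"
      and uniq: "\<And>T h h'. h \<in> Hom C T W \<Longrightarrow> h' \<in> Hom C T W \<Longrightarrow> v1 \<cdot> h = v1 \<cdot> h' \<Longrightarrow> q \<cdot> h = q \<cdot> h' \<Longrightarrow> h = h'"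
      by (rule pullback_short_exact[OF bv b v cH]) (rule that)
    have WO: "W \<in> Obj C" using W by auto
    have "v \<cdot> Zr C (Uo F i) V = c \<cdot> \<phi> F i" using cs(6) v UO by simp
    moreover have "Zr C (Uo F i) V \<in> Hom C (Uo F i) V" using UO VO by simp
    \<comment> \<open>\<open>\<phi> F i\<close> lifted to the pullback with zero component in
      \<open>V\<close>, which is legitimate because \<open>c\<close> kills
      \<open>\<phi> F i\<close>.\<close>
    ultimately obtain L where L: "L \<in> Hom C (Uo F i) W" "v1 \<cdot> L = Zr C (Uo F i) V" "q \<cdot> L = \<phi> F i"
      using univ pF(1) by blast
    let ?l = "\<lambda>\<alpha>. L \<cdot> Ui F i \<alpha>"
    have l: "?l \<alpha> \<in> Hom C (vob F (tail Q \<alpha>)) W" if "\<alpha> \<in> arrows_into Q i" for \<alpha>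
      using coproduct_inc[OF cU that] L(1) by auto
    have ql: "q \<cdot> ?l \<alpha> = amor F \<alpha>" if al: "\<alpha> \<in> arrows_into Q i" for \<alpha>
    proof -
      have "q \<cdot> ?l \<alpha> = \<phi> F i \<cdot> Ui F i \<alpha>"
        by (rule comp_cong_left1[OF L(3)]) (use coproduct_inc[OF cU al] L(1) W in auto)
      then show ?thesis using pF(2)[OF al] by simp
    qed
    obtain r where r: "r \<in> Hom C W B" "r \<cdot> j = Idn C B"
      and rl: "\<And>\<alpha>. \<alpha> \<in> arrows_into Q i \<Longrightarrow> r \<cdot> ?l \<alpha> = Zr C (vob F (tail Q \<alpha>)) B"
      by (rule stalk_extension_splits[OF F i BO z[OF B] W(1-3), of ?l]) (assumption | erule l | erule ql | rule that)+
    have rL: "r \<cdot> L = Zr C (Uo F i) B"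
    proof (rule coproduct_eqI[OF cU])
      fix \<alpha> assume al: "\<alpha> \<in> arrows_into Q i"
      have "(r \<cdot> L) \<cdot> Ui F i \<alpha> = r \<cdot> L \<cdot> Ui F i \<alpha>"
        by (rule comp_assoc) (use coproduct_inc[OF cU al] L(1) r in auto)
      then show "(r \<cdot> L) \<cdot> Ui F i \<alpha> = Zr C (Uo F i) B \<cdot> Ui F i \<alpha>"
        using rl[OF al] coproduct_inc[OF cU al] BO by simp
    qed (use r L UO BO in auto)
    \<comment> \<open>\<open>W\<close> is also an extension of \<open>V\<close>: the projection
      \<open>v1\<close> has the same kernel as \<open>c\<close>, namely the source of
      \<open>\<phi> F i\<close>.\<close>
    have se: "short_exact C L v1"
    proof (rule short_exactI[OF L(1) W(4) L(2)])
      fix T x assume x: "T \<in> Obj C" "x \<in> Hom C T (Uo F i)" "L \<cdot> x = Zr C T W"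
      have "\<phi> F i \<cdot> x = q \<cdot> L \<cdot> x" by (rule comp_cong_left1[OF L(3), symmetric]) (use L W x in auto)
      then have "\<phi> F i \<cdot> x = Zr C T (vob F i)" unfolding x(3) using W(3) x(1) by simp
      then show "x = Zr C T (Uo F i)" by (rule mono_zero[OF m]) (use pF x in auto)
    next
      obtain T e x where x: "is_epi C e" "e \<in> Hom C T V" "x \<in> Hom C T (vob F i)" "c \<cdot> x = v \<cdot> e"
        by (rule epi_lift[OF cs(2) cH v])
      obtain h where h: "h \<in> Hom C T W" "v1 \<cdot> h = e" using univ[OF x(2,3) x(4)[symmetric]] by blast
      show "is_epi C v1" by (rule epi_if_lifts[OF W(4) x(1,2) h])
    next
      fix T y assume y: "T \<in> Obj C" "y \<in> Hom C T W" "v1 \<cdot> y = Zr C T V"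
      have "c \<cdot> q \<cdot> y = v \<cdot> v1 \<cdot> y" by (rule comp_cong_left[OF W(5)[symmetric]]) (use W y cH v in auto)
      then have cqy: "c \<cdot> q \<cdot> y = Zr C T K" unfolding y(3) using v y(1) by simp
      have qy: "q \<cdot> y \<in> Hom C T (vob F i)" using W y by auto
      have cqy': "c \<cdot> q \<cdot> y = Zr C (Dom C (q \<cdot> y)) (Cod C c)" using cqy qy cH by simp
      obtain w where w: "w \<in> Arr C" "Dom C w = Dom C (q \<cdot> y)" "Cod C w = Dom C (\<phi> F i)" "\<phi> F i \<cdot> w = q \<cdot> y"
        by (rule kernel_factor[OF cs(3) _ _ cqy']) (use qy cH in auto)
      have wH: "w \<in> Hom C T (Uo F i)" using w(1-3) qy pF(1) by auto
      have "L \<cdot> w = y"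
      proof (rule uniq[of _ T])
        have "v1 \<cdot> L \<cdot> w = Zr C (Uo F i) V \<cdot> w" by (rule comp_cong_left1[OF L(2)]) (use L W wH in auto)
        then show "v1 \<cdot> L \<cdot> w = v1 \<cdot> y" unfolding y(3) using wH VO by simp
        have "q \<cdot> L \<cdot> w = \<phi> F i \<cdot> w" by (rule comp_cong_left1[OF L(3)]) (use L W wH in auto)
        then show "q \<cdot> L \<cdot> w = q \<cdot> y" unfolding w(4) .
      qed (use L wH y in auto)
      then have "L \<cdot> w = y \<cdot> Idn C T" using y by simp
      then show "\<exists>T' e. \<exists>x\<in>Hom C T' (Uo F i). is_epi C e \<and> e \<in> Hom C T' T \<and> L \<cdot> x = y \<cdot> e"
        using wH y(1) by (intro exI[of _ T] exI[of _ "Idn C T"] bexI[of _ w]) auto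
    qed
    note ss = short_exactD[OF se L(1) W(4)]
    \<comment> \<open>As \<open>r\<close> kills \<open>L\<close>, it descends along
      \<open>v1\<close> to \<open>V\<close>, and there it is a retraction of
      \<open>b\<close>.\<close>
    obtain r' where r': "r' \<in> Arr C" "Cod C r' = Cod C r" "Dom C r' = Cod C v1" "r' \<cdot> v1 = r"
      by (rule cokernel_factor[OF ss(4), of r]) (use r(1) L(1) rL in auto)
    have r'H: "r' \<in> Hom C V B" using r'(1-3) r(1) W(4) by auto
    have "r' \<cdot> v1 \<cdot> j = r \<cdot> j" by (rule comp_cong_left1[OF r'(4)]) (use r'H W in auto)
    then have "r' \<cdot> b = Idn C B" unfolding W(6) r(2) .
    then show "\<exists>s\<in>Hom C K V. v \<cdot> s = Idn C K"
      using retraction_imp_section[OF bv b v r'H] by blast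
  qed
  then have "K \<in> \<A>" using A_iff KO by blast
  then show ?thesis using m F by (simp add: good_def K_def)
qed

text \<open>
  The cover is the coproduct over all vertices \<open>k\<close> of \<open>f\<^sub>k(A\<^sub>k)\<close>, where \<open>A\<^sub>k \<in> \<A>\<close> covers \<open>E\<^sub>k\<close>.
\<close>

lemma good_cover:
  assumes E: "E \<in> reps Q C"
  obtains P p where "p \<in> Hom (Rep Q C) P E" "is_epi (Rep Q C) p" "\<And>i. i \<in> verts Q \<Longrightarrow> good i P"
proof -
  have "\<forall>j \<in> verts Q. \<exists>x. fst x \<in> \<A> \<and> snd x \<in> Hom C (fst x) (vob E j) \<and> is_epi C (snd x)"
  proof
    fix j assume j: "j \<in> verts Q"
    obtain A p where "A \<in> \<A>" "p \<in> Hom C A (vob E j)" "is_epi C p" by (rule A_cover[OF repsD(1)[OF E j]])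
    then show "\<exists>x. fst x \<in> \<A> \<and> snd x \<in> Hom C (fst x) (vob E j) \<and> is_epi C (snd x)"
      by (intro exI[of _ "(A, p)"]) simp
  qed
  from bchoice[OF this] obtain x where
    x: "\<forall>j \<in> verts Q. fst (x j) \<in> \<A> \<and> snd (x j) \<in> Hom C (fst (x j)) (vob E j) \<and> is_epi C (snd (x j))" by blast
  define A where "A j = fst (x j)" for j
  define a where "a j = snd (x j)" for j
  have A: "A j \<in> \<A>" "a j \<in> Hom C (A j) (vob E j)" "is_epi C (a j)" "A j \<in> Obj C" if "j \<in> verts Q" for j
    using bspec[OF x that] A_Obj unfolding A_def a_def by blast+
  have start: "fst \<rho> \<in> verts Q" if "\<rho> \<in> paths_to Q j" for \<rho> j
    using that mem_paths_to[of "fst \<rho>" "snd \<rho>" j] unfolding awalk_def by simp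
  \<comment> \<open>One copy of \<open>A k\<close> for each path from \<open>k\<close> to
    \<open>j\<close>. The coproduct of free representations is formed directly in this way, so that
    only coproducts over sets of paths ending at one vertex are needed.\<close>
  define P where "P j = coprod_obj C (paths_to Q j) (\<lambda>\<rho>. A (fst \<rho>))" for j
  define I where "I j = coprod_inj C (paths_to Q j) (\<lambda>\<rho>. A (fst \<rho>))" for j
  have cP: "is_coproduct C (paths_to Q j) (\<lambda>\<rho>. A (fst \<rho>)) (P j) (I j)" if "j \<in> verts Q" for j
    unfolding P_def I_def
    by (rule coprod_is_coproduct, rule AB4_ex_coproduct[OF AB4 Card_\<kappa> paths_small[OF that]])
      (rule A(4), rule start)
  have IH: "I j \<rho> \<in> Hom C (A (fst \<rho>)) (P j)" if "j \<in> verts Q" "\<rho> \<in> paths_to Q j" for j \<rho>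
    by (rule coproduct_inc[OF cP[OF that(1)] that(2)])
  have PO: "P j \<in> Obj C" if "j \<in> verts Q" for j by (rule coproduct_Obj[OF cP[OF that]])
  have snoc: "(fst \<rho>, snd \<rho> @ [\<alpha>]) \<in> paths_to Q (head Q \<alpha>)" if "\<alpha> \<in> arcs Q" "\<rho> \<in> paths_to Q (tail Q \<alpha>)" for \<alpha> \<rho>
  proof -
    have "awalk (fst \<rho>) (snd \<rho>) (tail Q \<alpha>)" using that(2) mem_paths_to[of "fst \<rho>" "snd \<rho>"] by simp
    from awalk_appendI[OF this arc_implies_awalk[OF that(1)]] show ?thesis unfolding mem_paths_to .
  qed
  have triv: "(j, []) \<in> paths_to Q j" if "j \<in> verts Q" for j
    using that by (simp add: mem_paths_to awalk_Nil_iff)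
  have path_cases: "(\<exists>\<alpha> p'. \<rho> = (fst \<rho>, p' @ [\<alpha>]) \<and> \<alpha> \<in> arrows_into Q j \<and> (fst \<rho>, p') \<in> paths_to Q (tail Q \<alpha>)) \<or> \<rho> = (j, [])"
    if \<rho>: "\<rho> \<in> paths_to Q j" for \<rho> j
  proof -
    obtain k p where kp: "\<rho> = (k, p)" by (cases \<rho>)
    have w: "awalk k p j" using \<rho> kp mem_paths_to by simp
    show ?thesis
    proof (cases p rule: rev_cases)
      case Nil
      then show ?thesis using w kp by (simp add: awalk_Nil_iff)
    next
      case (snoc p' \<alpha>)
      have w': "awalk k p' (awlast k p')" "awalk (awlast k p') [\<alpha>] j"
        using w unfolding snoc awalk_append_iff by blast+
      have "\<alpha> \<in> arcs Q" "tail Q \<alpha> = awlast k p'" "head Q \<alpha> = j"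
        using w'(2) unfolding awalk_def by simp_all
      then show ?thesis using w'(1) unfolding kp snoc arrows_into_def
        by (intro disjI1 exI[of _ \<alpha>] exI[of _ p']) (simp add: mem_paths_to)
    qed
  qed
  have "\<forall>\<alpha> \<in> arcs Q. \<exists>m. m \<in> Hom C (P (tail Q \<alpha>)) (P (head Q \<alpha>)) \<and>
      (\<forall>\<rho> \<in> paths_to Q (tail Q \<alpha>). m \<cdot> I (tail Q \<alpha>) \<rho> = I (head Q \<alpha>) (fst \<rho>, snd \<rho> @ [\<alpha>]))"
  proof
    fix \<alpha> assume al: "\<alpha> \<in> arcs Q"
    have vt: "head Q \<alpha> \<in> verts Q" "tail Q \<alpha> \<in> verts Q" using al by auto
    have "I (head Q \<alpha>) (fst \<rho>, snd \<rho> @ [\<alpha>]) \<in> Hom C (A (fst \<rho>)) (P (head Q \<alpha>))" if "\<rho> \<in> paths_to Q (tail Q \<alpha>)" for \<rho>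
      using IH[OF vt(1) snoc[OF al that]] by simp
    then show "\<exists>m. m \<in> Hom C (P (tail Q \<alpha>)) (P (head Q \<alpha>)) \<and>
      (\<forall>\<rho> \<in> paths_to Q (tail Q \<alpha>). m \<cdot> I (tail Q \<alpha>) \<rho> = I (head Q \<alpha>) (fst \<rho>, snd \<rho> @ [\<alpha>]))"
      by (rule coproduct_factor_ex[OF cP[OF vt(2)] PO[OF vt(1)]])
  qed
  from bchoice[OF this] obtain m where m': "\<forall>\<alpha> \<in> arcs Q. m \<alpha> \<in> Hom C (P (tail Q \<alpha>)) (P (head Q \<alpha>)) \<and>
      (\<forall>\<rho> \<in> paths_to Q (tail Q \<alpha>). m \<alpha> \<cdot> I (tail Q \<alpha>) \<rho> = I (head Q \<alpha>) (fst \<rho>, snd \<rho> @ [\<alpha>]))" by (rule exE) (rule that)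
  have m: "m \<alpha> \<in> Hom C (P (tail Q \<alpha>)) (P (head Q \<alpha>))" if "\<alpha> \<in> arcs Q" for \<alpha>
    by (rule conjunct1[OF bspec[OF m' that]])
  have m2: "m \<alpha> \<cdot> I (tail Q \<alpha>) \<rho> = I (head Q \<alpha>) (fst \<rho>, snd \<rho> @ [\<alpha>])"
    if "\<alpha> \<in> arcs Q" "\<rho> \<in> paths_to Q (tail Q \<alpha>)" for \<alpha> \<rho>
    by (rule bspec[OF conjunct2[OF bspec[OF m' that(1)]] that(2)])
  define R where "R = mk_rep Q P m"
  have R: "R \<in> reps Q C" unfolding R_def by (rule mk_rep_reps[OF _ ends']) (erule PO | erule m | assumption)+
  have vR: "vob R j = P j" if "j \<in> verts Q" for j using that by (simp add: R_def)
  have aR: "amor R \<alpha> = m \<alpha>" if "\<alpha> \<in> arcs Q" for \<alpha> using that by (simp add: R_def)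
  \<comment> \<open>The component of the cover on a path: apply \<open>a\<close> at the starting
    vertex, then the arrows of \<open>E\<close> along the path.\<close>
  define ev where "ev \<rho> = fold (\<lambda>\<alpha> f. amor E \<alpha> \<cdot> f) (snd \<rho>) (a (fst \<rho>))" for \<rho>
  have ev_snoc: "ev (fst \<rho>, snd \<rho> @ [\<alpha>]) = amor E \<alpha> \<cdot> ev \<rho>" for \<rho> \<alpha> by (simp add: ev_def)
  have evw: "ev (k, p) \<in> Hom C (A k) (vob E j)" if "awalk k p j" for k p j
    using that
  proof (induction p arbitrary: j rule: rev_induct)
    case Nil
    then have "k = j" "j \<in> verts Q" by (auto simp: awalk_Nil_iff)
    then show ?case using A(2)[OF \<open>j \<in> verts Q\<close>] by (simp add: ev_def)
  next
    case (snoc \<alpha> p)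
    have w: "awalk k p (awlast k p)" "awalk (awlast k p) [\<alpha>] j"
      using snoc.prems unfolding awalk_append_iff by blast+
    have al: "\<alpha> \<in> arcs Q" "tail Q \<alpha> = awlast k p" "head Q \<alpha> = j"
      using w(2) unfolding awalk_def by simp_all
    show ?case using snoc.IH[OF w(1)] repsD(2)[OF E al(1)] al(2,3) ev_snoc[of "(k, p)" \<alpha>] by simp
  qed
  have evH: "ev \<rho> \<in> Hom C (A (fst \<rho>)) (vob E j)" if "\<rho> \<in> paths_to Q j" for \<rho> j
    using that mem_paths_to[of "fst \<rho>" "snd \<rho>" j] evw[of "fst \<rho>" "snd \<rho>" j] by simp
  have "\<forall>j \<in> verts Q. \<exists>t. t \<in> Hom C (P j) (vob E j) \<and> (\<forall>\<rho> \<in> paths_to Q j. t \<cdot> I j \<rho> = ev \<rho>)"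
  proof
    fix j assume j: "j \<in> verts Q"
    show "\<exists>t. t \<in> Hom C (P j) (vob E j) \<and> (\<forall>\<rho> \<in> paths_to Q j. t \<cdot> I j \<rho> = ev \<rho>)"
      by (rule coproduct_factor_ex[OF cP[OF j] repsD(1)[OF E j]]) (erule evH)
  qed
  from bchoice[OF this] obtain t where t': "\<forall>j \<in> verts Q. t j \<in> Hom C (P j) (vob E j) \<and>
    (\<forall>\<rho> \<in> paths_to Q j. t j \<cdot> I j \<rho> = ev \<rho>)" by (rule exE) (rule that)
  have t: "t j \<in> Hom C (P j) (vob E j)" if "j \<in> verts Q" for j
    by (rule conjunct1[OF bspec[OF t' that]])
  have t2: "t j \<cdot> I j \<rho> = ev \<rho>" if "j \<in> verts Q" "\<rho> \<in> paths_to Q j" for j \<rho>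
    by (rule bspec[OF conjunct2[OF bspec[OF t' that(1)]] that(2)])
  have tM: "mk_mor Q R E t \<in> Hom (Rep Q C) R E"
  proof (rule mk_mor_Hom[OF R E _ ends'])
    show "t j \<in> Hom C (vob R j) (vob E j)" if "j \<in> verts Q" for j using t[OF that] vR[OF that] by simp
    fix \<alpha> assume al: "\<alpha> \<in> arcs Q"
    let ?h = "head Q \<alpha>" and ?t = "tail Q \<alpha>"
    have vt: "?h \<in> verts Q" "?t \<in> verts Q" using al by auto
    note ty = t[OF vt(1)] t[OF vt(2)] m[OF al] repsD(2)[OF E al]
    show "t ?h \<cdot> amor R \<alpha> = amor E \<alpha> \<cdot> t ?t" unfolding aR[OF al]
    proof (rule coproduct_eqI[OF cP[OF vt(2)]])
      fix \<rho> assume \<rho>: "\<rho> \<in> paths_to Q ?t"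
      note ty' = ty IH[OF vt(2) \<rho>]
      have "(t ?h \<cdot> m \<alpha>) \<cdot> I ?t \<rho> = t ?h \<cdot> m \<alpha> \<cdot> I ?t \<rho>" by (rule comp_assoc) (use ty' in auto)
      also have "\<dots> = ev (fst \<rho>, snd \<rho> @ [\<alpha>])" unfolding m2[OF al \<rho>] by (rule t2[OF vt(1) snoc[OF al \<rho>]])
      also have "\<dots> = amor E \<alpha> \<cdot> t ?t \<cdot> I ?t \<rho>" unfolding ev_snoc t2[OF vt(2) \<rho>] ..
      also have "\<dots> = (amor E \<alpha> \<cdot> t ?t) \<cdot> I ?t \<rho>" by (rule comp_assoc[symmetric]) (use ty' in auto)
      finally show "(t ?h \<cdot> m \<alpha>) \<cdot> I ?t \<rho> = (amor E \<alpha> \<cdot> t ?t) \<cdot> I ?t \<rho>" .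
    qed (use ty in auto)
  qed
  \<comment> \<open>On the summand of the trivial path \<open>t j\<close> is the epimorphism
    \<open>a j\<close>.\<close>
  have "is_epi C (t j)" if j: "j \<in> verts Q" for j
  proof (rule is_epi_cancel_right[of "t j" "I j (j, [])"])
    show "is_epi C (t j \<cdot> I j (j, []))" unfolding t2[OF j triv[OF j]] using A(3)[OF j] by (simp add: ev_def)
  qed (use t[OF j] IH[OF j triv[OF j]] in auto)
  then have tE: "is_epi (Rep Q C) (mk_mor Q R E t)" unfolding Rep_epi_iff[OF tM] by simp
  have "good j R" if j: "j \<in> verts Q" for j
  proof -
    note cU = U_coproduct[OF R j] and pR = phi_props[OF R j]
    note UO = coproduct_Obj[OF cU]
    have pRH: "\<phi> R j \<in> Hom C (Uo R j) (P j)" using pR(1) vR[OF j] by simp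
    have UiH: "Ui R j \<alpha> \<in> Hom C (P (tail Q \<alpha>)) (Uo R j)" if "\<alpha> \<in> arrows_into Q j" for \<alpha>
      using coproduct_inc[OF cU that] vR[OF arrows_intoD(3)[OF that]] by simp
    have pU: "\<phi> R j \<cdot> Ui R j \<alpha> = m \<alpha>" if "\<alpha> \<in> arrows_into Q j" for \<alpha>
      using pR(2)[OF that] aR[OF arrows_intoD(1)[OF that]] by simp
    \<comment> \<open>A nontrivial path is a last arrow after a path to the tail of that arrow. This
      identifies the summands of the nontrivial paths with the source of \<open>\<phi> R j\<close>
      and defines its left inverse \<open>\<psi>\<close>, which is zero on the trivial path.\<close>
    let ?f = "\<lambda>\<rho>. if snd \<rho> = [] then Zr C (A (fst \<rho>)) (Uo R j)
      else Ui R j (last (snd \<rho>)) \<cdot> I (tail Q (last (snd \<rho>))) (fst \<rho>, butlast (snd \<rho>))"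
    have fH: "?f \<rho> \<in> Hom C (A (fst \<rho>)) (Uo R j)" if \<rho>: "\<rho> \<in> paths_to Q j" for \<rho>
      using path_cases[OF \<rho>]
    proof
      assume "\<exists>\<alpha> p'. \<rho> = (fst \<rho>, p' @ [\<alpha>]) \<and> \<alpha> \<in> arrows_into Q j \<and> (fst \<rho>, p') \<in> paths_to Q (tail Q \<alpha>)"
      then obtain \<alpha> p' where ap: "snd \<rho> = p' @ [\<alpha>]" "\<alpha> \<in> arrows_into Q j" "(fst \<rho>, p') \<in> paths_to Q (tail Q \<alpha>)"
        by (metis snd_conv)
      then show ?thesis using UiH[OF ap(2)] IH[OF arrows_intoD(3)[OF ap(2)] ap(3)] by simp
    next
      assume "\<rho> = (j, [])"
      then show ?thesis using A(4)[OF j] UO by simp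
    qed
    obtain \<psi> where \<psi>: "\<psi> \<in> Hom C (P j) (Uo R j)" "\<And>\<rho>. \<rho> \<in> paths_to Q j \<Longrightarrow> \<psi> \<cdot> I j \<rho> = ?f \<rho>"
      by (rule coproduct_factor[OF cP[OF j] UO, of ?f]) (assumption | erule fH | rule that)+
    \<comment> \<open>The projection to the summand of the trivial path; it will be a cokernel of
      \<open>\<phi> R j\<close>, with target \<open>A j\<close> in \<open>\<A>\<close>.\<close>
    let ?g = "\<lambda>\<rho>. if snd \<rho> = [] then Idn C (A j) else Zr C (A (fst \<rho>)) (A j)"
    have gH: "?g \<rho> \<in> Hom C (A (fst \<rho>)) (A j)" if \<rho>: "\<rho> \<in> paths_to Q j" for \<rho>
    proof -
      have "fst \<rho> = j" if "snd \<rho> = []"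
        using \<rho> that by (cases \<rho>) (simp add: mem_paths_to awalk_Nil_iff)
      then show ?thesis using A(4)[OF j] A(4)[OF start[OF \<rho>]] by auto
    qed
    obtain \<tau> where \<tau>: "\<tau> \<in> Hom C (P j) (A j)" "\<And>\<rho>. \<rho> \<in> paths_to Q j \<Longrightarrow> \<tau> \<cdot> I j \<rho> = ?g \<rho>"
      by (rule coproduct_factor[OF cP[OF j] A(4)[OF j], of ?g]) (assumption | erule gH | rule that)+
    let ?i = "I j (j, [])"
    have iH: "?i \<in> Hom C (A j) (P j)" using IH[OF j triv[OF j]] by simp
    have \<tau>i: "\<tau> \<cdot> ?i = Idn C (A j)" using \<tau>(2)[OF triv[OF j]] by simp
    \<comment> \<open>The source of \<open>\<phi> R j\<close> is a coproduct of coproducts, so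
      equalities are tested on pairs of a last arrow and a path to its tail.\<close>
    have on_U: "(s \<cdot> \<phi> R j) \<cdot> Ui R j \<alpha> = s' \<cdot> Ui R j \<alpha>"
      if s: "s \<in> Hom C (P j) Z" "s' \<in> Hom C (Uo R j) Z" and al: "\<alpha> \<in> arrows_into Q j"
        and eq: "\<And>\<rho>. \<rho> \<in> paths_to Q (tail Q \<alpha>) \<Longrightarrow> s \<cdot> I j (fst \<rho>, snd \<rho> @ [\<alpha>]) = s' \<cdot> Ui R j \<alpha> \<cdot> I (tail Q \<alpha>) \<rho>"
      for s s' Z \<alpha>
    proof -
      note aD = arrows_intoD[OF al]
      have mH: "m \<alpha> \<in> Hom C (P (tail Q \<alpha>)) (P j)" using m[OF aD(1)] unfolding aD(2) .
      have "(s \<cdot> \<phi> R j) \<cdot> Ui R j \<alpha> = s \<cdot> \<phi> R j \<cdot> Ui R j \<alpha>"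
        by (rule comp_assoc) (use s pRH UiH[OF al] in auto)
      also have "\<dots> = s \<cdot> m \<alpha>" unfolding pU[OF al] ..
      also have "\<dots> = s' \<cdot> Ui R j \<alpha>"
      proof (rule coproduct_eqI[OF cP[OF aD(3)]])
        fix \<rho> assume \<rho>: "\<rho> \<in> paths_to Q (tail Q \<alpha>)"
        note ty = IH[OF aD(3) \<rho>] mH s UiH[OF al]
        have "(s \<cdot> m \<alpha>) \<cdot> I (tail Q \<alpha>) \<rho> = s \<cdot> m \<alpha> \<cdot> I (tail Q \<alpha>) \<rho>" by (rule comp_assoc) (use ty in auto)
        also have "\<dots> = s' \<cdot> Ui R j \<alpha> \<cdot> I (tail Q \<alpha>) \<rho>" unfolding m2[OF aD(1) \<rho>] aD(2) by (rule eq[OF \<rho>])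
        also have "\<dots> = (s' \<cdot> Ui R j \<alpha>) \<cdot> I (tail Q \<alpha>) \<rho>" by (rule comp_assoc[symmetric]) (use ty in auto)
        finally show "(s \<cdot> m \<alpha>) \<cdot> I (tail Q \<alpha>) \<rho> = (s' \<cdot> Ui R j \<alpha>) \<cdot> I (tail Q \<alpha>) \<rho>" .
      qed (use s mH UiH[OF al] in auto)
      finally show ?thesis .
    qed
    have snoc': "(fst \<rho>, snd \<rho> @ [\<alpha>]) \<in> paths_to Q j" if "\<alpha> \<in> arrows_into Q j" "\<rho> \<in> paths_to Q (tail Q \<alpha>)" for \<alpha> \<rho>
      using snoc[OF arrows_intoD(1)[OF that(1)] that(2)] unfolding arrows_intoD(2)[OF that(1)] .
    have \<psi>\<phi>: "\<psi> \<cdot> \<phi> R j = Idn C (Uo R j)"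
    proof (rule coproduct_eqI[OF cU])
      fix \<alpha> assume al: "\<alpha> \<in> arrows_into Q j"
      show "(\<psi> \<cdot> \<phi> R j) \<cdot> Ui R j \<alpha> = Idn C (Uo R j) \<cdot> Ui R j \<alpha>"
      proof (rule on_U[OF \<psi>(1) _ al])
        fix \<rho> assume \<rho>: "\<rho> \<in> paths_to Q (tail Q \<alpha>)"
        show "\<psi> \<cdot> I j (fst \<rho>, snd \<rho> @ [\<alpha>]) = Idn C (Uo R j) \<cdot> Ui R j \<alpha> \<cdot> I (tail Q \<alpha>) \<rho>"
          unfolding \<psi>(2)[OF snoc'[OF al \<rho>]] using UiH[OF al] IH[OF arrows_intoD(3)[OF al] \<rho>] by simp
      qed (use UO in simp)
    qed (use \<psi>(1) pRH UO in auto)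
    have \<tau>\<phi>: "\<tau> \<cdot> \<phi> R j = Zr C (Uo R j) (A j)"
    proof (rule coproduct_eqI[OF cU])
      fix \<alpha> assume al: "\<alpha> \<in> arrows_into Q j"
      show "(\<tau> \<cdot> \<phi> R j) \<cdot> Ui R j \<alpha> = Zr C (Uo R j) (A j) \<cdot> Ui R j \<alpha>"
      proof (rule on_U[OF \<tau>(1) _ al])
        fix \<rho> assume \<rho>: "\<rho> \<in> paths_to Q (tail Q \<alpha>)"
        show "\<tau> \<cdot> I j (fst \<rho>, snd \<rho> @ [\<alpha>]) = Zr C (Uo R j) (A j) \<cdot> Ui R j \<alpha> \<cdot> I (tail Q \<alpha>) \<rho>"
          unfolding \<tau>(2)[OF snoc'[OF al \<rho>]]
          using UiH[OF al] IH[OF arrows_intoD(3)[OF al] \<rho>] A(4)[OF j] by simp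
      qed (use UO A(4)[OF j] in simp)
    qed (use \<tau>(1) pRH UO A(4)[OF j] in auto)
    \<comment> \<open>Every path is trivial or has a last arrow, so \<open>P j\<close> is the
      biproduct of the source of \<open>\<phi> R j\<close> and \<open>A j\<close>.\<close>
    have sum: "Add C (\<phi> R j \<cdot> \<psi>) (?i \<cdot> \<tau>) = Idn C (P j)"
    proof (rule coproduct_eqI[OF cP[OF j]])
      fix \<rho> assume \<rho>: "\<rho> \<in> paths_to Q j"
      note ty = IH[OF j \<rho>] \<psi>(1) \<tau>(1) pRH iH
      have split: "Add C (\<phi> R j \<cdot> \<psi>) (?i \<cdot> \<tau>) \<cdot> I j \<rho> = Add C (\<phi> R j \<cdot> \<psi> \<cdot> I j \<rho>) (?i \<cdot> \<tau> \<cdot> I j \<rho>)"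
        using ty by simp
      show "Add C (\<phi> R j \<cdot> \<psi>) (?i \<cdot> \<tau>) \<cdot> I j \<rho> = Idn C (P j) \<cdot> I j \<rho>"
        using path_cases[OF \<rho>]
      proof
        assume "\<exists>\<alpha> p'. \<rho> = (fst \<rho>, p' @ [\<alpha>]) \<and> \<alpha> \<in> arrows_into Q j \<and> (fst \<rho>, p') \<in> paths_to Q (tail Q \<alpha>)"
        then obtain k \<alpha> p' where ap: "\<rho> = (k, p' @ [\<alpha>])" "\<alpha> \<in> arrows_into Q j" "(k, p') \<in> paths_to Q (tail Q \<alpha>)"
          by blast
        note aD = arrows_intoD[OF ap(2)]
        note ty' = UiH[OF ap(2)] IH[OF aD(3) ap(3)]
        have kO: "A k \<in> Obj C" using A(4)[OF start[OF \<rho>]] ap(1) by simp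
        have "\<phi> R j \<cdot> Ui R j \<alpha> \<cdot> I (tail Q \<alpha>) (k, p') = m \<alpha> \<cdot> I (tail Q \<alpha>) (k, p')"
          by (rule comp_cong_left1[OF pU[OF ap(2)]]) (use ty' pRH in auto)
        also have "\<dots> = I j \<rho>" using m2[OF aD(1) ap(3)] aD(2) ap(1) by simp
        finally have 1: "\<phi> R j \<cdot> \<psi> \<cdot> I j \<rho> = I j \<rho>" using \<psi>(2)[OF \<rho>] ap(1) by simp
        have 2: "?i \<cdot> \<tau> \<cdot> I j \<rho> = Zr C (A k) (P j)" using \<tau>(2)[OF \<rho>] ap(1) iH kO by simp
        show ?thesis unfolding split 1 2 using IH[OF j \<rho>] ap(1) by simp
      next
        assume r: "\<rho> = (j, [])"
        have 1: "\<phi> R j \<cdot> \<psi> \<cdot> I j \<rho> = Zr C (A j) (P j)" using \<psi>(2)[OF \<rho>] r pRH A(4)[OF j] by simp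
        have 2: "?i \<cdot> \<tau> \<cdot> I j \<rho> = I j \<rho>" using \<tau>i r iH by simp
        show ?thesis unfolding split 1 2 using IH[OF j \<rho>] r by simp
      qed
    qed (use \<psi>(1) \<tau>(1) pRH iH PO[OF j] in auto)
    have mono: "is_mono C (\<phi> R j)" by (rule is_mono_left_inverse[of _ \<psi>]) (use \<psi>(1) pRH \<psi>\<phi> in auto)
    have "is_cokernel C (\<phi> R j) \<tau>"
    proof (rule is_cokernelI)
      show "is_epi C \<tau>" by (rule is_epi_right_inverse[of _ ?i]) (use \<tau>(1) iH \<tau>i in auto)
      show "\<tau> \<cdot> \<phi> R j = Zr C (Dom C (\<phi> R j)) (Cod C \<tau>)" using \<tau>\<phi> \<tau>(1) pRH by simp
      fix u assume u: "u \<in> Arr C" "Dom C u = Cod C (\<phi> R j)" "u \<cdot> \<phi> R j = Zr C (Dom C (\<phi> R j)) (Cod C u)"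
      have uD: "Dom C u = P j" using u(2) pRH by simp
      have "u = u \<cdot> Add C (\<phi> R j \<cdot> \<psi>) (?i \<cdot> \<tau>)" unfolding sum using u(1) uD by simp
      also have "\<dots> = Add C (u \<cdot> \<phi> R j \<cdot> \<psi>) (u \<cdot> ?i \<cdot> \<tau>)" by (rule comp_Add) (use u(1) uD \<psi>(1) \<tau>(1) pRH iH in auto)
      also have "u \<cdot> \<phi> R j \<cdot> \<psi> = Zr C (Dom C (\<phi> R j)) (Cod C u) \<cdot> \<psi>"
        by (rule comp_cong_left1[OF u(3)]) (use u(1) uD \<psi>(1) pRH in auto)
      also have "Add C (Zr C (Dom C (\<phi> R j)) (Cod C u) \<cdot> \<psi>) (u \<cdot> ?i \<cdot> \<tau>) = (u \<cdot> ?i) \<cdot> \<tau>"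
        using u(1) uD \<psi>(1) \<tau>(1) pRH iH by simp
      finally have "(u \<cdot> ?i) \<cdot> \<tau> = u" by simp
      then show "\<exists>h\<in>Arr C. Cod C h = Cod C u \<and> Dom C h = Cod C \<tau> \<and> h \<cdot> \<tau> = u"
        by (intro bexI[of _ "u \<cdot> ?i"]) (use u(1) uD iH \<tau>(1) in auto)
    qed (use pRH \<tau>(1) in auto)
    from Coker_A_iff[OF this] have "Coker C (\<phi> R j) \<in> \<A>" using \<tau>(1) A(1)[OF j] by simp
    then show ?thesis using R mono by (simp add: good_def)
  qed
  note gR = this
  show thesis by (rule that[OF tM tE]) (rule gR)
qed

end

subsection \<open>Orthogonal classes\<close>

text \<open>
  Lift the cover \<open>\<pi>\<close> to an extension of \<open>F\<close> by \<open>S\<close>. On \<open>K\<close> the lift takes values in \<open>S\<close>, and this map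
  comes from a map \<open>P \<rightarrow> G\<close>; subtracting it leaves a lift that factors through \<open>F\<close>.
\<close>

lemma (in abelian_category) ext1_zero_quotient:
  assumes FG: "ext1_zero C F G"
    and kp: "short_exact C k p" "k \<in> Hom C T G" "p \<in> Hom C G S"
    and cover: "short_exact C \<iota> \<pi>" "\<iota> \<in> Hom C K P" "\<pi> \<in> Hom C P F"
    and PS: "ext1_zero C P S" and KT: "ext1_zero C K T"
  shows "ext1_zero C F S"
  unfolding ext1_zero_def
proof (intro allI ballI impI)
  fix E a b assume a: "a \<in> Hom C S E" and b: "b \<in> Hom C E F" and ab: "short_exact C a b"
  note abD = short_exactD[OF ab a b] and cD = short_exactD[OF cover]
  obtain v where v: "v \<in> Hom C P E" "b \<cdot> v = \<pi>" by (rule ext1_zero_lift[OF PS ab a b cover(3)])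
  have obj: "K \<in> Obj C" "F \<in> Obj C" "P \<in> Obj C" "E \<in> Obj C" "S \<in> Obj C" using cover(2,3) v kp(3) by auto
  have vi: "v \<cdot> \<iota> \<in> Hom C K E" using v cover(2) by auto
  have "b \<cdot> v \<cdot> \<iota> = \<pi> \<cdot> \<iota>" by (rule comp_cong_left1[OF v(2)]) (use v b cover in auto)
  then have bz: "b \<cdot> v \<cdot> \<iota> = Zr C (Dom C (v \<cdot> \<iota>)) (Cod C b)" unfolding cD(6) using vi b by simp
  obtain w where w: "w \<in> Arr C" "Dom C w = Dom C (v \<cdot> \<iota>)" "Cod C w = Dom C a" "a \<cdot> w = v \<cdot> \<iota>"
    by (rule kernel_factor[OF abD(3) _ _ bz]) (use vi b in auto)
  have wH: "w \<in> Hom C K S" using w(1-3) vi a by auto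
  \<comment> \<open>Here Ext^1(K, T) = 0 enters, in the place that Ext^2(F, T) = 0 would have in the
    long exact sequence.\<close>
  obtain w' where w': "w' \<in> Hom C K G" "p \<cdot> w' = w" by (rule ext1_zero_lift[OF KT kp wH])
  obtain y where y: "y \<in> Hom C P G" "y \<cdot> \<iota> = w'" by (rule ext1_zero_extend[OF FG cover w'(1)])
  define x where "x = a \<cdot> p \<cdot> y"
  have x: "x \<in> Hom C P E" unfolding x_def using a kp(3) y(1) by auto
  have "p \<cdot> y \<cdot> \<iota> = w" using w'(2) y(2) by simp
  then have "x \<cdot> \<iota> = a \<cdot> w" unfolding x_def using a kp(3) y(1) cover(2) by simp
  then have xi: "x \<cdot> \<iota> = v \<cdot> \<iota>" using w(4) by simp
  have "b \<cdot> x = Zr C S F \<cdot> p \<cdot> y" unfolding x_def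
    by (rule comp_cong_left1[OF abD(6)]) (use a b kp(3) y(1) in auto)
  then have bx: "b \<cdot> x = Zr C P F" using kp(3) y(1) obj by simp
  define v' where "v' = Add C v (neg x)"
  have v': "v' \<in> Hom C P E" unfolding v'_def using v(1) x by auto
  have "v' \<cdot> \<iota> = Add C (v \<cdot> \<iota>) (neg (x \<cdot> \<iota>))" unfolding v'_def using v(1) x cover(2) by simp
  then have "v' \<cdot> \<iota> = Zr C K E" unfolding xi using vi by simp
  then have "v' \<cdot> \<iota> = Zr C (Dom C \<iota>) (Cod C v')" using v' cover(2) by simp
  then obtain s where s: "s \<in> Arr C" "Cod C s = Cod C v'" "Dom C s = Cod C \<pi>" "s \<cdot> \<pi> = v'"
    by (rule cokernel_factor[OF cD(4), of v', rotated 2]) (use v' cover(2) in auto)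
  have sH: "s \<in> Hom C F E" using s(1-3) v' cover(3) by auto
  have "(b \<cdot> s) \<cdot> \<pi> = b \<cdot> v'" unfolding s(4)[symmetric] by (rule comp_assoc) (use sH b cover(3) in auto)
  also have "\<dots> = Add C (b \<cdot> v) (neg (b \<cdot> x))" unfolding v'_def using b v(1) x by simp
  also have "\<dots> = Idn C F \<cdot> \<pi>" unfolding v(2) bx using cover(3) obj by simp
  finally have eq: "(b \<cdot> s) \<cdot> \<pi> = Idn C F \<cdot> \<pi>" .
  have "b \<cdot> s = Idn C F" by (rule is_epiD[OF cD(2)]) (use eq sH b cover(3) obj in \<open>auto simp del: Idn_comp\<close>)
  then show "\<exists>s\<in>Hom C F E. b \<cdot> s = Idn C F" using sH by blast
qed

section \<open>Splitting a stalk off a representation\<close>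

context quiver_reps
begin

text \<open>A naturality square commutes by itself when it starts or ends in a zero object, which
  disposes of the squares at an erased vertex.\<close>

lemma mk_mor_Hom_zero:
  assumes F: "F \<in> reps Q C" and G: "G \<in> reps Q C"
    and \<eta>: "\<And>i. i \<in> verts Q \<Longrightarrow> \<eta> i \<in> Hom C (vob F i) (vob G i)"
    and c: "\<And>\<alpha>. \<alpha> \<in> arcs Q \<Longrightarrow> is_zero_obj C (vob F (tail Q \<alpha>)) \<or> is_zero_obj C (vob G (head Q \<alpha>)) \<or>
      \<eta> (head Q \<alpha>) \<cdot> amor F \<alpha> = amor G \<alpha> \<cdot> \<eta> (tail Q \<alpha>)"
  shows "mk_mor Q F G \<eta> \<in> Hom (Rep Q C) F G"
proof (rule mk_mor_Hom[OF F G \<eta> ends'])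
  fix \<alpha> assume al: "\<alpha> \<in> arcs Q"
  have 1: "\<eta> (head Q \<alpha>) \<cdot> amor F \<alpha> \<in> Hom C (vob F (tail Q \<alpha>)) (vob G (head Q \<alpha>))"
    by (rule Comp_Hom[OF repsD(2)[OF F al] \<eta>[OF ends(1)[OF al]]])
  have 2: "amor G \<alpha> \<cdot> \<eta> (tail Q \<alpha>) \<in> Hom C (vob F (tail Q \<alpha>)) (vob G (head Q \<alpha>))"
    by (rule Comp_Hom[OF \<eta>[OF ends(2)[OF al]] repsD(2)[OF G al]])
  show "\<eta> (head Q \<alpha>) \<cdot> amor F \<alpha> = amor G \<alpha> \<cdot> \<eta> (tail Q \<alpha>)"
    using c[OF al] zero_obj_Hom_eq(1)[OF _ 1 2] zero_obj_Hom_eq(2)[OF _ 1 2] by blast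
qed

text \<open>The arrows leaving \<open>j\<close> end in zero objects, so the value at
  \<open>j\<close> is a subrepresentation on its own, and dividing by it erases the vertex.\<close>

lemma stalk_subrepresentation:
  assumes G: "G \<in> reps Q C" and j: "j \<in> verts Q"
    and out: "\<And>\<alpha>. \<alpha> \<in> arcs Q \<Longrightarrow> tail Q \<alpha> = j \<Longrightarrow> is_zero_obj C (vob G (head Q \<alpha>))"
  obtains a b where "short_exact (Rep Q C) a b" "a \<in> Hom (Rep Q C) (s_rep Q C j (vob G j)) G"
    "b \<in> Hom (Rep Q C) G (trunc G j)"
proof -
  let ?s = "s_rep Q C j (vob G j)" and ?t = "trunc G j"
  have GO: "vob G k \<in> Obj C" if "k \<in> verts Q" for k by (rule repsD(1)[OF G that])
  note sP = s_rep_props[OF GO[OF j], where i = j] and tP = trunc_props[OF G, where j = j]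
  let ?a = "\<lambda>k. if k = j then Idn C (vob G j) else Zr C (zero_obj C) (vob G k)"
  let ?b = "\<lambda>k. if k = j then Zr C (vob G j) (zero_obj C) else Idn C (vob G k)"
  have a: "mk_mor Q ?s G ?a \<in> Hom (Rep Q C) ?s G"
  proof (rule mk_mor_Hom_zero[OF sP(1) G])
    show "?a k \<in> Hom C (vob ?s k) (vob G k)" if "k \<in> verts Q" for k using GO[OF that] GO[OF j] sP(2)[OF that] by simp
    fix \<alpha> assume al: "\<alpha> \<in> arcs Q"
    have "is_zero_obj C (vob ?s (tail Q \<alpha>)) \<or> is_zero_obj C (vob G (head Q \<alpha>))"
      using out[OF al] sP(2)[OF ends(2)[OF al]] zero_obj_is_zero by (cases "tail Q \<alpha> = j") simp_all
    then show "is_zero_obj C (vob ?s (tail Q \<alpha>)) \<or> is_zero_obj C (vob G (head Q \<alpha>)) \<or>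
      ?a (head Q \<alpha>) \<cdot> amor ?s \<alpha> = amor G \<alpha> \<cdot> ?a (tail Q \<alpha>)" by blast
  qed
  have b: "mk_mor Q G ?t ?b \<in> Hom (Rep Q C) G ?t"
  proof (rule mk_mor_Hom_zero[OF G tP(1)])
    show "?b k \<in> Hom C (vob G k) (vob ?t k)" if "k \<in> verts Q" for k using GO[OF that] GO[OF j] tP(2)[OF that] by simp
    fix \<alpha> assume al: "\<alpha> \<in> arcs Q"
    show "is_zero_obj C (vob G (tail Q \<alpha>)) \<or> is_zero_obj C (vob ?t (head Q \<alpha>)) \<or>
      ?b (head Q \<alpha>) \<cdot> amor G \<alpha> = amor ?t \<alpha> \<cdot> ?b (tail Q \<alpha>)"
    proof (cases "head Q \<alpha> = j \<or> tail Q \<alpha> = j")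
      case True
      then have "is_zero_obj C (vob ?t (head Q \<alpha>))"
        using out[OF al] tP(2)[OF ends(1)[OF al]] zero_obj_is_zero by (cases "head Q \<alpha> = j") simp_all
      then show ?thesis by blast
    next
      case False
      then show ?thesis using tP(3)[OF al] repsD(2)[OF G al] by simp
    qed
  qed
  have "short_exact (Rep Q C) (mk_mor Q ?s G ?a) (mk_mor Q G ?t ?b)"
    unfolding Rep_short_exact_iff[OF a b]
  proof
    fix k assume k: "k \<in> verts Q"
    show "short_exact C (cmp (mk_mor Q ?s G ?a) k) (cmp (mk_mor Q G ?t ?b) k)"
      using k short_exact_Idn_zero[OF zero_obj_is_zero GO[OF j]] short_exact_zero_Idn[OF zero_obj_is_zero GO[OF k]]
      by simp
  qed
  from that[OF this a b] show thesis .
qed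

text \<open>Nothing nonzero arrives at \<open>i\<close>, so the value there is a quotient on its
  own. The isomorphism \<open>u\<close> is carried along because the value of a free representation
  at \<open>i\<close> is only isomorphic to \<open>B\<close>.\<close>

lemma stalk_quotient:
  assumes G: "G \<in> reps Q C" and i: "i \<in> verts Q"
    and into: "\<And>\<alpha>. \<alpha> \<in> arcs Q \<Longrightarrow> head Q \<alpha> = i \<Longrightarrow> is_zero_obj C (vob G (tail Q \<alpha>))"
    and u: "u \<in> Hom C (vob G i) B" "is_mono C u" "is_epi C u"
  obtains a b where "short_exact (Rep Q C) a b" "a \<in> Hom (Rep Q C) (trunc G i) G"
    "b \<in> Hom (Rep Q C) G (s_rep Q C i B)"
proof -
  let ?s = "s_rep Q C i B" and ?t = "trunc G i"
  have GO: "vob G k \<in> Obj C" if "k \<in> verts Q" for k by (rule repsD(1)[OF G that])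
  have BO: "B \<in> Obj C" using u(1) by auto
  note sP = s_rep_props[OF BO, where i = i] and tP = trunc_props[OF G, where j = i]
  let ?a = "\<lambda>k. if k = i then Zr C (zero_obj C) (vob G i) else Idn C (vob G k)"
  let ?b = "\<lambda>k. if k = i then u else Zr C (vob G k) (zero_obj C)"
  have b: "mk_mor Q G ?s ?b \<in> Hom (Rep Q C) G ?s"
  proof (rule mk_mor_Hom_zero[OF G sP(1)])
    show "?b k \<in> Hom C (vob G k) (vob ?s k)" if "k \<in> verts Q" for k using u(1) GO[OF that] sP(2)[OF that] by simp
    fix \<alpha> assume al: "\<alpha> \<in> arcs Q"
    have "is_zero_obj C (vob G (tail Q \<alpha>)) \<or> is_zero_obj C (vob ?s (head Q \<alpha>))"
      using into[OF al] sP(2)[OF ends(1)[OF al]] zero_obj_is_zero by (cases "head Q \<alpha> = i") simp_all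
    then show "is_zero_obj C (vob G (tail Q \<alpha>)) \<or> is_zero_obj C (vob ?s (head Q \<alpha>)) \<or>
      ?b (head Q \<alpha>) \<cdot> amor G \<alpha> = amor ?s \<alpha> \<cdot> ?b (tail Q \<alpha>)" by blast
  qed
  have a: "mk_mor Q ?t G ?a \<in> Hom (Rep Q C) ?t G"
  proof (rule mk_mor_Hom_zero[OF tP(1) G])
    show "?a k \<in> Hom C (vob ?t k) (vob G k)" if "k \<in> verts Q" for k using GO[OF that] GO[OF i] tP(2)[OF that] by simp
    fix \<alpha> assume al: "\<alpha> \<in> arcs Q"
    show "is_zero_obj C (vob ?t (tail Q \<alpha>)) \<or> is_zero_obj C (vob G (head Q \<alpha>)) \<or>
      ?a (head Q \<alpha>) \<cdot> amor ?t \<alpha> = amor G \<alpha> \<cdot> ?a (tail Q \<alpha>)"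
    proof (cases "head Q \<alpha> = i \<or> tail Q \<alpha> = i")
      case True
      then have "is_zero_obj C (vob ?t (tail Q \<alpha>))"
        using into[OF al] tP(2)[OF ends(2)[OF al]] zero_obj_is_zero by (cases "tail Q \<alpha> = i") simp_all
      then show ?thesis by blast
    next
      case False
      then show ?thesis using tP(3)[OF al] repsD(2)[OF G al] by simp
    qed
  qed
  have "short_exact (Rep Q C) (mk_mor Q ?t G ?a) (mk_mor Q G ?s ?b)"
    unfolding Rep_short_exact_iff[OF a b]
  proof
    fix k assume k: "k \<in> verts Q"
    show "short_exact C (cmp (mk_mor Q ?t G ?a) k) (cmp (mk_mor Q G ?s ?b) k)"
      using k short_exact_Idn_zero[OF zero_obj_is_zero GO[OF k]] short_exact_zero_iso[OF zero_obj_is_zero u]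
      by simp
  qed
  from that[OF this a b] show thesis .
qed

end

section \<open>The left orthogonal class of a family of finitely supported representations\<close>

context left_setting
begin

text \<open>A vertex \<open>j\<close> of the support with least \<open>d j\<close> has no arrows to
  vertices of the support, as arrows lower \<open>d\<close>. Hence the stalk at \<open>j\<close> is
  a subrepresentation; dividing by it shrinks the support, and vanishing of Ext^1 passes from the
  two outer terms to the middle one.\<close>

lemma ext1_zero_finite_support:
  assumes "finite J" "J \<subseteq> verts Q" and F: "F \<in> reps Q C" and "G \<in> reps Q C"
    and "\<And>j. j \<in> verts Q - J \<Longrightarrow> is_zero_obj C (vob G j)"
    and "\<And>j. j \<in> J \<Longrightarrow> vob G j \<in> \<B>" and "\<And>j. j \<in> J \<Longrightarrow> good j F"
  shows "ext1_zero (Rep Q C) F G"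
  using assms(1,2,4-7)
proof (induction J arbitrary: G rule: finite_psubset_induct)
  case (psubset J)
  note J = psubset.prems(1) and G = psubset.prems(2) and z = psubset.prems(3) and GB = psubset.prems(4)
    and gF = psubset.prems(5)
  show ?case
  proof (cases "J = {}")
    case True
    have "is_zero_obj (Rep Q C) G" by (rule Rep_zero_objI[OF G]) (use z True in simp)
    then show ?thesis by (rule R.ext1_zero_zero_obj) (simp add: F Rep_Obj)
  next
    case False
    then obtain j where j: "j \<in> J" "\<And>k. k \<in> J \<Longrightarrow> d j \<le> d k"
      using ex_has_least_nat[of "\<lambda>k. k \<in> J" _ d] by blast
    have jv: "j \<in> verts Q" using j(1) J by blast
    note tP = trunc_props[OF G, where j = j]
    have out: "is_zero_obj C (vob G (head Q \<alpha>))" if al: "\<alpha> \<in> arcs Q" "tail Q \<alpha> = j" for \<alpha>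
    proof (rule z)
      have "d (head Q \<alpha>) < d j" using d_less[OF al(1)] al(2) by simp
      then have "head Q \<alpha> \<notin> J" using j(2)[of "head Q \<alpha>"] by linarith
      then show "head Q \<alpha> \<in> verts Q - J" using ends(1)[OF al(1)] by blast
    qed
    obtain a b where ab: "short_exact (Rep Q C) a b" "a \<in> Hom (Rep Q C) (s_rep Q C j (vob G j)) G"
      "b \<in> Hom (Rep Q C) G (trunc G j)" by (rule stalk_subrepresentation[OF G jv out])
    have "ext1_zero (Rep Q C) F (trunc G j)"
    proof (rule psubset.IH[of "J - {j}"])
      show "J - {j} \<subset> J" "J - {j} \<subseteq> verts Q" using j(1) J by blast+
      show "trunc G j \<in> reps Q C" by (rule tP(1))
      show "is_zero_obj C (vob (trunc G j) k)" if "k \<in> verts Q - (J - {j})" for k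
        using that z[of k] tP(2)[of k] zero_obj_is_zero by (cases "k = j") auto
      show "vob (trunc G j) k \<in> \<B>" "good k F" if "k \<in> J - {j}" for k
        using that GB[of k] tP(2)[of k] gF[of k] J by auto
    qed
    then show ?thesis by (rule R.ext1_zero_middle[OF good_ext1_stalk[OF gF[OF j(1)] jv GB[OF j(1)]] _ ab])
  qed
qed

text \<open>The stalk at \<open>i\<close> is the quotient of \<open>G\<close> by
  \<open>trunc G i\<close>, whose support has smaller rank. For the kernel \<open>K\<close> of a
  cover of \<open>F\<close> the group Ext^1(K, trunc G i) vanishes, because \<open>F\<close> and the
  cover, and hence \<open>K\<close>, are good on that support.\<close>

lemma ext1_stalk_if_ext1:
  assumes F: "F \<in> reps Q C" and G: "G \<in> reps Q C" and i: "i \<in> verts Q" and B: "B \<in> \<B>"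
    and u: "u \<in> Hom C (vob G i) B" "is_mono C u" "is_epi C u"
    and fin: "finite {j \<in> verts Q. \<not> is_zero_obj C (vob G j)}"
    and GB: "\<And>j. j \<in> verts Q \<Longrightarrow> vob G j \<in> \<B>"
    and sup: "\<And>j. j \<in> verts Q \<Longrightarrow> j \<noteq> i \<Longrightarrow> \<not> is_zero_obj C (vob G j) \<Longrightarrow> d j < d i"
    and ext: "ext1_zero (Rep Q C) F G"
    and gF: "\<And>j. j \<in> verts Q \<Longrightarrow> d j < d i \<Longrightarrow> good j F"
  shows "ext1_zero (Rep Q C) F (s_rep Q C i B)"
proof -
  have into: "is_zero_obj C (vob G (tail Q \<alpha>))" if al: "\<alpha> \<in> arcs Q" "head Q \<alpha> = i" for \<alpha>
    using sup[OF ends(2)[OF al(1)]] d_less[OF al(1)] al(2) by force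
  obtain a b where ab: "short_exact (Rep Q C) a b" "a \<in> Hom (Rep Q C) (trunc G i) G"
    "b \<in> Hom (Rep Q C) G (s_rep Q C i B)" by (rule stalk_quotient[OF G i into u])
  obtain P p where p: "p \<in> Hom (Rep Q C) P F" "is_epi (Rep Q C) p" and gP: "\<And>j. j \<in> verts Q \<Longrightarrow> good j P"
    by (rule good_cover[OF F]) (rule that)
  have "p \<in> Arr (Rep Q C)" using p(1) by simp
  then obtain k where k: "is_kernel (Rep Q C) p k" using R.ex_kernel by blast
  define K where "K = Dom (Rep Q C) k"
  have kH: "k \<in> Hom (Rep Q C) K P" using R.kernel_Arr[OF k] p(1) by (simp add: K_def)
  have kp: "short_exact (Rep Q C) k p" by (rule R.short_exact_if_kernel[OF k p(2)])
  define J where "J = {j \<in> verts Q. j \<noteq> i \<and> \<not> is_zero_obj C (vob G j)}"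
  note tP = trunc_props[OF G, where j = i]
  have "ext1_zero (Rep Q C) K (trunc G i)"
  proof (rule ext1_zero_finite_support[of J])
    show "finite J" by (rule finite_subset[OF _ fin]) (auto simp: J_def)
    show "J \<subseteq> verts Q" by (auto simp: J_def)
    show "K \<in> reps Q C" by (rule Rep_HomD(1)[OF kH])
    show "trunc G i \<in> reps Q C" by (rule tP(1))
    show "is_zero_obj C (vob (trunc G i) j)" if "j \<in> verts Q - J" for j
      using that tP(2)[of j] zero_obj_is_zero by (auto simp: J_def)
    fix j assume "j \<in> J"
    then have j: "j \<in> verts Q" "j \<noteq> i" "d j < d i" using sup unfolding J_def by blast+
    show "vob (trunc G i) j \<in> \<B>" using GB[OF j(1)] tP(2)[OF j(1)] j(2) by simp
    show "good j K" by (rule good_kernel[OF kp kH p(1) j(1) gP[OF j(1)] gF[OF j(1,3)]])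
  qed
  then show ?thesis by (rule R.ext1_zero_quotient[OF ext ab kp kH p(1) good_ext1_stalk[OF gP[OF i] i B]])
qed

text \<open>
  If \<open>good\<close> holds below \<open>i\<close>, then \<open>Ext\<^sup>1\<close>-orthogonality to a \<open>G\<close> supported below \<open>i\<close> passes to the stalk
  of \<open>G\<^sub>i\<close> at \<open>i\<close>; hence one argument serves stalk and free representations alike.
\<close>

theorem left_perp_eq_Phi:
  assumes sub: "\<F> \<subseteq> reps Q C"
    and fin: "\<And>G. G \<in> \<F> \<Longrightarrow> finite {j \<in> verts Q. \<not> is_zero_obj C (vob G j)}"
    and GB: "\<And>G j. G \<in> \<F> \<Longrightarrow> j \<in> verts Q \<Longrightarrow> vob G j \<in> \<B>"
    and top: "\<And>i B. i \<in> verts Q \<Longrightarrow> B \<in> \<B> \<Longrightarrow> \<exists>G \<in> \<F>. \<exists>u \<in> Hom C (vob G i) B. is_mono C u \<and> is_epi C u \<and>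
      (\<forall>j \<in> verts Q. j \<noteq> i \<longrightarrow> \<not> is_zero_obj C (vob G j) \<longrightarrow> d j < d i)"
  shows "left_perp (Rep Q C) \<F> = Phi Q C \<A>"
proof (rule subset_antisym; rule subsetI)
  fix F assume "F \<in> left_perp (Rep Q C) \<F>"
  then have F: "F \<in> reps Q C" and E0: "\<forall>n\<ge>1. \<forall>G \<in> \<F>. Ext_zero (Rep Q C) n F G"
    unfolding left_perp_def Rep_Obj by blast+
  have E: "Ext_zero (Rep Q C) 1 F G" if "G \<in> \<F>" for G
    by (rule bspec[OF mp[OF spec[OF E0] order_refl] that])
  have ext: "ext1_zero (Rep Q C) F G" if "G \<in> \<F>" for G
    using R.Ext_zero_one_iff[of F G] E[OF that] F sub that unfolding Rep_Obj by blast
  have "good i F" if "i \<in> verts Q" for i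
    using that
  proof (induction "d i" arbitrary: i rule: less_induct)
    case less
    note gF = less.hyps and i = less.prems
    show ?case
    proof (rule good_if_ext1_stalk[OF F i])
      fix B assume B: "B \<in> \<B>"
      \<comment> \<open>A member of the family with \<open>B\<close> on top at \<open>i\<close>; the
        rest of its support has smaller rank, where \<open>F\<close> is good by induction.\<close>
      obtain G u where G: "G \<in> \<F>" "u \<in> Hom C (vob G i) B" "is_mono C u" "is_epi C u"
        and sup: "\<And>j. j \<in> verts Q \<Longrightarrow> j \<noteq> i \<Longrightarrow> \<not> is_zero_obj C (vob G j) \<Longrightarrow> d j < d i"
        using top[OF i B] by blast
      have GR: "G \<in> reps Q C" using G(1) sub by blast
      show "ext1_zero (Rep Q C) F (s_rep Q C i B)"
        by (rule ext1_stalk_if_ext1[OF F GR i B G(2-4) fin[OF G(1)] GB[OF G(1)] sup ext[OF G(1)]])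
          (assumption | erule gF)+
    qed
  qed
  then show "F \<in> Phi Q C \<A>" unfolding Phi_iff using F by blast
next
  fix F assume F: "F \<in> Phi Q C \<A>"
  have PhiO: "Phi Q C \<A> \<subseteq> reps Q C" unfolding Phi_def by blast
  \<comment> \<open>Dimensions are shifted inside \<open>\<Phi>(\<A>)\<close>:
    \<open>good_cover\<close> and \<open>good_kernel\<close> give the two closure conditions, and
    filtration by stalks gives the case of Ext^1.\<close>
  have "Ext_zero (Rep Q C) n F G" if n: "n \<ge> 1" and G: "G \<in> \<F>" for n G
  proof (rule R.Ext_zero_dimension_shift[of "Phi Q C \<A>"])
    have GR: "G \<in> reps Q C" using G sub by blast
    show "\<exists>P\<in>Phi Q C \<A>. \<exists>p\<in>Hom (Rep Q C) P E. is_epi (Rep Q C) p" if "E \<in> Obj (Rep Q C)" for E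
    proof -
      have E: "E \<in> reps Q C" using that unfolding Rep_Obj .
      obtain P p where p: "p \<in> Hom (Rep Q C) P E" "is_epi (Rep Q C) p" and gP: "\<And>j. j \<in> verts Q \<Longrightarrow> good j P"
        by (rule good_cover[OF E]) (rule that)
      have "P \<in> Phi Q C \<A>" unfolding Phi_iff using gP Rep_HomD(1)[OF p(1)] by blast
      then show ?thesis using p by blast
    qed
    show "K \<in> Phi Q C \<A>" if s: "short_exact (Rep Q C) k p" "k \<in> Hom (Rep Q C) K P" "p \<in> Hom (Rep Q C) P X"
      and X: "P \<in> Phi Q C \<A>" "X \<in> Phi Q C \<A>" for K P X k p
      using X good_kernel[OF s] Rep_HomD(1)[OF s(2)] unfolding Phi_iff by blast
    show "ext1_zero (Rep Q C) X G" if X: "X \<in> Phi Q C \<A>" for X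
      by (rule ext1_zero_finite_support[OF fin[OF G]]) (use X[unfolded Phi_iff] GR GB[OF G] in auto)
  qed (use PhiO G sub n F in \<open>auto simp: Rep_Obj\<close>)
  then show "F \<in> left_perp (Rep Q C) \<F>" unfolding left_perp_def Rep_Obj using F PhiO by blast
qed

text \<open>A stalk is supported at one vertex, so the rank condition at the other vertices is
  vacuous and an identity serves as the comparison.\<close>

corollary left_perp_s_star: "left_perp (Rep Q C) (s_star Q C \<B>) = Phi Q C \<A>"
proof (rule left_perp_eq_Phi)
  show "s_star Q C \<B> \<subseteq> reps Q C" unfolding s_star_def using s_rep_props(1) B_Obj by blast
  show "finite {j \<in> verts Q. \<not> is_zero_obj C (vob G j)}" if GS: "G \<in> s_star Q C \<B>" for G
  proof -
    obtain i B where G: "G = s_rep Q C i B" "B \<in> \<B>" using GS unfolding s_star_def by blast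
    have "{j \<in> verts Q. \<not> is_zero_obj C (vob G j)} \<subseteq> {i}"
      unfolding G(1) using s_rep_props(2)[OF B_Obj[OF G(2)]] zero_obj_is_zero by (auto split: if_split_asm)
    then show ?thesis by (rule finite_subset) simp
  qed
  show "vob G j \<in> \<B>" if GS: "G \<in> s_star Q C \<B>" and j: "j \<in> verts Q" for G j
  proof -
    obtain i B where G: "G = s_rep Q C i B" "B \<in> \<B>" using GS unfolding s_star_def by blast
    show ?thesis unfolding G(1) s_rep_props(2)[OF B_Obj[OF G(2)] j]
      using G(2) B_zero[OF zero_obj_is_zero] by simp
  qed
  show "\<exists>G \<in> s_star Q C \<B>. \<exists>u \<in> Hom C (vob G i) B. is_mono C u \<and> is_epi C u \<and>
      (\<forall>j \<in> verts Q. j \<noteq> i \<longrightarrow> \<not> is_zero_obj C (vob G j) \<longrightarrow> d j < d i)"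
    if i: "i \<in> verts Q" and B: "B \<in> \<B>" for i B
  proof (intro bexI[of _ "s_rep Q C i B"] bexI[of _ "Idn C B"] conjI ballI impI)
    note BO = B_Obj[OF B]
    show "s_rep Q C i B \<in> s_star Q C \<B>" using i B unfolding s_star_def by blast
    show "Idn C B \<in> Hom C (vob (s_rep Q C i B) i) B" using s_rep_props(2)[OF BO i, of i] BO by simp
    show "is_mono C (Idn C B)" "is_epi C (Idn C B)" using BO by simp_all
    show "d j < d i" if "j \<in> verts Q" "j \<noteq> i" "\<not> is_zero_obj C (vob (s_rep Q C i B) j)" for j
      using that s_rep_props(2)[OF BO that(1), of i] zero_obj_is_zero by simp
  qed
qed

end

subsection \<open>Cardinals and paths\<close>

text \<open>Cardinals on one type are bounded by the cardinality of that type, so upper bounds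
  exist, and a nonempty set of cardinals has a least member.\<close>

lemma card_sup_is_card_sup:
  fixes R :: "'a rel set"
  assumes "\<And>r. r \<in> R \<Longrightarrow> Card_order r"
  shows "is_card_sup R (card_sup R)"
proof -
  let ?B = "{s :: 'a rel. Card_order s \<and> (\<forall>r \<in> R. r \<le>o s)}"
  have "r \<le>o |UNIV :: 'a set|" if "r \<in> R" for r
    by (rule ordIso_ordLeq_trans[OF ordIso_symmetric[OF card_of_Field_ordIso[OF assms[OF that]]] card_of_mono1])
      (rule subset_UNIV)
  then have "|UNIV :: 'a set| \<in> ?B" by (simp add: card_of_Card_order)
  then have "?B \<noteq> {}" by blast
  moreover have "\<forall>s \<in> ?B. Card_order s" by blast
  ultimately have "\<exists>s \<in> ?B. \<forall>t \<in> ?B. s \<le>o t" by (rule exists_minim_Card_order)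
  then obtain s where "s \<in> ?B" "\<forall>t \<in> ?B. s \<le>o t" by (rule bexE)
  then have "is_card_sup R s" unfolding is_card_sup_def by simp
  then show ?thesis unfolding card_sup_def by (rule someI)
qed

text \<open>Strictness is built into \<open>card_size\<close>: an unattained supremum exceeds each
  member, and otherwise its successor does. The copy by singletons in the first case changes the
  type but not the cardinal.\<close>

lemma ordLess_if_card_size:
  fixes R :: "'a rel set" and \<kappa> :: "'k rel"
  assumes R: "\<And>r. r \<in> R \<Longrightarrow> Card_order r" and \<kappa>: "card_size R \<le>o \<kappa>" and r: "r \<in> R"
  shows "r <o \<kappa>"
proof -
  let ?s = "card_sup R"
  have s: "Card_order ?s" "r \<le>o ?s"
    using card_sup_is_card_sup[of R, OF R] r unfolding is_card_sup_def by simp_all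
  show ?thesis
  proof (cases "\<forall>r \<in> R. r <o ?s")
    case True
    have "inj_on (\<lambda>x. {x}) (Field ?s)" by (rule inj_onI) simp
    then have "|Field ?s| =o |(\<lambda>x. {x}) ` Field ?s|"
      by (rule card_of_ordIsoI[OF inj_on_imp_bij_betw])
    then have "?s =o card_size R"
      using True ordIso_transitive[OF ordIso_symmetric[OF card_of_Field_ordIso[OF s(1)]]]
      by (simp add: card_size_def)
    then have "r <o card_size R" by (rule ordLess_ordIso_trans[OF bspec[OF True r]])
    then show ?thesis by (rule ordLess_ordLeq_trans[OF _ \<kappa>])
  next
    case False
    then have "card_size R = cardSuc ?s" unfolding card_size_def by (rule if_not_P)
    then have "r <o card_size R" using ordLeq_ordLess_trans[OF s(2) cardSuc_greater[OF s(1)]] by simp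
    then show ?thesis by (rule ordLess_ordLeq_trans[OF _ \<kappa>])
  qed
qed

lemma paths_to_small: "ltccn Q \<le>o \<kappa> \<Longrightarrow> i \<in> verts Q \<Longrightarrow> |paths_to Q i| <o \<kappa>"
  unfolding ltccn_def by (erule ordLess_if_card_size[rotated]) (auto simp: card_of_Card_order)

lemma paths_from_small: "rtccn Q \<le>o \<kappa> \<Longrightarrow> i \<in> verts Q \<Longrightarrow> |paths_from Q i| <o \<kappa>"
  unfolding rtccn_def by (erule ordLess_if_card_size[rotated]) (auto simp: card_of_Card_order)

section \<open>Counting paths\<close>

context wf_digraph
begin

lemma mem_paths: "(k, p) \<in> paths G i j \<longleftrightarrow> k = i \<and> awalk i p j"
  unfolding paths_def by blast

lemma mem_paths_from: "(k, p) \<in> paths_from G i \<longleftrightarrow> k = i \<and> (\<exists>j. awalk i p j)"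
  unfolding paths_from_def mem_paths UN_iff using awalk_last_in_verts awlast_in_verts
  by (auto simp: mem_paths)

text \<open>Prefixing \<open>\<alpha>\<close> embeds the paths from the head into those from the
  tail and misses the trivial path. This is where the rank \<open>d\<close> comes from.\<close>

lemma card_paths_from_less:
  assumes \<alpha>: "\<alpha> \<in> arcs G" and fin: "finite (paths_from G (tail G \<alpha>))"
  shows "card (paths_from G (head G \<alpha>)) < card (paths_from G (tail G \<alpha>))"
proof -
  let ?h = "\<lambda>x. (tail G \<alpha>, \<alpha> # snd x)"
  have inj: "inj_on ?h (paths_from G (head G \<alpha>))"
  proof (rule inj_onI)
    fix x y assume xy: "x \<in> paths_from G (head G \<alpha>)" "y \<in> paths_from G (head G \<alpha>)" "?h x = ?h y"
    have "fst x = head G \<alpha>" "fst y = head G \<alpha>"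
      using xy(1,2) mem_paths_from[of "fst x" "snd x"] mem_paths_from[of "fst y" "snd y"] by simp_all
    then show "x = y" using xy(3) by (simp add: prod_eq_iff)
  qed
  have "?h ` paths_from G (head G \<alpha>) \<subseteq> paths_from G (tail G \<alpha>)"
  proof (rule image_subsetI)
    fix x assume "x \<in> paths_from G (head G \<alpha>)"
    then obtain j where "awalk (head G \<alpha>) (snd x) j" using mem_paths_from[of "fst x" "snd x"] by auto
    then have "awalk (tail G \<alpha>) (\<alpha> # snd x) j" unfolding awalk_Cons_iff using \<alpha> by simp
    then show "?h x \<in> paths_from G (tail G \<alpha>)" unfolding mem_paths_from by blast
  qed
  moreover have "(tail G \<alpha>, []) \<in> paths_from G (tail G \<alpha>)"
    unfolding mem_paths_from awalk_Nil_iff using \<alpha> by auto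
  moreover have "(tail G \<alpha>, []) \<notin> ?h ` paths_from G (head G \<alpha>)" by auto
  ultimately have "?h ` paths_from G (head G \<alpha>) \<subset> paths_from G (tail G \<alpha>)" by blast
  from psubset_card_mono[OF fin this] show ?thesis unfolding card_image[OF inj] .
qed

end

text \<open>Two morphisms out of an empty coproduct have nothing to disagree on, so the identity of
  \<open>P\<close> is zero.\<close>

lemma (in abelian_category) is_zero_obj_empty_coproduct:
  assumes "is_coproduct C {} X P inc"
  shows "is_zero_obj C P"
proof -
  have P: "P \<in> Obj C" by (rule coproduct_Obj[OF assms])
  have eq: "f = g" if "f \<in> Hom C P Z" "g \<in> Hom C P Z" for f g Z
    by (rule coproduct_eqI[OF assms that]) simp
  have id: "Idn C P = Zr C P P" by (rule eq) (use P in simp_all)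
  have eq': "f = Zr C Z P" if f: "f \<in> Hom C Z P" for f Z
  proof -
    have "Z \<in> Obj C" using f by auto
    have "Idn C P \<cdot> f = Zr C P P \<cdot> f" unfolding id ..
    then show ?thesis using f P by simp
  qed
  show ?thesis unfolding is_zero_obj_def
  proof (intro conjI ballI P)
    fix Z assume Z: "Z \<in> Obj C"
    show "\<exists>!f. f \<in> Hom C Z P" by (rule ex1I[of _ "Zr C Z P"], use Z P in simp, rule eq')
    show "\<exists>!f. f \<in> Hom C P Z" by (rule ex1I[of _ "Zr C P Z"], use Z P in simp, rule eq) (use Z P in simp_all)
  qed
qed

text \<open>The morphism that is the identity on the single summand is inverse to the
  inclusion.\<close>

lemma (in abelian_category) singleton_coproduct_iso:
  assumes c: "is_coproduct C {x} (\<lambda>_. X) P inc"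
  obtains u where "u \<in> Hom C P X" "is_mono C u" "is_epi C u"
proof -
  have ix: "inc x \<in> Hom C X P" by (rule coproduct_inc[OF c]) simp
  have XO: "X \<in> Obj C" using ix by auto
  have PO: "P \<in> Obj C" by (rule coproduct_Obj[OF c])
  have "Idn C X \<in> Hom C X X" using XO by simp
  then have "\<exists>u. u \<in> Hom C P X \<and> (\<forall>i \<in> {x}. u \<cdot> inc i = Idn C X)"
    by (intro coproduct_factor_ex[OF c XO])
  then obtain u where u: "u \<in> Hom C P X" "u \<cdot> inc x = Idn C X" by blast
  have iu: "inc x \<cdot> u = Idn C P"
  proof (rule coproduct_eqI[OF c])
    fix i assume "i \<in> {x}"
    then have i: "i = x" by simp
    have "(inc x \<cdot> u) \<cdot> inc x = inc x \<cdot> u \<cdot> inc x" by (rule comp_assoc) (use ix u(1) in auto)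
    then show "(inc x \<cdot> u) \<cdot> inc i = Idn C P \<cdot> inc i" unfolding i u(2) using ix by simp
  qed (use ix u(1) PO in auto)
  have "is_mono C u" by (rule is_mono_left_inverse[of _ "inc x"]) (use ix u(1) iu in auto)
  moreover have "is_epi C u" by (rule is_epi_right_inverse[of _ "inc x"]) (use ix u in auto)
  ultimately show thesis by (rule that[OF u(1)])
qed

section \<open>Families of coproducts indexed by paths, and free representations\<close>

context left_setting
begin

text \<open>Each arrow lowers the rank. In particular there are no oriented cycles, so
  \<open>paths Q i i\<close> contains only the trivial path.\<close>

lemma awalk_descends: "awalk i p j \<Longrightarrow> p = [] \<or> d j < d i"
proof (induction p arbitrary: i)
  case (Cons \<alpha> p)
  then have w: "\<alpha> \<in> arcs Q" "i = tail Q \<alpha>" "awalk (head Q \<alpha>) p j" unfolding awalk_Cons_iff by blast+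
  show ?case
  proof (cases p)
    case Nil
    then have "head Q \<alpha> = j" using w(3) by (simp add: awalk_Nil_iff)
    then show ?thesis using d_less[OF w(1)] w(2) by simp
  next
    case (Cons \<beta> q)
    then have "d j < d (head Q \<alpha>)" using Cons.IH[OF w(3)] by simp
    then show ?thesis using d_less[OF w(1)] w(2) by simp
  qed
qed simp

text \<open>\<open>N i j\<close> abstracts the index set of the coproduct at \<open>j\<close>: paths
  from \<open>i\<close> to \<open>j\<close> for free representations and, over the dual category,
  paths from \<open>j\<close> to \<open>i\<close> for cofree ones. A chosen coproduct depends on its
  index set, so leaving \<open>N\<close> open avoids reindexing by reversed paths.\<close>

lemma left_perp_coproduct_family:
  fixes N :: "'v \<Rightarrow> 'v \<Rightarrow> 'p set" and H :: "'v \<Rightarrow> 'o \<Rightarrow> ('v, 'e, 'o, 'm) qrep"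
  assumes H: "\<And>i X. i \<in> verts Q \<Longrightarrow> X \<in> \<B> \<Longrightarrow> H i X \<in> reps Q C"
    and c: "\<And>i j X. i \<in> verts Q \<Longrightarrow> j \<in> verts Q \<Longrightarrow> X \<in> \<B> \<Longrightarrow>
      \<exists>inc. is_coproduct C (N i j) (\<lambda>_. X) (vob (H i X) j) inc"
    and fin: "\<And>i j. i \<in> verts Q \<Longrightarrow> j \<in> verts Q \<Longrightarrow> finite (N i j)"
    and supp: "\<And>i. i \<in> verts Q \<Longrightarrow> finite {j \<in> verts Q. N i j \<noteq> {}}"
    and diag: "\<And>i. i \<in> verts Q \<Longrightarrow> \<exists>x. N i i = {x}"
    and desc: "\<And>i j. i \<in> verts Q \<Longrightarrow> j \<in> verts Q \<Longrightarrow> j \<noteq> i \<Longrightarrow> N i j \<noteq> {} \<Longrightarrow> d j < d i"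
  shows "left_perp (Rep Q C) {H i X | i X. i \<in> verts Q \<and> X \<in> \<B>} = Phi Q C \<A>"
proof (rule left_perp_eq_Phi)
  let ?F = "{H i X | i X. i \<in> verts Q \<and> X \<in> \<B>}"
  have z: "N i j \<noteq> {}" if ij: "i \<in> verts Q" "j \<in> verts Q" and X: "X \<in> \<B>" and nz: "\<not> is_zero_obj C (vob (H i X) j)" for i j X
  proof
    assume e: "N i j = {}"
    obtain inc where "is_coproduct C (N i j) (\<lambda>_. X) (vob (H i X) j) inc" using c[OF ij X] by (rule exE)
    then have "is_zero_obj C (vob (H i X) j)" unfolding e by (rule is_zero_obj_empty_coproduct)
    then show False using nz by simp
  qed
  show "?F \<subseteq> reps Q C" using H by blast
  show "finite {j \<in> verts Q. \<not> is_zero_obj C (vob G j)}" if GF: "G \<in> ?F" for G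
  proof -
    obtain i X where G: "G = H i X" "i \<in> verts Q" "X \<in> \<B>" using GF by blast
    show ?thesis unfolding G(1) by (rule finite_subset[OF _ supp[OF G(2)]]) (use z[OF G(2) _ G(3)] in blast)
  qed
  show "vob G j \<in> \<B>" if GF: "G \<in> ?F" and j: "j \<in> verts Q" for G j
  proof -
    obtain i X where G: "G = H i X" "i \<in> verts Q" "X \<in> \<B>" using GF by blast
    obtain inc where "is_coproduct C (N i j) (\<lambda>_. X) (vob (H i X) j) inc" using c[OF G(2) j G(3)] by (rule exE)
    then show ?thesis unfolding G(1) by (rule finite_coproduct_B[OF fin[OF G(2) j] G(3)])
  qed
  show "\<exists>G \<in> ?F. \<exists>u \<in> Hom C (vob G i) B. is_mono C u \<and> is_epi C u \<and>
      (\<forall>j \<in> verts Q. j \<noteq> i \<longrightarrow> \<not> is_zero_obj C (vob G j) \<longrightarrow> d j < d i)"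
    if i: "i \<in> verts Q" and B: "B \<in> \<B>" for i B
  proof -
    obtain x where x: "N i i = {x}" using diag[OF i] by (rule exE)
    obtain inc where "is_coproduct C (N i i) (\<lambda>_. B) (vob (H i B) i) inc" using c[OF i i B] by (rule exE)
    then obtain u where u: "u \<in> Hom C (vob (H i B) i) B" "is_mono C u" "is_epi C u"
      unfolding x by (rule singleton_coproduct_iso)
    show ?thesis
    proof (intro bexI[of _ "H i B"] bexI[of _ u] conjI ballI impI u)
      show "H i B \<in> ?F" using i B by blast
      show "d j < d i" if j: "j \<in> verts Q" "j \<noteq> i" "\<not> is_zero_obj C (vob (H i B) j)" for j
        by (rule desc[OF i j(1,2) z[OF i j(1) B j(3)]])
    qed
  qed
qed

lemma paths_coproduct:
  assumes i: "i \<in> verts Q" and j: "j \<in> verts Q" and X: "X \<in> Obj C"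
  shows "is_coproduct C (paths Q i j) (\<lambda>_. X) (coprod_obj C (paths Q i j) (\<lambda>_. X)) (coprod_inj C (paths Q i j) (\<lambda>_. X))"
proof (rule coprod_is_coproduct, rule AB4_ex_coproduct[OF AB4 Card_\<kappa>])
  have "paths Q i j \<subseteq> paths_to Q j" unfolding paths_to_def using i by blast
  then show "|paths Q i j| <o \<kappa>" by (rule ordLeq_ordLess_trans[OF card_of_mono1 paths_small[OF j]])
qed (rule X)

lemma paths_trivial: "i \<in> verts Q \<Longrightarrow> paths Q i i = {(i, [])}"
  using awalk_descends[of i _ i] by (auto simp: mem_paths awalk_Nil_iff)

lemma f_rep_reps:
  assumes i: "i \<in> verts Q" and X: "X \<in> Obj C"
  shows "f_rep Q C i X \<in> reps Q C"
proof -
  let ?P = "\<lambda>j. coprod_obj C (paths Q i j) (\<lambda>_. X)" and ?I = "\<lambda>j. coprod_inj C (paths Q i j) (\<lambda>_. X)"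
  let ?m = "\<lambda>\<alpha>. THE h. h \<in> Hom C (?P (tail Q \<alpha>)) (?P (head Q \<alpha>)) \<and>
    (\<forall>x \<in> paths Q i (tail Q \<alpha>). h \<cdot> ?I (tail Q \<alpha>) x = ?I (head Q \<alpha>) (fst x, snd x @ [\<alpha>]))"
  have "f_rep Q C i X = mk_rep Q ?P ?m" by (simp add: f_rep_def mk_rep_def split_beta del: in_Hom_iff)
  moreover have "mk_rep Q ?P ?m \<in> reps Q C"
  proof (rule mk_rep_reps[OF _ ends'])
    show "?P j \<in> Obj C" if "j \<in> verts Q" for j by (rule coproduct_Obj[OF paths_coproduct[OF i that X]])
    fix \<alpha> assume al: "\<alpha> \<in> arcs Q"
    note vt = ends[OF al]
    have "\<forall>x \<in> paths Q i (tail Q \<alpha>). ?I (head Q \<alpha>) (fst x, snd x @ [\<alpha>]) \<in> Hom C X (?P (head Q \<alpha>))"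
    proof
      fix x assume x: "x \<in> paths Q i (tail Q \<alpha>)"
      obtain k p where kp: "x = (k, p)" by (cases x)
      have w: "k = i" "awalk i p (tail Q \<alpha>)" using x unfolding kp mem_paths by blast+
      from awalk_appendI[OF w(2) arc_implies_awalk[OF al]]
      have "(fst x, snd x @ [\<alpha>]) \<in> paths Q i (head Q \<alpha>)" unfolding kp by (simp add: mem_paths w(1))
      then show "?I (head Q \<alpha>) (fst x, snd x @ [\<alpha>]) \<in> Hom C X (?P (head Q \<alpha>))"
        by (rule coproduct_inc[OF paths_coproduct[OF i vt(1) X]])
    qed
    \<comment> \<open>The description in \<open>f_rep\<close> determines a unique morphism by the
      universal property of the coproduct at the tail.\<close>
    from theI'[OF is_coproductD[OF paths_coproduct[OF i vt(2) X] coproduct_Obj[OF paths_coproduct[OF i vt(1) X]] this]]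
    show "?m \<alpha> \<in> Hom C (?P (tail Q \<alpha>)) (?P (head Q \<alpha>))" by (rule conjunct1)
  qed
  ultimately show ?thesis by simp
qed

text \<open>Finiteness of \<open>paths_from Q i\<close> bounds both the number of summands at each
  vertex and the number of vertices in the support; the absence of cycles leaves a single copy of
  the object at \<open>i\<close> itself.\<close>

lemma left_perp_f_star:
  assumes fin: "\<And>x. x \<in> verts Q \<Longrightarrow> finite (paths_from Q x)"
  shows "left_perp (Rep Q C) (f_star Q C \<B>) = Phi Q C \<A>"
  unfolding f_star_def
proof (rule left_perp_coproduct_family[where N = "paths Q"])
  fix i assume i: "i \<in> verts Q"
  show "f_rep Q C i X \<in> reps Q C" if "X \<in> \<B>" for X by (rule f_rep_reps[OF i B_Obj[OF that]])
  show "\<exists>x. paths Q i i = {x}" using paths_trivial[OF i] by blast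
  have sub: "paths Q i j \<subseteq> paths_from Q i" if "j \<in> verts Q" for j unfolding paths_from_def using that by blast
  have "{j \<in> verts Q. paths Q i j \<noteq> {}} \<subseteq> (\<lambda>x. awlast (fst x) (snd x)) ` paths_from Q i"
  proof
    fix j assume "j \<in> {j \<in> verts Q. paths Q i j \<noteq> {}}"
    then have j: "j \<in> verts Q" "\<exists>x. x \<in> paths Q i j" unfolding ex_in_conv by simp_all
    obtain x where x: "x \<in> paths Q i j" using j(2) by (rule exE)
    obtain k p where kp: "x = (k, p)" by (cases x)
    have w: "k = i" "awalk i p j" using x unfolding kp mem_paths by simp_all
    have "awlast i p = j" by (rule awalkE'[OF w(2)])
    then have l: "j = awlast (fst x) (snd x)" unfolding kp w(1) by simp
    show "j \<in> (\<lambda>x. awlast (fst x) (snd x)) ` paths_from Q i"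
      by (rule image_eqI[where f = "\<lambda>x. awlast (fst x) (snd x)", OF l subsetD[OF sub[OF j(1)] x]])
  qed
  then show "finite {j \<in> verts Q. paths Q i j \<noteq> {}}" by (rule finite_subset) (use fin[OF i] in blast)
  fix j assume j: "j \<in> verts Q"
  show "finite (paths Q i j)" by (rule finite_subset[OF sub[OF j] fin[OF i]])
  show "\<exists>inc. is_coproduct C (paths Q i j) (\<lambda>_. X) (vob (f_rep Q C i X) j) inc" if "X \<in> \<B>" for X
  proof -
    have "vob (f_rep Q C i X) j = coprod_obj C (paths Q i j) (\<lambda>_. X)" using j by (simp add: f_rep_def)
    then show ?thesis using paths_coproduct[OF i j B_Obj[OF that]] by (intro exI) (simp only:)
  qed
  show "d j < d i" if ji: "j \<noteq> i" "paths Q i j \<noteq> {}"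
  proof -
    have "\<exists>x. x \<in> paths Q i j" unfolding ex_in_conv by (rule ji(2))
    then obtain x where "x \<in> paths Q i j" by (rule exE)
    then have w: "awalk i (snd x) j" using mem_paths[of "fst x" "snd x" i j] by simp
    have "snd x \<noteq> []"
    proof
      assume e: "snd x = []"
      have "i = j" using w unfolding e awalk_Nil_iff by simp
      then show False using ji(1) by simp
    qed
    then show ?thesis using awalk_descends[OF w] by simp
  qed
qed

end

subsection \<open>Passage to the opposite quiver\<close>

text \<open>Both sides choose from literally the same predicate, so even the Hilbert choices agree
  and products of \<open>C\<close> are equal, not merely isomorphic, to coproducts of
  \<open>dual C\<close>.\<close>

lemma prodt_eq_coprod_dual: "prodt C = coprod (dual C)"
  by (simp add: fun_eq_iff prodt_def coprod_def)

lemma zero_obj_dual [simp]: "zero_obj (dual C) = zero_obj C"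
  by (simp add: zero_obj_def)

lemma Coker_dual: "Coker (dual C) = Ker C"
  by (simp add: fun_eq_iff Coker_def Ker_def)

lemma phi_op_dual: "phi (op Q) (dual C) = psi Q C"
  unfolding fun_eq_iff phi_def psi_def prodt_eq_coprod_dual Hom_dual arrows_into_def arrows_out_def
  by simp

lemma Phi_op_dual: "Phi (op Q) (dual C) \<X> = Psi Q C \<X>"
  unfolding Phi_def Psi_def phi_op_dual Coker_dual reps_op_dual by simp

lemma s_rep_op_dual: "s_rep (op Q) (dual C) i X = s_rep Q C i X"
  unfolding s_rep_def Let_def zero_obj_dual op_simps dual_simps ..

lemma s_star_op_dual: "s_star (op Q) (dual C) \<S> = s_star Q C \<S>"
  by (simp add: s_star_def s_rep_op_dual)

lemma (in quiver_reps) left_perp_op_dual: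
  "left_perp (Rep (op Q) (dual C)) \<X> = right_perp (Rep Q C) \<X>"
  unfolding left_perp_def right_perp_def Ext_zero_op Rep_Obj reps_op_dual ..

text \<open>The two classes change places, and so do the approximation sequences: the one that ends
  in \<open>X\<close> becomes the one that starts in it.\<close>

lemma hereditary_cotorsion_dual:
  assumes "hereditary_cotorsion C \<A> \<B>"
  shows "hereditary_cotorsion (dual C) \<B> \<A>"
proof -
  interpret hereditary_cotorsion C \<A> \<B> by (rule assms)
  show ?thesis
  proof (intro hereditary_cotorsion.intro hereditary_cotorsion_axioms.intro abelian_dual)
    note c = cotorsion[unfolded cotorsion_pair_def]
    show "cotorsion_pair (dual C) \<B> \<A>"
      unfolding cotorsion_pair_def Ext_zero_dual dual_simps by (rule conjI[OF conjunct2[OF c] conjunct1[OF c]])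
    show "hereditary_pair (dual C) \<B> \<A>"
      unfolding hereditary_pair_def Ext_zero_dual
    proof (intro allI impI ballI)
      fix n :: nat and B A assume n: "1 \<le> n" and B: "B \<in> \<B>" and A: "A \<in> \<A>"
      show "Ext_zero C n A B" by (rule hereditary[unfolded hereditary_pair_def, rule_format, OF n A B])
    qed
    show "complete_pair (dual C) \<B> \<A>"
      unfolding complete_pair_def
    proof (intro ballI)
      fix X assume "X \<in> Obj (dual C)"
      then have X: "X \<in> Obj C" by simp
      note cX = complete[unfolded complete_pair_def, THEN bspec, OF X]
      from conjunct1[OF cX] obtain B A f g where p: "B \<in> \<B>" "A \<in> \<A>" "f \<in> Hom C B A" "g \<in> Hom C A X"
        "short_exact C f g" by (elim bexE) (rule that)
      from conjunct2[OF cX] obtain B' A' f' g' where p': "B' \<in> \<B>" "A' \<in> \<A>" "f' \<in> Hom C X B'" "g' \<in> Hom C B' A'"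
        "short_exact C f' g'" by (elim bexE) (rule that)
      show "(\<exists>B\<in>\<A>. \<exists>A\<in>\<B>. \<exists>f\<in>Hom (dual C) B A. \<exists>g\<in>Hom (dual C) A X. short_exact (dual C) f g) \<and>
         (\<exists>B\<in>\<A>. \<exists>A\<in>\<B>. \<exists>f\<in>Hom (dual C) X B. \<exists>g\<in>Hom (dual C) B A. short_exact (dual C) f g)"
        unfolding Hom_dual short_exact_dual
      proof
        show "\<exists>B\<in>\<A>. \<exists>A\<in>\<B>. \<exists>f\<in>Hom C A B. \<exists>g\<in>Hom C X A. short_exact C g f"
          by (rule bexI[of _ A'], rule bexI[of _ B'], rule bexI[of _ g'], rule bexI[of _ f']) (rule p')+
        show "\<exists>B\<in>\<A>. \<exists>A\<in>\<B>. \<exists>f\<in>Hom C B X. \<exists>g\<in>Hom C A B. short_exact C g f"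
          by (rule bexI[of _ A], rule bexI[of _ B], rule bexI[of _ g], rule bexI[of _ f]) (rule p)+
      qed
    qed
  qed
qed

section \<open>Paths of the opposite quiver\<close>

lemma wf_digraph_op: "wf_digraph Q \<Longrightarrow> wf_digraph (op Q)"
  by (simp add: wf_digraph_def)

lemma (in wf_digraph) awalk_op: "awalk u p v \<Longrightarrow> pre_digraph.awalk (op G) v (rev p) u"
proof (induction p arbitrary: u)
  interpret o: wf_digraph "op G" by (rule wf_digraph_op[OF wf_digraph_axioms])
  case Nil
  then show ?case unfolding awalk_Nil_iff rev.simps o.awalk_Nil_iff by auto
next
  interpret o: wf_digraph "op G" by (rule wf_digraph_op[OF wf_digraph_axioms])
  case (Cons \<alpha> p)
  have w: "\<alpha> \<in> arcs G" "u = tail G \<alpha>" "awalk (head G \<alpha>) p v"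
    using Cons.prems unfolding awalk_Cons_iff by simp_all
  have "o.awalk (head G \<alpha>) [\<alpha>] u" using o.arc_implies_awalk[of \<alpha>] w(1,2) by simp
  then show ?case unfolding rev.simps by (rule o.awalk_appendI[OF Cons.IH[OF w(3)]])
qed

context wf_digraph
begin

interpretation o: wf_digraph "op G" by (rule wf_digraph_op[OF wf_digraph_axioms])

lemma awalk_op_iff: "pre_digraph.awalk (op G) u p v \<longleftrightarrow> awalk v (rev p) u"
  using awalk_op[of v "rev p" u] o.awalk_op[of u p v] by auto

lemma finite_paths_from_op:
  assumes "finite (paths_to G x)"
  shows "finite (paths_from (op G) x)"
proof (rule finite_subset)
  show "paths_from (op G) x \<subseteq> (\<lambda>y. (x, rev (snd y))) ` paths_to G x"
  proof
    fix y assume y: "y \<in> paths_from (op G) x"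
    obtain k p where kp: "y = (k, p)" by (cases y)
    have "k = x \<and> (\<exists>j. o.awalk x p j)" using y unfolding kp o.mem_paths_from .
    then obtain j where w: "k = x" "o.awalk x p j" by (elim conjE exE)
    have wj: "awalk j (rev p) x" using w(2) unfolding awalk_op_iff .
    have "j \<in> verts G" using wj by (rule awalkE')
    then have "(j, rev p) \<in> paths_to G x" unfolding paths_to_def mem_paths[symmetric] UN_iff
      using wj by (intro bexI[of _ j]) (simp add: mem_paths)
    then show "y \<in> (\<lambda>y. (x, rev (snd y))) ` paths_to G x"
      by (rule image_eqI[rotated]) (simp add: kp w(1))
  qed
qed (use assms in simp)

text \<open>The reversed path is stored with \<open>i\<close> as its starting vertex, but the old
  one can be recovered as the end of the walk, so reversal is injective.\<close>

lemma card_paths_to_op: "|paths_to (op G) i| \<le>o |paths_from G i|"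
proof (rule card_of_ordLeqI)
  have w: "awalk i (rev (snd x)) (fst x)" if "x \<in> paths_to (op G) i" for x
  proof -
    obtain k p where kp: "x = (k, p)" by (cases x)
    have "o.awalk k p i" using that unfolding kp paths_to_def UN_iff o.mem_paths by blast
    then show ?thesis unfolding kp awalk_op_iff by simp
  qed
  show "inj_on (\<lambda>x. (i, rev (snd x))) (paths_to (op G) i)"
  proof (rule inj_onI)
    fix x y assume x: "x \<in> paths_to (op G) i" and y: "y \<in> paths_to (op G) i"
      and eq: "(i, rev (snd x)) = (i, rev (snd y))"
    have "awlast i (rev (snd x)) = fst x" by (rule awalkE'[OF w[OF x]])
    moreover have "awlast i (rev (snd y)) = fst y" by (rule awalkE'[OF w[OF y]])
    ultimately show "x = y" using eq by (simp add: prod_eq_iff)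
  qed
  show "(i, rev (snd x)) \<in> paths_from G i" if "x \<in> paths_to (op G) i" for x
    unfolding mem_paths_from using w[OF that] by blast
qed

end

section \<open>Applying the left-hand argument to the quiver and to its opposite\<close>

lemma left_settingI:
  fixes Q :: "('v, 'e) pre_digraph" and \<kappa> :: "'k rel"
  assumes "wf_digraph Q" "hereditary_cotorsion C \<A> \<B>" "Card_order \<kappa>" "AB4 \<kappa> C"
    and "\<And>i. i \<in> verts Q \<Longrightarrow> |paths_to Q i| <o \<kappa>"
    and fin: "\<And>x. x \<in> verts Q \<Longrightarrow> finite (paths_from Q x)"
  shows "left_setting Q C \<A> \<B> \<kappa> (\<lambda>x. card (paths_from Q x))"
proof -
  interpret wf_digraph Q by (rule assms(1))
  interpret hereditary_cotorsion C \<A> \<B> by (rule assms(2))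
  show ?thesis
  proof (intro left_setting.intro left_setting_axioms.intro quiver_reps.intro)
    show "card (paths_from Q (head Q \<alpha>)) < card (paths_from Q (tail Q \<alpha>))" if "\<alpha> \<in> arcs Q" for \<alpha>
      by (rule card_paths_from_less[OF that fin[OF tail_in_verts[OF that]]])
  qed (rule assms abelian_category_axioms | assumption)+
qed

text \<open>Over the dual category \<open>g_rep\<close> is made of coproducts indexed by the
  unreversed paths from \<open>j\<close> to \<open>i\<close>, whereas a free representation of the
  opposite quiver uses reversed paths. The two need not be equal, so the general family statement is
  applied to \<open>g_rep\<close> itself.\<close>

lemma right_perp_g_star:
  fixes Q :: "('v, 'e) pre_digraph" and \<kappa> :: "'k rel"
  assumes op: "left_setting (op Q) (dual C) \<B> \<A> \<kappa> d" and Q: "quiver_reps Q C"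
    and small: "\<And>i. i \<in> verts Q \<Longrightarrow> |paths_from Q i| <o \<kappa>"
    and fin: "\<And>x. x \<in> verts Q \<Longrightarrow> finite (paths_to Q x)"
  shows "right_perp (Rep Q C) (g_star Q C \<A>) = Psi Q C \<B>"
proof -
  interpret q: quiver_reps Q C by (rule Q)
  interpret o: left_setting "op Q" "dual C" \<B> \<A> \<kappa> d by (rule op)
  let ?N = "\<lambda>i j. paths Q j i"
  let ?P = "\<lambda>X i j. coprod_obj (dual C) (?N i j) (\<lambda>_. X)" and ?I = "\<lambda>X i j. coprod_inj (dual C) (?N i j) (\<lambda>_. X)"
  have c: "is_coproduct (dual C) (?N i j) (\<lambda>_. X) (?P X i j) (?I X i j)"
    if i: "i \<in> verts Q" and j: "j \<in> verts Q" and X: "X \<in> Obj (dual C)" for i j X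
  proof (rule coprod_is_coproduct, rule o.AB4_ex_coproduct[OF o.AB4 o.Card_\<kappa>])
    have "?N i j \<subseteq> paths_from Q j" unfolding paths_from_def using i by blast
    then show "|?N i j| <o \<kappa>" by (rule ordLeq_ordLess_trans[OF card_of_mono1 small[OF j]])
  qed (rule X)
  \<comment> \<open>Reversal turns a path from \<open>j\<close> to \<open>i\<close> into a walk of
    the opposite quiver, along which \<open>d\<close> descends.\<close>
  have rev: "o.awalk i (rev (snd x)) j" if "x \<in> ?N i j" for x i j
  proof -
    obtain k p where kp: "x = (k, p)" by (cases x)
    have "q.awalk j p i" using that unfolding kp q.mem_paths by simp
    then show ?thesis unfolding kp q.awalk_op_iff by simp
  qed
  have diag: "?N i i = {(i, [])}" if i: "i \<in> verts Q" for i
  proof (rule subset_antisym)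
    show "{(i, [])} \<subseteq> ?N i i" using i by (simp add: q.mem_paths q.awalk_Nil_iff)
    show "?N i i \<subseteq> {(i, [])}"
    proof
      fix x assume x: "x \<in> ?N i i"
      have "snd x = []" using o.awalk_descends[OF rev[OF x]] by simp
      moreover have "fst x = i" using x q.mem_paths[of "fst x" "snd x" i i] by simp
      ultimately show "x \<in> {(i, [])}" by (simp add: prod_eq_iff)
    qed
  qed
  have g: "g_rep Q C i X = mk_rep (op Q) (?P X i) (\<lambda>\<alpha>. THE h. h \<in> Hom (dual C) (?P X i (head Q \<alpha>)) (?P X i (tail Q \<alpha>)) \<and>
      (\<forall>x \<in> ?N i (head Q \<alpha>). Comp (dual C) h (?I X i (head Q \<alpha>) x) = ?I X i (tail Q \<alpha>) (tail Q \<alpha>, \<alpha> # snd x)))" for i X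
    by (simp add: g_rep_def mk_rep_def prodt_eq_coprod_dual Hom_dual split_beta del: in_Hom_iff)
  have "left_perp (Rep (op Q) (dual C)) {g_rep Q C i X | i X. i \<in> verts (op Q) \<and> X \<in> \<A>} = Phi (op Q) (dual C) \<B>"
  proof (rule o.left_perp_coproduct_family[where N = ?N])
    fix i assume "i \<in> verts (op Q)"
    then have i: "i \<in> verts Q" by simp
    show "g_rep Q C i X \<in> reps (op Q) (dual C)" if "X \<in> \<A>" for X unfolding g
    proof (rule mk_rep_reps[OF _ o.ends'])
      have X: "X \<in> Obj (dual C)" by (rule o.B_Obj[OF that])
      show "?P X i j \<in> Obj (dual C)" if "j \<in> verts (op Q)" for j
        by (rule o.coproduct_Obj[OF c[OF i _ X]]) (use that in simp)
      fix \<alpha> assume "\<alpha> \<in> arcs (op Q)"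
      then have al: "\<alpha> \<in> arcs Q" by simp
      have vt: "head Q \<alpha> \<in> verts Q" "tail Q \<alpha> \<in> verts Q" by (rule q.ends[OF al])+
      have "\<forall>x \<in> ?N i (head Q \<alpha>). ?I X i (tail Q \<alpha>) (tail Q \<alpha>, \<alpha> # snd x) \<in> Hom (dual C) X (?P X i (tail Q \<alpha>))"
      proof
        fix x assume x: "x \<in> ?N i (head Q \<alpha>)"
        have "q.awalk (head Q \<alpha>) (snd x) i" using x q.mem_paths[of "fst x" "snd x"] by simp
        then have "(tail Q \<alpha>, \<alpha> # snd x) \<in> ?N i (tail Q \<alpha>)"
          unfolding q.mem_paths q.awalk_Cons_iff using al by simp
        then show "?I X i (tail Q \<alpha>) (tail Q \<alpha>, \<alpha> # snd x) \<in> Hom (dual C) X (?P X i (tail Q \<alpha>))"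
          by (rule o.coproduct_inc[OF c[OF i vt(2) X]])
      qed
      from theI'[OF is_coproductD[OF c[OF i vt(1) X] o.coproduct_Obj[OF c[OF i vt(2) X]] this]]
      show "(THE h. h \<in> Hom (dual C) (?P X i (head Q \<alpha>)) (?P X i (tail Q \<alpha>)) \<and>
          (\<forall>x \<in> ?N i (head Q \<alpha>). Comp (dual C) h (?I X i (head Q \<alpha>) x) = ?I X i (tail Q \<alpha>) (tail Q \<alpha>, \<alpha> # snd x)))
        \<in> Hom (dual C) (?P X i (tail (op Q) \<alpha>)) (?P X i (head (op Q) \<alpha>))"
        unfolding op_simps by (rule conjunct1)
    qed
    show "\<exists>x. ?N i i = {x}" using diag[OF i] by blast
    have "{j \<in> verts (op Q). ?N i j \<noteq> {}} \<subseteq> fst ` paths_to Q i"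
    proof
      fix j assume "j \<in> {j \<in> verts (op Q). ?N i j \<noteq> {}}"
      then have j: "j \<in> verts Q" "\<exists>x. x \<in> ?N i j" unfolding ex_in_conv by simp_all
      obtain x where x: "x \<in> ?N i j" using j(2) by (rule exE)
      have l: "j = fst x" using x q.mem_paths[of "fst x" "snd x" j i] by simp
      have "x \<in> paths_to Q i" unfolding paths_to_def using x j(1) by blast
      then show "j \<in> fst ` paths_to Q i" unfolding l by (rule imageI)
    qed
    then show "finite {j \<in> verts (op Q). ?N i j \<noteq> {}}" by (rule finite_subset) (use fin[OF i] in simp)
    fix j assume "j \<in> verts (op Q)"
    then have j: "j \<in> verts Q" by simp
    have "?N i j \<subseteq> paths_to Q i" unfolding paths_to_def using j by blast
    then show "finite (?N i j)" by (rule finite_subset[OF _ fin[OF i]])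
    show "\<exists>inc. is_coproduct (dual C) (?N i j) (\<lambda>_. X) (vob (g_rep Q C i X) j) inc" if "X \<in> \<A>" for X
    proof -
      have "vob (g_rep Q C i X) j = ?P X i j" unfolding g using j by simp
      then show ?thesis using c[OF i j o.B_Obj[OF that]] by (intro exI) (simp only:)
    qed
    show "d j < d i" if ji: "j \<noteq> i" "?N i j \<noteq> {}"
    proof -
      have "\<exists>x. x \<in> ?N i j" unfolding ex_in_conv by (rule ji(2))
      then obtain x where x: "x \<in> ?N i j" by (rule exE)
      have "rev (snd x) \<noteq> []"
      proof
        assume e: "rev (snd x) = []"
        have "i = j" using rev[OF x] unfolding e o.awalk_Nil_iff by simp
        then show False using ji(1) by simp
      qed
      then show ?thesis using o.awalk_descends[OF rev[OF x]] by simp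
    qed
  qed
  then show ?thesis unfolding q.left_perp_op_dual Phi_op_dual g_star_def op_simps .
qed

theorem proposition4p24:
  fixes Q :: "('v, 'e) pre_digraph"
    and \<kappa> :: "'k rel"
    and C :: "('o, 'm) cat"
    and \<A> \<B> :: "'o set"
  assumes "wf_digraph Q"
    and "Card_order \<kappa>" and "infinite (Field \<kappa>)"
    and "abelian_category C"
    and "cotorsion_pair C \<A> \<B>" and "complete_pair C \<A> \<B>" and "hereditary_pair C \<A> \<B>"
  shows "((\<forall>x \<in> verts Q. finite (paths_from Q x)) \<and> ltccn Q \<le>o \<kappa> \<and> left_rooted Q \<and> AB4 \<kappa> C
      \<longrightarrow> left_perp (Rep Q C) (s_star Q C \<B>) = left_perp (Rep Q C) (f_star Q C \<B>) \<and>
          left_perp (Rep Q C) (f_star Q C \<B>) = Phi Q C \<A>) \<and>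
    ((\<forall>x \<in> verts Q. finite (paths_to Q x)) \<and> rtccn Q \<le>o \<kappa> \<and> right_rooted Q \<and> AB4_star \<kappa> C
      \<longrightarrow> right_perp (Rep Q C) (s_star Q C \<A>) = right_perp (Rep Q C) (g_star Q C \<A>) \<and>
          right_perp (Rep Q C) (g_star Q C \<A>) = Psi Q C \<B>)"
proof -
  have hc: "hereditary_cotorsion C \<A> \<B>"
    by (intro hereditary_cotorsion.intro hereditary_cotorsion_axioms.intro assms)
  show ?thesis
  proof (rule conjI; rule impI)
    assume a: "(\<forall>x \<in> verts Q. finite (paths_from Q x)) \<and> ltccn Q \<le>o \<kappa> \<and> left_rooted Q \<and> AB4 \<kappa> C"
    have fin: "finite (paths_from Q x)" if "x \<in> verts Q" for x using a that by simp
    have "left_setting Q C \<A> \<B> \<kappa> (\<lambda>x. card (paths_from Q x))"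
    proof (rule left_settingI[OF assms(1) hc assms(2)])
      show "AB4 \<kappa> C" using a by simp
      show "|paths_to Q i| <o \<kappa>" if "i \<in> verts Q" for i by (rule paths_to_small[OF _ that]) (use a in simp)
    qed (rule fin)
    then interpret left_setting Q C \<A> \<B> \<kappa> "\<lambda>x. card (paths_from Q x)" .
    have f: "left_perp (Rep Q C) (f_star Q C \<B>) = Phi Q C \<A>" by (rule left_perp_f_star[OF fin])
    show "left_perp (Rep Q C) (s_star Q C \<B>) = left_perp (Rep Q C) (f_star Q C \<B>) \<and>
        left_perp (Rep Q C) (f_star Q C \<B>) = Phi Q C \<A>"
      unfolding f left_perp_s_star by simp
  next
    assume b: "(\<forall>x \<in> verts Q. finite (paths_to Q x)) \<and> rtccn Q \<le>o \<kappa> \<and> right_rooted Q \<and> AB4_star \<kappa> C"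
    interpret wf_digraph Q by (rule assms(1))
    have fin: "finite (paths_to Q x)" if "x \<in> verts Q" for x using b that by simp
    have small: "|paths_from Q i| <o \<kappa>" if "i \<in> verts Q" for i by (rule paths_from_small[OF _ that]) (use b in simp)
    have Q: "quiver_reps Q C" by (intro quiver_reps.intro assms)
    \<comment> \<open>The number of paths of the opposite quiver that start at \<open>x\<close>,
      which are the reversals of the paths of \<open>Q\<close> that end there.\<close>
    let ?d = "\<lambda>x. card (paths_from (op Q) x)"
    have op: "left_setting (op Q) (dual C) \<B> \<A> \<kappa> ?d"
    proof (rule left_settingI[OF wf_digraph_op[OF assms(1)] hereditary_cotorsion_dual[OF hc] assms(2)])
      show "AB4 \<kappa> (dual C)" using b by (simp add: AB4_star_def)
      show "|paths_to (op Q) i| <o \<kappa>" if "i \<in> verts (op Q)" for i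
        by (rule ordLeq_ordLess_trans[OF card_paths_to_op small]) (use that in simp)
      show "finite (paths_from (op Q) x)" if "x \<in> verts (op Q)" for x
        by (rule finite_paths_from_op[OF fin]) (use that in simp)
    qed
    have g: "right_perp (Rep Q C) (g_star Q C \<A>) = Psi Q C \<B>"
      by (rule right_perp_g_star[OF op Q small fin])
    \<comment> \<open>A stalk of \<open>Q\<close> over \<open>C\<close> is literally the same
      representation for the opposite quiver over \<open>dual C\<close>, so the statement on stalks
      transfers as it stands.\<close>
    have s: "right_perp (Rep Q C) (s_star Q C \<A>) = Psi Q C \<B>"
      using left_setting.left_perp_s_star[OF op]
      unfolding quiver_reps.left_perp_op_dual[OF Q] Phi_op_dual s_star_op_dual .
    show "right_perp (Rep Q C) (s_star Q C \<A>) = right_perp (Rep Q C) (g_star Q C \<A>) \<and>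
        right_perp (Rep Q C) (g_star Q C \<A>) = Psi Q C \<B>"
      unfolding g s by simp
  qed
qed

end
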